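(* Let $n\ge 2$ and let $\lambda\in P^+_{\ge 0}$. As a $\widehat{\mathfrak g}$-module, the restriction of the irreducible highest weight $\mathfrak{gl}_{2n}(\mathbb C)$-module $L(\lambda)$ to $\widehat{\mathfrak g}\cong\mathfrak{sp}_{2n}(\mathbb C)$ decomposes as $$\mathrm{Res}^{\mathfrak g}_{\widehat{\mathfrak g}}\,L(\lambda)\;\cong\;\bigoplus_{\substack{\pi\in\mathbb B(\lambda)\\ \widehat\pi \text{ is } \widehat{\mathfrak g}\text{-dominant}}}\widehat L\bigl(\widehat\pi(1)\bigr).$$ Equivalently, for all $\mu\in\widehat P^+$, the multiplicity $[\mathrm{Res}^{\mathfrak g}_{\widehat{\mathfrak g}}L(\lambda):\widehat L(\mu)]$ equals the number of tableaux $T\in\mathsf{SST}_{2n}(\lambda)$ such that $\pi_T$ is $\widehat{\mathfrak g}$-dominant and $\widehat\pi_T(1)=\mu$.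
   Context: Lie algebras. $\mathfrak g=\mathfrak{gl}_{2n}(\mathbb C)$ with matrix units $E_{i,j}$; $P^\vee=\sum_{i=1}^{2n}\mathbb Z E_{i,i}$, $P=\mathrm{Hom}_{\mathbb Z}(P^\vee,\mathbb Z)$ with pairing $\langle\cdot,\cdot\rangle$, $P_{\mathbb R}=\mathbb R\otimes_{\mathbb Z}P$, and $\varepsilon_i\in P$ is defined by $\langle\varepsilon_i,E_{j,j}\rangle=\delta_{ij}$. For $i\in I=\{1,\dots,2n-1\}$ put $e_i=E_{i,i+1}$, $f_i=E_{i+1,i}$, $h_i=E_{i,i}-E_{i+1,i+1}$; these generate $\mathfrak{sl}_{2n}(\mathbb C)$. Let $P^+_{\ge0}=\{\lambda_1\varepsilon_1+\cdots+\lambda_{2n}\varepsilon_{2n}\in P:\lambda_1\ge\cdots\ge\lambda_{2n}\ge0\}$, identified with the set of partitions of length at most $2n$. $L(\lambda)$ is the irreducible $\mathfrak g$-module of highest weight $\lambda$. Let $\sigma(i)=2n-i$ on $I$; $e_i\mapsto e_{\sigma(i)}$, $f_i\mapsto f_{\sigma(i)}$, $h_i\mapsto h_{\sigma(i)}$ defines an automorphism of $\mathfrak{sl}_{2n}(\mathbb C)$, also denoted $\sigma$, and $\widehat{\mathfrak g}=\{x\in\mathfrak{sl}_{2n}(\mathbb C):\sigma(x)=x\}$, which is isomorphic to $\mathfrak{sp}_{2n}(\mathbb C)$ with Chevalley generators $\widehat e_i=e_i+e_{\sigma(i)}$, $\widehat f_i=f_i+f_{\sigma(i)}$, $\widehat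 h_i=h_i+h_{\sigma(i)}$ for $1\le i<n$ and $\widehat e_n=e_n$, $\widehat f_n=f_n$, $\widehat h_n=h_n$. Let $\widehat P^\vee=\sum_{i=1}^n\mathbb Z\widehat h_i$, $\widehat P=\mathrm{Hom}_{\mathbb Z}(\widehat P^\vee,\mathbb Z)$, $\widehat P_{\mathbb R}=\mathbb R\otimes_{\mathbb Z}\widehat P$, $\widehat P^+=\{\mu\in\widehat P:\langle\mu,\widehat h_i\rangle\ge0,\ 1\le i\le n\}$. $\widehat L(\mu)$ is the irreducible $\widehat{\mathfrak g}$-module of highest weight $\mu\in\widehat P^+$. The inclusion $\widehat P^\vee\subset P^\vee$ induces a restriction map $P_{\mathbb R}\to\widehat P_{\mathbb R}$, written $\nu\mapsto\widehat\nu$; one has $\widehat\varepsilon_{2n+1-i}=-\widehat\varepsilon_i$. Tableaux and paths. $\mathsf{SST}_{2n}(\lambda)$ is the set of semistandard tableaux of shape $\lambda$ (rows weakly increasing, columns strictly increasing from top to bottom) with entries in $\{1,\dots,2n\}$. Let $N=|\lambda|$ be the number of boxes. For $T\in\mathsf{SST}_{2n}(\lambda)$, let $i_1i_2\cdots i_N$ be the word obtained by reading the entries of $T$ from the rightmost column to the leftmost column, and from top to bottom in each column. With $t_j=j/N$, define the piecewise-linear path $\pi_T:[0,1]\to P_{\mathbb R}$ by $$\pi_T(t)=\sum_{k=1}^{j-1}\varepsilon_{i_k}+N(t-t_{j-1})\,\varepsilon_{i_j}\quad\text{for }t_{j-1}\le t\le t_j,\ 1\le j\le N$$ (the zero path if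 $N=0$). Put $\mathbb B(\lambda)=\{\pi_T:T\in\mathsf{SST}_{2n}(\lambda)\}$. For $\pi\in\mathbb B(\lambda)$ let $\widehat\pi(t)=\widehat{\pi(t)}\in\widehat P_{\mathbb R}$. The path $\pi$ (equivalently $\widehat\pi$) is called $\widehat{\mathfrak g}$-dominant if $\langle\widehat\pi(t),\widehat h_i\rangle\ge0$ for all $t\in[0,1]$ and all $1\le i\le n$. *)

theory Defs
  imports Complex_Main "HOL-Library.FuncSet" "HOL-Library.Function_Algebras"
    "Jordan_Normal_Form.Matrix"
begin

section \<open>Complex vector spaces\<close>

class complex_vector = ab_group_add +
  fixes scaleC :: "complex \<Rightarrow> 'a \<Rightarrow> 'a" (infixr \<open>*\<^sub>C\<close> 75)
  assumes scaleC_add_right: "a *\<^sub>C (x + y) = a *\<^sub>C x + a *\<^sub>C y"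
    and scaleC_add_left: "(a + b) *\<^sub>C x = a *\<^sub>C x + b *\<^sub>C x"
    and scaleC_scaleC: "a *\<^sub>C (b *\<^sub>C x) = (a * b) *\<^sub>C x"
    and scaleC_one: "1 *\<^sub>C x = x"

interpretation complex_vector: vector_space "scaleC :: complex \<Rightarrow> 'a \<Rightarrow> 'a::complex_vector"
  by unfold_locales (rule scaleC_add_right scaleC_add_left scaleC_scaleC scaleC_one)+

instantiation complex :: complex_vector
begin

definition scaleC_complex :: "complex \<Rightarrow> complex \<Rightarrow> complex" where
  "scaleC_complex c z = c * z"

instance
  by standard (simp_all add: scaleC_complex_def algebra_simps)

end

instantiation "fun" :: (type, complex_vector) complex_vector
begin

definition scaleC_fun :: "complex \<Rightarrow> ('a \<Rightarrow> 'b) \<Rightarrow> 'a \<Rightarrow> 'b" where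
  "scaleC_fun c f = (\<lambda>x. c *\<^sub>C f x)"

instance
  by standard
    (simp_all add: scaleC_fun_def fun_eq_iff scaleC_add_right scaleC_add_left scaleC_scaleC scaleC_one)

end

section \<open>Modules over a Lie algebra of matrices\<close>

definition lie_bracket :: "complex mat \<Rightarrow> complex mat \<Rightarrow> complex mat" where
  "lie_bracket x y = x * y - y * x"

text \<open>A Lie algebra is given by its underlying set \<open>\<gg>\<close> of square matrices.  The space of a module
  is a linear subspace of an ambient type, so that submodules live in the same type.\<close>

record 'v lie_rep =
  mspace :: "'v set"
  mact :: "complex mat \<Rightarrow> 'v \<Rightarrow> 'v"

definition lie_module :: "complex mat set \<Rightarrow> 'v::complex_vector lie_rep \<Rightarrow> bool" where
  "lie_module \<gg> M \<longleftrightarrow>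
     complex_vector.subspace (mspace M) \<and>
     (\<forall>x\<in>\<gg>. \<forall>v\<in>mspace M. mact M x v \<in> mspace M) \<and>
     (\<forall>x\<in>\<gg>. \<forall>u\<in>mspace M. \<forall>v\<in>mspace M. mact M x (u + v) = mact M x u + mact M x v) \<and>
     (\<forall>x\<in>\<gg>. \<forall>c. \<forall>v\<in>mspace M. mact M x (c *\<^sub>C v) = c *\<^sub>C mact M x v) \<and>
     (\<forall>x\<in>\<gg>. \<forall>y\<in>\<gg>. \<forall>v\<in>mspace M. mact M (x + y) v = mact M x v + mact M y v) \<and>
     (\<forall>c. \<forall>x\<in>\<gg>. \<forall>v\<in>mspace M. mact M (c \<cdot>\<^sub>m x) v = c *\<^sub>C mact M x v) \<and>
     (\<forall>x\<in>\<gg>. \<forall>y\<in>\<gg>. \<forall>v\<in>mspace M.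
        mact M (lie_bracket x y) v = mact M x (mact M y v) - mact M y (mact M x v))"

definition lie_submodule ::
    "complex mat set \<Rightarrow> 'v::complex_vector lie_rep \<Rightarrow> 'v set \<Rightarrow> bool" where
  "lie_submodule \<gg> M W \<longleftrightarrow>
     complex_vector.subspace W \<and> W \<subseteq> mspace M \<and> (\<forall>x\<in>\<gg>. \<forall>v\<in>W. mact M x v \<in> W)"

definition sub_rep :: "'v lie_rep \<Rightarrow> 'v set \<Rightarrow> 'v lie_rep" where
  "sub_rep M W = M\<lparr>mspace := W\<rparr>"

definition irreducible_module ::
    "complex mat set \<Rightarrow> 'v::complex_vector lie_rep \<Rightarrow> bool" where
  "irreducible_module \<gg> M \<longleftrightarrow>
     lie_module \<gg> M \<and> mspace M \<noteq> {0} \<and>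
     (\<forall>W. lie_submodule \<gg> M W \<longrightarrow> W = {0} \<or> W = mspace M)"

definition Res :: "complex mat set \<Rightarrow> 'v::complex_vector lie_rep \<Rightarrow> 'v lie_rep" where
  "Res \<gg> M = M\<lparr>mact := (\<lambda>x. if x \<in> \<gg> then mact M x else (\<lambda>v. 0))\<rparr>"

definition module_iso ::
    "complex mat set \<Rightarrow> 'v::complex_vector lie_rep \<Rightarrow> 'w::complex_vector lie_rep \<Rightarrow> bool" where
  "module_iso \<gg> M N \<longleftrightarrow>
     (\<exists>\<phi>. bij_betw \<phi> (mspace M) (mspace N) \<and>
        (\<forall>u\<in>mspace M. \<forall>v\<in>mspace M. \<phi> (u + v) = \<phi> u + \<phi> v) \<and>
        (\<forall>c. \<forall>v\<in>mspace M. \<phi> (c *\<^sub>C v) = c *\<^sub>C \<phi> v) \<and>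
        (\<forall>x\<in>\<gg>. \<forall>v\<in>mspace M. \<phi> (mact M x v) = mact N x (\<phi> v)))"

definition direct_sum :: "'i set \<Rightarrow> ('i \<Rightarrow> 'v::complex_vector lie_rep) \<Rightarrow> ('i \<Rightarrow> 'v) lie_rep" where
  "direct_sum I M =
     \<lparr>mspace = {f. (\<forall>i\<in>I. f i \<in> mspace (M i)) \<and> (\<forall>i. i \<notin> I \<longrightarrow> f i = 0) \<and> finite {i. f i \<noteq> 0}},
      mact = (\<lambda>x f i. if i \<in> I then mact (M i) x (f i) else 0)\<rparr>"

text \<open>Decompositions into a finite internal direct sum of irreducible submodules.  The summands are
  nonzero, hence pairwise distinct, so a set of submodules suffices.\<close>

definition irreducible_decomposition ::
    "complex mat set \<Rightarrow> 'v::complex_vector lie_rep \<Rightarrow> 'v set set \<Rightarrow> bool" where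
  "irreducible_decomposition \<gg> M \<W> \<longleftrightarrow>
     finite \<W> \<and>
     (\<forall>W\<in>\<W>. lie_submodule \<gg> M W \<and> irreducible_module \<gg> (sub_rep M W)) \<and>
     bij_betw (\<lambda>f. \<Sum>W\<in>\<W>. f W) (mspace (direct_sum \<W> (sub_rep M))) (mspace M)"

text \<open>The multiplicity \<open>[M : S]\<close> of an irreducible module in a finite direct sum of irreducibles.  The
  value is specified only if \<open>M\<close> has such a decomposition and all of them give the same number.\<close>

definition irr_multiplicity ::
    "complex mat set \<Rightarrow> 'v::complex_vector lie_rep \<Rightarrow> 'w::complex_vector lie_rep \<Rightarrow> nat" where
  "irr_multiplicity \<gg> M S =
     (THE k. \<exists>\<W>. irreducible_decomposition \<gg> M \<W> \<and>
        k = card {W \<in> \<W>. module_iso \<gg> (sub_rep M W) S})"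

section \<open>The Lie algebra \<open>gl(2n)\<close> and its fixed point subalgebra\<close>

text \<open>Matrix units and generators carry indices starting from 1, whereas the entries of a matrix are
  counted from 0.\<close>

definition E_unit :: "nat \<Rightarrow> nat \<Rightarrow> nat \<Rightarrow> complex mat" where
  "E_unit n i j = mat (2*n) (2*n) (\<lambda>(a, b). if Suc a = i \<and> Suc b = j then 1 else 0)"

definition gl :: "nat \<Rightarrow> complex mat set" where
  "gl n = carrier_mat (2*n) (2*n)"

definition sl :: "nat \<Rightarrow> complex mat set" where
  "sl n = {x \<in> gl n. (\<Sum>i<2*n. x $$ (i, i)) = 0}"

definition e_gen :: "nat \<Rightarrow> nat \<Rightarrow> complex mat" where
  "e_gen n i = E_unit n i (i+1)"

definition f_gen :: "nat \<Rightarrow> nat \<Rightarrow> complex mat" where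
  "f_gen n i = E_unit n (i+1) i"

definition h_gen :: "nat \<Rightarrow> nat \<Rightarrow> complex mat" where
  "h_gen n i = E_unit n i i - E_unit n (i+1) (i+1)"

definition lie_automorphism :: "complex mat set \<Rightarrow> (complex mat \<Rightarrow> complex mat) \<Rightarrow> bool" where
  "lie_automorphism \<gg> s \<longleftrightarrow>
     bij_betw s \<gg> \<gg> \<and>
     (\<forall>x\<in>\<gg>. \<forall>y\<in>\<gg>. s (x + y) = s x + s y) \<and>
     (\<forall>c. \<forall>x\<in>\<gg>. s (c \<cdot>\<^sub>m x) = c \<cdot>\<^sub>m s x) \<and>
     (\<forall>x\<in>\<gg>. \<forall>y\<in>\<gg>. s (lie_bracket x y) = lie_bracket (s x) (s y))"

text \<open>The automorphism is determined by its values on the Chevalley generators; explicitly it is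
  \<open>E\<^sub>i\<^sub>,\<^sub>j \<mapsto> (-1)\<^sup>i\<^sup>+\<^sup>j\<^sup>+\<^sup>1 E\<^sub>2\<^sub>n\<^sub>+\<^sub>1\<^sub>-\<^sub>j\<^sub>,\<^sub>2\<^sub>n\<^sub>+\<^sub>1\<^sub>-\<^sub>i\<close>.\<close>

definition sigma :: "nat \<Rightarrow> complex mat \<Rightarrow> complex mat" where
  "sigma n = (THE s. s \<in> extensional (sl n) \<and> lie_automorphism (sl n) s \<and>
     (\<forall>i\<in>{1..2*n-1}. s (e_gen n i) = e_gen n (2*n-i) \<and>
                      s (f_gen n i) = f_gen n (2*n-i) \<and>
                      s (h_gen n i) = h_gen n (2*n-i)))"

definition ghat :: "nat \<Rightarrow> complex mat set" where
  "ghat n = {x \<in> sl n. sigma n x = x}"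

definition e_hat :: "nat \<Rightarrow> nat \<Rightarrow> complex mat" where
  "e_hat n i = (if i = n then e_gen n n else e_gen n i + e_gen n (2*n-i))"

definition h_hat :: "nat \<Rightarrow> nat \<Rightarrow> complex mat" where
  "h_hat n i = (if i = n then h_gen n n else h_gen n i + h_gen n (2*n-i))"

section \<open>Weights\<close>

text \<open>Elements of \<open>P\<^sub>\<real>\<close> are additive real functions on the coweight lattice, set to \<open>0\<close> outside of it,
  and \<open>P\<close> consists of the integer-valued ones; the pairing of \<open>\<nu>\<close> and \<open>h\<close> is application \<open>\<nu> h\<close>.
  The same is done for the fixed point subalgebra.\<close>

type_synonym weight = "complex mat \<Rightarrow> real"

definition Pv :: "nat \<Rightarrow> complex mat set" where
  "Pv n = {h. \<exists>c::nat \<Rightarrow> int.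
     h = mat (2*n) (2*n) (\<lambda>ab. \<Sum>i=1..2*n. of_int (c i) * E_unit n i i $$ ab)}"

definition Pv_hat :: "nat \<Rightarrow> complex mat set" where
  "Pv_hat n = {h. \<exists>c::nat \<Rightarrow> int.
     h = mat (2*n) (2*n) (\<lambda>ab. \<Sum>i=1..n. of_int (c i) * h_hat n i $$ ab)}"

definition integral_dual :: "complex mat set \<Rightarrow> weight set" where
  "integral_dual A = {\<nu>. (\<forall>h\<in>A. \<forall>k\<in>A. \<nu> (h + k) = \<nu> h + \<nu> k) \<and>
     (\<forall>h\<in>A. \<nu> h \<in> \<int>) \<and> (\<forall>h. h \<notin> A \<longrightarrow> \<nu> h = 0)}"

definition P_gl :: "nat \<Rightarrow> weight set" where
  "P_gl n = integral_dual (Pv n)"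

definition P_hat :: "nat \<Rightarrow> weight set" where
  "P_hat n = integral_dual (Pv_hat n)"

definition eps :: "nat \<Rightarrow> nat \<Rightarrow> weight" where
  "eps n i = (\<lambda>h. if h \<in> Pv n then Re (h $$ (i-1, i-1)) else 0)"

definition P_plus_ge0 :: "nat \<Rightarrow> weight set" where
  "P_plus_ge0 n = {lam \<in> P_gl n. \<exists>l::nat \<Rightarrow> int.
     lam = (\<lambda>h. \<Sum>i=1..2*n. of_int (l i) * eps n i h) \<and>
     (\<forall>i\<in>{1..<2*n}. l (i+1) \<le> l i) \<and> 0 \<le> l (2*n)}"

definition P_hat_plus :: "nat \<Rightarrow> weight set" where
  "P_hat_plus n = {\<mu> \<in> P_hat n. \<forall>i\<in>{1..n}. 0 \<le> \<mu> (h_hat n i)}"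

definition hat :: "nat \<Rightarrow> weight \<Rightarrow> weight" where
  "hat n \<nu> = (\<lambda>h. if h \<in> Pv_hat n then \<nu> h else 0)"

text \<open>The modules \<open>L(lam)\<close> and \<open>L^(\<mu>)\<close> are described up to isomorphism: irreducible modules with a
  highest weight vector of the given weight.\<close>

definition is_L :: "nat \<Rightarrow> weight \<Rightarrow> 'v::complex_vector lie_rep \<Rightarrow> bool" where
  "is_L n lam M \<longleftrightarrow> irreducible_module (gl n) M \<and>
     (\<exists>v\<in>mspace M. v \<noteq> 0 \<and>
        (\<forall>i\<in>{1..2*n-1}. mact M (e_gen n i) v = 0) \<and>
        (\<forall>h\<in>Pv n. mact M h v = of_real (lam h) *\<^sub>C v))"

definition is_L_hat :: "nat \<Rightarrow> weight \<Rightarrow> 'v::complex_vector lie_rep \<Rightarrow> bool" where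
  "is_L_hat n \<mu> M \<longleftrightarrow> irreducible_module (ghat n) M \<and>
     (\<exists>v\<in>mspace M. v \<noteq> 0 \<and>
        (\<forall>i\<in>{1..n}. mact M (e_hat n i) v = 0) \<and>
        (\<forall>h\<in>Pv_hat n. mact M h v = of_real (\<mu> h) *\<^sub>C v))"

section \<open>Tableaux and paths\<close>

definition part :: "nat \<Rightarrow> weight \<Rightarrow> nat \<Rightarrow> nat" where
  "part n lam i = nat \<lfloor>lam (E_unit n i i)\<rfloor>"

definition diagram :: "nat \<Rightarrow> weight \<Rightarrow> (nat \<times> nat) set" where
  "diagram n lam = {(r, c). 1 \<le> r \<and> r \<le> 2*n \<and> 1 \<le> c \<and> c \<le> part n lam r}"

text \<open>\<open>T r c\<close> is the entry in row \<open>r\<close> and column \<open>c\<close>; it is \<open>0\<close> outside the diagram.\<close>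

definition SST :: "nat \<Rightarrow> weight \<Rightarrow> (nat \<Rightarrow> nat \<Rightarrow> nat) set" where
  "SST n lam = {T.
     (\<forall>r c. (r, c) \<in> diagram n lam \<longrightarrow> T r c \<in> {1..2*n}) \<and>
     (\<forall>r c. (r, c) \<notin> diagram n lam \<longrightarrow> T r c = 0) \<and>
     (\<forall>r c. (r, c) \<in> diagram n lam \<and> (r, c+1) \<in> diagram n lam \<longrightarrow> T r c \<le> T r (c+1)) \<and>
     (\<forall>r c. (r, c) \<in> diagram n lam \<and> (r+1, c) \<in> diagram n lam \<longrightarrow> T r c < T (r+1) c)}"

definition reading_word :: "nat \<Rightarrow> weight \<Rightarrow> (nat \<Rightarrow> nat \<Rightarrow> nat) \<Rightarrow> nat list" where
  "reading_word n lam T =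
     concat (map (\<lambda>c. map (\<lambda>r. T r c) (filter (\<lambda>r. (r, c) \<in> diagram n lam) [1..<2*n+1]))
       (rev [1..<part n lam 1 + 1]))"

text \<open>On \<open>[0, 1]\<close>, with \<open>N\<close> the length of the word, \<open>j\<close> is an index with
  \<open>(j-1)/N \<le> t \<le> j/N\<close>; see \<open>word_path_segment\<close> below.  Paths vanish outside \<open>[0, 1]\<close>.\<close>

type_synonym path = "real \<Rightarrow> weight"

definition word_path :: "nat \<Rightarrow> nat list \<Rightarrow> path" where
  "word_path n w t h =
     (if t \<in> {0..1} then
        let N = real (length w); j = max 1 (nat \<lceil>N * t\<rceil>) in
        (\<Sum>k=1..j-1. eps n (w ! (k-1)) h) + N * (t - real (j-1) / N) * eps n (w ! (j-1)) h
      else 0)"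

lemma word_path_segment:
  assumes "1 \<le> j" "j \<le> length w"
    and "real (j-1) / real (length w) \<le> t" "t \<le> real j / real (length w)"
  shows "word_path n w t h =
    (\<Sum>k=1..j-1. eps n (w ! (k-1)) h)
    + real (length w) * (t - real (j-1) / real (length w)) * eps n (w ! (j-1)) h"
proof -
  define N where "N = real (length w)"
  have N: "N > 0" using assms(1,2) by (auto simp: N_def)
  have lo: "real j - 1 \<le> N * t" and hi: "N * t \<le> real j"
    using assms N by (simp_all add: N_def of_nat_diff field_simps)
  have "0 \<le> N * t" using lo assms(1) by linarith
  then have t0: "0 \<le> t" using N by (simp add: zero_le_mult_iff)
  have "N * t \<le> N * 1" using hi assms(2) by (simp add: N_def)
  then have t: "t \<in> {0..1}" using N t0 by simp
  show ?thesis
  proof (cases "N * t = real j - 1")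
    case False
    then have "\<lceil>N * t\<rceil> = int j" using lo hi by (intro ceiling_unique) auto
    then have "max 1 (nat \<lceil>N * t\<rceil>) = j" using assms(1) by simp
    then show ?thesis using t by (simp add: word_path_def Let_def flip: N_def)
  next
    case True
    then have c: "\<lceil>N * t\<rceil> = int j - 1"
      by (intro ceiling_unique) auto
    have tj: "N * (t - real (j-1) / N) = 0"
      using True N assms(1) by (simp add: field_simps of_nat_diff)
    show ?thesis
    proof (cases "j = 1")
      case j: True
      show ?thesis using t c by (simp add: word_path_def Let_def j flip: N_def)
    next
      case False
      then obtain i where i: "j = Suc (Suc i)"
        using assms(1) by (metis One_nat_def not0_implies_Suc not_one_le_zero)
      have "nat \<lceil>N * t\<rceil> = Suc i" using c i by simp
      moreover have "N * (t - real i / N) = 1"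
        using True N i by (simp add: field_simps)
      ultimately show ?thesis
        using t tj by (simp add: word_path_def Let_def i flip: N_def)
    qed
  qed
qed

definition tableau_path :: "nat \<Rightarrow> weight \<Rightarrow> (nat \<Rightarrow> nat \<Rightarrow> nat) \<Rightarrow> path" where
  "tableau_path n lam T = word_path n (reading_word n lam T)"

definition B_paths :: "nat \<Rightarrow> weight \<Rightarrow> path set" where
  "B_paths n lam = tableau_path n lam ` SST n lam"

definition ghat_dominant :: "nat \<Rightarrow> path \<Rightarrow> bool" where
  "ghat_dominant n \<pi> \<longleftrightarrow> (\<forall>t\<in>{0..1}. \<forall>i\<in>{1..n}. 0 \<le> hat n (\<pi> t) (h_hat n i))"

end

theory Submission
 imports Defs "HOL-Library.Poly_Mapping" "HOL-Library.Product_Plus" "HOL-Combinatorics.Transposition"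
begin

text \<open>An irreducible submodule \<open>W\<close> of a tensor power of the natural module, for \<open>gl(2n)\<close> as well as for the
 fixed point subalgebra, is unitary, and the Casimir operator acts on it by a scalar. Taking traces over the weight
 spaces gives Freudenthal's recursion for the weight multiplicities \<open>m\<close>, from which one obtains
 \<open>\<Sum>\<eta>. m(\<eta>) J(\<mu> + \<delta> - \<eta>) = [\<mu> is the highest weight of W]\<close> for dominant \<open>\<mu>\<close>, where \<open>J\<close> are the coefficients of the
 Weyl denominator. So this linear functional of the weight multiplicities counts the summands of highest
 weight \<open>\<mu>\<close> in any submodule. Evaluated on the contents of semistandard tableaux, it is computed by Stembridge's
 sign reversing involution: a Bender-Knuth move at the first place where the reading word leaves the dominant
 chamber cancels all tableaux but those whose paths are dominant. For \<open>gl(2n)\<close> only one tableau survives, and as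
 both sides are symmetric the weight multiplicities of \<open>L(\<lambda>)\<close> are the numbers of tableaux. Folding these weights
 and applying the functional of the fixed point subalgebra gives the branching multiplicities.\<close>

section \<open>Roots\<close>

text \<open>For both algebras the positive roots are the differences \<open>root i j\<close> of
  letter weights with \<open>i < j\<close>; folding only identifies each pair of letters with its
  mirror image. So one family of operators, one Casimir sum and one denominator serve both, and the
  two cases differ in little more than the factor \<open>1 + fold_coeff\<close>. Freudenthal's
  recursion says that the product of denominator and character is an eigenvector of the Laplacian,
  so all its exponents have the same norm. Among the exponents \<open>\<mu> + \<delta>\<close> with
  \<mu> dominant this leaves \<open>\<kappa> + \<delta>\<close>, where \<kappa> is the highest
  weight. Only these coefficients of the product are ever used, and the Weyl group enters through
  its simple reflections. In a tensor power the operators with exchanged indices are adjoint to each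
  other. Orthogonal complements therefore split submodules, and traces become sums of squared norms.
  A module given abstractly by its highest weight is carried into a tensor power by uniqueness; that
  the weight occurs there follows from the positivity of a count of summands.\<close>

type_synonym ivec = "nat \<Rightarrow> int"
type_synonym tab = "nat \<Rightarrow> nat \<Rightarrow> nat"
type_synonym tens = "nat list \<Rightarrow> complex"
type_synonym 'v ops = "nat \<Rightarrow> nat \<Rightarrow> 'v \<Rightarrow> 'v"

lemma sum_fun_apply: "(\<Sum>x\<in>A. f x) y = (\<Sum>x\<in>A. f x y)" by (induction A rule: infinite_finite_induct) auto

definition bv :: "nat \<Rightarrow> nat \<Rightarrow> int" where
 "bv a = (\<lambda>i. if i = a then 1 else 0)"

text \<open>The parameter \<open>symplectic\<close> selects \<open>gl(2n)\<close> or its fixed point subalgebra, whose weights are written as vectors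
 of \<open>2n\<close> coordinates that change sign under \<open>i \<mapsto> 2n - 1 - i\<close>. Letters and coordinates are counted from 0, and
 \<open>hv a\<close> is the weight of the letter \<open>a\<close>.\<close>

locale folding =
 fixes n :: nat and symplectic :: bool
 assumes n_pos: "0 < n"
begin

text \<open>A constant rather than the parameter itself: simplification would replace an assumed
 parameter by \<open>True\<close> inside all other constants of the locale.\<close>

definition sp :: bool where "sp = symplectic"

definition bar :: "nat \<Rightarrow> nat" where "bar a = 2*n - 1 - a"

text \<open>A number instead of a truth value lets most identities for the two algebras be proved at
  once by ring arithmetic.\<close>

definition fold_coeff :: int where "fold_coeff = (if sp then 1 else 0)"

definition hv :: "nat \<Rightarrow> nat \<Rightarrow> int" where
 "hv a = (\<lambda>i. bv a i - fold_coeff * bv (bar a) i)"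

definition root :: "nat \<Rightarrow> nat \<Rightarrow> nat \<Rightarrow> int" where
 "root i j = hv i - hv j"

text \<open>The positive roots of type A, or after folding those of type C: then
  \<open>(i, j)\<close> and \<open>(bar j, bar i)\<close> give the same root, and the pairs
  \<open>(i, bar i)\<close> give the long roots.\<close>

definition roots :: "ivec set" where
 "roots = {root i j | i j. i < j \<and> j < 2*n}"

text \<open>After folding each coordinate occurs twice up to sign, so this is twice the standard
  form of type C.\<close>

definition ipr :: "ivec \<Rightarrow> ivec \<Rightarrow> int" where
 "ipr \<xi> \<eta> = (\<Sum>i<2*n. \<xi> i * \<eta> i)"

definition lat :: "ivec set" where
 "lat = {\<xi>. (\<forall>i\<ge>2*n. \<xi> i = 0) \<and> (sp \<longrightarrow> (\<forall>i<2*n. \<xi> (bar i) = - \<xi> i))}"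

text \<open>A simple reflection as a permutation of coordinates. In the folded case the mirror
  images are exchanged as well; for \<open>Suc a = n\<close> the two exchanges are the same
  one.\<close>

definition sw :: "nat \<Rightarrow> nat \<Rightarrow> nat" where
 "sw a i = (if i = a then Suc a else if i = Suc a then a
       else if sp \<and> i = bar a then bar (Suc a) else if sp \<and> i = bar (Suc a) then bar a else i)"

text \<open>Strict dominance. On a folded vector the inequality in the middle compares a coordinate
  with its own negative and so says that it is positive.\<close>

definition sdec :: "ivec \<Rightarrow> bool" where
 "sdec \<xi> \<longleftrightarrow> (\<forall>a. Suc a < 2*n \<longrightarrow> \<xi> (Suc a) < \<xi> a)"

definition wdec :: "ivec \<Rightarrow> bool" where
 "wdec \<xi> \<longleftrightarrow> (\<forall>a. Suc a < 2*n \<longrightarrow> \<xi> (Suc a) \<le> \<xi> a)"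

text \<open>In the folded case half the sum of the positive roots, with coordinates
  \<open>n, ..., 1, -1, ..., -n\<close>, so that the step in the middle is 2. Otherwise half the sum
  of the roots is moved along \<open>(1, ..., 1)\<close> to the integral vector
  \<open>2n - 1, ..., 0\<close>.\<close>

definition delta :: "nat \<Rightarrow> int" where
 "delta = (\<lambda>a. if a \<ge> 2*n then 0 else if sp then (if a < n then int n - int a else int n - 1 - int a)
        else 2 * int n - 1 - int a)"

lemma bar_bar [simp]: "a < 2*n ==> bar (bar a) = a" by (simp add: bar_def)

lemma bar_less [simp]: "a < 2*n ==> bar a < 2*n" by (simp add: bar_def)

lemma bar_less' [simp]: "bar a < 2*n" using n_pos by (simp add: bar_def)

lemma bar_neq [simp]: "a < 2*n ==> bar a \<noteq> a" unfolding bar_def by arith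

lemma bar_eq_iff: "a < 2*n ==> b < 2*n ==> bar a = bar b \<longleftrightarrow> a = b" by (auto simp: bar_def)

lemma bar_eq_swap: "a < 2*n ==> b < 2*n ==> bar a = b \<longleftrightarrow> a = bar b" by (auto simp: bar_def)

lemma bar_less_iff: "a < 2*n ==> b < 2*n ==> bar a < bar b \<longleftrightarrow> b < a" by (auto simp: bar_def)

lemma sum_bv: "a < 2*n ==> (\<Sum>i<2*n. bv a i * f i) = (f a :: int)"
 by (simp add: bv_def if_distrib[of "\<lambda>x. x * _"] cong: if_cong)

lemma lat_bar: "\<xi> \<in> lat ==> i < 2*n ==> fold_coeff * \<xi> (bar i) = - fold_coeff * \<xi> i"
 by (auto simp: lat_def fold_coeff_def)

lemma hv_lat: "a < 2*n ==> hv a \<in> lat" using bar_eq_swap[of a] bar_eq_iff[of _ a]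
 by (auto simp: lat_def hv_def bv_def fold_coeff_def bar_eq_iff) (metis bar_less' not_less)+

lemma lat_zero: "0 \<in> lat" by (simp add: lat_def)
lemma lat_add: "\<xi> \<in> lat ==> \<eta> \<in> lat ==> \<xi> + \<eta> \<in> lat" by (simp add: lat_def)
lemma lat_diff: "\<xi> \<in> lat ==> \<eta> \<in> lat ==> \<xi> - \<eta> \<in> lat" by (simp add: lat_def)
lemma root_lat: "i < 2*n ==> j < 2*n ==> root i j \<in> lat" by (simp add: root_def hv_lat lat_diff)

lemma roots_lat: "\<alpha> \<in> roots ==> \<alpha> \<in> lat" by (auto simp: roots_def intro!: root_lat)

lemma delta_lat: "delta \<in> lat" by (auto simp: lat_def delta_def bar_def)

lemma ipr_commute: "ipr \<xi> \<eta> = ipr \<eta> \<xi>" by (simp add: ipr_def mult.commute)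

lemma ipr_add: "ipr (\<xi> + \<eta>) \<zeta> = ipr \<xi> \<zeta> + ipr \<eta> \<zeta>" "ipr \<zeta> (\<xi> + \<eta>) = ipr \<zeta> \<xi> + ipr \<zeta> \<eta>"
 by (simp_all add: ipr_def algebra_simps sum.distrib)

lemma ipr_diff: "ipr (\<xi> - \<eta>) \<zeta> = ipr \<xi> \<zeta> - ipr \<eta> \<zeta>" "ipr \<zeta> (\<xi> - \<eta>) = ipr \<zeta> \<xi> - ipr \<zeta> \<eta>"
 by (simp_all add: ipr_def algebra_simps sum_subtractf)

lemma ipr_zero [simp]: "ipr 0 \<zeta> = 0" by (simp add: ipr_def)

lemma ipr_sum: "ipr (sum f A) \<zeta> = (\<Sum>x\<in>A. ipr (f x) \<zeta>)"
 by (induction A rule: infinite_finite_induct) (simp_all only: sum.infinite sum.empty sum.insert ipr_zero ipr_add not_False_eq_True)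

text \<open>The mirror coordinate contributes the same amount once more, because both vectors change
  sign there.\<close>

lemma ipr_hv: "a < 2*n ==> \<xi> \<in> lat ==> ipr (hv a) \<xi> = (1 + fold_coeff) * \<xi> a"
 using lat_bar[of \<xi> a] by (simp add: ipr_def hv_def left_diff_distrib sum_subtractf sum_bv mult.assoc
  flip: sum_distrib_left) (simp add: algebra_simps)

lemma ipr_root: "i < 2*n ==> j < 2*n ==> \<xi> \<in> lat ==> ipr (root i j) \<xi> = (1 + fold_coeff) * (\<xi> i - \<xi> j)"
 by (simp add: root_def ipr_diff ipr_hv algebra_simps)

lemma sdec_less: "sdec \<xi> ==> i < j ==> j < 2*n ==> \<xi> j < \<xi> i"
proof (induction j)
 case (Suc j)
 thus ?case by (metis Suc_lessD less_antisym less_trans sdec_def)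
qed simp

lemma wdec_le: "wdec \<xi> ==> i \<le> j ==> j < 2*n ==> \<xi> j \<le> \<xi> i"
proof (induction j)
 case (Suc j)
 thus ?case by (metis Suc_lessD le_Suc_eq order.trans order_refl wdec_def)
qed simp

lemma fold_coeff_pos: "0 < 1 + fold_coeff" by (simp add: fold_coeff_def)

lemma ipr_root_pos: "\<alpha> \<in> roots ==> \<xi> \<in> lat ==> sdec \<xi> ==> 0 < ipr \<alpha> \<xi>"
 using fold_coeff_pos by (auto simp: roots_def ipr_root sdec_less)

lemma rootsI: "i < j ==> j < 2*n ==> root i j \<in> roots" by (auto simp: roots_def)

lemma finite_roots: "finite roots"
proof -
 have "roots \<subseteq> (\<lambda>(i,j). root i j) ` ({..<2*n} \<times> {..<2*n})" by (auto simp: roots_def)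
 thus ?thesis by (rule finite_subset) auto
qed

lemma sdec_delta: "sdec delta" by (auto simp: sdec_def delta_def)

section \<open>Simple reflections of the roots and of the Weyl vector\<close>

lemma bar_Suc: "Suc a < 2*n ==> bar a = Suc (bar (Suc a))" by (simp add: bar_def)

lemma sw_invol [simp]: "Suc a < 2*n ==> sw a (sw a i) = i"
 using bar_neq[of a] bar_neq[of "Suc a"] by (auto simp: sw_def bar_Suc)

lemma sw_less: "Suc a < 2*n ==> i < 2*n ==> sw a i < 2*n" by (auto simp: sw_def)

lemma sw_ge: "Suc a < 2*n ==> 2*n \<le> i ==> sw a i = i" by (auto simp: sw_def) (metis bar_less' leD)+

lemma sw_bar: "sp ==> Suc a < 2*n ==> i < 2*n ==> sw a (bar i) = bar (sw a i)"
 using bar_eq_swap[of i a] bar_eq_swap[of i "Suc a"] bar_eq_iff[of i a] bar_eq_iff[of i "Suc a"]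
  bar_neq[of a] bar_neq[of "Suc a"] bar_Suc[of a] bar_bar[of a] bar_bar[of "Suc a"]
 by (cases "i = a"; cases "i = Suc a"; cases "i = bar a"; cases "i = bar (Suc a)") (simp_all add: sw_def)

lemma sw_bij: "Suc a < 2*n ==> bij_betw (sw a) {..<2*n} {..<2*n}"
 by (rule bij_betwI[where g = "sw a"]) (auto simp: sw_less)

lemma ipr_sw: "Suc a < 2*n ==> ipr (\<xi> \<circ> sw a) (\<eta> \<circ> sw a) = ipr \<xi> \<eta>"
 unfolding ipr_def using sum.reindex_bij_betw[OF sw_bij, of a "\<lambda>i. \<xi> i * \<eta> i"] by simp

lemma hv_sw: "Suc a < 2*n ==> i < 2*n ==> hv i \<circ> sw a = hv (sw a i)"
proof
 fix k assume a: "Suc a < 2*n" "i < 2*n"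
 have 1: "(sw a k = i) = (k = sw a i)" using a by (metis sw_invol)
 have 2: "sp ==> (sw a k = bar i) = (k = bar (sw a i))" using a by (metis sw_bar sw_invol)
 show "(hv i \<circ> sw a) k = hv (sw a i) k" using 1 2 by (auto simp: hv_def bv_def fold_coeff_def)
qed

lemma root_sw: "Suc a < 2*n ==> i < 2*n ==> j < 2*n ==> root i j \<circ> sw a = root (sw a i) (sw a j)"
 by (simp add: root_def flip: hv_sw) (simp add: fun_eq_iff)

lemma root_bar: "sp ==> i < 2*n ==> j < 2*n ==> root (bar j) (bar i) = root i j"
 by (auto simp: root_def hv_def fold_coeff_def fun_eq_iff)

lemma root_swap: "- root i j = root j i" by (simp add: root_def)

text \<open>An exchange of neighbouring letters reverses the order of that one pair only. The folded
  reflection consists of two such exchanges, and both reversed pairs give the simple root, which is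
  excluded.\<close>

lemma sw_less_iff:
 assumes "Suc a < 2*n" "i < j" "j < 2*n" "root i j \<noteq> root a (Suc a)"
 shows "sw a i < sw a j"
proof -
 have ne: "\<not> (i = a \<and> j = Suc a)" using assms(4) by auto
 have ne2: "sp ==> \<not> (i = bar (Suc a) \<and> j = bar a)" using assms root_bar[of a "Suc a"] by auto
 define b where "b = bar (Suc a)"
 have b: "bar a = Suc b" "a \<noteq> Suc b" "b \<noteq> Suc a"
  using bar_Suc[of a] bar_neq[of a] bar_neq[of "Suc a"] assms(1) by (auto simp: b_def)
 \<comment> \<open>\<open>t c\<close> is the exchange of \<open>c\<close> and \<open>Suc c\<close>;
   the folded reflection is \<open>t a\<close> after \<open>t b\<close>, except in the middle, where
   \<open>a = b\<close>.\<close>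
 define t :: "nat \<Rightarrow> nat \<Rightarrow> nat" where
  "t c k = (if k = c then Suc c else if k = Suc c then c else k)" for c k
 have t: "t c k < t c l" if "k < l" "\<not> (k = c \<and> l = Suc c)" for c k l using that by (auto simp: t_def)
 have sw: "sw a k = (if sp \<and> a \<noteq> b then t a (t b k) else t a k)" for k
  using b unfolding sw_def b(1) b_def[symmetric] t_def by auto
 show ?thesis
 proof (cases "sp \<and> a \<noteq> b")
  case True
  hence "t b i < t b j" using t assms(2) ne2 b by (auto simp: b_def)
  moreover have "\<not> (t b i = a \<and> t b j = Suc a)" using ne b True by (auto simp: t_def)
  ultimately show ?thesis using True by (simp add: sw t)
 next
  case False
  show ?thesis unfolding sw if_not_P[OF False] by (rule t[OF assms(2) ne])
 qed
qed

lemma sw_simple: "Suc a < 2*n ==> root a (Suc a) \<circ> sw a = - root a (Suc a)"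
 using root_bar[of a "Suc a"] by (subst root_sw, simp_all add: root_swap, auto simp: sw_def bar_def)

lemma roots_sw:
 assumes a: "Suc a < 2*n"
 shows "bij_betw (\<lambda>\<alpha> i. \<alpha> (sw a i)) (roots - {root a (Suc a)}) (roots - {root a (Suc a)})"
proof -
 have 1: "\<alpha> \<circ> sw a \<in> roots - {root a (Suc a)}" if "\<alpha> \<in> roots - {root a (Suc a)}" for \<alpha>
 proof -
  obtain i j where ij: "\<alpha> = root i j" "i < j" "j < 2*n" and ne: "\<alpha> \<noteq> root a (Suc a)"
   using \<open>\<alpha> \<in> _\<close> by (auto simp: roots_def)
  have "\<alpha> \<circ> sw a = root (sw a i) (sw a j)" using ij a by (simp add: root_sw)
  moreover have "sw a i < sw a j" using sw_less_iff[OF a ij(2,3)] ne ij by simp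
  ultimately have r: "\<alpha> \<circ> sw a \<in> roots" using ij a by (simp add: rootsI sw_less)
  have "\<alpha> \<circ> sw a \<noteq> root a (Suc a)"
  proof
   assume "\<alpha> \<circ> sw a = root a (Suc a)"
   hence "\<alpha> \<circ> sw a \<circ> sw a = - root a (Suc a)" using sw_simple[OF a] by simp
   moreover have "\<alpha> \<circ> sw a \<circ> sw a = \<alpha>" using a by (auto simp: fun_eq_iff)
   ultimately have e: "\<alpha> = - root a (Suc a)" by simp
   \<comment> \<open>Pairing with \<open>delta\<close> shows that no positive root is the negative
     of another one.\<close>
   have "ipr \<alpha> delta > 0" "ipr (root a (Suc a)) delta > 0"
    using that a rootsI[of a "Suc a"] by (simp_all add: ipr_root_pos delta_lat sdec_delta)
   moreover have "ipr (- root a (Suc a)) delta = - ipr (root a (Suc a)) delta" by (simp add: ipr_def sum_negf)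
   ultimately show False using e by simp
  qed
  thus ?thesis using r by simp
 qed
 show ?thesis by (rule bij_betwI[where g = "\<lambda>\<alpha> i. \<alpha> (sw a i)"])
   (use 1 a in \<open>auto simp: comp_def\<close>)
qed

text \<open>The characteristic property of a Weyl vector. A multiple of \<open>(1, ..., 1)\<close>
  is invariant under the reflections, so the integral shift does no harm, and in the folded middle
  the step of 2 in \<open>delta\<close> matches the long simple root.\<close>

lemma delta_sw:
 assumes a: "Suc a < 2*n"
 shows "delta \<circ> sw a = delta - root a (Suc a)"
proof
 fix i
 define b where "b = bar (Suc a)"
 have b: "bar a = Suc b" "bar (Suc a) = b" "Suc (Suc (a + b)) = 2*n" "a \<noteq> Suc b" "b \<noteq> Suc a"
  using a bar_Suc[of a] bar_neq[of a] bar_neq[of "Suc a"] by (auto simp: b_def bar_def)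
 have sw: "sw a i = (if i = a then Suc a else if i = Suc a then a
   else if sp \<and> i = Suc b then b else if sp \<and> i = b then Suc b else i)" by (simp add: sw_def b(1,2))
 have rt: "root a (Suc a) i = (if i = a then 1 else 0) - (if i = Suc a then 1 else 0)
   - (if sp \<and> i = Suc b then 1 else 0) + (if sp \<and> i = b then 1 else 0)"
  by (simp add: root_def hv_def bv_def fold_coeff_def b(1,2))
 show "(delta \<circ> sw a) i = (delta - root a (Suc a)) i"
 proof (cases "i = a \<or> i = Suc a \<or> i = b \<or> i = Suc b")
  case False
  thus ?thesis by (simp add: sw rt)
 next
  case True
  thus ?thesis using b(3-5) unfolding comp_apply fun_diff_def sw rt by (cases sp; elim disjE; simp add: delta_def)
 qed
qed

lemma roots_simple: "Suc a < 2*n ==> root a (Suc a) \<in> roots" by (auto simp: roots_def)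

lemma const_if_sw_invariant:
 assumes "\<And>a. Suc a < 2*n ==> \<eta> \<circ> sw a = \<eta>" "i < 2*n"
 shows "\<eta> i = \<eta> 0" using assms(2)
proof (induction i)
 case (Suc i)
 have "(\<eta> \<circ> sw i) i = \<eta> i" using assms(1)[of i] Suc by simp
 moreover have "sw i i = Suc i" using Suc.prems by (auto simp: sw_def bar_def)
 ultimately show ?case using Suc by simp
qed simp

lemma sum_roots_sw:
 assumes a: "Suc a < 2*n"
 shows "(\<Sum>roots) \<circ> sw a = \<Sum>roots - root a (Suc a) - root a (Suc a)"
proof -
 let ?b = "root a (Suc a)"
 have "\<Sum>roots = ?b + \<Sum>(roots - {?b})" using sum.remove[OF finite_roots roots_simple[OF a], of "\<lambda>x. x"] by simp
 moreover have "(\<Sum>(roots - {?b})) \<circ> sw a = \<Sum>(roots - {?b})"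
 proof -
  have "(\<Sum>(roots - {?b})) \<circ> sw a = (\<Sum>\<alpha>\<in>roots - {?b}. \<alpha> \<circ> sw a)" by (rule ext) (simp add: sum_fun_apply)
  also have "\<dots> = (\<Sum>\<alpha>\<in>roots - {?b}. (\<lambda>i. \<alpha> (sw a i)))" by (simp add: comp_def)
  also have "\<dots> = \<Sum>(roots - {?b})" by (rule sum.reindex_bij_betw[OF roots_sw[OF a], of "\<lambda>x. x"])
  finally show ?thesis .
 qed
 moreover have "x \<circ> f = (y \<circ> f) + (z \<circ> f)" if "x = y + z"
  for x y z :: "nat \<Rightarrow> int" and f :: "nat \<Rightarrow> nat" using that by (simp add: fun_eq_iff)
 ultimately have "(\<Sum>roots) \<circ> sw a = (?b \<circ> sw a) + \<Sum>(roots - {?b})" by metis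
 with \<open>\<Sum>roots = _\<close> show ?thesis using sw_simple[OF a] by simp
qed

text \<open>Twice \<open>delta\<close> and the sum of the roots change by the same vector under each
  simple reflection, so their difference is fixed by all of them and is a multiple of
  \<open>(1, ..., 1)\<close>.\<close>

lemma sum_roots_ipr:
 obtains k where "\<And>\<nu>. (\<Sum>\<alpha>\<in>roots. ipr \<alpha> \<nu>) = 2 * ipr delta \<nu> + k * (\<Sum>i<2*n. \<nu> i)"
proof
 fix \<nu>
 define \<eta> where "\<eta> = \<Sum>roots - (delta + delta)"
 have "\<eta> \<circ> sw a = \<eta>" if a: "Suc a < 2*n" for a
 proof -
  have "\<eta> \<circ> sw a = ((\<Sum>roots) \<circ> sw a) - ((delta \<circ> sw a) + (delta \<circ> sw a))" by (simp add: \<eta>_def fun_eq_iff)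
  also have "\<dots> = (\<Sum>roots - root a (Suc a) - root a (Suc a))
    - ((delta - root a (Suc a)) + (delta - root a (Suc a)))" by (simp only: sum_roots_sw[OF a] delta_sw[OF a])
  also have "\<dots> = \<eta>" unfolding \<eta>_def by simp
  finally show ?thesis .
 qed
 hence c: "\<eta> i = \<eta> 0" if "i < 2*n" for i using const_if_sw_invariant that by blast
 have "(\<Sum>\<alpha>\<in>roots. ipr \<alpha> \<nu>) = ipr (\<eta> + (delta + delta)) \<nu>"
 proof -
  have "\<eta> + (delta + delta) = \<Sum>roots" unfolding \<eta>_def by simp
  thus ?thesis by (simp only: ipr_sum)
 qed
 also have "\<dots> = 2 * ipr delta \<nu> + ipr \<eta> \<nu>" by (simp only: ipr_add)
 also have "ipr \<eta> \<nu> = \<eta> 0 * (\<Sum>i<2*n. \<nu> i)"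
  unfolding ipr_def sum_distrib_left by (rule sum.cong) (use c in \<open>metis lessThan_iff\<close>)+
 finally show "(\<Sum>\<alpha>\<in>roots. ipr \<alpha> \<nu>) = 2 * ipr delta \<nu> + (\<Sum>roots - (delta + delta)) 0 * (\<Sum>i<2*n. \<nu> i)"
  by (simp add: \<eta>_def)
qed

lemma sw_stabilizes:
 assumes "\<xi> \<in> lat" "Suc a < 2*n" "\<xi> a = \<xi> (Suc a)"
 shows "\<xi> \<circ> sw a = \<xi>"
proof -
 have "sp ==> \<xi> (bar a) = \<xi> (bar (Suc a))" using assms by (simp add: lat_def)
 thus ?thesis using assms(3) by (auto simp: fun_eq_iff sw_def transpose_def)
qed

text \<open>Reflecting at an ascent raises the pairing with \<open>delta\<close>, so in a finite set
  that is closed under reflections an element of maximal pairing is dominant. Several extremal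
  arguments rest on this.\<close>

lemma ipr_sw_delta:
 assumes "\<xi> \<in> lat" "Suc a < 2*n"
 shows "ipr (\<xi> \<circ> sw a) delta = ipr \<xi> delta + (1 + fold_coeff) * (\<xi> (Suc a) - \<xi> a)"
proof -
 have "ipr (\<xi> \<circ> sw a) delta = ipr (\<xi> \<circ> sw a \<circ> sw a) (delta \<circ> sw a)" using ipr_sw[OF assms(2)] by metis
 also have "\<xi> \<circ> sw a \<circ> sw a = \<xi>" using assms by (auto simp: fun_eq_iff)
 finally have "ipr (\<xi> \<circ> sw a) delta = ipr \<xi> delta - ipr (root a (Suc a)) \<xi>"
  by (simp only: delta_sw[OF assms(2)] ipr_diff ipr_commute[of \<xi> "root a (Suc a)"])
 thus ?thesis using assms by (simp add: ipr_root algebra_simps)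
qed

text \<open>A point of the support with maximal pairing with \<open>delta\<close> has no ascent,
  since reflecting there would stay in the support and go higher, and it lies on no wall. So it is
  strictly dominant, where the function vanishes.\<close>

lemma antisym_zero:
 fixes g :: "ivec \<Rightarrow> 'b::{ab_group_add}"
 assumes fin: "finite {\<xi>. g \<xi> \<noteq> 0}"
  and lat: "\<And>\<xi>. g \<xi> \<noteq> 0 ==> \<xi> \<in> lat"
  and anti: "\<And>\<xi> a. \<xi> \<in> lat ==> Suc a < 2*n ==> \<xi> a < \<xi> (Suc a) ==> g \<xi> \<noteq> 0 ==> g (\<xi> \<circ> sw a) \<noteq> 0"
  and wall: "\<And>\<xi> a. \<xi> \<in> lat ==> Suc a < 2*n ==> \<xi> a = \<xi> (Suc a) ==> g \<xi> = 0"
  and dom: "\<And>\<xi>. \<xi> \<in> lat ==> sdec \<xi> ==> g \<xi> = 0"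
 shows "g \<xi> = 0"
proof (rule ccontr)
 assume "g \<xi> \<noteq> 0"
 hence ne: "{\<xi>. g \<xi> \<noteq> 0} \<noteq> {}" by auto
 define M where "M = Max ((\<lambda>\<xi>. ipr \<xi> delta) ` {\<xi>. g \<xi> \<noteq> 0})"
 have "M \<in> (\<lambda>\<xi>. ipr \<xi> delta) ` {\<xi>. g \<xi> \<noteq> 0}" unfolding M_def using fin ne by (intro Max_in) auto
 then obtain \<zeta> where z: "g \<zeta> \<noteq> 0" "M = ipr \<zeta> delta" by auto
 have zl: "\<zeta> \<in> lat" using z lat by blast
 then obtain a where a: "Suc a < 2*n" "\<zeta> a \<le> \<zeta> (Suc a)" using dom z by (force simp: sdec_def not_less)
 hence lt: "\<zeta> a < \<zeta> (Suc a)" using wall z zl by fastforce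
 hence "g (\<zeta> \<circ> sw a) \<noteq> 0" using anti z zl a by blast
 hence "ipr (\<zeta> \<circ> sw a) delta \<le> M" unfolding M_def using fin by (intro Max_ge) auto
 moreover have "0 < (1 + fold_coeff) * (\<zeta> (Suc a) - \<zeta> a)" using lt fold_coeff_pos by simp
 ultimately show False using ipr_sw_delta[OF zl a(1)] z(2) by linarith
qed

lemma sum_root: "(\<Sum>k<2*n. root i j k) = 0" if "i < 2*n" "j < 2*n"
proof -
 have "(\<Sum>k<2*n. hv a k) = 1 - fold_coeff" if "a < 2*n" for a
  using sum_bv[of a "\<lambda>_. 1"] sum_bv[of "bar a" "\<lambda>_. 1"] that
  by (simp add: hv_def sum_subtractf flip: sum_distrib_left)
 thus ?thesis using that by (simp add: root_def sum_subtractf)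
qed

text \<open>Integral coordinates make strict descents at least 1, which is what \<open>delta\<close>
  takes away. In the folded middle \<open>delta\<close> takes away 2, but there the coordinates are
  opposite and their difference is even.\<close>

lemma sdec_minus_delta:
 assumes "\<xi> \<in> lat" "sdec \<xi>"
 shows "wdec (\<xi> - delta)" unfolding wdec_def
proof (intro allI impI)
 fix a assume a: "Suc a < 2*n"
 have l: "\<xi> (Suc a) < \<xi> a" using assms(2) a by (simp add: sdec_def)
 have "\<xi> (Suc a) = - \<xi> a" if "sp" "Suc a = n"
 proof -
  have "bar a = Suc a" using that(2) unfolding bar_def by arith
  moreover have "\<xi> (bar a) = - \<xi> a" using assms(1) that(1) a by (simp add: lat_def)
  ultimately show ?thesis by simp
 qed
 thus "(\<xi> - delta) (Suc a) \<le> (\<xi> - delta) a" using l a by (cases "Suc a = n"; cases sp) (auto simp: delta_def)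
qed

lemma sdec_plus_delta: "wdec \<xi> ==> sdec (\<xi> + delta)"
 using sdec_delta by (auto simp: sdec_def wdec_def intro: add_le_less_mono)

text \<open>Chebyshev's sum inequality for two decreasing sequences, one of them with mean 0. The
  sign is changed because the inequality is applied to sequences of opposite monotonicity.\<close>

lemma ipr_wdec_nonneg:
 assumes "wdec \<xi>" "(\<Sum>i<2*n. \<xi> i) = 0"
 shows "0 \<le> ipr \<xi> delta"
proof -
 have "of_nat (2*n) * (\<Sum>k=0..<2*n. (- \<xi> k) * delta k) \<le> (\<Sum>k=0..<2*n. - \<xi> k) * (\<Sum>k=0..<2*n. delta k)"
 proof (rule Chebyshev_sum_upper)
  fix i j assume ij: "i \<le> j" "j < 2*n"
  show "- \<xi> i \<le> - \<xi> j" using wdec_le[OF assms(1) ij] by simp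
  show "delta j \<le> delta i" using sdec_less[OF sdec_delta, of i j] ij by (cases "i = j") auto
 qed
 moreover have "(\<Sum>k=0..<2*n. - \<xi> k) = 0" using assms(2) by (simp add: sum_negf atLeast0LessThan)
 moreover have "(\<Sum>k=0..<2*n. (- \<xi> k) * delta k) = - ipr \<xi> delta" by (simp add: sum_negf ipr_def atLeast0LessThan)
 ultimately have "0 \<le> int (2*n) * ipr \<xi> delta" by simp
 thus ?thesis using n_pos by (simp add: zero_le_mult_iff)
qed

end

section \<open>The Weyl denominator\<close>

text \<open>Applied to \<open>f x\<close> for a variable \<open>x\<close>, these rules make the simplifier eta-expand weights.\<close>

declare zero_fun_apply [simp del] plus_fun_apply [simp del] minus_apply [simp del] uminus_apply [simp del]

lemmas fun_ops = zero_fun_apply plus_fun_apply minus_apply uminus_apply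

type_synonym chr = "ivec \<Rightarrow>\<^sub>0 complex"

abbreviation lkp :: "chr \<Rightarrow> ivec \<Rightarrow> complex" where "lkp \<equiv> Poly_Mapping.lookup"
abbreviation mon :: "ivec \<Rightarrow> chr" where "mon k \<equiv> Poly_Mapping.single k 1"

lemma chr_induct [case_names single add]:
 fixes F :: chr
 assumes s: "\<And>k c. P (Poly_Mapping.single k c)" and a: "\<And>F G. P F ==> P G ==> P (F + G)"
 shows "P F"
proof -
 have z: "P 0" using s[of 0 0] by simp
 have "P (\<Sum>k\<in>A. Poly_Mapping.single k (lkp F k))" if "finite A" for A
  using that by (induction A) (auto intro: z a s)
 moreover have "F = (\<Sum>k\<in>Poly_Mapping.keys F. Poly_Mapping.single k (lkp F k))"
  by (rule poly_mapping_eqI) (simp add: lookup_sum lookup_single when_def in_keys_iff)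
 ultimately show ?thesis by (metis finite_keys)
qed

lemma lookup_single_times: "lkp (Poly_Mapping.single k c * F) x = c * lkp F (x - k)"
proof (induction F rule: chr_induct)
 case (single k' c')
 have "k + k' = x \<longleftrightarrow> k' = x - k" by (auto simp: algebra_simps)
 thus ?case by (cases "k + k' = x") (simp_all add: mult_single lookup_single)
qed (simp add: distrib_left lookup_add)

lemma mon_mult: "mon k * mon l = mon (k + l)" by (simp add: mult_single)

text \<open>The derivative of exponentials along the coordinate \<open>i\<close>. As a derivation it
  makes logarithmic derivatives available for formal characters.\<close>

definition pd :: "nat \<Rightarrow> chr \<Rightarrow> chr" where
 "pd i F = Poly_Mapping.mapp (\<lambda>k c. of_int (k i) * c) F"

lemma lookup_pd: "lkp (pd i F) k = of_int (k i) * lkp F k" by (simp add: pd_def lookup_mapp when_def in_keys_iff)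

lemma pd_add: "pd i (F + G) = pd i F + pd i G"
 by (rule poly_mapping_eqI) (simp add: lookup_pd lookup_add distrib_left)

lemma pd_diff: "pd i (F - G) = pd i F - pd i G"
 by (rule poly_mapping_eqI) (simp add: lookup_pd lookup_minus right_diff_distrib)

lemma pd_single: "pd i (Poly_Mapping.single k c) = Poly_Mapping.single k (of_int (k i) * c)"
 by (rule poly_mapping_eqI) (simp add: lookup_pd lookup_single when_def)

lemma pd_mult: "pd i (F * G) = pd i F * G + F * pd i G"
proof (induction F rule: chr_induct)
 case (single k c)
 show ?case
 proof (induction G rule: chr_induct)
  case (single k' c')
  show ?case by (simp add: mult_single pd_single fun_ops algebra_simps flip: single_add)
 qed (simp add: pd_add distrib_left)
qed (simp add: pd_add distrib_right)

lemma lookup_of_int_times: "lkp (of_int c * F) k = of_int c * lkp F k"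
 using lookup_single_times[of 0 "of_int c" F k] by simp

lemma pd_prod: "finite A ==> pd i (\<Prod>a\<in>A. f a) = (\<Sum>a\<in>A. (\<Prod>b\<in>A - {a}. f b) * pd i (f a))"
proof (induction A rule: finite_induct)
 case empty
 show ?case using pd_single[of i 0 1] by (simp add: fun_ops)
next
 case (insert x A)
 note ins = insert
 have "(\<Prod>b\<in>insert x A - {a}. f b) = f x * (\<Prod>b\<in>A - {a}. f b)" if "a \<in> A" for a
 proof -
  have "insert x A - {a} = insert x (A - {a})" using ins that by auto
  thus ?thesis using ins by simp
 qed
 moreover have "insert x A - {x} = A" using ins by auto
 ultimately show ?case using ins by (simp add: pd_mult sum_distrib_left mult.assoc algebra_simps cong: sum.cong)
qed

context folding
begin

inductive_set cone :: "ivec set" where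
 cone_zero: "0 \<in> cone"
| cone_root: "\<beta> \<in> cone ==> \<alpha> \<in> roots ==> \<alpha> + \<beta> \<in> cone"

lemma cone_add: "\<beta> \<in> cone ==> \<gamma> \<in> cone ==> \<beta> + \<gamma> \<in> cone"
 by (induction rule: cone.induct) (simp_all add: add.assoc cone_root)

lemma cone_lat: "\<beta> \<in> cone ==> \<beta> \<in> lat" by (induction rule: cone.induct) (simp_all add: lat_zero lat_add roots_lat)

lemma sum_fun_add: "sum (f + g) A = sum f A + sum g A" for f g :: "'b \<Rightarrow> int" by (simp add: plus_fun_def sum.distrib)

lemma sum_fun_diff: "sum (f - g) A = sum f A - sum g A" for f g :: "'b \<Rightarrow> int"
 by (simp add: fun_diff_def sum_subtractf)

lemma cone_sum: "\<beta> \<in> cone ==> (\<Sum>i<2*n. \<beta> i) = 0"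
proof (induction rule: cone.induct)
 case cone_zero
 show ?case by (simp add: zero_fun_def)
next
 case (cone_root \<beta> \<alpha>)
 thus ?case unfolding sum_fun_add by (auto simp: roots_def sum_root)
qed

text \<open>Every strictly dominant vector is a height function on the cone. The argument with equal
  norms uses one that depends on the two weights compared.\<close>

lemma cone_ipr: "\<beta> \<in> cone ==> \<zeta> \<in> lat ==> sdec \<zeta> ==> 0 \<le> ipr \<beta> \<zeta> \<and> (ipr \<beta> \<zeta> = 0 \<longrightarrow> \<beta> = 0)"
proof (induction rule: cone.induct)
 case (cone_root \<beta> \<alpha>)
 hence "0 < ipr \<alpha> \<zeta>" "0 \<le> ipr \<beta> \<zeta>" by (auto intro: ipr_root_pos)
 thus ?case by (simp add: ipr_add)
qed simp

lemma cone_pointed: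
 assumes "\<beta> \<in> cone" "- \<beta> \<in> cone"
 shows "\<beta> = 0"
proof -
 have "ipr (- \<beta>) delta = - ipr \<beta> delta" by (simp add: ipr_def sum_negf fun_ops)
 thus ?thesis using cone_ipr[OF assms(1) delta_lat sdec_delta] cone_ipr[OF assms(2) delta_lat sdec_delta] by auto
qed

lemma sdec_add: "sdec \<xi> ==> sdec \<eta> ==> sdec (\<xi> + \<eta>)" unfolding sdec_def plus_fun_def by (auto intro: add_strict_mono)

text \<open>\<open>J\<close> gives the coefficients of \<open>e^\<delta> \<Prod>\<alpha>. (1 - e^(-\<alpha>))\<close>. For \<open>gl(2n)\<close> the vector \<open>\<delta>\<close> is the half sum of the roots
 up to a multiple of \<open>(1,...,1)\<close>.\<close>

definition denom_part :: "ivec set \<Rightarrow> chr" where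
 "denom_part A = (\<Prod>\<alpha>\<in>A. 1 - mon (- \<alpha>))"

definition denom :: chr where "denom = mon delta * denom_part roots"

definition J :: "ivec \<Rightarrow> complex" where "J = lkp denom"

text \<open>A factor \<open>1 - e^(-\<alpha>)\<close> moves exponents only downwards. The
  coefficient at 0 stays 1: a further contribution would come from the exponent \<alpha>, and a
  pointed cone does not contain both \<alpha> and its negative.\<close>

lemma denom_part_support:
 assumes "finite A" "A \<subseteq> roots"
 shows "(lkp (denom_part A) x \<noteq> 0 \<longrightarrow> - x \<in> cone) \<and> lkp (denom_part A) 0 = 1" using assms
proof (induction A arbitrary: x rule: finite_induct)
 case empty
 show ?case by (simp add: denom_part_def lookup_one when_def cone_zero)
next
 case (insert \<alpha> A)
 have e: "lkp (denom_part (insert \<alpha> A)) y = lkp (denom_part A) y - lkp (denom_part A) (y + \<alpha>)" for y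
  using insert by (simp add: denom_part_def left_diff_distrib lookup_minus lookup_single_times)
 have r: "\<alpha> \<in> roots" using insert by simp
 have IH: "\<And>y. lkp (denom_part A) y \<noteq> 0 ==> - y \<in> cone" "lkp (denom_part A) 0 = 1" using insert by auto
 have "- x \<in> cone" if "lkp (denom_part (insert \<alpha> A)) x \<noteq> 0"
 proof (cases "lkp (denom_part A) x = 0")
  case True
  hence "lkp (denom_part A) (x + \<alpha>) \<noteq> 0" using that e[of x] by simp
  hence "- (x + \<alpha>) \<in> cone" by (rule IH(1))
  from cone_root[OF this r] show ?thesis by simp
 qed (rule IH(1))
 moreover have "lkp (denom_part A) \<alpha> = 0"
 proof (rule ccontr)
  assume "lkp (denom_part A) \<alpha> \<noteq> 0"
  hence "- \<alpha> \<in> cone" by (rule IH)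
  moreover have "\<alpha> \<in> cone" using cone_root[OF cone_zero r] by simp
  ultimately have "\<alpha> = 0" using cone_pointed by blast
  thus False using ipr_root_pos[OF r delta_lat sdec_delta] by simp
 qed
 ultimately show ?case using e[of 0] IH(2) by simp
qed

lemma J_support: "J \<xi> \<noteq> 0 ==> delta - \<xi> \<in> cone"
 using denom_part_support[OF finite_roots, of "\<xi> - delta"] by (simp add: J_def denom_def lookup_single_times)

lemma J_delta: "J delta = 1"
 using denom_part_support[OF finite_roots, of 0] by (simp add: J_def denom_def lookup_single_times)

lemma J_lat: "J \<xi> \<noteq> 0 ==> \<xi> \<in> lat" using lat_diff[OF delta_lat cone_lat[OF J_support]] by simp

text \<open>By the support property \<xi> is at most as high as \<open>delta\<close>; by Chebyshev's
  inequality the dominant vector \<open>\<xi> - delta\<close>, of coordinate sum 0, has nonnegative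
  height. Together the height of \<open>delta - \<xi>\<close> is 0, which on the cone means
  equality.\<close>

lemma J_sdec:
 assumes "\<xi> \<in> lat" "sdec \<xi>"
 shows "J \<xi> = (if \<xi> = delta then 1 else 0)"
proof (cases "J \<xi> = 0")
 case True
 thus ?thesis using J_delta by auto
next
 case False
 hence c: "delta - \<xi> \<in> cone" by (rule J_support)
 have "(\<Sum>i<2*n. (\<xi> - delta) i) = 0" using cone_sum[OF c] unfolding sum_fun_diff by linarith
 hence "0 \<le> ipr (\<xi> - delta) delta" by (rule ipr_wdec_nonneg[OF sdec_minus_delta[OF assms]])
 moreover have "ipr (\<xi> - delta) delta = - ipr (delta - \<xi>) delta" by (simp add: ipr_diff)
 ultimately have "delta - \<xi> = 0" using cone_ipr[OF c delta_lat sdec_delta] by auto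
 thus ?thesis using J_delta by simp
qed

section \<open>Antisymmetry of the Weyl denominator\<close>

definition swp :: "nat \<Rightarrow> chr \<Rightarrow> chr" where "swp a = Poly_Mapping.map_key (\<lambda>k. k \<circ> sw a)"

lemma sw_sw: "Suc a < 2*n ==> (k \<circ> sw a) \<circ> sw a = k" by (auto simp: fun_eq_iff)

lemma sw_inj: "Suc a < 2*n ==> inj (\<lambda>k::nat \<Rightarrow> int. k \<circ> sw a)" by (rule injI) (metis sw_sw)

lemma lookup_swp: "Suc a < 2*n ==> lkp (swp a F) k = lkp F (k \<circ> sw a)"
 unfolding swp_def by (subst map_key.rep_eq[OF sw_inj]) auto

lemma swp_add: "Suc a < 2*n ==> swp a (F + G) = swp a F + swp a G"
 by (rule poly_mapping_eqI) (simp add: lookup_swp lookup_add)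

lemma swp_diff: "Suc a < 2*n ==> swp a (F - G) = swp a F - swp a G"
 by (rule poly_mapping_eqI) (simp add: lookup_swp lookup_minus)

lemma swp_single: "Suc a < 2*n ==> swp a (Poly_Mapping.single k c) = Poly_Mapping.single (k \<circ> sw a) c"
 by (rule poly_mapping_eqI) (auto simp: lookup_swp lookup_single when_def sw_sw dest: sw_sw)

lemma swp_mult: "Suc a < 2*n ==> swp a (F * G) = swp a F * swp a G"
proof (induction F rule: chr_induct)
 case (single k c)
 thus ?case
 proof (induction G rule: chr_induct)
  case (single k' c')
  have "(k + k') \<circ> sw a = (k \<circ> sw a) + (k' \<circ> sw a)" by (simp add: fun_eq_iff fun_ops)
  thus ?case using single by (simp add: swp_single mult_single)
 qed (simp add: distrib_left swp_add)
qed (simp add: distrib_right swp_add)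

lemma swp_one: "Suc a < 2*n ==> swp a 1 = 1"
proof -
 assume a: "Suc a < 2*n"
 have "(0 :: nat \<Rightarrow> int) \<circ> sw a = 0" by (simp add: fun_eq_iff fun_ops)
 thus ?thesis using swp_single[OF a, of 0 1] by simp
qed

lemma swp_prod: "Suc a < 2*n ==> swp a (\<Prod>x\<in>A. f x) = (\<Prod>x\<in>A. swp a (f x))"
 by (induction A rule: infinite_finite_induct) (simp_all add: swp_one swp_mult)

lemma uminus_comp: "(- k) \<circ> f = - (k \<circ> f)" for k :: "nat \<Rightarrow> int" by (simp add: fun_eq_iff fun_ops)

text \<open>The reflection permutes all factors except the one of its own root \<open>b\<close>, and
  for that one \<open>e^(\<delta>-b) (1 - e^b) = - e^\<delta> (1 - e^(-b))\<close>.\<close>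

lemma denom_swp:
 assumes a: "Suc a < 2*n"
 shows "swp a denom = - denom"
proof -
 let ?b = "root a (Suc a)"
 have d: "denom_part roots = (1 - mon (- ?b)) * denom_part (roots - {?b})"
  unfolding denom_part_def by (rule prod.remove[OF finite_roots roots_simple[OF a]])
 have "swp a (denom_part (roots - {?b})) = (\<Prod>\<alpha>\<in>roots - {?b}. 1 - mon (- (\<lambda>i. \<alpha> (sw a i))))"
  unfolding denom_part_def using a
  by (simp add: swp_prod swp_diff swp_one swp_single uminus_comp) (simp add: comp_def)
 also have "\<dots> = denom_part (roots - {?b})"
  unfolding denom_part_def by (rule prod.reindex_bij_betw[OF roots_sw[OF a], of "\<lambda>\<alpha>. 1 - mon (- \<alpha>)"])
 finally have r: "swp a (denom_part (roots - {?b})) = denom_part (roots - {?b})" .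
 have "swp a denom = mon (delta - ?b) * ((1 - mon ?b) * denom_part (roots - {?b}))" unfolding denom_def d using a
  by (simp add: swp_mult swp_diff swp_one swp_single uminus_comp sw_simple delta_sw r)
 also have "\<dots> = (mon (delta - ?b) * (1 - mon ?b)) * denom_part (roots - {?b})" by (rule mult.assoc[symmetric])
 also have "mon (delta - ?b) * (1 - mon ?b) = - (mon delta * (1 - mon (- ?b)))"
  by (simp add: right_diff_distrib mon_mult)
 also have "\<dots> * denom_part (roots - {?b}) = - denom" unfolding denom_def d by (simp add: mult.assoc)
 finally show ?thesis .
qed

lemma J_sw: "Suc a < 2*n ==> J (\<xi> \<circ> sw a) = - J \<xi>" using lookup_swp[of a denom \<xi>] denom_swp[of a] by (simp add: J_def)

lemma J_wall:
 assumes "\<xi> \<in> lat" "Suc a < 2*n" "\<xi> a = \<xi> (Suc a)"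
 shows "J \<xi> = 0" using J_sw[OF assms(2), of \<xi>] sw_stabilizes[OF assms] by simp

lemma finite_J: "finite {\<xi>. J \<xi> \<noteq> 0}" unfolding J_def by simp

text \<open>Weighted by the defect of the norm, the coefficients are still antisymmetric, and they
  vanish at the only strictly dominant exponent \<open>delta\<close>; hence they vanish
  everywhere.\<close>

lemma J_norm: "J \<xi> \<noteq> 0 ==> ipr \<xi> \<xi> = ipr delta delta"
proof -
 define g where "g \<zeta> = of_int (ipr \<zeta> \<zeta> - ipr delta delta) * J \<zeta>" for \<zeta>
 have "g \<xi> = 0"
 proof (rule antisym_zero)
  have "{\<xi>. g \<xi> \<noteq> 0} \<subseteq> {\<xi>. J \<xi> \<noteq> 0}" by (auto simp: g_def)
  thus "finite {\<xi>. g \<xi> \<noteq> 0}" using finite_J finite_subset by blast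
  show "\<zeta> \<in> lat" if "g \<zeta> \<noteq> 0" for \<zeta> using that J_lat by (auto simp: g_def)
  show "g (\<zeta> \<circ> sw a) \<noteq> 0" if "Suc a < 2*n" "g \<zeta> \<noteq> 0" for \<zeta> a using that by (auto simp: g_def J_sw ipr_sw)
  show "g \<zeta> = 0" if "\<zeta> \<in> lat" "Suc a < 2*n" "\<zeta> a = \<zeta> (Suc a)" for \<zeta> a using J_wall[OF that] by (simp add: g_def)
  show "g \<zeta> = 0" if "\<zeta> \<in> lat" "sdec \<zeta>" for \<zeta> using J_sdec[OF that] by (auto simp: g_def)
 qed
 thus "J \<xi> \<noteq> 0 ==> ipr \<xi> \<xi> = ipr delta delta" by (simp add: g_def)
qed

section \<open>The Laplacian on formal characters and Freudenthal's recursion\<close>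

definition lap :: "chr \<Rightarrow> chr" where "lap F = (\<Sum>i<2*n. pd i (pd i F))"

definition dirv :: "ivec \<Rightarrow> chr \<Rightarrow> chr" where "dirv v F = (\<Sum>i<2*n. of_int (v i) * pd i F)"

lemma lookup_lap: "lkp (lap F) k = of_int (ipr k k) * lkp F k"
 by (simp add: lap_def lookup_sum lookup_pd ipr_def sum_distrib_right mult.assoc)

lemma lookup_dirv: "lkp (dirv v F) k = of_int (ipr v k) * lkp F k"
 by (simp add: dirv_def lookup_sum lookup_pd ipr_def sum_distrib_right lookup_of_int_times mult.assoc)

lemma lap_mult: "lap (F * G) = lap F * G + 2 * (\<Sum>i<2*n. pd i F * pd i G) + F * lap G"
proof -
 have "pd i (pd i (F * G)) = pd i (pd i F) * G + 2 * (pd i F * pd i G) + F * pd i (pd i G)" for i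
  by (simp add: pd_mult pd_add algebra_simps)
 thus ?thesis by (simp add: lap_def sum.distrib sum_distrib_left sum_distrib_right)
qed

text \<open>The denominator divided by the factor of \<alpha>; it allows logarithmic derivatives to
  be multiplied out without a division.\<close>

definition codenom :: "ivec \<Rightarrow> chr" where
 "codenom \<alpha> = mon delta * denom_part (roots - {\<alpha>})"

lemma denom_codenom: "\<alpha> \<in> roots ==> denom = codenom \<alpha> * (1 - mon (- \<alpha>))"
 unfolding denom_def codenom_def denom_part_def by (subst prod.remove[OF finite_roots]) (simp_all add: ac_simps)

lemma pd_denom:
 "pd i denom = of_int (delta i) * denom + (\<Sum>\<alpha>\<in>roots. of_int (\<alpha> i) * (mon (- \<alpha>) * codenom \<alpha>))"
proof -
 have s: "Poly_Mapping.single k (of_int c) = of_int c * mon k" for k c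
  by (rule poly_mapping_eqI) (simp add: lookup_of_int_times lookup_single when_def)
 have "pd i (1 - mon (- \<alpha>)) = of_int (\<alpha> i) * mon (- \<alpha>)" for \<alpha>
  using pd_single[of i 0 1] s[of "- \<alpha>" "- \<alpha> i"] by (simp add: pd_diff pd_single fun_ops single_uminus)
 thus ?thesis unfolding denom_def codenom_def denom_part_def using s
  by (simp add: pd_mult pd_single pd_prod[OF finite_roots] sum_distrib_left ac_simps)
qed

text \<open>In the application \<open>u \<alpha> \<nu>\<close> is a trace over the weight space of
  \<nu>: a lowering operator for \<alpha> followed by its adjoint. Then \<open>rec\<close> is the
  commutator relation and \<open>cas\<close> the trace of the Casimir operator. Multiplication by
  the denominator turns \<open>cas\<close> into an eigenvalue equation of the Laplacian for
  denominator times character.\<close>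

theorem weyl_coefficient:
 fixes m :: "ivec \<Rightarrow> complex" and u :: "ivec \<Rightarrow> ivec \<Rightarrow> complex"
 assumes fin_m: "finite {\<nu>. m \<nu> \<noteq> 0}"
  and fin_u: "\<And>\<alpha>. \<alpha> \<in> roots ==> finite {\<nu>. u \<alpha> \<nu> \<noteq> 0}"
  and const: "\<And>\<nu>. m \<nu> \<noteq> 0 ==> (\<Sum>i<2*n. \<nu> i) = K"
  and rec: "\<And>\<alpha> \<nu>. \<alpha> \<in> roots ==> u \<alpha> \<nu> - u \<alpha> (\<nu> + \<alpha>) = of_int (ipr \<alpha> \<nu>) * m \<nu>"
  and cas: "\<And>\<nu>. of_int (ipr \<nu> \<nu>) * m \<nu> + (\<Sum>\<alpha>\<in>roots. u \<alpha> \<nu> + u \<alpha> (\<nu> + \<alpha>)) = c * m \<nu>"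
  and top: "m \<kappa> = 1" "\<kappa> \<in> lat" "wdec \<kappa>"
  and cone: "\<And>\<nu>. m \<nu> \<noteq> 0 ==> \<kappa> - \<nu> \<in> cone"
  and \<mu>: "\<mu> \<in> lat" "wdec \<mu>"
 shows "(\<Sum>\<eta> | m \<eta> \<noteq> 0. m \<eta> * J (\<mu> + delta - \<eta>)) = (if \<mu> = \<kappa> then 1 else 0)"
proof -
 define ch where "ch = Poly_Mapping.Abs_poly_mapping m"
 have ch: "lkp ch = m" unfolding ch_def using fin_m by simp
 \<comment> \<open>With this shift by \<alpha>, the hypothesis \<open>rec\<close> reads
   \<open>(e^\<alpha> - 1) G \<alpha> = dirv \<alpha> ch\<close>.\<close>
 define G where "G \<alpha> = Poly_Mapping.Abs_poly_mapping (\<lambda>\<nu>. u \<alpha> (\<nu> + \<alpha>))" for \<alpha>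
 have G: "lkp (G \<alpha>) \<nu> = u \<alpha> (\<nu> + \<alpha>)" if "\<alpha> \<in> roots" for \<alpha> \<nu>
 proof -
  have "{\<nu>. u \<alpha> (\<nu> + \<alpha>) \<noteq> 0} = (\<lambda>\<nu>. \<nu> - \<alpha>) ` {\<nu>. u \<alpha> \<nu> \<noteq> 0}" by (force simp: image_iff)
  thus ?thesis unfolding G_def using fin_u[OF that] by simp
 qed
 have recG: "(mon \<alpha> - 1) * G \<alpha> = dirv \<alpha> ch" if "\<alpha> \<in> roots" for \<alpha> by (rule poly_mapping_eqI)
   (simp add: left_diff_distrib lookup_minus lookup_single_times G[OF that] lookup_dirv ch rec[OF that])
 have casG: "lap ch + (\<Sum>\<alpha>\<in>roots. (mon \<alpha> + 1) * G \<alpha>) = Poly_Mapping.single 0 c * ch"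
 proof (rule poly_mapping_eqI)
  fix \<nu>
  have "lkp (\<Sum>\<alpha>\<in>roots. (mon \<alpha> + 1) * G \<alpha>) \<nu> = (\<Sum>\<alpha>\<in>roots. u \<alpha> \<nu> + u \<alpha> (\<nu> + \<alpha>))"
   unfolding lookup_sum by (rule sum.cong) (simp_all add: distrib_right lookup_add lookup_single_times G)
  thus "lkp (lap ch + (\<Sum>\<alpha>\<in>roots. (mon \<alpha> + 1) * G \<alpha>)) \<nu> = lkp (Poly_Mapping.single 0 c * ch) \<nu>"
   using cas[of \<nu>] by (simp add: lookup_add lookup_lap ch lookup_single_times)
 qed
 have step: "denom * ((mon \<alpha> + 1) * G \<alpha>) = denom * dirv \<alpha> ch + 2 * (mon (- \<alpha>) * codenom \<alpha> * dirv \<alpha> ch)"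
  if "\<alpha> \<in> roots" for \<alpha>
 proof -
  \<comment> \<open>Here \<open>1 - y = y (x - 1)\<close>: the factor
    \<open>1 - e^(-\<alpha>)\<close> of the denominator supplies the factor
    \<open>e^\<alpha> - 1\<close> that makes \<open>recG\<close> applicable.\<close>
  have key: "c * (1 - y) * ((x + 1) * g) = c * (1 - y) * ((x - 1) * g) + 2 * (y * c * ((x - 1) * g))"
   if "x * y = 1" for c x y g :: chr
  proof -
   have "c * (1 - y) * ((x + 1) * g) - (c * (1 - y) * ((x - 1) * g) + 2 * (y * c * ((x - 1) * g)))
     = 2 * c * g * (1 - x * y)" by (simp add: algebra_simps)
   thus ?thesis using that by simp
  qed
  have "mon \<alpha> * mon (- \<alpha>) = 1" by (simp add: mon_mult)
  thus ?thesis unfolding denom_codenom[OF that] recG[OF that, symmetric] by (rule key)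
 qed
 obtain k where k: "\<And>\<nu>. (\<Sum>\<alpha>\<in>roots. ipr \<alpha> \<nu>) = 2 * ipr delta \<nu> + k * (\<Sum>i<2*n. \<nu> i)" using sum_roots_ipr by blast
 \<comment> \<open>The shift of \<open>delta\<close> against half the sum of the roots contributes
   only a scalar, since all weights have the same coordinate sum \<open>K\<close>.\<close>
 have dsum: "(\<Sum>\<alpha>\<in>roots. dirv \<alpha> ch) = 2 * dirv delta ch + of_int (k * K) * ch"
 proof (rule poly_mapping_eqI)
  fix \<nu>
  have "lkp (\<Sum>\<alpha>\<in>roots. dirv \<alpha> ch) \<nu> = of_int (\<Sum>\<alpha>\<in>roots. ipr \<alpha> \<nu>) * m \<nu>"
   by (simp add: lookup_sum lookup_dirv ch sum_distrib_right)
  also have "\<dots> = (2 * of_int (ipr delta \<nu>) + of_int (k * K)) * m \<nu>"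
   using const[of \<nu>] by (cases "m \<nu> = 0") (simp_all add: k)
  finally show "lkp (\<Sum>\<alpha>\<in>roots. dirv \<alpha> ch) \<nu> = lkp (2 * dirv delta ch + of_int (k * K) * ch) \<nu>"
   unfolding lookup_add lookup_of_int_times lookup_of_int_times[of 2, simplified] lookup_dirv ch
   by (simp add: distrib_right)
 qed
 have lapJ: "lap denom = of_int (ipr delta delta) * denom" by (rule poly_mapping_eqI)
   (use J_norm in \<open>auto simp: lookup_lap lookup_of_int_times J_def\<close>)
 have grad: "(\<Sum>i<2*n. pd i denom * pd i ch)
   = denom * dirv delta ch + (\<Sum>\<alpha>\<in>roots. mon (- \<alpha>) * codenom \<alpha> * dirv \<alpha> ch)"
 proof -
  have "(\<Sum>i<2*n. pd i denom * pd i ch) = (\<Sum>i<2*n. denom * (of_int (delta i) * pd i ch))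
    + (\<Sum>i<2*n. \<Sum>\<alpha>\<in>roots. mon (- \<alpha>) * codenom \<alpha> * (of_int (\<alpha> i) * pd i ch))"
   unfolding sum.distrib[symmetric] pd_denom
   by (rule sum.cong[OF refl], simp only: distrib_right sum_distrib_right, simp add: ac_simps)
  also have "(\<Sum>i<2*n. \<Sum>\<alpha>\<in>roots. mon (- \<alpha>) * codenom \<alpha> * (of_int (\<alpha> i) * pd i ch))
    = (\<Sum>\<alpha>\<in>roots. \<Sum>i<2*n. mon (- \<alpha>) * codenom \<alpha> * (of_int (\<alpha> i) * pd i ch))" by (rule sum.swap)
  finally show ?thesis by (simp add: dirv_def sum_distrib_left)
 qed
 define S where "S = (\<Sum>\<alpha>\<in>roots. mon (- \<alpha>) * codenom \<alpha> * dirv \<alpha> ch)"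
 have "denom * (\<Sum>\<alpha>\<in>roots. (mon \<alpha> + 1) * G \<alpha>) = denom * (\<Sum>\<alpha>\<in>roots. dirv \<alpha> ch) + 2 * S"
  unfolding S_def sum_distrib_left sum.distrib[symmetric] by (rule sum.cong) (simp_all add: step)
 hence e1: "denom * lap ch = denom * (Poly_Mapping.single 0 c * ch)
   - (denom * (2 * dirv delta ch + of_int (k * K) * ch) + 2 * S)"
  unfolding casG[symmetric] dsum by (simp add: algebra_simps)
 define X where "X = lkp (denom * ch)"
 \<comment> \<open>The cross term \<open>grad\<close> in the Laplacian of a product cancels the
   first order terms of \<open>e1\<close>.\<close>
 have "lap (denom * ch) = (of_int (ipr delta delta) + Poly_Mapping.single 0 c - of_int (k * K)) * (denom * ch)"
  unfolding lap_mult lapJ grad S_def[symmetric] e1 by (simp add: algebra_simps)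
 hence "of_int (ipr \<xi> \<xi>) * X \<xi> = (of_int (ipr delta delta) + c - of_int (k * K)) * X \<xi>" for \<xi>
  unfolding X_def lookup_lap[symmetric] using lookup_of_int_times[of "k * K" "denom * ch" \<xi>]
  by (simp only: left_diff_distrib distrib_right lookup_add lookup_minus lookup_of_int_times lookup_single_times diff_zero)
 then obtain C where C: "\<And>\<xi>. of_int (ipr \<xi> \<xi>) * X \<xi> = C * X \<xi>" by blast
 have X: "X \<xi> = (\<Sum>\<eta> | m \<eta> \<noteq> 0. m \<eta> * J (\<xi> - \<eta>))" for \<xi>
 proof -
  have "ch = (\<Sum>\<eta> | m \<eta> \<noteq> 0. Poly_Mapping.single \<eta> (m \<eta>))"
   by (rule poly_mapping_eqI) (use fin_m in \<open>simp add: lookup_sum lookup_single when_def ch\<close>)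
  hence "X \<xi> = lkp (\<Sum>\<eta> | m \<eta> \<noteq> 0. Poly_Mapping.single \<eta> (m \<eta>) * denom) \<xi>"
   unfolding X_def by (simp add: mult.commute[of denom] sum_distrib_right)
  thus ?thesis by (simp add: lookup_sum lookup_single_times J_def)
 qed
 \<comment> \<open>A further term would put both \<open>\<kappa> - \<eta>\<close> and its negative
   into the cone.\<close>
 have X\<kappa>: "X (\<kappa> + delta) = 1"
 proof -
  have z: "m \<eta> * J (\<kappa> + delta - \<eta>) = 0" if "m \<eta> \<noteq> 0" "\<eta> \<noteq> \<kappa>" for \<eta>
  proof (rule ccontr)
   assume "m \<eta> * J (\<kappa> + delta - \<eta>) \<noteq> 0"
   hence "J (\<kappa> + delta - \<eta>) \<noteq> 0" by simp
   hence "delta - (\<kappa> + delta - \<eta>) \<in> cone" by (rule J_support)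
   hence "- (\<kappa> - \<eta>) \<in> cone" by simp
   thus False using cone_pointed[OF cone[OF that(1)]] that(2) by simp
  qed
  have "X (\<kappa> + delta) = (\<Sum>\<eta>\<in>{\<kappa>}. m \<eta> * J (\<kappa> + delta - \<eta>))"
   unfolding X by (rule sum.mono_neutral_right) (use fin_m top(1) z in auto)
  thus ?thesis using top J_delta by simp
 qed
 have "\<mu> = \<kappa>" if "X (\<mu> + delta) \<noteq> 0"
 proof -
  have n: "ipr (\<mu> + delta) (\<mu> + delta) = ipr (\<kappa> + delta) (\<kappa> + delta)"
  proof -
   have "of_int (ipr (\<mu> + delta) (\<mu> + delta)) = C" using C[of "\<mu> + delta"] that by simp
   moreover have "of_int (ipr (\<kappa> + delta) (\<kappa> + delta)) = C" using C[of "\<kappa> + delta"] X\<kappa> by simp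
   ultimately show ?thesis by (metis of_int_eq_iff)
  qed
  have Xn: "X (\<mu> + delta) \<noteq> 0" by (rule that)
  obtain \<eta> where \<eta>: "m \<eta> \<noteq> 0" "J (\<mu> + delta - \<eta>) \<noteq> 0"
  proof -
   have "(\<Sum>\<eta> | m \<eta> \<noteq> 0. m \<eta> * J (\<mu> + delta - \<eta>)) \<noteq> 0" using Xn unfolding X .
   from sum.not_neutral_contains_not_neutral[OF this] show thesis using that by auto
  qed
  have "(\<kappa> - \<eta>) + (delta - (\<mu> + delta - \<eta>)) \<in> cone" by (rule cone_add[OF cone[OF \<eta>(1)] J_support[OF \<eta>(2)]])
  hence c: "\<kappa> - \<mu> \<in> cone" by (simp add: algebra_simps)
  \<comment> \<open>Equal norms of \<open>\<mu> + delta\<close> and \<open>\<kappa> + delta\<close>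
    make their difference orthogonal to their sum, which is strictly dominant and so positive on the
    nonzero elements of the cone.\<close>
  have "ipr (\<kappa> - \<mu>) ((\<kappa> + delta) + (\<mu> + delta)) = 0"
   using n ipr_commute[of \<kappa> \<mu>] ipr_commute[of delta \<kappa>] ipr_commute[of delta \<mu>]
   unfolding ipr_add ipr_diff by linarith
  moreover have "sdec ((\<kappa> + delta) + (\<mu> + delta))"
   by (rule sdec_add[OF sdec_plus_delta[OF top(3)] sdec_plus_delta[OF \<mu>(2)]])
  moreover have "(\<kappa> + delta) + (\<mu> + delta) \<in> lat" using top \<mu> by (intro lat_add delta_lat)
  ultimately have "\<kappa> - \<mu> = 0" using cone_ipr[OF c, of "(\<kappa> + delta) + (\<mu> + delta)"] by simp
  thus ?thesis by (simp only: right_minus_eq)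
 qed
 hence "X (\<mu> + delta) = (if \<mu> = \<kappa> then 1 else 0)" using X\<kappa> by metis
 thus ?thesis by (rule trans[OF X[symmetric]])
qed

end

section \<open>Tableaux\<close>

lemma bij_betw_mutual_inverse:
 assumes "\<And>x. x \<in> X ==> f x \<in> Y \<and> h (f x) = x" "\<And>y. y \<in> Y ==> h y \<in> X \<and> f (h y) = y"
 shows "bij_betw f X Y" by (rule bij_betwI[where g = h]) (use assms in auto)

locale shape = folding +
 fixes p :: "nat \<Rightarrow> nat"
 assumes p_anti: "\<And>r. 1 \<le> r ==> r < 2*n ==> p (Suc r) \<le> p r"
begin

definition D :: "(nat \<times> nat) set" where
 "D = {(r, c). 1 \<le> r \<and> r \<le> 2*n \<and> 1 \<le> c \<and> c \<le> p r}"

text \<open>The entry \<open>Suc i\<close> stands for the letter \<open>i\<close>, which leaves 0 to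
  mark the outside of the diagram.\<close>

definition sst :: "tab set" where
 "sst = {T.
   (\<forall>r c. (r, c) \<in> D \<longrightarrow> T r c \<in> {1..2*n}) \<and>
   (\<forall>r c. (r, c) \<notin> D \<longrightarrow> T r c = 0) \<and>
   (\<forall>r c. (r, c) \<in> D \<and> (r, c+1) \<in> D \<longrightarrow> T r c \<le> T r (c+1)) \<and>
   (\<forall>r c. (r, c) \<in> D \<and> (r+1, c) \<in> D \<longrightarrow> T r c < T (r+1) c)}"

lemma p_mono: "1 \<le> r ==> r \<le> r' ==> r' \<le> 2*n ==> p r' \<le> p r"
proof (induction r')
 case (Suc r')
 thus ?case by (cases "r = Suc r'") (auto intro: order.trans[OF p_anti])
qed simp

lemma D_left: "(r, c) \<in> D ==> 1 \<le> c' ==> c' \<le> c ==> (r, c') \<in> D" by (auto simp: D_def)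

lemma D_up: "(r, c) \<in> D ==> 1 \<le> r' ==> r' \<le> r ==> (r', c) \<in> D" using p_mono[of r' r] by (auto simp: D_def)

lemma D_pos: "(r, c) \<in> D ==> 1 \<le> r \<and> 1 \<le> c" by (auto simp: D_def)

lemma finite_D: "finite D"
proof -
 have "D \<subseteq> {..2*n} \<times> {..p 1}" using p_mono[of 1] by (fastforce simp: D_def)
 thus ?thesis by (rule finite_subset) auto
qed

lemma sst_D: "T \<in> sst ==> (r, c) \<in> D \<longleftrightarrow> T r c \<noteq> 0" by (cases "(r, c) \<in> D") (force simp: sst_def)+

lemma sst_out: "T \<in> sst ==> (r, c) \<notin> D ==> T r c = 0" by (simp add: sst_def)

lemma sst_le: "T \<in> sst ==> T r c \<le> 2*n" by (cases "(r, c) \<in> D") (auto simp: sst_def)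

text \<open>The value 0 outside of the diagram lets this hold at column 0 too, which serves as left
  neighbour of the first column; the same device provides a row 0 for the column
  inequalities.\<close>

lemma sst_row1: "T \<in> sst ==> (r, Suc c) \<in> D ==> T r c \<le> T r (Suc c)"
proof (cases "c = 0")
 case True
 assume "T \<in> sst"
 hence "T r 0 = 0" by (rule sst_out) (simp add: D_def)
 thus ?thesis using True by simp
next
 case False
 assume a: "T \<in> sst" "(r, Suc c) \<in> D"
 hence "(r, c) \<in> D" using False D_left[of r "Suc c" c] by simp
 thus ?thesis using a by (simp add: sst_def)
qed

lemma sst_row: "T \<in> sst ==> (r, c') \<in> D ==> c \<le> c' ==> T r c \<le> T r c'"
proof (induction c')
 case (Suc c')
 show ?case
 proof (cases "c = Suc c'")
  case False
  hence c: "c \<le> c'" using Suc.prems by simp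
  show ?thesis
  proof (cases "c' = 0")
   case True
   thus ?thesis using c sst_row1[OF Suc.prems(1,2)] by simp
  next
   case False
   hence "(r, c') \<in> D" using Suc.prems(2) D_left by auto
   thus ?thesis using Suc.IH[OF Suc.prems(1) _ c] sst_row1[OF Suc.prems(1,2)] by simp
  qed
 qed simp
qed (simp add: D_def)

lemma sst_col1: "T \<in> sst ==> (Suc r, c) \<in> D ==> T r c < T (Suc r) c"
proof (cases "r = 0")
 case True
 assume a: "T \<in> sst" "(Suc r, c) \<in> D"
 hence "T 0 c = 0" by (intro sst_out) (simp_all add: D_def)
 thus ?thesis using True sst_D[OF a(1), of "Suc r" c] a(2) by simp
next
 case False
 assume a: "T \<in> sst" "(Suc r, c) \<in> D"
 hence "(r, c) \<in> D" using False D_up[of "Suc r" c r] by simp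
 thus ?thesis using a by (simp add: sst_def)
qed

lemma sst_col: "T \<in> sst ==> (r', c) \<in> D ==> r < r' ==> T r c < T r' c"
proof (induction r')
 case (Suc r')
 show ?case
 proof (cases "r = r'")
  case True
  thus ?thesis using sst_col1 Suc.prems by blast
 next
  case False
  hence "r < r'" "(r', c) \<in> D" using Suc.prems D_up[of "Suc r'" c r'] by auto
  thus ?thesis using Suc sst_col1[OF Suc.prems(1,2)] by fastforce
 qed
qed simp

lemma sst_col_inj: "T \<in> sst ==> (r, c) \<in> D ==> (r', c) \<in> D ==> T r c = T r' c ==> r = r'"
 using sst_col[of T r c r'] sst_col[of T r' c r] by (metis less_irrefl linorder_neqE_nat)

lemma finite_sst: "finite sst"
proof -
 let ?f = "\<lambda>T. restrict (\<lambda>(r,c). T r c) D"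
 have "inj_on ?f sst"
 proof (rule inj_onI, intro ext)
  fix S T r c assume a: "S \<in> sst" "T \<in> sst" "?f S = ?f T"
  show "S r c = T r c"
  proof (cases "(r, c) \<in> D")
   case True
   thus ?thesis using fun_cong[OF a(3), of "(r, c)"] by simp
  next
   case False
   thus ?thesis using a(1,2) by (simp add: sst_def)
  qed
 qed
 moreover have "?f ` sst \<subseteq> D \<rightarrow>\<^sub>E {1..2*n}" by (auto simp: sst_def)
 ultimately show ?thesis
  using finite_PiE[OF finite_D, of "\<lambda>_. {1..2*n}"] by (metis finite_atLeastAtMost finite_imageD finite_subset)
qed

subsection \<open>Bender-Knuth involutions\<close>

text \<open>Values \<open>a + 1\<close> and \<open>a + 2\<close> that do not form a vertical pair.
  For the first row, \<open>r - 1\<close> is row 0, where all entries are 0.\<close>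

definition free :: "tab \<Rightarrow> nat \<Rightarrow> nat \<Rightarrow> nat \<Rightarrow> bool" where
 "free T a r c \<longleftrightarrow> (T r c = Suc a \<and> T (Suc r) c \<noteq> Suc (Suc a)) \<or>
   (T r c = Suc (Suc a) \<and> T (r - 1) c \<noteq> Suc a)"

definition frees :: "tab \<Rightarrow> nat \<Rightarrow> nat \<Rightarrow> nat \<Rightarrow> nat set" where
 "frees T a c0 r = {c. c0 < c \<and> free T a r c}"

definition refl :: "nat set \<Rightarrow> nat \<Rightarrow> nat" where
 "refl A c = Min A + Max A - c"

text \<open>Reflecting the interval of free cells of a row exchanges the numbers of their entries
 \<open>a + 1\<close> and \<open>a + 2\<close>. Only the columns to the right of \<open>c0\<close> are changed.\<close>

definition bk :: "nat \<Rightarrow> nat \<Rightarrow> tab \<Rightarrow> nat \<Rightarrow> nat \<Rightarrow> nat" where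
 "bk a c0 T r c = (if c \<in> frees T a c0 r
   then Suc a + Suc (Suc a) - T r (refl (frees T a c0 r) c) else T r c)"

text \<open>The condition under which a move cut off at column \<open>c0\<close> does not spoil the
  rows: an \<open>a + 2\<close> in the last unchanged column could meet a new \<open>a + 1\<close>
  to its right unless it is locked in a vertical pair. For a tableau it is vacuous at
  \<open>c0 = 0\<close>.\<close>

definition bd :: "nat \<Rightarrow> nat \<Rightarrow> tab \<Rightarrow> bool" where
 "bd a c0 T \<longleftrightarrow> (\<forall>r. T r c0 = Suc (Suc a) \<longrightarrow> T (r - 1) c0 = Suc a)"

lemma free_val: "free T a r c ==> T r c = Suc a \<or> T r c = Suc (Suc a)" by (auto simp: free_def)

lemma frees_D: "T \<in> sst ==> c \<in> frees T a c0 r ==> (r, c) \<in> D" using free_val by (fastforce simp: frees_def sst_D)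

lemma finite_frees: "T \<in> sst ==> finite (frees T a c0 r)"
 using finite_subset[of "frees T a c0 r" "{..p r}"] frees_D by (fastforce simp: D_def)

lemma row_pos: "T \<in> sst ==> T r c \<noteq> 0 ==> 1 \<le> r" using sst_D[of T r c] D_pos by blast

lemma free_below: "T \<in> sst ==> free T a r c ==> T (Suc r) c \<noteq> Suc a \<and> T (Suc r) c \<noteq> Suc (Suc a)"
 using sst_col1[of T r c] sst_D[of T "Suc r" c] by (auto simp: free_def)

lemma free_above: "T \<in> sst ==> free T a r c ==> T (r - 1) c \<noteq> Suc a \<and> T (r - 1) c \<noteq> Suc (Suc a)"
 using sst_col1[of T "r - 1" c] sst_D[of T r c] row_pos[of T r c] by (auto simp: free_def)

text \<open>If a cell between two free ones had a vertical partner, then the row of the partner,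
  being weakly increasing, would force a partner on one of the two ends as well.\<close>

lemma free_interval:
 assumes T: "T \<in> sst" and f: "free T a r c1" "free T a r c2" and c: "c1 \<le> c" "c \<le> c2"
 shows "free T a r c"
proof -
 have d1: "(r, c1) \<in> D" and d2: "(r, c2) \<in> D" using free_val[OF f(1)] free_val[OF f(2)] sst_D[OF T] by auto
 have d: "(r, c) \<in> D" using D_left[OF d2 _ c(2)] D_pos[OF d1] c(1) by simp
 have r1: "T r c1 \<le> T r c" "T r c \<le> T r c2" using sst_row[OF T d c(1)] sst_row[OF T d2 c(2)] .
 then consider "T r c = Suc a" | "T r c = Suc (Suc a)" using free_val[OF f(1)] free_val[OF f(2)] by linarith
 thus ?thesis
 proof cases
  case 1
  have "T (Suc r) c \<noteq> Suc (Suc a)"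
  proof
   assume e: "T (Suc r) c = Suc (Suc a)"
   hence D': "(Suc r, c) \<in> D" using sst_D[OF T] by simp
   hence "(Suc r, c1) \<in> D" using D_left[OF D' _ c(1)] D_pos[OF d1] by simp
   hence "T r c1 < T (Suc r) c1" using sst_col1[OF T] by blast
   moreover have "T (Suc r) c1 \<le> Suc (Suc a)" using sst_row[OF T D' c(1)] e by simp
   moreover have "T r c1 = Suc a" using r1 1 free_val[OF f(1)] by simp
   ultimately show False using f(1) by (auto simp: free_def)
  qed
  thus ?thesis using 1 by (simp add: free_def)
 next
  case 2
  have "T (r - 1) c \<noteq> Suc a"
  proof
   assume e: "T (r - 1) c = Suc a"
   hence D': "(r - 1, c) \<in> D" using sst_D[OF T] by simp
   hence r: "1 \<le> r - 1" using D_pos by blast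
   have D2: "(r - 1, c2) \<in> D" using D_up[OF d2 r] by simp
   have v: "T r c2 = Suc (Suc a)" using r1 2 free_val[OF f(2)] by simp
   have "Suc a \<le> T (r - 1) c2" using sst_row[OF T D2 c(2)] e by simp
   moreover have "T (r - 1) c2 < T r c2" using sst_col[OF T d2] r by simp
   ultimately have "T (r - 1) c2 = Suc a" using v by simp
   thus False using f(2) v by (auto simp: free_def)
  qed
  thus ?thesis using 2 by (simp add: free_def)
 qed
qed

lemma refl_frees:
 assumes T: "T \<in> sst" and c: "c \<in> frees T a c0 r"
 shows "refl (frees T a c0 r) c \<in> frees T a c0 r" "refl (frees T a c0 r) (refl (frees T a c0 r) c) = c"
proof -
 let ?A = "frees T a c0 r"
 have fin: "finite ?A" "?A \<noteq> {}" using finite_frees[OF T] c by auto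
 have m: "Min ?A \<in> ?A" "Max ?A \<in> ?A" using Min_in[OF fin] Max_in[OF fin] .
 have le: "Min ?A \<le> c" "c \<le> Max ?A" using Min_le[OF fin(1) c] Max_ge[OF fin(1) c] .
 obtain m M where mM: "m = Min ?A" "M = Max ?A" by blast
 have m': "c0 < m" "free T a r m" "free T a r M" using m unfolding mM frees_def by auto
 have "free T a r (m + M - c)" by (rule free_interval[OF T m'(2,3)]) (use le in \<open>simp_all add: mM\<close>)
 moreover have "c0 < m + M - c" using m'(1) le unfolding mM by linarith
 ultimately show "refl ?A c \<in> ?A" unfolding refl_def mM[symmetric] by (simp add: frees_def)
 show "refl ?A (refl ?A c) = c" using le by (simp add: refl_def)
qed

lemma refl_anti:
 assumes T: "T \<in> sst" and c: "c \<in> frees T a c0 r" "c' \<in> frees T a c0 r" "c \<le> c'"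
 shows "refl (frees T a c0 r) c' \<le> refl (frees T a c0 r) c" using c(3) by (simp add: refl_def)

lemma bk_free_val:
 assumes T: "T \<in> sst" and c: "c \<in> frees T a c0 r"
 shows "bk a c0 T r c = Suc a \<or> bk a c0 T r c = Suc (Suc a)"
proof -
 have "free T a r (refl (frees T a c0 r) c)" using refl_frees(1)[OF T c] unfolding frees_def by blast
 from free_val[OF this] show ?thesis using c by (auto simp: bk_def)
qed

lemma bk_cases:
 assumes T: "T \<in> sst"
 obtains "bk a c0 T r c = T r c" "c \<notin> frees T a c0 r"
 | "c0 < c" "c \<in> frees T a c0 r" "T r c = Suc a \<or> T r c = Suc (Suc a)" "bk a c0 T r c = Suc a \<or> bk a c0 T r c = Suc (Suc a)"
proof (cases "c \<in> frees T a c0 r")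
 case False
 thus ?thesis using that(1) by (simp add: bk_def)
next
 case True
 show ?thesis by (rule that(2)) (use True bk_free_val[OF T True] free_val in \<open>auto simp: frees_def\<close>)
qed

lemma bk_cell:
 "T \<in> sst ==> bk a c0 T r c = T r c \<or> (T r c = Suc a \<or> T r c = Suc (Suc a)) \<and>
   (bk a c0 T r c = Suc a \<or> bk a c0 T r c = Suc (Suc a)) \<and> c0 < c" by (rule bk_cases) auto

lemma bk_left: "c \<le> c0 ==> bk a c0 T r c = T r c" by (simp add: bk_def frees_def)

lemma bk_other:
 assumes T: "T \<in> sst" "x \<noteq> Suc a" "x \<noteq> Suc (Suc a)"
 shows "bk a c0 T r c = x \<longleftrightarrow> T r c = x" by (rule bk_cases[OF T(1), of a c0 r c]) (use T(2,3) in auto)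

text \<open>Directly above and below a free cell neither of the two values occurs, before or after
  the move. So the free cells stay the same, and reflecting them twice restores the tableau.\<close>

lemma free_bk:
 assumes T: "T \<in> sst"
 shows "free (bk a c0 T) a r c \<longleftrightarrow> free T a r c"
proof (cases "c \<le> c0")
 case True
 thus ?thesis by (simp add: free_def bk_left)
next
 case False
 have nf: "bk a c0 T r' c = T r' c" if "\<not> free T a r' c" for r' using that by (simp add: bk_def frees_def)
 show ?thesis
 proof (cases "free T a r c")
  case True
  hence "c \<in> frees T a c0 r" using False by (simp add: frees_def)
  from bk_free_val[OF T this] have v: "bk a c0 T r c = Suc a \<or> bk a c0 T r c = Suc (Suc a)" .
  have b: "T (Suc r) c \<noteq> Suc a" "T (Suc r) c \<noteq> Suc (Suc a)"
   and u: "T (r - 1) c \<noteq> Suc a" "T (r - 1) c \<noteq> Suc (Suc a)"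
   using free_below[OF T True] free_above[OF T True] by auto
  have "bk a c0 T (Suc r) c \<noteq> Suc (Suc a)" "bk a c0 T (r - 1) c \<noteq> Suc a"
  proof -
   have "\<not> free T a (Suc r) c" "\<not> free T a (r - 1) c"
    using b u free_val[of T a "Suc r" c] free_val[of T a "r - 1" c] by auto
   thus "bk a c0 T (Suc r) c \<noteq> Suc (Suc a)" "bk a c0 T (r - 1) c \<noteq> Suc a" using b u nf by metis+
  qed
  thus ?thesis using v True by (auto simp: free_def)
 next
  case nfree: False
  have e: "bk a c0 T r c = T r c" by (rule nf[OF nfree])
  show ?thesis
  proof
   assume f: "free (bk a c0 T) a r c"
   then consider "T r c = Suc a" "bk a c0 T (Suc r) c \<noteq> Suc (Suc a)"
    | "T r c = Suc (Suc a)" "bk a c0 T (r - 1) c \<noteq> Suc a" by (auto simp: free_def e)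
   thus "free T a r c"
   proof cases
    case 1
    hence s: "T (Suc r) c = Suc (Suc a)" using nfree by (auto simp: free_def)
    hence "\<not> free T a (Suc r) c" using 1(1) by (auto simp: free_def)
    thus ?thesis using nf[of "Suc r"] s 1 by simp
   next
    case 2
    hence s: "T (r - 1) c = Suc a" using nfree by (auto simp: free_def)
    moreover have "1 \<le> r" using row_pos[OF T, of r c] 2(1) by simp
    ultimately have "\<not> free T a (r - 1) c" using 2(1) by (auto simp: free_def)
    thus ?thesis using nf[of "r - 1"] s 2 by simp
   qed
  qed (use nfree in simp)
 qed
qed

lemma frees_bk: "T \<in> sst ==> frees (bk a c0 T) a c0 r = frees T a c0 r" by (simp add: frees_def free_bk)

lemma bk_bk:
 assumes T: "T \<in> sst"
 shows "bk a c0 (bk a c0 T) = T"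
proof (intro ext)
 fix r c
 show "bk a c0 (bk a c0 T) r c = T r c"
 proof (cases "c \<in> frees T a c0 r")
  case True
  let ?R = "refl (frees T a c0 r)"
  have "free T a r c" using True by (simp add: frees_def)
  hence le: "T r c \<le> Suc a + Suc (Suc a)" using free_val[of T a r c] by auto
  have "bk a c0 T r (?R c) = Suc a + Suc (Suc a) - T r c" using refl_frees[OF T True] by (simp add: bk_def)
  thus ?thesis using True le by (subst bk_def) (simp add: frees_bk[OF T])
 next
  case False
  hence "bk a c0 T r c = T r c" by (simp add: bk_def)
  thus ?thesis using False by (subst bk_def) (simp add: frees_bk[OF T])
 qed
qed

lemma bk_sst:
 assumes T: "T \<in> sst" and b: "bd a c0 T" and a: "Suc a < 2*n"
 shows "bk a c0 T \<in> sst"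
proof -
 let ?B = "bk a c0 T"
 have nz: "?B r c \<noteq> 0 \<longleftrightarrow> T r c \<noteq> 0" for r c by (rule bk_cases[OF T, of a c0 r c]) auto
 have le: "?B r c \<le> 2*n" for r c by (rule bk_cases[OF T, of a c0 r c]) (use sst_le[OF T, of r c] a in auto)
 have row: "?B r c \<le> ?B r (Suc c)" if d: "(r, c) \<in> D" "(r, Suc c) \<in> D" for r c
 proof -
  have t: "T r c \<le> T r (Suc c)" using sst_row1[OF T d(2)] .
  consider (both) "c \<in> frees T a c0 r" "Suc c \<in> frees T a c0 r"
   | (left) "c \<in> frees T a c0 r" "Suc c \<notin> frees T a c0 r"
   | (right) "c \<notin> frees T a c0 r" "Suc c \<in> frees T a c0 r"
   | (none) "c \<notin> frees T a c0 r" "Suc c \<notin> frees T a c0 r" by blast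
  thus ?thesis
  proof cases
   case both
   \<comment> \<open>Reversing the positions and exchanging the two values both reverse the order,
     so the free part of a row stays weakly increasing.\<close>
   have "T r (refl (frees T a c0 r) (Suc c)) \<le> T r (refl (frees T a c0 r) c)"
    by (rule sst_row[OF T frees_D[OF T refl_frees(1)[OF T both(1)]] refl_anti[OF T both]]) simp
   thus ?thesis using both by (simp add: bk_def)
  next
   case left
   have f: "free T a r c" "c0 < c" using left(1) by (auto simp: frees_def)
   have nf: "\<not> free T a r (Suc c)" using left(2) f(2) by (auto simp: frees_def)
   have "Suc (Suc a) \<le> T r (Suc c)"
   proof (rule ccontr)
    assume "\<not> ?thesis"
    hence e: "T r (Suc c) = Suc a" "T r c = Suc a" using t free_val[OF f(1)] by auto
    hence e2: "T (Suc r) (Suc c) = Suc (Suc a)" using nf by (auto simp: free_def)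
    hence d2: "(Suc r, Suc c) \<in> D" using sst_D[OF T] by simp
    hence d3: "(Suc r, c) \<in> D" using D_left[OF d2, of c] D_pos[OF d(1)] by simp
    have "T (Suc r) c \<le> Suc (Suc a)" using sst_row1[OF T d2] e2 by simp
    moreover have "Suc a < T (Suc r) c" using sst_col1[OF T d3] e by simp
    ultimately show False using f(1) e by (auto simp: free_def)
   qed
   thus ?thesis using bk_free_val[OF T left(1)] left(2) by (auto simp: bk_def)
  next
   case right
   have f: "free T a r (Suc c)" "c0 < Suc c" using right(2) by (auto simp: frees_def)
   have "T r c \<le> Suc a"
   proof (rule ccontr)
    assume "\<not> ?thesis"
    hence e: "T r c = Suc (Suc a)" "T r (Suc c) = Suc (Suc a)" using t free_val[OF f(1)] by auto
    \<comment> \<open>In the border column \<open>c0\<close> the condition \<open>bd\<close> takes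
      over what the failure of freeness provides further right.\<close>
    have e2: "T (r - 1) c = Suc a"
    proof (cases "c = c0")
     case True
     thus ?thesis using b e(1) by (simp add: bd_def)
    next
     case False
     hence "\<not> free T a r c" using right(1) f(2) by (simp add: frees_def)
     thus ?thesis using e(1) by (auto simp: free_def)
    qed
    hence "(r - 1, c) \<in> D" using sst_D[OF T] by simp
    hence r: "1 \<le> r - 1" using D_pos by blast
    have d2: "(r - 1, Suc c) \<in> D" using D_up[OF d(2) r] by simp
    have "Suc a \<le> T (r - 1) (Suc c)" using sst_row1[OF T d2] e2 by simp
    moreover have "T (r - 1) (Suc c) < Suc (Suc a)" using sst_col[OF T d(2), of "r - 1"] r e by simp
    ultimately show False using f(1) e by (auto simp: free_def)
   qed
   thus ?thesis using bk_free_val[OF T right(2)] right(1) by (auto simp: bk_def)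
  next
   case none
   thus ?thesis using t by (simp add: bk_def)
  qed
 qed
 have col: "?B r c < ?B (Suc r) c" if d: "(r, c) \<in> D" "(Suc r, c) \<in> D" for r c
 proof -
  have t: "T r c < T (Suc r) c" using sst_col1[OF T d(2)] .
  show ?thesis
  proof (cases "c \<in> frees T a c0 r")
   case True
   hence f: "free T a r c" by (simp add: frees_def)
   have g: "T (Suc r) c \<noteq> Suc a" "T (Suc r) c \<noteq> Suc (Suc a)" using free_below[OF T f] by auto
   hence "c \<notin> frees T a c0 (Suc r)" using free_val by (auto simp: frees_def)
   thus ?thesis using bk_free_val[OF T True] g t free_val[OF f] by (auto simp: bk_def)
  next
   case False
   show ?thesis
   proof (cases "c \<in> frees T a c0 (Suc r)")
    case True
    hence f: "free T a (Suc r) c" by (simp add: frees_def)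
    have g: "T r c \<noteq> Suc a" "T r c \<noteq> Suc (Suc a)" using free_above[OF T f] by auto
    thus ?thesis using bk_free_val[OF T True] False t free_val[OF f] by (auto simp: bk_def)
   next
    case False
    thus ?thesis using \<open>c \<notin> frees T a c0 r\<close> t by (simp add: bk_def)
   qed
  qed
 qed
 have "?B r c \<in> {1..2*n}" if "(r, c) \<in> D" for r c using nz[of r c] le[of r c] that sst_D[OF T, of r c] by simp
 moreover have "?B r c = 0" if "(r, c) \<notin> D" for r c using nz[of r c] that sst_D[OF T, of r c] by simp
 ultimately show ?thesis using row col by (simp add: sst_def)
qed

text \<open>Free cells are matched by the reflection, and a locked \<open>a + 1\<close> is matched
  with the \<open>a + 2\<close> below it, which lies in the same column and so on the same side of
  \<open>c0\<close>.\<close>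

lemma bk_count:
 assumes T: "T \<in> sst"
 shows "card {(r, c) \<in> D. c0 < c \<and> bk a c0 T r c = Suc a} = card {(r, c) \<in> D. c0 < c \<and> T r c = Suc (Suc a)}"
proof -
 let ?B = "bk a c0 T"
 let ?R = "\<lambda>r c. refl (frees T a c0 r) c"
 let ?g = "\<lambda>(r, c). if free T a r c then (r, ?R r c) else (Suc r, c)"
 let ?h = "\<lambda>(r, c). if free T a r c then (r, ?R r c) else (r - 1, c)"
 let ?X = "{(r, c) \<in> D. c0 < c \<and> ?B r c = Suc a}"
 let ?Y = "{(r, c) \<in> D. c0 < c \<and> T r c = Suc (Suc a)}"
 have R: "(r, ?R r c) \<in> D" "c0 < ?R r c" "free T a r (?R r c)" "?R r (?R r c) = c"
  if "c0 < c" "free T a r c" for r c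
 proof -
  have m: "c \<in> frees T a c0 r" using that by (simp add: frees_def)
  have "?R r c \<in> frees T a c0 r" using refl_frees(1)[OF T m] .
  thus "(r, ?R r c) \<in> D" "c0 < ?R r c" "free T a r (?R r c)" using frees_D[OF T] by (blast, auto simp: frees_def)
  show "?R r (?R r c) = c" using refl_frees(2)[OF T m] .
 qed
 have bkv: "?B r c = Suc a + Suc (Suc a) - T r (?R r c)" if "c0 < c" "free T a r c" for r c
  using that by (simp add: bk_def frees_def)
 have bkn: "?B r c = T r c" if "\<not> free T a r c" for r c using that by (simp add: bk_def frees_def)
 have g: "?g x \<in> ?Y \<and> ?h (?g x) = x" if xX: "x \<in> ?X" for x
 proof -
  obtain r c where x: "x = (r, c)" "(r, c) \<in> D" "c0 < c" "?B r c = Suc a" using xX by auto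
  show ?thesis
  proof (cases "free T a r c")
   case True
   note R = R[OF x(3) True]
   have "T r (?R r c) = Suc (Suc a)" using bkv[OF x(3) True] x(4) free_val[OF R(3)] by auto
   thus ?thesis using R True x(1) by simp
  next
   case False
   hence t: "T r c = Suc a" using bkn x(4) by simp
   hence t2: "T (Suc r) c = Suc (Suc a)" using False by (auto simp: free_def)
   hence "(Suc r, c) \<in> D" using sst_D[OF T] by simp
   moreover have "\<not> free T a (Suc r) c" using t t2 by (auto simp: free_def)
   ultimately show ?thesis using False x t2 by simp
  qed
 qed
 have h: "?h y \<in> ?X \<and> ?g (?h y) = y" if yY: "y \<in> ?Y" for y
 proof -
  obtain r c where y: "y = (r, c)" "(r, c) \<in> D" "c0 < c" "T r c = Suc (Suc a)" using yY by auto
  show ?thesis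
  proof (cases "free T a r c")
   case True
   note R = R[OF y(3) True]
   have "?B r (?R r c) = Suc a" using bkv[OF R(2,3)] R(4) y(4) by simp
   thus ?thesis using R True y(1) by simp
  next
   case False
   hence t: "T (r - 1) c = Suc a" using y(4) by (auto simp: free_def)
   hence d: "(r - 1, c) \<in> D" using sst_D[OF T] by simp
   have r: "Suc (r - 1) = r" using D_pos[OF y(2)] by simp
   have nf: "\<not> free T a (r - 1) c" using t y(4) r by (auto simp: free_def)
   hence "?B (r - 1) c = Suc a" using bkn t by simp
   thus ?thesis using False nf d y r by simp
  qed
 qed
 have "bij_betw ?g ?X ?Y" by (rule bij_betw_mutual_inverse[of ?X ?g ?Y ?h, OF g h])
 thus ?thesis by (rule bij_betw_same_card)
qed

lemma bk_count':
 assumes T: "T \<in> sst" and b: "bd a c0 T" and a: "Suc a < 2*n"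
 shows "card {(r, c) \<in> D. c0 < c \<and> bk a c0 T r c = Suc (Suc a)} = card {(r, c) \<in> D. c0 < c \<and> T r c = Suc a}"
 using bk_count[OF bk_sst[OF T b a], of c0 a] by (simp add: bk_bk[OF T])

lemma free_disjoint:
 assumes "\<And>r c x. x \<in> {Suc a, Suc (Suc a)} ==> S r c = x \<longleftrightarrow> T r c = x"
 shows "free S a r c = free T a r c" using assms by (auto simp: free_def)

text \<open>Moves for disjoint pairs of values act on different cells and leave each other's free
  cells alone. A folded reflection uses two such moves, each with its own threshold.\<close>

lemma bk_commute:
 assumes T: "T \<in> sst" and d: "a' \<noteq> a" "Suc a' \<noteq> a" "a' \<noteq> Suc a"
 shows "bk a c0 (bk a' c0' T) = bk a' c0' (bk a c0 T)"
proof (intro ext)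
 fix r c
 have F1: "free (bk a' c0' T) a r c = free T a r c" for r c
  by (rule free_disjoint, rule bk_other[OF T]) (use d in auto)
 have F2: "free (bk a c0 T) a' r c = free T a' r c" for r c
  by (rule free_disjoint, rule bk_other[OF T]) (use d in auto)
 have f1: "frees (bk a' c0' T) a c0 r = frees T a c0 r" for r by (simp add: frees_def F1)
 have f2: "frees (bk a c0 T) a' c0' r = frees T a' c0' r" for r by (simp add: frees_def F2)
 have ex: "\<not> (free T a r c \<and> free T a' r c)" for r c using free_val[of T a r c] free_val[of T a' r c] d by auto
 have n1: "bk a' c0' T r c = T r c" if "c \<in> frees T a c0 r" for r c
  using that ex[of r c] by (simp add: frees_def bk_def)
 have n2: "bk a c0 T r c = T r c" if "c \<in> frees T a' c0' r" for r c
  using that ex[of r c] by (simp add: frees_def bk_def)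
 have e1: "bk a c0 (bk a' c0' T) r c = (if c \<in> frees T a c0 r then bk a c0 T r c else bk a' c0' T r c)"
  unfolding bk_def[of a c0] f1 using n1[OF refl_frees(1)[OF T]] by simp
 have e2: "bk a' c0' (bk a c0 T) r c = (if c \<in> frees T a' c0' r then bk a' c0' T r c else bk a c0 T r c)"
  unfolding bk_def[of a' c0'] f2 using n2[OF refl_frees(1)[OF T]] by simp
 show "bk a c0 (bk a' c0' T) r c = bk a' c0' (bk a c0 T) r c"
  unfolding e1 e2 using n1[of c r] n2[of c r] by (auto simp: bk_def)
qed

subsection \<open>Contents and times\<close>

definition cnt :: "tab \<Rightarrow> (nat \<times> nat) set \<Rightarrow> nat \<Rightarrow> int" where
 "cnt T C i = int (card {(r, c) \<in> C. T r c = Suc i})"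

definition wt :: "tab \<Rightarrow> (nat \<times> nat) set \<Rightarrow> nat \<Rightarrow> int" where
 "wt T C = (\<lambda>i. if i < 2*n then cnt T C i - fold_coeff * cnt T C (bar i) else 0)"

text \<open>The cells in the reverse of the reading order: columns from left to right, and in each column
 the entries in decreasing order, one unit of time for each of the \<open>2n\<close> possible entries.\<close>

definition tm :: "tab \<Rightarrow> nat \<times> nat \<Rightarrow> nat" where
 "tm T = (\<lambda>(r, c). (c - 1) * (2*n) + (2*n - T r c))"

definition letter :: "nat \<Rightarrow> nat" where
 "letter t = 2*n - 1 - t mod (2*n)"

definition proc :: "tab \<Rightarrow> nat \<Rightarrow> (nat \<times> nat) set" where
 "proc T t = {x \<in> D. tm T x < t}"

text \<open>Since times run against the reading order, these are the cells read first, and their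
  weight is a vertex of the path.\<close>

definition rest :: "tab \<Rightarrow> nat \<Rightarrow> (nat \<times> nat) set" where
 "rest T t = {x \<in> D. t \<le> tm T x}"

lemma wt_lat: "wt T C \<in> lat" by (auto simp: lat_def wt_def fold_coeff_def)

lemma cnt_Un: "finite A ==> finite B ==> A \<inter> B = {} ==> cnt T (A \<union> B) i = cnt T A i + cnt T B i"
proof -
 assume a: "finite A" "finite B" "A \<inter> B = {}"
 have "{(r, c) \<in> A \<union> B. T r c = Suc i} = {(r, c) \<in> A. T r c = Suc i} \<union> {(r, c) \<in> B. T r c = Suc i}" by auto
 moreover have "finite {(r, c) \<in> A. T r c = Suc i}" "finite {(r, c) \<in> B. T r c = Suc i}"
  by (rule finite_subset[OF _ a(1)], blast) (rule finite_subset[OF _ a(2)], blast)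
 ultimately show ?thesis using a(3) unfolding cnt_def by (simp, subst card_Un_disjoint) auto
qed

lemma wt_Un: "finite A ==> finite B ==> A \<inter> B = {} ==> wt T (A \<union> B) = wt T A + wt T B"
 by (rule ext) (simp add: wt_def cnt_Un plus_fun_apply algebra_simps)

lemma finite_proc: "finite (proc T t)" and finite_rest: "finite (rest T t)"
 using finite_D by (auto simp: proc_def rest_def)

lemma wt_split: "wt T D = wt T (proc T t) + wt T (rest T t)"
proof -
 have "D = proc T t \<union> rest T t" "proc T t \<inter> rest T t = {}" by (auto simp: proc_def rest_def)
 thus ?thesis using wt_Un finite_proc finite_rest by metis
qed

lemma hv_out: "b < 2*n ==> 2*n \<le> i ==> hv b i = 0"
proof -
 assume "b < 2*n" "2*n \<le> i"
 hence "i \<noteq> b" "i \<noteq> bar b" using bar_less'[of b] by (auto simp del: bar_less' bar_less)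
 thus ?thesis by (simp add: hv_def bv_def)
qed

lemma wt_single: "T r c = Suc b ==> b < 2*n ==> wt T {(r, c)} = hv b"
proof
 fix i assume a: "T r c = Suc b" "b < 2*n"
 have c: "cnt T {(r, c)} j = bv b j" for j
 proof -
  have "{(r', c') \<in> {(r, c)}. T r' c' = Suc j} = (if j = b then {(r, c)} else {})" using a(1) by auto
  thus ?thesis by (simp add: cnt_def bv_def)
 qed
 show "wt T {(r, c)} i = hv b i"
 proof (cases "i < 2*n")
  case True
  thus ?thesis using bar_eq_swap[of i b] a(2) by (simp add: wt_def c hv_def bv_def)
 next
  case False
  thus ?thesis using hv_out[OF a(2), of i] by (simp add: wt_def)
 qed
qed

lemma wt_empty: "wt T {} = 0" by (simp add: wt_def cnt_def fun_eq_iff zero_fun_apply)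

lemma letter_less: "letter t < 2*n" using n_pos by (simp add: letter_def)

text \<open>The entries lie between 1 and \<open>2n\<close>, so \<open>2n\<close> minus an entry is
  a remainder modulo \<open>2n\<close>, and division recovers column and entry from a time. As
  columns are strict, no two cells share a time.\<close>

lemma tm_step:
 assumes T: "T \<in> sst" and x: "(r, c) \<in> D"
 shows "tm T (r, c) = t \<longleftrightarrow> c = Suc (t div (2*n)) \<and> T r c = Suc (letter t)"
proof -
 have b: "1 \<le> T r c" "T r c \<le> 2*n" using T x by (auto simp: sst_def)
 obtain i where i: "T r c = Suc i" using b(1) by (cases "T r c") auto
 obtain c' where c: "c = Suc c'" using D_pos[OF x] by (cases c) auto
 have "tm T (r, c) = c' * (2*n) + (2*n - Suc i)" using i c by (simp add: tm_def)
 also have "\<dots> = t \<longleftrightarrow> c' = t div (2*n) \<and> 2*n - Suc i = t mod (2*n)"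
 proof
  assume e: "c' * (2*n) + (2*n - Suc i) = t"
  have l: "2*n - Suc i < 2*n" using n_pos by simp
  have "t div (2*n) = c'" "t mod (2*n) = 2*n - Suc i"
   using l by (simp_all flip: e add: div_mult_self1 mod_mult_self1 ac_simps)
  thus "c' = t div (2*n) \<and> 2*n - Suc i = t mod (2*n)" by simp
 next
  assume "c' = t div (2*n) \<and> 2*n - Suc i = t mod (2*n)"
  thus "c' * (2*n) + (2*n - Suc i) = t" using div_mult_mod_eq[of t "2*n"] by simp
 qed
 also have "2*n - Suc i = t mod (2*n) \<longleftrightarrow> i = letter t"
  using b(2) i n_pos mod_less_divisor[of "2*n" t] unfolding letter_def by linarith
 finally show ?thesis using i c by simp
qed

definition present :: "tab \<Rightarrow> nat \<Rightarrow> bool" where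
 "present T t \<longleftrightarrow> (\<exists>r. T r (Suc (t div (2*n))) = Suc (letter t))"

lemma wt_proc_Suc:
 assumes T: "T \<in> sst"
 shows "wt T (proc T (Suc t)) = wt T (proc T t) + (if present T t then hv (letter t) else 0)"
proof -
 let ?S = "{x \<in> D. tm T x = t}"
 have "wt T (proc T (Suc t)) = wt T (proc T t) + wt T ?S"
 proof -
  have "proc T (Suc t) = proc T t \<union> ?S" "proc T t \<inter> ?S = {}" by (auto simp: proc_def)
  thus ?thesis using wt_Un[of "proc T t" ?S T] finite_proc finite_D by simp
 qed
 moreover have "wt T ?S = (if present T t then hv (letter t) else 0)"
 proof (cases "present T t")
  case True
  then obtain r where r: "T r (Suc (t div (2*n))) = Suc (letter t)" by (auto simp: present_def)
  let ?x = "(r, Suc (t div (2*n)))"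
  have d: "?x \<in> D" using r sst_D[OF T] by simp
  have "?S = {?x}"
  proof (intro equalityI subsetI)
   fix y assume y: "y \<in> ?S"
   obtain r' c' where yy: "y = (r', c')" by fastforce
   hence "(r', c') \<in> D" "c' = Suc (t div (2*n))" "T r' c' = Suc (letter t)"
    using y tm_step[OF T, of r' c' t] by auto
   thus "y \<in> {?x}" using sst_col_inj[OF T d, of r'] r yy by simp
  qed (use d r tm_step[OF T d, of t] in simp)
  thus ?thesis using True wt_single[of T r "Suc (t div (2*n))" "letter t", OF r letter_less] by simp
 next
  case False
  have "y \<notin> ?S" for y
  proof
   assume y: "y \<in> ?S"
   obtain r' c' where yy: "y = (r', c')" by fastforce
   hence "T r' (Suc (t div (2*n))) = Suc (letter t)" using y tm_step[OF T, of r' c' t] by auto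
   thus False using False by (auto simp: present_def)
  qed
  hence "?S = {}" by blast
  thus ?thesis using False by (simp only: wt_empty if_False)
 qed
 ultimately show ?thesis by simp
qed

lemma hv_diff:
 assumes "Suc a < 2*n" "b < 2*n"
 shows "hv b a - hv b (Suc a) = (if b = a then 1 else 0) - (if b = Suc a then 1 else 0)
  + fold_coeff * ((if b = bar (Suc a) then 1 else 0) - (if b = bar a then 1 else 0))"
proof -
 have "hv b i = (if b = i then 1 else 0) - fold_coeff * (if b = bar i then 1 else 0)" if "i < 2*n" for i
  using bar_eq_swap[OF that assms(2)] by (auto simp: hv_def bv_def)
 thus ?thesis using assms(1) by (simp add: right_diff_distrib)
qed

subsection \<open>Cancellation\<close>

text \<open>The position of a walk that starts at \<open>\<nu> + delta\<close> and subtracts letter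
  weights against the reading order; it ends at the argument of \<open>j\<close> in the alternating
  sum over tableaux.\<close>

definition xi :: "ivec \<Rightarrow> tab \<Rightarrow> nat \<Rightarrow> nat \<Rightarrow> int" where
 "xi \<nu> T t = \<nu> + delta - wt T (proc T t)"

text \<open>The lower letters of the pairs that \<open>sw a\<close> exchanges; in the folded middle
  the two pairs agree.\<close>

definition prs :: "nat \<Rightarrow> nat set" where
 "prs a = insert a (if sp then {bar (Suc a)} else {})"

text \<open>The last column in which the letter \<open>y\<close> has had its turn by time
  \<open>q\<close>: in column \<open>c\<close> its turn comes at time
  \<open>2n c - (y + 1)\<close>.\<close>

definition thr :: "nat \<Rightarrow> nat \<Rightarrow> nat" where
 "thr q y = (q + y + 1) div (2*n)"

text \<open>The counterpart of the reflection \<open>sw (letter q)\<close> on the cells not yet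
  processed: one Bender-Knuth move for each exchanged pair of letters.\<close>

definition phi :: "nat \<Rightarrow> tab \<Rightarrow> nat \<Rightarrow> nat \<Rightarrow> nat" where
 "phi q T = (let a = letter q; b = bar (Suc a); T1 = bk a (thr q a) T
   in if sp \<and> b \<noteq> a then bk b (thr q b) T1 else T1)"

lemma xi_lat: "\<nu> \<in> lat ==> xi \<nu> T t \<in> lat" by (simp add: xi_def lat_diff lat_add delta_lat wt_lat)

lemma prs_less: "Suc a < 2*n ==> y \<in> prs a ==> Suc y < 2*n" unfolding prs_def bar_def by (auto split: if_splits)

lemma prs_neq: "Suc a < 2*n ==> y \<in> prs a ==> Suc y \<noteq> a \<and> y \<noteq> Suc a"
 unfolding prs_def bar_def by (auto split: if_splits) presburger+

lemma xi_Suc: "T \<in> sst ==> xi \<nu> T (Suc t) = xi \<nu> T t - (if present T t then hv (letter t) else 0)"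
 by (simp add: xi_def wt_proc_Suc)

lemma xi_diff_Suc:
 assumes "T \<in> sst" "Suc a < 2*n"
 shows "xi \<nu> T (Suc t) a - xi \<nu> T (Suc t) (Suc a) = xi \<nu> T t a - xi \<nu> T t (Suc a)
  - (if present T t then hv (letter t) a - hv (letter t) (Suc a) else 0)"
 unfolding xi_Suc[OF assms(1)] by (simp add: minus_apply zero_fun_apply)

lemma xi_pair:
 assumes "\<nu> \<in> lat" "Suc a < 2*n" "y \<in> prs a"
 shows "xi \<nu> T t y - xi \<nu> T t (Suc y) = xi \<nu> T t a - xi \<nu> T t (Suc a)"
proof (cases "y = a")
 case False
 hence s: "sp" and y: "y = bar (Suc a)" using assms(3) by (auto simp: prs_def split: if_splits)
 have l: "xi \<nu> T t \<in> lat" by (rule xi_lat[OF assms(1)])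
 have "Suc y = bar a" using y bar_Suc[OF assms(2)] by simp
 thus ?thesis using l s y assms(2) by (simp add: lat_def)
qed simp

lemma letter_eq_iff: "x < 2*n ==> letter t = x \<longleftrightarrow> t mod (2*n) = 2*n - 1 - x"
 using n_pos mod_less_divisor[of "2*n" t] unfolding letter_def by linarith

lemma letter_mod: "letter t = letter s ==> t mod (2*n) = s mod (2*n)"
 using letter_eq_iff[of "letter s" t] letter_eq_iff[of "letter s" s] letter_less[of s] by simp

lemma mod_window: "w \<le> q ==> q < w + m ==> w mod m = q mod m ==> w = q" for w q m :: nat
 using mod_eq_dvd_iff_nat[of w q m] nat_dvd_not_less[of "q - w" m] by fastforce

text \<open>A step lowers the decisive difference by 1, or by 2 in the folded middle, where the
  difference is even. So the first violation lands exactly on a wall, and it is the wall of the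
  letter just processed. The third claim makes the Bender-Knuth moves on the remaining cells
  legitimate.\<close>

lemma first_bad:
 assumes T: "T \<in> sst" and \<nu>: "\<nu> \<in> lat" and bad: "\<not> sdec (xi \<nu> T (Suc q))"
  and ok: "\<And>s. s \<le> q ==> sdec (xi \<nu> T s)"
 defines "a \<equiv> letter q"
 shows "Suc a < 2*n" "xi \<nu> T (Suc q) a = xi \<nu> T (Suc q) (Suc a)" "\<And>y. y \<in> prs a ==> bd y (thr q y) T"
proof -
 let ?d = "\<lambda>t. xi \<nu> T t a - xi \<nu> T t (Suc a)"
 obtain e where e: "Suc e < 2*n" "xi \<nu> T (Suc q) e \<le> xi \<nu> T (Suc q) (Suc e)"
  using bad by (auto simp: sdec_def not_less)
 have qe: "xi \<nu> T q (Suc e) < xi \<nu> T q e" using ok[of q] e(1) by (simp add: sdec_def)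
 have p: "present T q"
 proof (rule ccontr)
  assume "\<not> present T q"
  hence "xi \<nu> T (Suc q) = xi \<nu> T q" unfolding xi_Suc[OF T] by simp
  thus False using e(2) qe by simp
 qed
 have al: "a < 2*n" by (simp add: a_def letter_less)
 have ch: "hv a e - hv a (Suc e) \<ge> 1" using xi_diff_Suc[OF T e(1), of \<nu> q] p e(2) qe by (simp add: a_def)
 have ae: "a = e \<or> (sp \<and> a = bar (Suc e))"
 proof (rule ccontr)
  assume "\<not> (a = e \<or> (sp \<and> a = bar (Suc e)))"
  thus False using ch unfolding hv_diff[OF e(1) al] fold_coeff_def by (cases sp) (simp_all split: if_split_asm)
 qed
 show a1: "Suc a < 2*n" using ae e(1) by (auto simp: bar_def)
 have aep: "e \<in> prs a" using ae e(1) by (auto simp: prs_def bar_def)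
 have l: "xi \<nu> T q \<in> lat" by (rule xi_lat[OF \<nu>])
 have step: "?d (Suc q) = ?d q - (hv a a - hv a (Suc a))" using xi_diff_Suc[OF T a1, of \<nu> q] p by (simp add: a_def)
 have d_le: "?d (Suc q) \<le> 0" using xi_pair[OF \<nu> a1 aep, of T "Suc q"] e(2) by simp
 have d1: "?d s \<ge> 1" if "s \<le> q" for s
 proof -
  have "xi \<nu> T s (Suc a) < xi \<nu> T s a" using ok[OF that] a1 by (simp add: sdec_def)
  thus ?thesis by simp
 qed
 have dq: "?d q \<ge> 1" by (rule d1) simp
 have hva: "hv a a - hv a (Suc a) = (if sp \<and> a = bar (Suc a) then 2 else 1)"
  using hv_diff[OF a1 al] bar_neq[OF al] by (auto simp: fold_coeff_def)
 have par: "?d q \<ge> 2" if "sp" "a = bar (Suc a)"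
 proof -
  have "xi \<nu> T q (bar (Suc a)) = - xi \<nu> T q (Suc a)" using l that(1) a1 unfolding lat_def by blast
  hence "xi \<nu> T q a = - xi \<nu> T q (Suc a)" by (simp only: that(2)[symmetric])
  thus ?thesis using dq by presburger
 qed
 have "?d (Suc q) = 0" using step hva dq d_le par by (auto split: if_splits)
 thus "xi \<nu> T (Suc q) a = xi \<nu> T (Suc q) (Suc a)" by simp
 show "bd y (thr q y) T" if y: "y \<in> prs a" for y unfolding bd_def
 proof (intro allI impI, rule ccontr)
  fix r assume r: "T r (thr q y) = Suc (Suc y)" "T (r - 1) (thr q y) \<noteq> Suc y"
  define c where "c = thr q y"
  have dr: "(r, c) \<in> D" using r(1) sst_D[OF T] by (simp add: c_def)
  hence c1: "1 \<le> c" using D_pos by blast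
  have y1: "Suc y < 2*n" by (rule prs_less[OF a1 y])
  have cb: "c * (2*n) \<le> q + y + 1" "q + y + 1 < c * (2*n) + 2*n"
   using div_mult_mod_eq[of "q + y + 1" "2*n"] mod_less_divisor[of "2*n" "q + y + 1"] n_pos
   unfolding c_def thr_def by linarith+
  obtain c' where c': "c = Suc c'" using c1 by (cases c) auto
  \<comment> \<open>The turn of the letter \<open>y\<close> in column \<open>c\<close>; that of
    \<open>Suc y\<close> comes at \<open>w - 1\<close>. If the entry \<open>y + 2\<close> is
    unmatched, the weight of \<open>Suc y\<close> was subtracted and that of \<open>y\<close> was
    not, which raises the difference to at least 2.\<close>
  define w where "w = c' * (2*n) + (2*n - 1 - y)"
  have wS: "w = Suc (w - 1)" "w - 1 = c' * (2*n) + (2*n - 1 - Suc y)" using y1 by (auto simp: w_def)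
  have wq: "w \<le> q" "q < w + 2*n" using cb y1 unfolding w_def c' by auto
  have wdm: "w div (2*n) = c'" "w mod (2*n) = 2*n - 1 - y"
   unfolding w_def using n_pos by (simp_all add: div_mult_self1 mod_mult_self1 add.commute)
  have wdm': "(w - 1) div (2*n) = c'" "(w - 1) mod (2*n) = 2*n - 1 - Suc y"
   unfolding wS(2) using n_pos by (simp_all add: div_mult_self1 mod_mult_self1 add.commute)
  have lw: "letter w = y" "letter (w - 1) = Suc y" using wdm wdm' y1 by (simp_all add: letter_def)
  have pw: "present T (w - 1)" using r(1) unfolding present_def wdm' lw c_def[symmetric] c' by auto
  have npw: "\<not> present T w"
  proof
   assume "present T w"
   then obtain r' where r': "T r' c = Suc y" unfolding present_def wdm lw c' by auto
   have d': "(r', c) \<in> D" using r' sst_D[OF T] by simp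
   have "r' < r"
   proof (rule ccontr)
    assume "\<not> r' < r"
    hence "T r c \<le> T r' c" using sst_col[OF T d', of r] by (cases "r = r'") auto
    thus False using r(1) r' c_def by simp
   qed
   moreover have "\<not> r' < r - 1"
   proof
    assume l: "r' < r - 1"
    hence "(r - 1, c) \<in> D" using D_up[OF dr, of "r - 1"] by simp
    hence "T r' c < T (r - 1) c" "T (r - 1) c < T r c" using sst_col[OF T] l dr by auto
    thus False using r(1) r' c_def by simp
   qed
   ultimately have "r' = r - 1" by linarith
   thus False using r(2) r' c_def by simp
  qed
  have "?d (w - 1) \<ge> 1" by (rule d1) (use wq in simp)
  moreover have "hv (Suc y) a - hv (Suc y) (Suc a) \<le> -1"
  proof -
   have "Suc y = Suc a \<or> (sp \<and> Suc y = bar a)" using y bar_Suc[OF a1] by (auto simp: prs_def split: if_splits)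
   moreover have "Suc y \<noteq> a" using prs_neq[OF a1 y] by simp
   moreover have "sp ==> Suc y \<noteq> bar (Suc a)"
    using y prs_neq[OF a1, of "bar (Suc a)"] bar_Suc[OF a1] by (auto simp: prs_def split: if_splits)
   ultimately show ?thesis unfolding hv_diff[OF a1 y1] by (auto simp: fold_coeff_def)
  qed
  ultimately have dw: "?d w \<ge> 2" using xi_diff_Suc[OF T a1, of \<nu> "w - 1"] pw unfolding lw wS(1)[symmetric] by simp
  have dw1: "?d (Suc w) \<ge> 2" using xi_diff_Suc[OF T a1, of \<nu> w] npw dw by simp
  show False
  proof (cases "y = a")
   case True
   have "w = q"
   proof -
    have "w mod (2*n) = q mod (2*n)" by (rule letter_mod) (simp add: lw(1) True a_def)
    thus ?thesis by (rule mod_window[OF wq])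
   qed
   thus False using dw1 d_le by simp
  next
   case False
   hence s: "sp" "y = bar (Suc a)" using y by (auto simp: prs_def split: if_splits)
   have "w \<noteq> q" using lw(1) False by (auto simp: a_def)
   hence wq': "Suc w \<le> q" using wq(1) by simp
   \<comment> \<open>Strictly between \<open>w\<close> and \<open>q\<close>, which are less than a
     full column apart, neither of the two letters that lower the difference has its turn.\<close>
   have mono: "?d s \<ge> 2" if "Suc w \<le> s" "s \<le> q" for s using that
   proof (induction s rule: dec_induct)
    case base
    thus ?case using dw1 by simp
   next
    case (step s)
    have na: "letter s \<noteq> a"
    proof
     assume "letter s = a"
     hence "s mod (2*n) = q mod (2*n)" by (intro letter_mod) (simp add: a_def)
     thus False using mod_window[of s q "2*n"] step wq by simp
    qed
    have ny: "letter s \<noteq> y"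
    proof
     assume "letter s = y"
     hence "s mod (2*n) = w mod (2*n)" by (intro letter_mod) (simp add: lw)
     thus False using mod_window[of w s "2*n"] step wq by simp
    qed
    have "hv (letter s) a - hv (letter s) (Suc a) \<le> 0"
     unfolding hv_diff[OF a1 letter_less] using na ny s(2) by (auto simp: fold_coeff_def)
    thus ?case using xi_diff_Suc[OF T a1, of \<nu> s] step by (auto split: if_splits)
   qed
   have "?d q \<ge> 2" by (rule mono[OF wq' order_refl])
   moreover have "hv a a - hv a (Suc a) = 1" using hva s False by auto
   ultimately show False using step d_le by simp
  qed
 qed
qed

text \<open>The turns of \<open>Suc y\<close> and \<open>y\<close> in a column are consecutive, and
  time \<open>q\<close> does not belong to \<open>Suc y\<close>; so one threshold separates the
  processed cells of both values.\<close>

lemma pair_time: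
 assumes T: "T \<in> sst" and a: "Suc (letter q) < 2*n" and y: "y \<in> prs (letter q)" and d: "(r, c) \<in> D"
  and v: "T r c = Suc y \<or> T r c = Suc (Suc y)"
 shows "Suc q \<le> tm T (r, c) \<longleftrightarrow> thr q y < c"
proof -
 have y1: "Suc y < 2*n" by (rule prs_less[OF a y])
 obtain c' where c: "c = Suc c'" using D_pos[OF d] by (cases c) auto
 have t: "thr q y < c \<longleftrightarrow> q + y + 1 < c' * (2*n) + 2*n"
  unfolding thr_def c using n_pos by (subst div_less_iff_less_mult) (simp_all add: algebra_simps)
 show ?thesis
 proof (cases "T r c = Suc y")
  case True
  hence "tm T (r, c) = c' * (2*n) + (2*n - Suc y)" using c by (simp add: tm_def)
  thus ?thesis using y1 unfolding t by linarith
 next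
  case False
  hence s: "T r c = Suc (Suc y)" using v by simp
  have "tm T (r, c) \<noteq> q" using tm_step[OF T d, of q] s prs_neq[OF a y] by auto
  moreover have "tm T (r, c) = c' * (2*n) + (2*n - Suc (Suc y))" using s c by (simp add: tm_def)
  ultimately show ?thesis using y1 unfolding t by linarith
 qed
qed

section \<open>The involution at a violation of dominance\<close>

context
 fixes T q
 assumes T: "T \<in> sst" and a1: "Suc (letter q) < 2*n" and bdT: "\<And>y. y \<in> prs (letter q) ==> bd y (thr q y) T"
begin

lemma phi_form:
 obtains "prs (letter q) = {letter q}" "\<And>S. phi q S = bk (letter q) (thr q (letter q)) S"
 | b where "prs (letter q) = {letter q, b}" "b \<noteq> letter q" "Suc b \<noteq> letter q" "b \<noteq> Suc (letter q)" "Suc b < 2*n"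
  "\<And>S. phi q S = bk b (thr q b) (bk (letter q) (thr q (letter q)) S)"
proof (cases "sp \<and> bar (Suc (letter q)) \<noteq> letter q")
 case True
 have b: "bar (Suc (letter q)) \<in> prs (letter q)" using True by (simp add: prs_def)
 show ?thesis by (rule that(2)[of "bar (Suc (letter q))"])
   (use True prs_neq[OF a1 b] prs_less[OF a1 b] in \<open>auto simp: prs_def phi_def Let_def\<close>)
next
 case False
 show ?thesis by (rule that(1)) (use False in \<open>auto simp: prs_def phi_def Let_def\<close>)
qed

lemma phi_sst_aux: "bk (letter q) (thr q (letter q)) T \<in> sst" by (rule bk_sst[OF T bdT a1]) (simp add: prs_def)

lemma phi_sst: "phi q T \<in> sst"
proof (rule phi_form)
 fix b
 assume b: "prs (letter q) = {letter q, b}" "b \<noteq> letter q" "Suc b \<noteq> letter q" "b \<noteq> Suc (letter q)" "Suc b < 2*n"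
  and f: "\<And>S. phi q S = bk b (thr q b) (bk (letter q) (thr q (letter q)) S)"
 have "bd b (thr q b) (bk (letter q) (thr q (letter q)) T)" using bdT[of b] b bk_other[OF T] by (simp add: bd_def)
 from bk_sst[OF phi_sst_aux this b(5)] show ?thesis unfolding f .
qed (simp add: phi_sst_aux)

lemma phi_phi: "phi q (phi q T) = T"
proof (rule phi_form)
 assume f: "\<And>S. phi q S = bk (letter q) (thr q (letter q)) S"
 show ?thesis unfolding f by (rule bk_bk[OF T])
next
 fix b
 assume b: "b \<noteq> letter q" "Suc b \<noteq> letter q" "b \<noteq> Suc (letter q)"
  and f: "\<And>S. phi q S = bk b (thr q b) (bk (letter q) (thr q (letter q)) S)"
 show ?thesis unfolding f bk_commute[OF phi_sst_aux b] bk_bk[OF T] by (rule HOL.refl)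
qed

lemma phi_cell:
 "phi q T r c = T r c \<or> (\<exists>y\<in>prs (letter q). (T r c = Suc y \<or> T r c = Suc (Suc y)) \<and>
   (phi q T r c = Suc y \<or> phi q T r c = Suc (Suc y)) \<and> thr q y < c)"
proof (rule phi_form)
 assume f: "prs (letter q) = {letter q}" "\<And>S. phi q S = bk (letter q) (thr q (letter q)) S"
 show ?thesis unfolding f using bk_cell[OF T, of "letter q" "thr q (letter q)" r c] by blast
next
 fix b
 let ?a = "letter q" and ?T1 = "bk (letter q) (thr q (letter q)) T"
 assume b: "prs ?a = {?a, b}" "b \<noteq> ?a" "Suc b \<noteq> ?a" "b \<noteq> Suc ?a"
  and f: "\<And>S. phi q S = bk b (thr q b) (bk ?a (thr q ?a) S)"
 have gen: "z = x \<or> (x = Suc a \<or> x = Suc (Suc a)) \<and> (z = Suc a \<or> z = Suc (Suc a)) \<and> P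
   \<or> (x = Suc b \<or> x = Suc (Suc b)) \<and> (z = Suc b \<or> z = Suc (Suc b)) \<and> Q"
  if "y = x \<or> (x = Suc a \<or> x = Suc (Suc a)) \<and> (y = Suc a \<or> y = Suc (Suc a)) \<and> P"
   "z = y \<or> (y = Suc b \<or> y = Suc (Suc b)) \<and> (z = Suc b \<or> z = Suc (Suc b)) \<and> Q"
   "b \<noteq> a" "Suc b \<noteq> a" "b \<noteq> Suc a"
  for x y z a b :: nat and P Q using that by auto
 show ?thesis unfolding f b(1) using gen[OF bk_cell[OF T] bk_cell[OF phi_sst_aux] b(2-4)] by blast
qed

text \<open>A changed entry is unprocessed before and after the change. Hence the walk up to the
  violation is the same for both tableaux, and the same violation is found again.\<close>

lemma phi_tm: "x \<in> D ==> phi q T (fst x) (snd x) = T (fst x) (snd x) \<or> (Suc q \<le> tm T x \<and> Suc q \<le> tm (phi q T) x)"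
 using phi_cell[of "fst x" "snd x"] pair_time[OF T a1, of _ "fst x" "snd x"]
  pair_time[OF phi_sst a1, of _ "fst x" "snd x"] by auto

lemma phi_tm_eq: "phi q T (fst x) (snd x) = T (fst x) (snd x) ==> tm (phi q T) x = tm T x"
 by (cases x) (simp add: tm_def)

lemma phi_proc: "t \<le> Suc q ==> proc (phi q T) t = proc T t"
 unfolding proc_def using phi_tm phi_tm_eq by (intro Collect_cong) (metis less_le_trans not_less)

lemma phi_rest: "rest (phi q T) (Suc q) = rest T (Suc q)"
 unfolding rest_def using phi_tm phi_tm_eq by (intro Collect_cong) metis

lemma phi_wt_proc: "t \<le> Suc q ==> wt (phi q T) (proc (phi q T) t) = wt T (proc T t)"
proof -
 assume t: "t \<le> Suc q"
 have "phi q T r c = T r c" if "(r, c) \<in> proc T t" for r c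
 proof -
  have "(r, c) \<in> D" "\<not> Suc q \<le> tm T (r, c)" using that t by (auto simp: proc_def)
  thus ?thesis using phi_tm[of "(r, c)"] by simp
 qed
 hence "{(r, c) \<in> proc T t. phi q T r c = Suc i} = {(r, c) \<in> proc T t. T r c = Suc i}" for i by auto
 hence e: "cnt (phi q T) (proc T t) = cnt T (proc T t)" by (intro ext) (simp add: cnt_def)
 show ?thesis unfolding phi_proc[OF t] wt_def e by (rule HOL.refl)
qed

lemma phi_xi: "t \<le> Suc q ==> xi \<nu> (phi q T) t = xi \<nu> T t" by (simp add: xi_def phi_wt_proc)

lemma phi_count:
 assumes y: "y \<in> prs (letter q)"
 shows "card {(r, c) \<in> D. thr q y < c \<and> phi q T r c = Suc y} = card {(r, c) \<in> D. thr q y < c \<and> T r c = Suc (Suc y)}"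
  "card {(r, c) \<in> D. thr q y < c \<and> phi q T r c = Suc (Suc y)} = card {(r, c) \<in> D. thr q y < c \<and> T r c = Suc y}"
proof (atomize(full), rule phi_form)
 let ?a = "letter q" and ?T1 = "bk (letter q) (thr q (letter q)) T"
 have ba: "bd ?a (thr q ?a) T" by (rule bdT) (simp add: prs_def)
 {
  assume "prs ?a = {?a}" and f: "\<And>S. phi q S = bk ?a (thr q ?a) S"
  thus "card {(r, c) \<in> D. thr q y < c \<and> phi q T r c = Suc y} = card {(r, c) \<in> D. thr q y < c \<and> T r c = Suc (Suc y)} \<and>
   card {(r, c) \<in> D. thr q y < c \<and> phi q T r c = Suc (Suc y)} = card {(r, c) \<in> D. thr q y < c \<and> T r c = Suc y}"
   using y bk_count[OF T] bk_count'[OF T ba a1] by simp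
 next
  fix b
  assume b: "prs ?a = {?a, b}" "b \<noteq> ?a" "Suc b \<noteq> ?a" "b \<noteq> Suc ?a" "Suc b < 2*n"
   and f: "\<And>S. phi q S = bk b (thr q b) (bk ?a (thr q ?a) S)"
  have bb: "bd b (thr q b) ?T1" using bdT[of b] b bk_other[OF T] by (simp add: bd_def)
  consider "y = ?a" | "y = b" using y b(1) by auto
  thus "card {(r, c) \<in> D. thr q y < c \<and> phi q T r c = Suc y} = card {(r, c) \<in> D. thr q y < c \<and> T r c = Suc (Suc y)} \<and>
   card {(r, c) \<in> D. thr q y < c \<and> phi q T r c = Suc (Suc y)} = card {(r, c) \<in> D. thr q y < c \<and> T r c = Suc y}"
  proof cases
   case 1
   show ?thesis unfolding f 1
    using bk_other[OF phi_sst_aux, of "Suc ?a" b] bk_other[OF phi_sst_aux, of "Suc (Suc ?a)" b] b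
     bk_count[OF T] bk_count'[OF T ba a1] by simp
  next
   case 2
   show ?thesis unfolding f 2 using bk_other[OF T, of "Suc b" ?a] bk_other[OF T, of "Suc (Suc b)" ?a] b
     bk_count[OF phi_sst_aux] bk_count'[OF phi_sst_aux bb b(5)] by simp
  qed
 }
qed

lemma phi_cnt_rest:
 assumes j: "j < 2*n"
 shows "cnt (phi q T) (rest T (Suc q)) j = cnt T (rest T (Suc q)) (sw (letter q) j)"
proof -
 let ?a = "letter q"
 have r1: "{(r, c) \<in> rest T (Suc q). T r c = v} = {(r, c) \<in> D. thr q y < c \<and> T r c = v}"
  if "y \<in> prs ?a" "v = Suc y \<or> v = Suc (Suc y)" for y v
  using pair_time[OF T a1 that(1)] that(2) by (auto simp: rest_def)
 have r2: "{(r, c) \<in> rest T (Suc q). phi q T r c = v} = {(r, c) \<in> D. thr q y < c \<and> phi q T r c = v}"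
  if "y \<in> prs ?a" "v = Suc y \<or> v = Suc (Suc y)" for y v
  unfolding phi_rest[symmetric] using pair_time[OF phi_sst a1 that(1)] that(2) by (auto simp: rest_def)
 have k1: "cnt (phi q T) (rest T (Suc q)) y = cnt T (rest T (Suc q)) (Suc y)"
  and k2: "cnt (phi q T) (rest T (Suc q)) (Suc y) = cnt T (rest T (Suc q)) y"
  if "y \<in> prs ?a" for y using r1[OF that] r2[OF that] phi_count[OF that] by (simp_all add: cnt_def)
 have k3: "cnt (phi q T) (rest T (Suc q)) j = cnt T (rest T (Suc q)) j"
  if "\<And>y. y \<in> prs ?a ==> j \<noteq> y \<and> j \<noteq> Suc y"
 proof -
  have "phi q T r c = Suc j \<longleftrightarrow> T r c = Suc j" for r c using phi_cell[of r c] that by auto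
  thus ?thesis by (simp add: cnt_def)
 qed
 have pa: "?a \<in> prs ?a" by (simp add: prs_def)
 have pb: "sp ==> bar (Suc ?a) \<in> prs ?a" by (simp add: prs_def)
 consider "j = ?a" | "j = Suc ?a" | "sp" "j = bar ?a" "j \<noteq> ?a" "j \<noteq> Suc ?a"
  | "sp" "j = bar (Suc ?a)" "j \<noteq> ?a" "j \<noteq> Suc ?a" "j \<noteq> bar ?a"
  | "j \<noteq> ?a" "j \<noteq> Suc ?a" "\<not> (sp \<and> (j = bar ?a \<or> j = bar (Suc ?a)))" by blast
 thus ?thesis
 proof cases
  case 1
  thus ?thesis using k1[OF pa] by (simp add: sw_def)
 next
  case 2
  thus ?thesis using k2[OF pa] by (simp add: sw_def)
 next
  case 3
  thus ?thesis using k2[OF pb] bar_Suc[OF a1] by (simp add: sw_def)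
 next
  case 4
  thus ?thesis using k1[OF pb] bar_Suc[OF a1] by (simp add: sw_def)
 next
  case 5
  hence "j \<noteq> y \<and> j \<noteq> Suc y" if "y \<in> prs ?a" for y
   using that bar_Suc[OF a1] by (auto simp: prs_def split: if_splits)
  thus ?thesis using k3 5 by (auto simp: sw_def)
 qed
qed

lemma phi_wt_rest: "wt (phi q T) (rest (phi q T) (Suc q)) = wt T (rest T (Suc q)) \<circ> sw (letter q)"
proof
 fix i
 show "wt (phi q T) (rest (phi q T) (Suc q)) i = (wt T (rest T (Suc q)) \<circ> sw (letter q)) i"
 proof (cases "i < 2*n")
  case True
  thus ?thesis using sw_less[OF a1 True] sw_bar[OF _ a1 True] phi_cnt_rest[of i] phi_cnt_rest[of "bar i"]
   by (cases sp) (simp_all add: wt_def phi_rest fold_coeff_def)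
 next
  case False
  thus ?thesis using sw_ge[OF a1, of i] by (simp add: wt_def)
 qed
qed

text \<open>Split at the violation: the walk so far ends on the wall and is fixed by the reflection,
  while the moves reflect the weight of the remaining cells.\<close>

lemma phi_end:
 assumes "\<nu> \<in> lat" "xi \<nu> T (Suc q) (letter q) = xi \<nu> T (Suc q) (Suc (letter q))"
 shows "\<nu> + delta - wt (phi q T) D = (\<nu> + delta - wt T D) \<circ> sw (letter q)"
proof -
 have e: "\<nu> + delta - wt S D = xi \<nu> S (Suc q) - wt S (rest S (Suc q))" for S
  unfolding xi_def wt_split[of S "Suc q"] by simp
 have "xi \<nu> T (Suc q) \<circ> sw (letter q) = xi \<nu> T (Suc q)" by (rule sw_stabilizes[OF xi_lat[OF assms(1)] a1 assms(2)])
 moreover have "(f - g) \<circ> h = (f \<circ> h) - (g \<circ> h)" for f g :: "nat \<Rightarrow> int" and h :: "nat \<Rightarrow> nat"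
  by (simp add: fun_eq_iff minus_apply)
 ultimately show ?thesis unfolding e phi_wt_rest by (simp add: phi_xi)
qed

end

text \<open>The condition that the path stays in the dominant chamber, expressed through
  times.\<close>

definition dominated :: "tab \<Rightarrow> bool" where
 "dominated T \<longleftrightarrow> (\<forall>t. wdec (wt T (rest T t)))"

lemma proc_all: "T \<in> sst ==> proc T (p 1 * (2*n) + 1) = D"
proof -
 assume T: "T \<in> sst"
 have "tm T x < p 1 * (2*n) + 1" if x: "x \<in> D" for x
 proof -
  obtain r c where rc: "x = (r, c)" by fastforce
  have r: "1 \<le> r" "r \<le> 2*n" "1 \<le> c" "c \<le> p r" using x rc by (auto simp: D_def)
  hence "c \<le> p 1" using p_mono[of 1 r] by simp
  hence "c * (2*n) \<le> p 1 * (2*n)" by simp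
  moreover have "(c - 1) * (2*n) + 2*n = c * (2*n)" using r(3) by (cases c) simp_all
  moreover have "2*n - T r c \<le> 2*n" by simp
  ultimately have "(c - 1) * (2*n) + (2*n - T r c) < p 1 * (2*n) + 1" by linarith
  thus ?thesis unfolding rc tm_def by simp
 qed
 thus ?thesis by (auto simp: proc_def)
qed

text \<open>The involution \<open>F\<close> reflects the end of a walk with a violation, where
  \<open>j\<close> changes sign. For a walk that stays strictly dominant, \<open>j\<close> at the
  end is 1 or 0 according to whether the end is \<open>delta\<close>.\<close>

theorem stembridge_cancellation:
 fixes j :: "ivec \<Rightarrow> complex"
 assumes anti: "\<And>\<xi> a. Suc a < 2*n ==> j (\<xi> \<circ> sw a) = - j \<xi>"
  and dom: "\<And>\<xi>. \<xi> \<in> lat ==> sdec \<xi> ==> j \<xi> = (if \<xi> = delta then 1 else 0)"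
  and \<nu>: "\<nu> \<in> lat" "wdec \<nu>"
 shows "(\<Sum>T\<in>sst. j (\<nu> + delta - wt T D)) = of_nat (card {T \<in> sst. dominated T \<and> wt T D = \<nu>})"
proof -
 define good where "good T \<longleftrightarrow> (\<forall>t. sdec (xi \<nu> T t))" for T
 \<comment> \<open>The walk starts strictly dominant, so the first violation is not at time 0 and
   the subtraction does not truncate. The letter that causes the violation is the one of time
   \<open>t0 T\<close>.\<close>
 define t0 where "t0 T = (LEAST t. \<not> sdec (xi \<nu> T t)) - 1" for T
 define F where "F T = phi (t0 T) T" for T
 let ?e = "\<lambda>T. \<nu> + delta - wt T D"
 have first: "\<not> sdec (xi \<nu> T (Suc (t0 T)))" "\<And>s. s \<le> t0 T ==> sdec (xi \<nu> T s)" if "\<not> good T" for T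
 proof -
  let ?m = "LEAST t. \<not> sdec (xi \<nu> T t)"
  have ex: "\<exists>t. \<not> sdec (xi \<nu> T t)" using that by (simp add: good_def)
  have m: "\<not> sdec (xi \<nu> T ?m)" by (rule LeastI_ex[OF ex])
  have "xi \<nu> T 0 = \<nu> + delta" by (simp add: xi_def proc_def wt_empty)
  hence "?m \<noteq> 0" using m sdec_plus_delta[OF \<nu>(2)] by metis
  hence "Suc (t0 T) = ?m" by (simp add: t0_def)
  thus "\<not> sdec (xi \<nu> T (Suc (t0 T)))" "\<And>s. s \<le> t0 T ==> sdec (xi \<nu> T s)"
   using m not_less_Least[of _ "\<lambda>t. \<not> sdec (xi \<nu> T t)"] by (metis, metis le_imp_less_Suc)
 qed
 have F: "F T \<in> sst \<and> \<not> good (F T) \<and> F (F T) = T \<and> j (?e (F T)) = - j (?e T)"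
  if T: "T \<in> sst" "\<not> good T" for T
 proof -
  note f = first[OF T(2)]
  let ?a = "letter (t0 T)"
  have b1: "Suc ?a < 2*n" by (rule first_bad(1)[OF T(1) \<nu>(1) f])
  have b2: "xi \<nu> T (Suc (t0 T)) ?a = xi \<nu> T (Suc (t0 T)) (Suc ?a)" by (rule first_bad(2)[OF T(1) \<nu>(1) f])
  have b3: "bd y (thr (t0 T) y) T" if "y \<in> prs ?a" for y by (rule first_bad(3)[OF T(1) \<nu>(1) f that])
  have ph1: "phi (t0 T) T \<in> sst" by (rule phi_sst[OF T(1) b1 b3])
  have ph2: "phi (t0 T) (phi (t0 T) T) = T" by (rule phi_phi[OF T(1) b1 b3])
  have ph4: "?e (phi (t0 T) T) = ?e T \<circ> sw ?a" by (rule phi_end[OF T(1) b1 b3 \<nu>(1) b2])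
  have x: "xi \<nu> (F T) s = xi \<nu> T s" if "s \<le> Suc (t0 T)" for s
   unfolding F_def using phi_xi[OF T(1) b1 b3 that] by simp
  have ng: "\<not> good (F T)" unfolding good_def using x[of "Suc (t0 T)"] f(1) by (metis order_refl)
  have "(LEAST t. \<not> sdec (xi \<nu> (F T) t)) = Suc (t0 T)"
  proof (rule Least_equality)
   show "\<not> sdec (xi \<nu> (F T) (Suc (t0 T)))" using x[of "Suc (t0 T)"] f(1) by simp
   show "Suc (t0 T) \<le> s" if "\<not> sdec (xi \<nu> (F T) s)" for s
   proof (rule ccontr)
    assume "\<not> Suc (t0 T) \<le> s"
    thus False using x[of s] f(2)[of s] that by simp
   qed
  qed
  hence "t0 (F T) = t0 T" by (simp add: t0_def)
  hence "F (F T) = T" using ph2 by (simp add: F_def)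
  moreover have "j (?e (F T)) = - j (?e T)" unfolding F_def ph4 by (rule anti[OF b1])
  ultimately show ?thesis using ph1 ng by (simp add: F_def)
 qed
 let ?bad = "{T \<in> sst. \<not> good T}"
 have "(\<Sum>T\<in>?bad. j (?e T)) = (\<Sum>T\<in>?bad. - j (?e T))"
  by (rule sum.reindex_bij_witness[where i = F and j = F]) (use F in auto)
 hence bad: "(\<Sum>T\<in>?bad. j (?e T)) = 0" by (simp add: sum_negf)
 have sd: "sdec (delta + \<eta>) \<longleftrightarrow> wdec \<eta>" if "\<eta> \<in> lat" for \<eta>
 proof
  assume "sdec (delta + \<eta>)"
  from sdec_minus_delta[OF lat_add[OF delta_lat that] this] show "wdec \<eta>" by simp
 qed (use sdec_plus_delta[of \<eta>] in \<open>simp add: add.commute\<close>)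
 have gd: "good T \<longleftrightarrow> dominated T" if "wt T D = \<nu>" for T
 proof -
  \<comment> \<open>Seen from its end, the walk adds letter weights to \<open>delta\<close> in the
    reading order.\<close>
  have "xi \<nu> T t = delta + wt T (rest T t)" for t using wt_split[of T t] that by (simp add: xi_def)
  thus ?thesis by (simp add: good_def dominated_def sd wt_lat)
 qed
 have "(\<Sum>T\<in>sst. j (?e T)) = (\<Sum>T\<in>{T \<in> sst. good T}. j (?e T)) + (\<Sum>T\<in>?bad. j (?e T))"
  using sum.union_disjoint[of "{T \<in> sst. good T}" ?bad "\<lambda>T. j (?e T)"] finite_sst
  by (simp add: Collect_disj_eq[symmetric] conj_disj_distribL[symmetric] disjoint_iff)
 also have "(\<Sum>T\<in>{T \<in> sst. good T}. j (?e T)) = (\<Sum>T\<in>{T \<in> sst. good T}. if wt T D = \<nu> then 1 else 0)"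
 proof (rule sum.cong[OF refl])
  fix T assume T: "T \<in> {T \<in> sst. good T}"
  hence "xi \<nu> T (p 1 * (2*n) + 1) = ?e T" using proc_all[of T] by (simp add: xi_def)
  hence "sdec (?e T)" using T by (metis (mono_tags, lifting) good_def mem_Collect_eq)
  moreover have "?e T \<in> lat" by (intro lat_diff lat_add \<nu> delta_lat wt_lat)
  ultimately have "j (?e T) = (if ?e T = delta then 1 else 0)" by (rule dom[rotated])
  also have "?e T = delta \<longleftrightarrow> wt T D = \<nu>" by (auto simp: algebra_simps)
  finally show "j (?e T) = (if wt T D = \<nu> then 1 else 0)" .
 qed
 also have "\<dots> = of_nat (card {T \<in> {T \<in> sst. good T}. wt T D = \<nu>})"
  using finite_sst by (simp add: sum.If_cases Int_def)
 also have "{T \<in> {T \<in> sst. good T}. wt T D = \<nu>} = {T \<in> sst. dominated T \<and> wt T D = \<nu>}" using gd by auto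
 finally show ?thesis using bad by simp
qed

text \<open>The classical Bender-Knuth involution: with threshold 0 all columns take part.\<close>

lemma wt_symmetric:
 assumes a: "Suc a < 2*n" and s: "\<not> sp"
 shows "card {T \<in> sst. wt T D = \<eta>} = card {T \<in> sst. wt T D = \<eta> \<circ> sw a}"
proof -
 have b: "bd a 0 T" if "T \<in> sst" for T using sst_D[OF that, of _ 0] by (auto simp: bd_def D_def)
 have e: "wt (bk a 0 T) D = wt T D \<circ> sw a" if T: "T \<in> sst" for T
 proof
  fix i
  have pos: "cnt S D k = int (card {(r, c) \<in> D. 0 < c \<and> S r c = Suc k})" for S k
   unfolding cnt_def by (intro arg_cong[where f = "\<lambda>A. int (card A)"]) (auto simp: D_def)
  have k1: "cnt (bk a 0 T) D a = cnt T D (Suc a)" unfolding pos using bk_count[OF T, of 0 a] by simp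
  have k2: "cnt (bk a 0 T) D (Suc a) = cnt T D a" unfolding pos using bk_count'[OF T b[OF T] a] by simp
  have k3: "cnt (bk a 0 T) D i = cnt T D i" if "i \<noteq> a" "i \<noteq> Suc a" for i
   unfolding cnt_def using bk_other[OF T, of "Suc i" a 0] that by simp
  have fc: "fold_coeff = 0" using s by (simp add: fold_coeff_def)
  show "wt (bk a 0 T) D i = (wt T D \<circ> sw a) i"
   using a k1 k2 k3[of i] by (cases "i = a"; cases "i = Suc a") (simp_all add: wt_def fc sw_def s)
 qed
 have i: "x \<circ> sw a = y \<circ> sw a \<longleftrightarrow> x = y" for x y :: "nat \<Rightarrow> int" using sw_invol[OF a] by (metis comp_apply ext)
 have "bij_betw (bk a 0) {T \<in> sst. wt T D = \<eta>} {T \<in> sst. wt T D = \<eta> \<circ> sw a}"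
  by (rule bij_betw_mutual_inverse[where h = "bk a 0"])
   (use e b a bk_sst bk_bk sw_invol[OF a] in \<open>auto simp: comp_def\<close>)
 thus ?thesis by (rule bij_betw_same_card)
qed

definition row_tableau :: "nat \<Rightarrow> nat \<Rightarrow> nat" where
 "row_tableau r c = (if (r, c) \<in> D then r else 0)"

lemma row_tableau_sst: "row_tableau \<in> sst" by (auto simp: sst_def row_tableau_def D_def)

lemma cnt_row_tableau: "i < 2*n ==> cnt row_tableau D i = int (p (Suc i))"
proof -
 assume i: "i < 2*n"
 have "{(r, c) \<in> D. row_tableau r c = Suc i} = {Suc i} \<times> {1..p (Suc i)}"
  using i by (auto simp: row_tableau_def D_def)
 thus ?thesis by (simp add: cnt_def)
qed

text \<open>In the reading order the first entry exceeding its row number would be some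
  \<open>e + 2\<close> read before any \<open>e + 1\<close>, against dominance.\<close>

lemma dominated_gl:
 assumes s: "\<not> sp" and T: "T \<in> sst" and d: "dominated T"
 shows "T = row_tableau"
proof -
 have fc: "fold_coeff = 0" using s by (simp add: fold_coeff_def)
 have main: "T r c = r" if x: "(r, c) \<in> D" for r c using x
 \<comment> \<open>Induction along the reading order; the factor \<open>Suc (2*n)\<close> exceeds
   all row numbers.\<close>
 proof (induction "(p 1 - c) * Suc (2*n) + r" arbitrary: r c rule: less_induct)
  case less
  have ge: "r \<le> T r c" using less.prems
  proof (induction r)
   case (Suc r)
   show ?case
   proof (cases "r = 0")
    case True
    thus ?thesis using sst_D[OF T, of "Suc r" c] Suc.prems by simp
   next
    case False
    hence "(r, c) \<in> D" using D_up[OF Suc.prems, of r] by simp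
    thus ?thesis using Suc.IH sst_col1[OF T Suc.prems] by simp
   qed
  qed simp
  have c1: "1 \<le> c" "c \<le> p r" "1 \<le> r" "r \<le> 2*n" using less.prems by (auto simp: D_def)
  have right: "T r' c' = r'" if "(r', c') \<in> D" "c < c'" for r' c'
  proof (rule less.hyps[OF _ that(1)])
   have b: "1 \<le> r'" "r' \<le> 2*n" "c' \<le> p r'" using that(1) by (auto simp: D_def)
   hence "c' \<le> p 1" using p_mono[of 1 r'] by simp
   hence "Suc (p 1 - c') * Suc (2*n) \<le> (p 1 - c) * Suc (2*n)" using that(2) by (intro mult_le_mono1) simp
   thus "(p 1 - c') * Suc (2*n) + r' < (p 1 - c) * Suc (2*n) + r" using b(2) by simp
  qed
  show ?case
  proof (cases "(r, Suc c) \<in> D")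
   case True
   hence "T r (Suc c) = r" using right by simp
   thus ?thesis using ge sst_row1[OF T True] by simp
  next
   case False
   hence pc: "p r = c" using c1 by (auto simp: D_def)
   show ?thesis
   proof (rule ccontr)
    assume ne: "T r c \<noteq> r"
    obtain e where e: "T r c = Suc (Suc e)" "r \<le> Suc e"
    proof -
     have "2 \<le> T r c" "r < T r c" using ge ne c1 by auto
     thus thesis using that[of "T r c - 2"] by simp
    qed
    have e2: "Suc e < 2*n" using sst_le[OF T, of r c] e by simp
    let ?R = "rest T (tm T (r, c))"
    have "wt T ?R (Suc e) \<le> wt T ?R e" using d e2 by (auto simp: dominated_def wdec_def)
    hence le: "cnt T ?R (Suc e) \<le> cnt T ?R e" using e2 by (simp add: wt_def fc)
    have "(r, c) \<in> {(r, c) \<in> ?R. T r c = Suc (Suc e)}" using e less.prems by (simp add: rest_def)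
    moreover have "finite {(r, c) \<in> ?R. T r c = Suc (Suc e)}"
     by (rule finite_subset[OF _ finite_rest[of T "tm T (r, c)"]]) auto
    ultimately have G: "1 \<le> cnt T ?R (Suc e)"
     unfolding cnt_def using card_gt_0_iff[of "{(r, c) \<in> ?R. T r c = Suc (Suc e)}"]
     by (simp only: One_nat_def) force
    \<comment> \<open>By induction an \<open>e + 1\<close> already read is in row
      \<open>e + 1\<close>, which is not above row \<open>r\<close>. To the right of column
      \<open>c\<close> this row is too short, and in column \<open>c\<close> only rows above
      \<open>r\<close> have been read.\<close>
    have E: "{(r, c) \<in> ?R. T r c = Suc e} = {}"
    proof (rule ccontr)
     assume "{(r, c) \<in> ?R. T r c = Suc e} \<noteq> {}"
     then obtain r' c' where rc: "(r', c') \<in> D" "tm T (r, c) \<le> tm T (r', c')" "T r' c' = Suc e"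
      by (auto simp: rest_def)
     have b: "1 \<le> r'" "r' \<le> 2*n" "1 \<le> c'" "c' \<le> p r'" using rc(1) by (auto simp: D_def)
     show False
     proof (cases "c < c'")
      case True
      have "T r' c' = r'" by (rule right[OF rc(1) True])
      hence "r \<le> r'" using rc(3) e(2) by simp
      hence "p r' \<le> p r" using p_mono[of r r'] c1 b by simp
      thus False using pc b True by simp
     next
      case False
      have "\<not> c' < c"
      proof
       assume "c' < c"
       hence "Suc c' * (2*n) \<le> c * (2*n)" by (intro mult_le_mono1) simp
       hence "Suc (c' - 1) * (2*n) \<le> (c - 1) * (2*n)" using b c1 by (cases c; cases c') simp_all
       hence "(c' - 1) * (2*n) + 2*n \<le> (c - 1) * (2*n)" by (simp add: add.commute)
       moreover have "(c - 1) * (2*n) + (2*n - Suc (Suc e)) \<le> (c' - 1) * (2*n) + (2*n - Suc e)"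
        using rc(2,3) e(1) by (simp only: tm_def prod.case)
       ultimately show False using e2 by linarith
      qed
      hence cc: "c' = c" using False by simp
      have "r' < r"
      proof (rule ccontr)
       assume "\<not> r' < r"
       hence "T r c \<le> T r' c" using sst_col[OF T, of r' c r] rc(1) cc by (cases "r = r'") auto
       thus False using rc(3) e cc by simp
      qed
      hence "T r' c = r'" using less.hyps[of c r'] rc(1) cc by simp
      thus False using e(2) rc(3) cc \<open>r' < r\<close> by simp
     qed
    qed
    have "cnt T ?R e = 0" unfolding cnt_def E by simp
    thus False using G le by simp
   qed
  qed
 qed
 show ?thesis
 proof (intro ext)
  fix r c show "T r c = row_tableau r c" using main[of r c] sst_out[OF T, of r c] by (auto simp: row_tableau_def)
 qed
qed

end

section \<open>Operator modules\<close>

text \<open>The isomorphism between two modules with the same highest weight is found as a submodule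
  of their product.\<close>

instantiation prod :: (complex_vector, complex_vector) complex_vector
begin

definition scaleC_prod :: "complex \<Rightarrow> 'a \<times> 'b \<Rightarrow> 'a \<times> 'b" where
 "scaleC_prod c p = (c *\<^sub>C fst p, c *\<^sub>C snd p)"

instance by standard
  (simp_all add: scaleC_prod_def prod_eq_iff scaleC_add_right scaleC_add_left scaleC_scaleC scaleC_one)

end

abbreviation csubspace :: "'a::complex_vector set \<Rightarrow> bool" where "csubspace \<equiv> complex_vector.subspace"
abbreviation cspan :: "'a::complex_vector set \<Rightarrow> 'a set" where "cspan \<equiv> complex_vector.span"

lemmas csub_intros = complex_vector.subspace_0 complex_vector.subspace_add complex_vector.subspace_diff
 complex_vector.subspace_scale complex_vector.subspace_neg complex_vector.subspace_sum

lemma scaleC_zero [simp]: "0 *\<^sub>C x = 0" "c *\<^sub>C 0 = 0"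
 by (rule complex_vector.scale_zero_left, rule complex_vector.scale_zero_right)

section \<open>Separation of eigenvectors\<close>

definition shifts :: "('a \<Rightarrow> 'a) \<Rightarrow> complex list \<Rightarrow> 'a::complex_vector \<Rightarrow> 'a" where
 "shifts D ks = fold (\<lambda>k x. D x - k *\<^sub>C x) ks"

lemma shifts_simps [simp]: "shifts D [] x = x" "shifts D (k # ks) x = shifts D ks (D x - k *\<^sub>C x)"
 by (simp_all add: shifts_def)

text \<open>A vector in the span is annihilated by some product of operators \<open>D - k\<close>
  with \<open>k \<noteq> e\<close>, and on an eigenvector for \<open>e\<close> such a product is
  multiplication by a nonzero number. Linearity is assumed on \<open>S\<close> only, since modules
  live on subspaces of a type.\<close>

lemma eigen_span:
 fixes D :: "'a::complex_vector \<Rightarrow> 'a"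
 assumes S: "csubspace S" "\<And>x. x \<in> S ==> D x \<in> S"
  and D: "\<And>x y. x \<in> S ==> y \<in> S ==> D (x + y) = D x + D y" "\<And>c x. x \<in> S ==> D (c *\<^sub>C x) = c *\<^sub>C D x"
  and A: "A \<subseteq> S" "\<And>a. a \<in> A ==> \<exists>k. k \<noteq> e \<and> D a = k *\<^sub>C a"
  and x: "x \<in> cspan A" "D x = e *\<^sub>C x"
 shows "x = 0"
proof -
 note SI = csub_intros[OF S(1)] S(2)
 have Dm: "D (x - y) = D x - D y" if "x \<in> S" "y \<in> S" for x y
  using D(1)[of "x - y" y] that SI(3)[of x y] by (simp add: algebra_simps)
 have Sk: "D x - k *\<^sub>C x \<in> S" if "x \<in> S" for k x by (intro SI that)
 have sS: "shifts D ks x \<in> S" if "x \<in> S" for ks x using that by (induction ks arbitrary: x) (simp_all add: Sk)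
 have sadd: "shifts D ks (x + y) = shifts D ks x + shifts D ks y" if "x \<in> S" "y \<in> S" for ks x y using that
 proof (induction ks arbitrary: x y)
  case (Cons k ks)
  have "D (x + y) - k *\<^sub>C (x + y) = (D x - k *\<^sub>C x) + (D y - k *\<^sub>C y)"
   using Cons.prems by (simp add: D scaleC_add_right)
  thus ?case using Cons by (simp add: Sk)
 qed simp
 have sscale: "shifts D ks (c *\<^sub>C x) = c *\<^sub>C shifts D ks x" if "x \<in> S" for ks c x using that
 proof (induction ks arbitrary: x)
  case (Cons k ks)
  have "D (c *\<^sub>C x) - k *\<^sub>C (c *\<^sub>C x) = c *\<^sub>C (D x - k *\<^sub>C x)"
   using Cons.prems by (simp add: D complex_vector.scale_right_diff_distrib mult.commute)
  thus ?case using Cons by (simp add: Sk)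
 qed simp
 have s0: "shifts D ks 0 = 0" for ks using sscale[of 0 ks 0] SI(1) by simp
 have sapp: "shifts D (ks @ ls) x = shifts D ls (shifts D ks x)" for ks ls x by (simp add: shifts_def)
 have scomm1: "shifts D ks (D x - k *\<^sub>C x) = D (shifts D ks x) - k *\<^sub>C shifts D ks x" if "x \<in> S" for ks k x
  using that
 proof (induction ks arbitrary: x)
  case (Cons l ks)
  have "D (D x - k *\<^sub>C x) - l *\<^sub>C (D x - k *\<^sub>C x) = D (D x - l *\<^sub>C x) - k *\<^sub>C (D x - l *\<^sub>C x)"
   using Cons.prems by (simp add: Dm D SI complex_vector.scale_right_diff_distrib mult.commute algebra_simps)
  thus ?case using Cons.IH[of "D x - l *\<^sub>C x"] Cons.prems by (simp add: Sk)
 qed simp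
 have scomm: "shifts D ls (shifts D ks x) = shifts D ks (shifts D ls x)" if "x \<in> S" for ks ls x using that
 proof (induction ks arbitrary: x)
  case (Cons k ks)
  thus ?case using scomm1[OF Cons.prems, of ls k] by (simp add: Sk)
 qed simp
 have "x \<in> S \<and> (\<exists>ks. e \<notin> set ks \<and> shifts D ks x = 0)"
 proof (rule complex_vector.span_induct[OF x(1), of "\<lambda>x. x \<in> S \<and> (\<exists>ks. e \<notin> set ks \<and> shifts D ks x = 0)"])
  fix a assume a: "a \<in> A"
  then obtain k where "k \<noteq> e" "D a = k *\<^sub>C a" using A(2) by blast
  hence "e \<notin> set [k] \<and> shifts D [k] a = 0" by simp
  thus "a \<in> S \<and> (\<exists>ks. e \<notin> set ks \<and> shifts D ks a = 0)" using a A(1) by blast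
 next
  show "csubspace {x. x \<in> S \<and> (\<exists>ks. e \<notin> set ks \<and> shifts D ks x = 0)}" unfolding complex_vector.subspace_def
  proof (intro conjI allI ballI, goal_cases)
   case 1
   show ?case by (auto intro!: exI[of _ "[]"] SI)
  next
   case (2 x y)
   then obtain ks ls where S': "x \<in> S" "y \<in> S"
    and k: "e \<notin> set ks" "shifts D ks x = 0" and l: "e \<notin> set ls" "shifts D ls y = 0" by auto
   have "shifts D (ks @ ls) (x + y) = shifts D ls (shifts D ks x) + shifts D ks (shifts D ls y)"
    unfolding sapp sadd[OF S'] sadd[OF sS[OF S'(1)] sS[OF S'(2)]] scomm[OF S'(2), of ls ks] by simp
   hence "shifts D (ks @ ls) (x + y) = 0" by (simp add: k l s0)
   thus ?case using k l S' by (intro CollectI conjI exI[of _ "ks @ ls"] SI) simp_all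
  next
   case (3 c x)
   thus ?case by (auto simp: sscale intro!: SI)
  qed
 qed
 then obtain ks where ks: "x \<in> S" "e \<notin> set ks" "shifts D ks x = 0" by blast
 have "shifts D ks x = (\<Prod>k\<leftarrow>ks. e - k) *\<^sub>C x" if "x \<in> S" "D x = e *\<^sub>C x" for x using that
 proof (induction ks arbitrary: x)
  case (Cons k ks)
  have e: "D x - k *\<^sub>C x = (e - k) *\<^sub>C x" by (simp add: Cons.prems complex_vector.scale_left_diff_distrib)
  have "D (D x - k *\<^sub>C x) = e *\<^sub>C (D x - k *\<^sub>C x)" unfolding e using Cons.prems by (simp add: D mult.commute)
  moreover have "(e - k) *\<^sub>C x \<in> S" by (intro SI Cons.prems)
  ultimately show ?case using Cons.IH[of "(e - k) *\<^sub>C x"] by (simp add: e mult.commute)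
 qed (simp add: scaleC_one)
 hence "(\<Prod>k\<leftarrow>ks. e - k) *\<^sub>C x = 0" using ks x(2) by simp
 moreover have "(\<Prod>k\<leftarrow>ks. e - k) \<noteq> 0" using ks(2) by (induction ks) auto
 ultimately show "x = 0" by simp
qed

text \<open>The sign of the involution, which sends the matrix unit at \<open>(i, j)\<close> to
  \<open>- eps2 i j\<close> times the one reflected in the antidiagonal.\<close>

definition eps2 :: "nat \<Rightarrow> nat \<Rightarrow> complex" where "eps2 i j = (-1) ^ (i + j)"

context folding
begin

text \<open>The relations between the operators by which the matrices \<open>E\<^sub>i\<^sub>j\<close> (general linear case) or
 \<open>E\<^sub>i\<^sub>j + \<sigma>(E\<^sub>i\<^sub>j)\<close> (symplectic case) act on a module.\<close>

definition bracket_value ::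
  "'v ops \<Rightarrow> nat \<Rightarrow> nat \<Rightarrow> nat \<Rightarrow> nat \<Rightarrow> 'v \<Rightarrow> 'v::complex_vector" where
 "bracket_value F k l i j v = (if i = l then F k j v else 0) - (if j = k then F i l v else 0)
   - (if sp then eps2 k l *\<^sub>C ((if i = bar k then F (bar l) j v else 0) - (if j = bar l then F i (bar k) v else 0))
    else 0)"

lemma bracket_value_closed:
 assumes Q: "csubspace Q" and F: "\<And>a b. a < 2*n ==> b < 2*n ==> F a b v \<in> Q"
  and b: "k < 2*n" "l < 2*n" "i < 2*n" "j < 2*n"
 shows "bracket_value F k l i j v \<in> Q"
proof -
 have t: "(if P then F a b v else 0) \<in> Q" if "a < 2*n" "b < 2*n" for P a b
  using F[OF that] csub_intros(1)[OF Q] by simp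
 have "eps2 k l *\<^sub>C ((if i = bar k then F (bar l) j v else 0) - (if j = bar l then F i (bar k) v else 0)) \<in> Q"
  by (intro csub_intros(3,4)[OF Q] t b) simp_all
 moreover have "(if i = l then F k j v else 0) - (if j = k then F i l v else 0) \<in> Q"
  by (intro csub_intros(3)[OF Q] t b)
 ultimately show ?thesis unfolding bracket_value_def
  by (cases sp) (simp_all only: if_True if_False diff_zero csub_intros(3)[OF Q])
qed

text \<open>The last clause expresses that the involution fixes
  \<open>E\<^sub>i\<^sub>j + \<sigma>(E\<^sub>i\<^sub>j)\<close>, so that after folding
  \<open>(i, j)\<close> and \<open>(bar j, bar i)\<close> give the same operator up to sign.\<close>

definition opmod :: "'v::complex_vector set \<Rightarrow> 'v ops \<Rightarrow> bool" where
 "opmod S F \<longleftrightarrow> csubspace S \<and>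
   (\<forall>i<2*n. \<forall>j<2*n. \<forall>v\<in>S. F i j v \<in> S) \<and>
   (\<forall>i<2*n. \<forall>j<2*n. \<forall>v\<in>S. \<forall>w\<in>S. F i j (v + w) = F i j v + F i j w) \<and>
   (\<forall>i<2*n. \<forall>j<2*n. \<forall>v\<in>S. \<forall>c. F i j (c *\<^sub>C v) = c *\<^sub>C F i j v) \<and>
   (\<forall>k<2*n. \<forall>l<2*n. \<forall>i<2*n. \<forall>j<2*n. \<forall>v\<in>S.
    F k l (F i j v) = F i j (F k l v) + bracket_value F k l i j v) \<and>
   (\<forall>i<2*n. \<forall>j<2*n. \<forall>v\<in>S. sp \<longrightarrow> F (bar j) (bar i) v = - (eps2 i j *\<^sub>C F i j v))"

definition opsub :: "'v ops \<Rightarrow> 'v::complex_vector set \<Rightarrow> bool" where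
 "opsub F W \<longleftrightarrow> csubspace W \<and> (\<forall>i<2*n. \<forall>j<2*n. \<forall>v\<in>W. F i j v \<in> W)"

definition opirr :: "'v::complex_vector set \<Rightarrow> 'v ops \<Rightarrow> bool" where
 "opirr S F \<longleftrightarrow> opmod S F \<and> S \<noteq> {0} \<and> (\<forall>W. opsub F W \<and> W \<subseteq> S \<longrightarrow> W = {0} \<or> W = S)"

definition hwv :: "'v::complex_vector set \<Rightarrow> 'v ops \<Rightarrow> ivec \<Rightarrow> 'v \<Rightarrow> bool" where
 "hwv S F \<nu> v \<longleftrightarrow> v \<in> S \<and> (\<forall>j<2*n. \<forall>i<j. F i j v = 0) \<and> (\<forall>i<2*n. F i i v = of_int (\<nu> i) *\<^sub>C v)"

lemma opmodD:
 assumes "opmod S F"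
 shows "csubspace S"
  "\<And>i j v. i < 2*n ==> j < 2*n ==> v \<in> S ==> F i j v \<in> S"
  "\<And>i j v w. i < 2*n ==> j < 2*n ==> v \<in> S ==> w \<in> S ==> F i j (v + w) = F i j v + F i j w"
  "\<And>i j v c. i < 2*n ==> j < 2*n ==> v \<in> S ==> F i j (c *\<^sub>C v) = c *\<^sub>C F i j v"
  "\<And>k l i j v. k < 2*n ==> l < 2*n ==> i < 2*n ==> j < 2*n ==> v \<in> S ==>
    F k l (F i j v) = F i j (F k l v) + bracket_value F k l i j v"
  "\<And>i j v. i < 2*n ==> j < 2*n ==> v \<in> S ==> sp ==> F (bar j) (bar i) v = - (eps2 i j *\<^sub>C F i j v)"
proof -
 note a = assms[unfolded opmod_def]
 note b = a[THEN conjunct2] a[THEN conjunct2, THEN conjunct2] a[THEN conjunct2, THEN conjunct2, THEN conjunct2]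
  a[THEN conjunct2, THEN conjunct2, THEN conjunct2, THEN conjunct2]
 show "csubspace S" by (rule a[THEN conjunct1])
 show "F i j v \<in> S" if "i < 2*n" "j < 2*n" "v \<in> S" for i j v by (rule b(1)[THEN conjunct1, rule_format, OF that])
 show "F i j (v + w) = F i j v + F i j w" if "i < 2*n" "j < 2*n" "v \<in> S" "w \<in> S" for i j v w
  by (rule b(2)[THEN conjunct1, rule_format, OF that])
 show "F i j (c *\<^sub>C v) = c *\<^sub>C F i j v" if "i < 2*n" "j < 2*n" "v \<in> S" for i j v c
  by (rule b(3)[THEN conjunct1, rule_format, OF that])
 show "F k l (F i j v) = F i j (F k l v) + bracket_value F k l i j v"
  if "k < 2*n" "l < 2*n" "i < 2*n" "j < 2*n" "v \<in> S" for k l i j v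
  by (rule b(4)[THEN conjunct1, rule_format, OF that])
 show "F (bar j) (bar i) v = - (eps2 i j *\<^sub>C F i j v)" if "i < 2*n" "j < 2*n" "v \<in> S" "sp" for i j v
  by (rule b(4)[THEN conjunct2, rule_format, OF that])
qed

lemma opmod_zero: "opmod S F ==> i < 2*n ==> j < 2*n ==> F i j 0 = 0"
proof -
 assume M: "opmod S F" and i: "i < 2*n" "j < 2*n"
 have "0 \<in> S" by (rule complex_vector.subspace_0[OF opmodD(1)[OF M]])
 from opmodD(4)[OF M i this, of 0] show ?thesis by simp
qed

lemma opmod_sub: "opmod S F ==> opsub F W ==> W \<subseteq> S ==> opmod W F"
proof -
 assume M: "opmod S F" and W: "opsub F W" "W \<subseteq> S"
 show "opmod W F"
  unfolding opmod_def by (intro conjI allI impI ballI) (use W in \<open>auto simp: opsub_def intro: opmodD[OF M]\<close>)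
qed

text \<open>Products of lowering operators applied to \<open>v0\<close>. The sum of the subtracted
  roots is carried along because a word may yield the vector 0, which has no weight of its
  own.\<close>

inductive_set words :: "'v ops \<Rightarrow> 'v \<Rightarrow> (ivec \<times> 'v) set"
 for F :: "nat \<Rightarrow> nat \<Rightarrow> 'v \<Rightarrow> 'v" and v0 :: 'v where
 words_base: "(0, v0) \<in> words F v0"
| words_step: "(\<beta>, x) \<in> words F v0 ==> i < j ==> j < 2*n ==> (root i j + \<beta>, F j i x) \<in> words F v0"

lemma cspan_map_on:
 assumes S: "csubspace S" "A \<subseteq> S" and x: "x \<in> cspan A"
  and add: "\<And>x y. x \<in> S ==> y \<in> S ==> f (x + y) = f x + f y"
  and scale: "\<And>c x. x \<in> S ==> f (c *\<^sub>C x) = c *\<^sub>C f x"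
  and A: "\<And>a. a \<in> A ==> f a \<in> Q" and Q: "csubspace Q"
 shows "f x \<in> Q"
proof -
 have f0: "f 0 = 0" using scale[of 0 0] complex_vector.subspace_0[OF S(1)] by simp
 have "x \<in> S \<and> f x \<in> Q" by (rule complex_vector.span_induct[OF x, of "\<lambda>x. x \<in> S \<and> f x \<in> Q"])
   (use A S in \<open>auto simp: complex_vector.subspace_def add scale f0 intro!: csub_intros Q\<close>)
 thus ?thesis by simp
qed

section \<open>The submodule generated by a highest weight vector\<close>

context
 fixes S :: "'v::complex_vector set" and F and \<nu> and v0 :: 'v
 assumes M: "opmod S F" and hw: "hwv S F \<nu> v0"
begin

lemma words_props:
 "(\<beta>, x) \<in> words F v0 ==> x \<in> S \<and> \<beta> \<in> cone \<and> (\<forall>i<2*n. F i i x = of_int ((\<nu> - \<beta>) i) *\<^sub>C x)"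
proof (induction rule: words.induct)
 case words_base
 thus ?case using hw by (auto simp: hwv_def cone_zero)
next
 case (words_step \<beta> x p q)
 hence x: "x \<in> S" "\<beta> \<in> cone" "p < 2*n" "q < 2*n" by auto
 have r: "root p q \<in> roots" using words_step by (simp add: rootsI)
 have "F i i (F q p x) = of_int ((\<nu> - (root p q + \<beta>)) i) *\<^sub>C F q p x" if i: "i < 2*n" for i
 proof -
  have "F i i (F q p x) = F q p (F i i x) + bracket_value F i i q p x" by (rule opmodD(5)[OF M i i x(4,3,1)])
  also have "F q p (F i i x) = of_int ((\<nu> - \<beta>) i) *\<^sub>C F q p x" using words_step i x by (simp add: opmodD(4)[OF M])
  also have "bracket_value F i i q p x = of_int (- root p q i) *\<^sub>C F q p x"
  proof -
   have e: "eps2 i i = 1" by (simp add: eps2_def flip: mult_2)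
   have rt: "- root p q i = (if q = i then 1 else 0) - (if p = i then 1 else 0)
     - (if sp then (if q = bar i then 1 else 0) - (if p = bar i then 1 else 0) else 0)"
    using bar_eq_swap[OF i x(3)] bar_eq_swap[OF i x(4)]
    by (simp add: root_def hv_def bv_def fold_coeff_def minus_apply eq_commute)
   show ?thesis unfolding rt bracket_value_def e
    by (auto simp: scaleC_one complex_vector.scale_left_diff_distrib)
  qed
  finally show ?thesis by (simp add: fun_ops scaleC_add_left[symmetric] algebra_simps del: of_int_add of_int_diff of_int_minus flip: of_int_add)
 qed
 thus ?case using cone_root[OF x(2) r] opmodD(2)[OF M] x by simp
qed

abbreviation Q where "Q \<equiv> cspan (snd ` words F v0)"

lemma words_S: "snd ` words F v0 \<subseteq> S" using words_props by force

lemma Q_S: "Q \<subseteq> S" by (rule complex_vector.span_minimal[OF words_S opmodD(1)[OF M]])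

lemma word_Q: "(\<beta>, x) \<in> words F v0 ==> x \<in> Q" by (rule complex_vector.span_base) force

lemma Q_lower:
 assumes ij: "i < j" "j < 2*n" and x: "x \<in> Q"
 shows "F j i x \<in> Q"
proof (rule cspan_map_on[OF opmodD(1)[OF M] words_S x])
 fix a assume "a \<in> snd ` words F v0"
 then obtain \<beta> where "(\<beta>, a) \<in> words F v0" by auto
 from words.words_step[OF this ij] show "F j i a \<in> Q" by (rule word_Q)
qed (use ij in \<open>auto intro: opmodD[OF M]\<close>)

text \<open>A raising operator is moved past the outermost lowering operator; the bracket applies
  single operators to the shorter word, and these stay in the span by induction. So the span of the
  lowering words is already a submodule.\<close>

lemma Q_upper_word: "(\<beta>, x) \<in> words F v0 ==> \<forall>j<2*n. \<forall>i\<le>j. F i j x \<in> Q"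
proof (induction rule: words.induct)
 case words_base
 have v: "v0 \<in> Q" by (rule word_Q[OF words.words_base])
 have "F i j v0 \<in> Q" if "j < 2*n" "i \<le> j" for i j
 proof -
  have e: "F i j v0 = (if i = j then of_int (\<nu> i) *\<^sub>C v0 else 0)"
   using hw that by (cases "i = j") (simp_all add: hwv_def)
  show ?thesis unfolding e using v by (auto intro: complex_vector.span_zero complex_vector.span_scale)
 qed
 thus ?case by blast
next
 case (words_step \<beta> x p q)
 have xS: "x \<in> S" and xQ: "x \<in> Q" using words_props[OF words_step(1)] word_Q[OF words_step(1)] by auto
 have all: "F a b x \<in> Q" if "a < 2*n" "b < 2*n" for a b
  using words_step.IH Q_lower[OF _ that(1) xQ, of b] that by (cases "a \<le> b") auto
 have "F i j (F q p x) \<in> Q" if j: "j < 2*n" "i \<le> j" for i j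
 proof -
  have l: "i < 2*n" "p < 2*n" "q < 2*n" using j words_step by auto
  have e: "F i j (F q p x) = F q p (F i j x) + bracket_value F i j q p x"
   by (rule opmodD(5)[OF M l(1) j(1) l(3,2) xS])
  have "F q p (F i j x) \<in> Q" by (rule Q_lower[OF words_step(2,3) all[OF l(1) j(1)]])
  moreover have "bracket_value F i j q p x \<in> Q"
   by (rule bracket_value_closed[where F = F and Q = Q and v = x, OF complex_vector.subspace_span all l(1) j(1) l(3,2)])
  ultimately show ?thesis unfolding e by (rule complex_vector.span_add)
 qed
 thus ?case by blast
qed

lemma Q_sub: "opsub F Q"
proof -
 have "F i j x \<in> Q" if "i < 2*n" "j < 2*n" "x \<in> Q" for i j x
 proof (cases "i \<le> j")
  case True
  show ?thesis
  proof (rule cspan_map_on[OF opmodD(1)[OF M] words_S that(3)])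
   fix a assume "a \<in> snd ` words F v0"
   then obtain \<beta> where "(\<beta>, a) \<in> words F v0" by auto
   thus "F i j a \<in> Q" using Q_upper_word that True by blast
  qed (use that in \<open>auto intro: opmodD[OF M]\<close>)
 qed (use Q_lower that in auto)
 thus ?thesis by (simp add: opsub_def)
qed

lemma Q_irr: "opirr S F ==> v0 \<noteq> 0 ==> Q = S"
proof -
 assume "opirr S F" "v0 \<noteq> 0"
 hence "Q = {0} \<or> Q = S" using Q_sub Q_S unfolding opirr_def by blast
 moreover have "v0 \<in> Q" by (rule word_Q[OF words.words_base])
 ultimately show ?thesis using \<open>v0 \<noteq> 0\<close> by auto
qed

end

text \<open>The action of the coweight dual to \<open>delta\<close>. It grades a highest weight
  module by height, and this single operator separates the highest weight from all others.\<close>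

definition ht :: "'v::complex_vector set \<Rightarrow> 'v ops \<Rightarrow> 'v \<Rightarrow> 'v" where
 "ht S F x = (\<Sum>i<2*n. of_int (delta i) *\<^sub>C F i i x)"

lemma ht_linear:
 assumes "opmod S F" "x \<in> S" "y \<in> S"
 shows "ht S F (x + y) = ht S F x + ht S F y" "ht S F (c *\<^sub>C x) = c *\<^sub>C ht S F x"
 using assms by (simp_all add: ht_def opmodD(3,4)[OF assms(1)] scaleC_add_right sum.distrib
  complex_vector.scale_sum_right mult.commute)

lemma ht_weight:
 assumes "\<And>i. i < 2*n ==> F i i x = of_int (\<nu> i) *\<^sub>C x"
 shows "ht S F x = of_int (ipr \<nu> delta) *\<^sub>C x"
 unfolding ht_def by (simp add: assms ipr_def flip: complex_vector.scale_sum_left of_int_mult of_int_sum)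
  (simp add: mult.commute)

lemma ht_closed: "opmod S F ==> x \<in> S ==> ht S F x \<in> S"
 unfolding ht_def by (intro csub_intros opmodD(1)) (auto intro: opmodD(2))

lemma eigen_span_ht:
 assumes M: "opmod S F" and A: "A \<subseteq> S" "\<And>a. a \<in> A ==> \<exists>k. k \<noteq> e \<and> ht S F a = k *\<^sub>C a"
  and x: "x \<in> cspan A" "ht S F x = e *\<^sub>C x"
 shows "x = 0"
 by (rule eigen_span[OF opmodD(1)[OF M] ht_closed[OF M] ht_linear(1)[OF M] ht_linear(2)[OF M] A x]) auto

lemma words_ht:
 assumes M: "opmod S F" and hw: "hwv S F \<nu> v0" and w: "(\<beta>, x) \<in> words F v0"
 shows "ht S F x = of_int (ipr \<nu> delta - ipr \<beta> delta) *\<^sub>C x" "x = v0 \<or> 0 < ipr \<beta> delta" "0 \<le> ipr \<beta> delta"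
proof -
 show "ht S F x = of_int (ipr \<nu> delta - ipr \<beta> delta) *\<^sub>C x"
  using ht_weight[of F x "\<nu> - \<beta>"] words_props[OF M hw w] by (simp add: ipr_diff)
 show "0 \<le> ipr \<beta> delta" using words_props[OF M hw w] cone_ipr[OF _ delta_lat sdec_delta] by blast
 show "x = v0 \<or> 0 < ipr \<beta> delta" using w
 proof cases
  case (words_step \<beta>' y i j)
  have "0 < ipr (root i j) delta" using words_step by (intro ipr_root_pos rootsI delta_lat sdec_delta)
  moreover have "0 \<le> ipr \<beta>' delta"
   using words_props[OF M hw words_step(3)] cone_ipr[OF _ delta_lat sdec_delta] by blast
  ultimately show ?thesis using words_step by (simp add: ipr_add)
 qed simp
qed

text \<open>Every word other than \<open>v0\<close> has smaller height, so the eigenspace of the top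
  height is the line of \<open>v0\<close>.\<close>

lemma hwv_multiple:
 assumes M: "opmod S F" and hw: "hwv S F \<nu> v0" and x: "x \<in> cspan (snd ` words F v0)"
  and e: "ht S F x = of_int (ipr \<nu> delta) *\<^sub>C x"
 obtains c where "x = c *\<^sub>C v0"
proof -
 let ?A = "snd ` words F v0" and ?B = "{y. \<exists>\<beta>. (\<beta>, y) \<in> words F v0 \<and> 0 < ipr \<beta> delta}"
 have B: "?B \<subseteq> S" using words_props[OF M hw] by blast
 have v0: "v0 \<in> S" "ht S F v0 = of_int (ipr \<nu> delta) *\<^sub>C v0" using hw by (auto simp: hwv_def intro: ht_weight)
 have "?A \<subseteq> insert v0 ?B" using words_ht(2)[OF M hw] by force
 hence "x \<in> cspan (insert v0 ?B)" using x complex_vector.span_mono by blast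
 then obtain c where c: "x - c *\<^sub>C v0 \<in> cspan ?B" using complex_vector.span_breakdown_eq by blast
 have xS: "x \<in> S" using x Q_S[OF M hw] by blast
 have "x - c *\<^sub>C v0 = 0"
 proof (rule eigen_span_ht[OF M B _ c])
  fix a assume "a \<in> ?B"
  then obtain \<beta> where w: "(\<beta>, a) \<in> words F v0" "0 < ipr \<beta> delta" by blast
  show "\<exists>k. k \<noteq> of_int (ipr \<nu> delta) \<and> ht S F a = k *\<^sub>C a"
   by (rule exI[of _ "of_int (ipr \<nu> delta - ipr \<beta> delta)"])
    (use words_ht(1)[OF M hw w(1)] w(2) in \<open>simp only: of_int_eq_iff, simp\<close>)
 next
  have "x - c *\<^sub>C v0 = x + (- c) *\<^sub>C v0" by simp
  moreover have m: "(- c) *\<^sub>C v0 \<in> S" by (rule csub_intros(4)[OF opmodD(1)[OF M] v0(1)])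
  ultimately have "ht S F (x - c *\<^sub>C v0) = ht S F x + (- c) *\<^sub>C ht S F v0"
   using ht_linear(1)[OF M xS m] ht_linear(2)[OF M v0(1) v0(1), of "- c"] by metis
  thus "ht S F (x - c *\<^sub>C v0) = of_int (ipr \<nu> delta) *\<^sub>C (x - c *\<^sub>C v0)"
   by (simp add: e v0 complex_vector.scale_right_diff_distrib mult.commute)
 qed
 hence "x = c *\<^sub>C v0" by simp
 thus ?thesis by (rule that)
qed

lemma ht_le:
 assumes M: "opmod S F" and hw: "hwv S F \<nu> v0" and x: "x \<in> cspan (snd ` words F v0)" "x \<noteq> 0"
  and e: "ht S F x = of_int k *\<^sub>C x"
 shows "k \<le> ipr \<nu> delta"
proof (rule ccontr)
 assume k: "\<not> k \<le> ipr \<nu> delta"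
 have "x = 0"
 proof (rule eigen_span_ht[OF M words_S[OF M hw] _ x(1) e])
  fix a assume "a \<in> snd ` words F v0"
  then obtain \<beta> where w: "(\<beta>, a) \<in> words F v0" by auto
  show "\<exists>l. l \<noteq> of_int k \<and> ht S F a = l *\<^sub>C a" by (rule exI[of _ "of_int (ipr \<nu> delta - ipr \<beta> delta)"])
    (use words_ht(1,3)[OF M hw w] k in \<open>simp only: of_int_eq_iff, simp\<close>)
 qed
 thus False using x by simp
qed

text \<open>Each of the two vectors generates the module, so neither has smaller height than the
  other; vectors of equal top height are proportional.\<close>

lemma hwv_unique:
 assumes M: "opirr S F" and hw: "hwv S F \<nu> v" "v \<noteq> 0" and hw': "hwv S F \<nu>' v'" "v' \<noteq> 0"
 shows "\<exists>c. v' = c *\<^sub>C v" "\<And>i. i < 2*n ==> \<nu>' i = \<nu> i"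
proof -
 have m: "opmod S F" using M by (simp add: opirr_def)
 have s: "cspan (snd ` words F v) = S" "cspan (snd ` words F v') = S"
  using Q_irr[OF m hw(1) M hw(2)] Q_irr[OF m hw'(1) M hw'(2)] .
 have vS: "v \<in> S" "v' \<in> S" using hw hw' by (auto simp: hwv_def)
 have e: "ht S F v = of_int (ipr \<nu> delta) *\<^sub>C v" "ht S F v' = of_int (ipr \<nu>' delta) *\<^sub>C v'"
  using hw hw' by (auto simp: hwv_def intro: ht_weight)
 have "ipr \<nu>' delta \<le> ipr \<nu> delta" by (rule ht_le[OF m hw(1) _ hw'(2) e(2)]) (simp add: s vS)
 moreover have "ipr \<nu> delta \<le> ipr \<nu>' delta" by (rule ht_le[OF m hw'(1) _ hw(2) e(1)]) (simp add: s vS)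
 ultimately have "ht S F v' = of_int (ipr \<nu> delta) *\<^sub>C v'" using e(2) by simp
 then obtain c where c: "v' = c *\<^sub>C v" using hwv_multiple[OF m hw(1), of v'] s vS by metis
 thus "\<exists>c. v' = c *\<^sub>C v" ..
 show "\<nu>' i = \<nu> i" if i: "i < 2*n" for i
 proof -
  have "F i i v' = of_int (\<nu> i) *\<^sub>C v'"
   using hw(1) i unfolding c by (simp add: hwv_def opmodD(4)[OF m] mult.commute)
  moreover have "F i i v' = of_int (\<nu>' i) *\<^sub>C v'" using hw'(1) i by (simp add: hwv_def)
  ultimately have "(of_int (\<nu> i) :: complex) *\<^sub>C v' = of_int (\<nu>' i) *\<^sub>C v'" by metis
  thus ?thesis using hw'(2) complex_vector.scale_right_imp_eq[of v' "of_int (\<nu> i)" "of_int (\<nu>' i)"] by auto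
 qed
qed

subsection \<open>Isomorphism of highest weight modules\<close>

definition opiso :: "'v::complex_vector set \<Rightarrow> 'v ops \<Rightarrow>
  'w::complex_vector set \<Rightarrow> 'w ops \<Rightarrow> ('v \<Rightarrow> 'w) \<Rightarrow> bool" where
 "opiso S F S' F' \<phi> \<longleftrightarrow> bij_betw \<phi> S S' \<and>
   (\<forall>u\<in>S. \<forall>v\<in>S. \<phi> (u + v) = \<phi> u + \<phi> v) \<and> (\<forall>c. \<forall>v\<in>S. \<phi> (c *\<^sub>C v) = c *\<^sub>C \<phi> v) \<and>
   (\<forall>i<2*n. \<forall>j<2*n. \<forall>v\<in>S. \<phi> (F i j v) = F' i j (\<phi> v))"

definition prod_op :: "'v ops \<Rightarrow> 'w ops \<Rightarrow> nat \<Rightarrow> nat \<Rightarrow> 'v \<times> 'w \<Rightarrow> 'v \<times> 'w" where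
 "prod_op F F' i j p = (F i j (fst p), F' i j (snd p))"

lemma prod_subspace: "csubspace S ==> csubspace S' ==> csubspace (S \<times> S')"
 by (auto simp: complex_vector.subspace_def scaleC_prod_def zero_prod_def)

lemma prod_opmod:
 assumes M: "opmod S F" and M': "opmod S' F'"
 shows "opmod (S \<times> S') (prod_op F F')"
proof -
 have b: "bracket_value (prod_op F F') k l i j p = (bracket_value F k l i j (fst p), bracket_value F' k l i j (snd p))"
  for k l i j p by (simp add: bracket_value_def prod_op_def prod_eq_iff scaleC_prod_def)
 show ?thesis unfolding opmod_def by (intro conjI allI impI ballI prod_subspace opmodD(1)[OF M] opmodD(1)[OF M'])
   (auto simp: prod_op_def b scaleC_prod_def prod_eq_iff opmodD(2,3,4,6)[OF M] opmodD(2,3,4,6)[OF M']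
    intro: opmodD(5)[OF M] opmodD(5)[OF M'])
qed

text \<open>The submodule generated by the pair of highest weight vectors is the graph of an
  isomorphism. By irreducibility it could fail to be one only by containing \<open>(0, v')\<close>
  or \<open>(v, 0)\<close>, which have the top height but are not multiples of
  \<open>(v, v')\<close>.\<close>

theorem hw_irr_iso:
 assumes M: "opirr S F" and M': "opirr S' F'" and hw: "hwv S F \<nu> v" "v \<noteq> 0" and hw': "hwv S' F' \<nu> v'" "v' \<noteq> 0"
 shows "\<exists>\<phi>. opiso S F S' F' \<phi>"
proof -
 let ?G = "prod_op F F'"
 have m: "opmod S F" "opmod S' F'" using M M' by (auto simp: opirr_def)
 have p: "opmod (S \<times> S') ?G" by (rule prod_opmod[OF m])
 have h: "hwv (S \<times> S') ?G \<nu> (v, v')" using hw hw' by (auto simp: hwv_def prod_op_def scaleC_prod_def zero_prod_def)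
 define N where "N = cspan (snd ` words ?G (v, v'))"
 have N: "opsub ?G N" "N \<subseteq> S \<times> S'" unfolding N_def using Q_sub[OF p h] Q_S[OF p h] by auto
 have Ns: "csubspace N" using N(1) by (simp add: opsub_def)
 have NI: "(x + y, x' + y') \<in> N" "(c *\<^sub>C x, c *\<^sub>C x') \<in> N" "(x - y, x' - y') \<in> N" if "(x, x') \<in> N" "(y, y') \<in> N" for x x' y y' c
  using csub_intros(2,3)[OF Ns that] csub_intros(4)[OF Ns that(1), of c] by (simp_all add: scaleC_prod_def)
 have N0: "(0, 0) \<in> N" using csub_intros(1)[OF Ns] by (simp add: zero_prod_def)
 have Nop: "(F i j x, F' i j x') \<in> N" if "(x, x') \<in> N" "i < 2*n" "j < 2*n" for i j x x'
  using N(1) that unfolding opsub_def prod_op_def by fastforce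
 have vN: "(v, v') \<in> N" unfolding N_def by (rule word_Q[OF p h words.words_base])
 have wt: "ht (S \<times> S') ?G q = of_int (ipr \<nu> delta) *\<^sub>C q" if "q \<in> {(0, v'), (v, 0)}" for q
  using that hw hw' opmod_zero[OF m(1)] opmod_zero[OF m(2)]
  by (intro ht_weight) (auto simp: prod_op_def hwv_def scaleC_prod_def)
 have no: "q \<notin> N" if q: "q \<in> {(0, v'), (v, 0)}" for q
 proof
  assume "q \<in> N"
  then obtain c where "q = c *\<^sub>C (v, v')" using hwv_multiple[OF p h _ wt[OF q]] unfolding N_def by blast
  thus False using q hw(2) hw'(2) by (auto simp: scaleC_prod_def)
 qed
 have snd0: "x' = 0" if "(0, x') \<in> N" for x'
 proof -
  let ?K = "{x'. (0, x') \<in> N}"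
  have "opsub F' ?K" unfolding opsub_def complex_vector.subspace_def
   using N0 NI Nop[of 0] opmod_zero[OF m(1)] by (auto; fastforce)
  moreover have "?K \<subseteq> S'" using N(2) by auto
  ultimately have "?K = {0} \<or> ?K = S'" using M' unfolding opirr_def by blast
  moreover have "v' \<in> S'" using hw' by (simp add: hwv_def)
  ultimately show ?thesis using no that by auto
 qed
 have fst0: "x = 0" if "(x, 0) \<in> N" for x
 proof -
  let ?K = "{x. (x, 0) \<in> N}"
  have "opsub F ?K" unfolding opsub_def complex_vector.subspace_def
   using N0 NI Nop[of _ 0] opmod_zero[OF m(2)] by (auto; fastforce)
  moreover have "?K \<subseteq> S" using N(2) by auto
  ultimately have "?K = {0} \<or> ?K = S" using M unfolding opirr_def by blast
  moreover have "v \<in> S" using hw by (simp add: hwv_def)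
  ultimately show ?thesis using no that by auto
 qed
 have surj1: "\<exists>x'. (x, x') \<in> N" if "x \<in> S" for x
 proof -
  let ?K = "fst ` N"
  have "opsub F ?K" unfolding opsub_def complex_vector.subspace_def
  proof (intro conjI allI impI ballI, goal_cases)
   case 1
   show ?case using N0 by force
  next
   case (2 x y)
   thus ?case using NI(1) by force
  next
   case (3 c x)
   thus ?case using NI(2) by force
  next
   case (4 i j x)
   thus ?case using Nop by force
  qed
  moreover have "?K \<subseteq> S" using N(2) by auto
  ultimately have "?K = {0} \<or> ?K = S" using M unfolding opirr_def by blast
  moreover have "v \<in> ?K" using vN by force
  ultimately show ?thesis using hw(2) that by fastforce
 qed
 have surj2: "\<exists>x. (x, x') \<in> N" if "x' \<in> S'" for x'
 proof -
  let ?K = "snd ` N"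
  have "opsub F' ?K" unfolding opsub_def complex_vector.subspace_def
  proof (intro conjI allI impI ballI, goal_cases)
   case 1
   show ?case using N0 by force
  next
   case (2 x y)
   thus ?case using NI(1) by force
  next
   case (3 c x)
   thus ?case using NI(2) by force
  next
   case (4 i j x)
   thus ?case using Nop by force
  qed
  moreover have "?K \<subseteq> S'" using N(2) by auto
  ultimately have "?K = {0} \<or> ?K = S'" using M' unfolding opirr_def by blast
  moreover have "v' \<in> ?K" using vN by force
  ultimately show ?thesis using hw'(2) that by fastforce
 qed
 have fun1: "x' = y'" if "(x, x') \<in> N" "(x, y') \<in> N" for x x' y' using snd0[of "x' - y'"] NI(3)[OF that] by simp
 have fun2: "x = y" if "(x, x') \<in> N" "(y, x') \<in> N" for x y x' using fst0[of "x - y"] NI(3)[OF that] by simp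
 define \<phi> where "\<phi> x = (THE x'. (x, x') \<in> N)" for x
 have \<phi>: "\<phi> x = x'" if "(x, x') \<in> N" for x x' unfolding \<phi>_def using that fun1 by blast
 have \<phi>N: "(x, \<phi> x) \<in> N" if "x \<in> S" for x using surj1[OF that] \<phi> by auto
 have "opiso S F S' F' \<phi>" unfolding opiso_def
 proof (intro conjI allI impI ballI)
  show "bij_betw \<phi> S S'" unfolding bij_betw_def
  proof
   show "inj_on \<phi> S" by (rule inj_onI) (metis \<phi>N fun2)
   show "\<phi> ` S = S'"
   proof
    show "\<phi> ` S \<subseteq> S'" using \<phi>N N(2) by blast
    show "S' \<subseteq> \<phi> ` S" using surj2 \<phi> N(2) by blast
   qed
  qed
  show "\<phi> (x + y) = \<phi> x + \<phi> y" if "x \<in> S" "y \<in> S" for x y by (rule \<phi>[OF NI(1)[OF \<phi>N[OF that(1)] \<phi>N[OF that(2)]]])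
  show "\<phi> (c *\<^sub>C x) = c *\<^sub>C \<phi> x" if "x \<in> S" for c x by (rule \<phi>[OF NI(2)[OF \<phi>N[OF that] \<phi>N[OF that]]])
  show "\<phi> (F i j x) = F' i j (\<phi> x)" if "i < 2*n" "j < 2*n" "x \<in> S" for i j x
   by (rule \<phi>[OF Nop[OF \<phi>N[OF that(3)] that(1,2)]])
 qed
 thus ?thesis by blast
qed

end

section \<open>Functions on a finite set as a Hilbert space\<close>

definition hil :: "'a set \<Rightarrow> ('a \<Rightarrow> complex) set" where "hil X = {f. \<forall>u. u \<notin> X \<longrightarrow> f u = 0}"

definition ip :: "'a set \<Rightarrow> ('a \<Rightarrow> complex) \<Rightarrow> ('a \<Rightarrow> complex) \<Rightarrow> complex" where
 "ip X f g = (\<Sum>u\<in>X. f u * cnj (g u))"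

lemma scaleC_apply: "(c *\<^sub>C f) x = c * f x" for f :: "'a \<Rightarrow> complex" by (simp add: scaleC_fun_def scaleC_complex_def)

lemmas fn_ops = zero_fun_apply plus_fun_apply minus_apply uminus_apply scaleC_apply

lemma ip_add1: "ip X (f + g) h = ip X f h + ip X g h"
 and ip_add2: "ip X h (f + g) = ip X h f + ip X h g"
 and ip_diff1: "ip X (f - g) h = ip X f h - ip X g h"
 and ip_diff2: "ip X h (f - g) = ip X h f - ip X h g"
 and ip_scale1: "ip X (c *\<^sub>C f) h = c * ip X f h"
 and ip_scale2: "ip X h (c *\<^sub>C f) = cnj c * ip X h f"
 and ip_zero1: "ip X 0 h = 0" and ip_zero2: "ip X h 0 = 0"
 by (simp_all add: ip_def fn_ops algebra_simps sum.distrib sum_subtractf sum_distrib_left)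

lemma ip_sum1: "ip X (\<Sum>a\<in>A. f a) g = (\<Sum>a\<in>A. ip X (f a) g)"
 by (induction A rule: infinite_finite_induct) (simp_all add: ip_zero1 ip_add1)

lemma ip_sum2: "ip X g (\<Sum>a\<in>A. f a) = (\<Sum>a\<in>A. ip X g (f a))"
 by (induction A rule: infinite_finite_induct) (simp_all add: ip_zero2 ip_add2)

lemma ip_cnj: "cnj (ip X f g) = ip X g f" by (simp add: ip_def mult.commute)

lemma ip_self: "ip X f f = of_real (\<Sum>u\<in>X. (cmod (f u))\<^sup>2)" unfolding ip_def of_real_sum complex_norm_square ..

lemma ip_self_Re: "ip X f f = of_real (Re (ip X f f))" "0 \<le> Re (ip X f f)" by (simp_all add: ip_self sum_nonneg)

lemma ip_mult_cnj: "ip X f g * ip X g f = of_real ((cmod (ip X f g))\<^sup>2)" unfolding complex_norm_square ip_cnj ..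

lemma ip_pos: "finite X ==> f \<in> hil X ==> ip X f f = 0 ==> f = 0"
proof -
 assume X: "finite X" "f \<in> hil X" "ip X f f = 0"
 hence "(\<Sum>u\<in>X. (cmod (f u))\<^sup>2) = 0" using ip_self[of X f] by (metis of_real_eq_0_iff)
 hence "\<forall>u\<in>X. f u = 0" using X(1) by (simp add: sum_nonneg_eq_0_iff)
 thus "f = 0" using X(2) by (auto simp: hil_def fn_ops fun_eq_iff)
qed

lemma hil_subspace: "csubspace (hil X)" by (auto simp: complex_vector.subspace_def hil_def fn_ops)

definition orthonormal :: "'a set \<Rightarrow> ('a \<Rightarrow> complex) set \<Rightarrow> bool" where
 "orthonormal X B \<longleftrightarrow> finite B \<and> (\<forall>a\<in>B. \<forall>b\<in>B. ip X a b = (if a = b then 1 else 0))"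

definition onb :: "'a set \<Rightarrow> ('a \<Rightarrow> complex) set \<Rightarrow> ('a \<Rightarrow> complex) set \<Rightarrow> bool" where
 "onb X B W \<longleftrightarrow> orthonormal X B \<and> B \<subseteq> W \<and> (\<forall>x\<in>W. x = (\<Sum>b\<in>B. ip X x b *\<^sub>C b))"

lemma onbD:
 assumes "onb X B W"
 shows "orthonormal X B" "finite B" "B \<subseteq> W" "\<And>x. x \<in> W ==> x = (\<Sum>b\<in>B. ip X x b *\<^sub>C b)"
  "\<And>a b. a \<in> B ==> b \<in> B ==> ip X a b = (if a = b then 1 else 0)"
 using assms unfolding onb_def orthonormal_def by blast+

lemma ip_residue:
 assumes "orthonormal X B" "b \<in> B"
 shows "ip X (x - (\<Sum>b\<in>B. ip X x b *\<^sub>C b)) b = 0"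
proof -
 have B: "finite B" "\<And>a. a \<in> B ==> ip X a b = (if a = b then 1 else 0)"
  using assms unfolding orthonormal_def by blast+
 have "(\<Sum>a\<in>B. ip X x a * ip X a b) = (\<Sum>a\<in>B. if a = b then ip X x a else 0)"
  by (rule sum.cong[OF refl]) (simp add: B)
 thus ?thesis using B(1) assms(2) by (simp add: ip_diff1 ip_sum1 ip_scale1)
qed

lemma bessel:
 assumes "orthonormal X B"
 shows "(\<Sum>b\<in>B. (cmod (ip X x b))\<^sup>2) \<le> Re (ip X x x)"
proof -
 define p where "p = (\<Sum>b\<in>B. ip X x b *\<^sub>C b)"
 define y where "y = x - p"
 have "ip X y b = 0" if "b \<in> B" for b unfolding y_def p_def by (rule ip_residue[OF assms that])
 hence "ip X y p = 0" unfolding p_def by (simp add: ip_sum2 ip_scale2)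
 hence "ip X y y = ip X y x" by (subst (2) y_def) (simp add: ip_diff2)
 also have "\<dots> = ip X x x - (\<Sum>b\<in>B. ip X x b * ip X b x)"
  unfolding y_def p_def by (simp add: ip_diff1 ip_sum1 ip_scale1)
 also have "\<dots> = ip X x x - of_real (\<Sum>b\<in>B. (cmod (ip X x b))\<^sup>2)" by (simp add: ip_mult_cnj)
 finally show ?thesis using ip_self_Re(2)[of X y] by simp
qed

text \<open>Bessel's inequality for the point masses, summed over all points.\<close>

lemma orthonormal_card_le_space:
 assumes X: "finite X" and B: "orthonormal X B"
 shows "card B \<le> card X"
proof -
 have fB: "finite B" using B by (simp add: orthonormal_def)
 have *: "(\<Sum>b\<in>B. (cmod (b u))\<^sup>2) \<le> 1" if u: "u \<in> X" for u
 proof -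
  let ?e = "\<lambda>w. if w = u then 1 else 0 :: complex"
  have s: "(\<Sum>w\<in>X. ?e w * g w) = g u" for g
  proof -
   have "(\<Sum>w\<in>X. ?e w * g w) = (\<Sum>w\<in>X. if w = u then g w else 0)" by (rule sum.cong) auto
   thus ?thesis using X u by simp
  qed
  have "ip X ?e b = cnj (b u)" for b unfolding ip_def by (rule s)
  moreover have "ip X ?e ?e = 1" unfolding ip_def by (subst s) simp
  ultimately show ?thesis using bessel[OF B, of ?e] by simp
 qed
 have "real (card B) = (\<Sum>b\<in>B. Re (ip X b b))" using B by (simp add: orthonormal_def)
 also have "\<dots> = (\<Sum>b\<in>B. \<Sum>u\<in>X. (cmod (b u))\<^sup>2)" by (simp add: ip_self)
 also have "\<dots> = (\<Sum>u\<in>X. \<Sum>b\<in>B. (cmod (b u))\<^sup>2)" by (rule sum.swap)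
 also have "\<dots> \<le> (\<Sum>u\<in>X. 1)" by (rule sum_mono) (rule *)
 finally show ?thesis by simp
qed

text \<open>A maximal orthonormal set in \<open>W\<close> is a basis: a nonzero residue of an
  element, normalized, would enlarge it.\<close>

lemma onb_exists:
 assumes X: "finite X" and W: "csubspace W" "W \<subseteq> hil X"
 shows "\<exists>B. onb X B W"
proof -
 have "orthonormal X {} \<and> {} \<subseteq> W" by (simp add: orthonormal_def)
 moreover have "\<forall>B. orthonormal X B \<and> B \<subseteq> W \<longrightarrow> card B < Suc (card X)"
  using orthonormal_card_le_space[OF X] by (auto simp: less_Suc_eq_le)
 ultimately obtain B where B: "orthonormal X B" "B \<subseteq> W"
  and mx: "\<And>C. orthonormal X C ==> C \<subseteq> W ==> card C \<le> card B"
  using ex_has_greatest_nat[of "\<lambda>B. orthonormal X B \<and> B \<subseteq> W" "{}" card "Suc (card X)"] by blast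
 have fB: "finite B" using B(1) by (simp add: orthonormal_def)
 have "x = (\<Sum>b\<in>B. ip X x b *\<^sub>C b)" if x: "x \<in> W" for x
 proof (rule ccontr)
  assume ne: "\<not> ?thesis"
  define y where "y = x - (\<Sum>b\<in>B. ip X x b *\<^sub>C b)"
  have yW: "y \<in> W" unfolding y_def using B(2) x by (intro csub_intros(3,6)[OF W(1)] csub_intros(4)[OF W(1)]) auto
  have y0: "y \<noteq> 0" using ne by (simp add: y_def)
  have yb: "ip X y b = 0" if "b \<in> B" for b unfolding y_def by (rule ip_residue[OF B(1) that])
  have by': "ip X b y = 0" if "b \<in> B" for b using yb[OF that] ip_cnj[of X y b] by simp
  define r where "r = Re (ip X y y)"
  have "ip X y y \<noteq> 0" using ip_pos[OF X] yW W(2) y0 by blast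
  hence r: "r > 0" "ip X y y = of_real r"
   using ip_self_Re[of X y] unfolding r_def by (metis of_real_0 order_le_less, simp)
  define z where "z = of_real (1 / sqrt r) *\<^sub>C y"
  have zz: "ip X z z = 1" using r by (simp add: z_def ip_scale1 ip_scale2 flip: of_real_mult of_real_divide)
  have zb: "ip X z b = 0" "ip X b z = 0" if "b \<in> B" for b
   using that yb by' by (simp_all add: z_def ip_scale1 ip_scale2)
  have zB: "z \<notin> B" using zz zb(1)[of z] by auto
  have "orthonormal X (insert z B)" unfolding orthonormal_def
  proof (intro conjI ballI)
   show "finite (insert z B)" using fB by simp
   fix a b assume "a \<in> insert z B" "b \<in> insert z B"
   then consider "a = z" "b = z" | "a = z" "b \<in> B" | "a \<in> B" "b = z" | "a \<in> B" "b \<in> B" by blast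
   thus "ip X a b = (if a = b then 1 else 0)"
   proof cases
    case 2
    hence "a \<noteq> b" using zB by blast
    thus ?thesis using 2 zb(2)[of b] ip_cnj[of X b z] zb(1)[of b] by simp
   next
    case 3
    hence "a \<noteq> b" using zB by blast
    thus ?thesis using 3 zb(1)[of a] ip_cnj[of X z a] zb(2)[of a] by simp
   next
    case 4
    thus ?thesis using B(1) unfolding orthonormal_def by blast
   qed (use zz in simp)
  qed
  moreover have "insert z B \<subseteq> W" using B(2) csub_intros(4)[OF W(1) yW] by (simp add: z_def)
  ultimately show False using mx[of "insert z B"] zB fB by simp
 qed
 thus ?thesis using B unfolding onb_def by blast
qed

lemma onb_dim:
 assumes "onb X B W"
 shows "complex_vector.dim W = card B"
proof (rule complex_vector.dim_unique[OF onbD(3)[OF assms] _ _ refl])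
 show "W \<subseteq> cspan B"
 proof
  fix x assume x: "x \<in> W"
  show "x \<in> cspan B" by (subst onbD(4)[OF assms x])
    (intro complex_vector.span_sum complex_vector.span_scale complex_vector.span_base)
 qed
 show "complex_vector.independent B" unfolding complex_vector.dependent_finite[OF onbD(2)[OF assms]]
 proof
  assume "\<exists>u. (\<exists>v\<in>B. u v \<noteq> 0) \<and> (\<Sum>v\<in>B. u v *\<^sub>C v) = 0"
  then obtain u v where u: "v \<in> B" "u v \<noteq> 0" "(\<Sum>v\<in>B. u v *\<^sub>C v) = 0" by blast
  have "(\<Sum>a\<in>B. u a * ip X a v) = (\<Sum>a\<in>B. if a = v then u a else 0)"
   by (rule sum.cong[OF refl]) (simp add: onbD(5)[OF assms _ u(1)])
  hence "ip X (\<Sum>v\<in>B. u v *\<^sub>C v) v = u v" using onbD(2)[OF assms] u(1) by (simp add: ip_sum1 ip_scale1)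
  thus False using u by (simp add: ip_zero1)
 qed
qed

lemma parseval:
 assumes "onb X B W" "x \<in> W"
 shows "ip X x x = of_real (\<Sum>b\<in>B. (cmod (ip X x b))\<^sup>2)"
proof -
 have "ip X x x = ip X (\<Sum>b\<in>B. ip X x b *\<^sub>C b) x" using onbD(4)[OF assms] by (rule arg_cong)
 also have "\<dots> = of_real (\<Sum>b\<in>B. (cmod (ip X x b))\<^sup>2)" by (simp add: ip_sum1 ip_scale1 ip_mult_cnj)
 finally show ?thesis .
qed

text \<open>The squared inner products with an orthonormal basis are summed in two ways, by Parseval
  and by Bessel.\<close>

lemma orthonormal_card_le_dim:
 assumes X: "finite X" and W: "csubspace W" "W \<subseteq> hil X" and B: "orthonormal X B" "B \<subseteq> W"
 shows "card B \<le> complex_vector.dim W"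
proof -
 obtain C where C: "onb X C W" using onb_exists[OF X W] by blast
 have "real (card B) = (\<Sum>b\<in>B. Re (ip X b b))" using B by (simp add: orthonormal_def)
 also have "\<dots> = (\<Sum>b\<in>B. \<Sum>c\<in>C. (cmod (ip X b c))\<^sup>2)"
  by (rule sum.cong[OF refl]) (use B(2) in \<open>auto simp: parseval[OF C]\<close>)
 also have "\<dots> = (\<Sum>c\<in>C. \<Sum>b\<in>B. (cmod (ip X b c))\<^sup>2)" by (rule sum.swap)
 also have "\<dots> = (\<Sum>c\<in>C. \<Sum>b\<in>B. (cmod (ip X c b))\<^sup>2)" by (subst ip_cnj[symmetric]) (simp only: complex_mod_cnj)
 also have "\<dots> \<le> (\<Sum>c\<in>C. Re (ip X c c))" by (rule sum_mono) (rule bessel[OF B(1)])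
 also have "\<dots> = card C" using onbD(5)[OF C] by simp
 finally show ?thesis using onb_dim[OF C] by simp
qed

section \<open>Orthogonal complements\<close>

lemma onb_Un:
 assumes B: "onb X B W" and C: "onb X C V" and WV: "W \<subseteq> Y" "V \<subseteq> Y" "csubspace V" "csubspace W"
  and orth: "\<And>w v. w \<in> W ==> v \<in> V ==> ip X w v = 0"
  and Y: "\<And>y. y \<in> Y ==> \<exists>w\<in>W. \<exists>v\<in>V. y = w + v"
 shows "onb X (B \<union> C) Y" "B \<inter> C = {}"
proof -
 have o2: "ip X v w = 0" if "w \<in> W" "v \<in> V" for w v using orth[OF that] ip_cnj[of X w v] by simp
 note b = onbD[OF B] and c = onbD[OF C]
 show d: "B \<inter> C = {}"
 proof (rule ccontr)
  assume "B \<inter> C \<noteq> {}"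
  then obtain a where "a \<in> B" "a \<in> C" by blast
  thus False using orth[of a a] b(3) c(3) b(5)[of a a] by auto
 qed
 have "orthonormal X (B \<union> C)" unfolding orthonormal_def
 proof (intro conjI ballI)
  show "finite (B \<union> C)" using b(2) c(2) by simp
  show "ip X x y = (if x = y then 1 else 0)" if "x \<in> B \<union> C" "y \<in> B \<union> C" for x y
  proof (cases "x = y")
   case True thus ?thesis using that b(5)[of x y] c(5)[of x y] by auto
  next
   case False
   consider "x \<in> B" "y \<in> B" | "x \<in> C" "y \<in> C" | "x \<in> B" "y \<in> C" | "x \<in> C" "y \<in> B" using \<open>x \<in> B \<union> C\<close> \<open>y \<in> B \<union> C\<close> by blast
   thus ?thesis using False b(5)[of x y] c(5)[of x y] orth[of x y] o2[of y x] b(3) c(3) by cases auto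
  qed
 qed
 moreover have "y = (\<Sum>b\<in>B \<union> C. ip X y b *\<^sub>C b)" if y: "y \<in> Y" for y
 proof -
  obtain w v where wv: "w \<in> W" "v \<in> V" "y = w + v" using Y[OF y] by blast
  have "(\<Sum>b\<in>B \<union> C. ip X y b *\<^sub>C b) = (\<Sum>b\<in>B. ip X y b *\<^sub>C b) + (\<Sum>b\<in>C. ip X y b *\<^sub>C b)"
   by (rule sum.union_disjoint[OF b(2) c(2) d])
  also have "(\<Sum>b\<in>B. ip X y b *\<^sub>C b) = (\<Sum>b\<in>B. ip X w b *\<^sub>C b)"
   by (rule sum.cong[OF refl]) (use b(3) o2 wv in \<open>auto simp: ip_add1\<close>)
  also have "(\<Sum>b\<in>C. ip X y b *\<^sub>C b) = (\<Sum>b\<in>C. ip X v b *\<^sub>C b)"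
   by (rule sum.cong[OF refl]) (use c(3) orth wv in \<open>auto simp: ip_add1\<close>)
  finally show ?thesis using b(4)[OF wv(1)] c(4)[OF wv(2)] wv(3) by simp
 qed
 ultimately show "onb X (B \<union> C) Y" using b(3) c(3) WV unfolding onb_def by blast
qed

definition oc :: "'a set \<Rightarrow> ('a \<Rightarrow> complex) set \<Rightarrow> ('a \<Rightarrow> complex) set \<Rightarrow> ('a \<Rightarrow> complex) set" where
 "oc X Y W = {f \<in> Y. \<forall>g\<in>W. ip X f g = 0}"

lemma oc_subspace: "csubspace Y ==> csubspace (oc X Y W)"
 by (auto simp: complex_vector.subspace_def oc_def ip_zero1 ip_add1 ip_scale1)

lemma oc_split:
 assumes X: "finite X" and W: "csubspace W" "W \<subseteq> Y" and Y: "csubspace Y" "Y \<subseteq> hil X" and y: "y \<in> Y"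
 shows "\<exists>w\<in>W. \<exists>v\<in>oc X Y W. y = w + v"
proof -
 obtain B where B: "onb X B W" using onb_exists[OF X W(1)] W(2) Y(2) by blast
 define w where "w = (\<Sum>b\<in>B. ip X y b *\<^sub>C b)"
 have wW: "w \<in> W" unfolding w_def using onbD(3)[OF B]
  by (intro csub_intros(6)[OF W(1)] csub_intros(4)[OF W(1)]) auto
 have "ip X (y - w) g = 0" if g: "g \<in> W" for g
 proof -
  have "ip X (y - w) b = 0" if "b \<in> B" for b unfolding w_def by (rule ip_residue[OF onbD(1)[OF B] that])
  hence "ip X (y - w) (\<Sum>b\<in>B. ip X g b *\<^sub>C b) = 0" by (simp add: ip_sum2 ip_scale2)
  thus ?thesis using onbD(4)[OF B g] by simp
 qed
 hence "y - w \<in> oc X Y W" unfolding oc_def using csub_intros(3)[OF Y(1) y, of w] wW W(2) by blast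
 thus ?thesis using wW by (intro bexI[of _ w] bexI[of _ "y - w"]) simp_all
qed

lemma dim_oc:
 assumes X: "finite X" and W: "csubspace W" "W \<subseteq> Y" and Y: "csubspace Y" "Y \<subseteq> hil X"
 shows "complex_vector.dim Y = complex_vector.dim W + complex_vector.dim (oc X Y W)"
proof -
 let ?V = "oc X Y W"
 have V: "csubspace ?V" "?V \<subseteq> Y" using oc_subspace[OF Y(1)] by (auto simp: oc_def)
 obtain B where B: "onb X B W" using onb_exists[OF X W(1)] W(2) Y(2) by blast
 obtain C where C: "onb X C ?V" using onb_exists[OF X V(1)] V(2) Y(2) by blast
 have o: "ip X w v = 0" if "w \<in> W" "v \<in> ?V" for w v using that ip_cnj[of X v w] by (simp add: oc_def)
 have u: "onb X (B \<union> C) Y" "B \<inter> C = {}"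
  by (rule onb_Un[OF B C W(2) V(2,1) W(1)]; (rule o oc_split[OF X W Y]; assumption))+
 show ?thesis unfolding onb_dim[OF B] onb_dim[OF C] onb_dim[OF u(1)]
  by (rule card_Un_disjoint[OF onbD(2)[OF B] onbD(2)[OF C] u(2)])
qed

lemma dim_pos:
 assumes X: "finite X" and W: "csubspace W" "W \<subseteq> hil X"
 shows "complex_vector.dim W = 0 \<longleftrightarrow> W = {0}"
proof -
 obtain B where B: "onb X B W" using onb_exists[OF X W] by blast
 have "W = {0}" if "B = {}" using onbD(4)[OF B] that csub_intros(1)[OF W(1)] by auto
 moreover have "B = {}" if "W = {0}"
 proof -
  have "b = 0" if "b \<in> B" for b using onbD(3)[OF B] that \<open>W = {0}\<close> by blast
  thus ?thesis using onbD(5)[OF B] by (force simp: ip_zero1)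
 qed
 ultimately show ?thesis using onb_dim[OF B] onbD(2)[OF B] by auto
qed

section \<open>Gradings\<close>

definition proj :: "('a \<Rightarrow> 'c) \<Rightarrow> 'c \<Rightarrow> ('a \<Rightarrow> complex) \<Rightarrow> 'a \<Rightarrow> complex" where
 "proj wg \<nu> f = (\<lambda>u. if wg u = \<nu> then f u else 0)"

definition wsp :: "('a \<Rightarrow> 'c) \<Rightarrow> ('a \<Rightarrow> complex) set \<Rightarrow> 'c \<Rightarrow> ('a \<Rightarrow> complex) set" where
 "wsp wg Y \<nu> = {f \<in> Y. \<forall>u. f u \<noteq> 0 \<longrightarrow> wg u = \<nu>}"

definition graded :: "('a \<Rightarrow> 'c) \<Rightarrow> ('a \<Rightarrow> complex) set \<Rightarrow> bool" where
 "graded wg Y \<longleftrightarrow> csubspace Y \<and> (\<forall>f\<in>Y. \<forall>\<nu>. proj wg \<nu> f \<in> Y)"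

lemma ip_proj: "ip X (proj wg \<nu> f) g = ip X f (proj wg \<nu> g)" unfolding ip_def proj_def by (rule sum.cong) auto

lemma wsp_subspace: "csubspace Y ==> csubspace (wsp wg Y \<nu>)"
 unfolding complex_vector.subspace_def wsp_def by (auto simp: fn_ops) (metis add_0)+

lemma proj_wsp: "graded wg Y ==> f \<in> Y ==> proj wg \<nu> f \<in> wsp wg Y \<nu>" by (auto simp: graded_def wsp_def proj_def)

lemma proj_id: "f \<in> wsp wg Y \<nu> ==> proj wg \<nu> f = f" by (force simp: wsp_def proj_def fun_eq_iff)

lemma ip_wsp_neq: "f \<in> wsp wg Y \<nu> ==> g \<in> wsp wg Z \<nu>' ==> \<nu> \<noteq> \<nu>' ==> ip X f g = 0"
 unfolding ip_def wsp_def by (intro sum.neutral) auto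

text \<open>Projection to a weight space is self-adjoint, so for a vector of one weight
  orthogonality to the graded \<open>W\<close> can be tested within that weight.\<close>

lemma wsp_oc:
 assumes "graded wg W"
 shows "wsp wg (oc X Y W) \<nu> = oc X (wsp wg Y \<nu>) (wsp wg W \<nu>)"
proof -
 have "ip X f g = 0" if f: "f \<in> wsp wg Y \<nu>" "\<forall>g\<in>wsp wg W \<nu>. ip X f g = 0" and g: "g \<in> W" for f g
 proof -
  have "ip X f g = ip X (proj wg \<nu> f) g" by (simp only: proj_id[OF f(1)])
  also have "\<dots> = ip X f (proj wg \<nu> g)" by (rule ip_proj)
  also have "\<dots> = 0" using f(2) proj_wsp[OF assms g] by blast
  finally show ?thesis .
 qed
 thus ?thesis by (auto simp: oc_def wsp_def)
qed

lemma dim_wsp_oc: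
 assumes X: "finite X" and W: "graded wg W" "W \<subseteq> Y" and Y: "csubspace Y" "Y \<subseteq> hil X"
 shows "complex_vector.dim (wsp wg Y \<nu>) = complex_vector.dim (wsp wg W \<nu>) + complex_vector.dim (wsp wg (oc X Y W) \<nu>)"
proof -
 have "csubspace W" using W(1) by (simp add: graded_def)
 moreover have "wsp wg W \<nu> \<subseteq> wsp wg Y \<nu>" "wsp wg Y \<nu> \<subseteq> hil X" using W Y by (auto simp: wsp_def)
 ultimately show ?thesis unfolding wsp_oc[OF W(1)] using Y(1) by (intro dim_oc[OF X] wsp_subspace)
qed

lemma proj_sum:
 assumes X: "finite X" and f: "f \<in> hil X"
 shows "(\<Sum>\<nu>\<in>wg ` X. proj wg \<nu> f) = f"
proof
 fix u
 show "(\<Sum>\<nu>\<in>wg ` X. proj wg \<nu> f) u = f u" using X f by (cases "u \<in> X") (auto simp: sum_fun_apply proj_def hil_def)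
qed

text \<open>Serves for the folding of weights: a weight space of the fixed point subalgebra is the
  orthogonal sum of the weight spaces of \<open>gl(2n)\<close> whose weights restrict to it.\<close>

lemma dim_wsp_coarse:
 assumes X: "finite X" and Y: "graded wg Y" "Y \<subseteq> hil X" and h: "\<And>u. u \<in> X ==> wg' u = h (wg u)"
 shows "complex_vector.dim (wsp wg' Y \<eta>) = (\<Sum>\<nu> | \<nu> \<in> wg ` X \<and> h \<nu> = \<eta>. complex_vector.dim (wsp wg Y \<nu>))"
proof -
 have Ys: "csubspace Y" using Y(1) by (simp add: graded_def)
 have "\<exists>B. onb X B (wsp wg Y \<nu>)" for \<nu>
  using Y(2) by (intro onb_exists[OF X wsp_subspace[OF Ys]]) (auto simp: wsp_def)
 then obtain B where B: "\<And>\<nu>. onb X (B \<nu>) (wsp wg Y \<nu>)" by metis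
 let ?I = "{\<nu>. \<nu> \<in> wg ` X \<and> h \<nu> = \<eta>}"
 have fI: "finite ?I" using X by auto
 have ne: "b \<notin> B \<nu>'" if "b \<in> B \<nu>" "\<nu> \<noteq> \<nu>'" for b \<nu> \<nu>'
 proof
  assume "b \<in> B \<nu>'"
  hence "ip X b b = 0"
   using that onbD(3)[OF B, of \<nu>] onbD(3)[OF B, of \<nu>'] by (intro ip_wsp_neq[of b wg Y \<nu> b Y \<nu>' X]) auto
  thus False using onbD(5)[OF B that(1,1)] by simp
 qed
 have sub: "wsp wg Y \<nu> \<subseteq> wsp wg' Y \<eta>" if "\<nu> \<in> ?I" for \<nu>
 proof
  fix f assume f: "f \<in> wsp wg Y \<nu>"
  have "wg' u = \<eta>" if u: "f u \<noteq> 0" for u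
  proof -
   have "u \<in> X" using f u Y(2) by (auto simp: wsp_def hil_def)
   thus ?thesis using f u \<open>\<nu> \<in> ?I\<close> h by (auto simp: wsp_def)
  qed
  thus "f \<in> wsp wg' Y \<eta>" using f by (auto simp: wsp_def)
 qed
 have "onb X (\<Union>\<nu>\<in>?I. B \<nu>) (wsp wg' Y \<eta>)" unfolding onb_def
 proof (intro conjI ballI)
  show "orthonormal X (\<Union>\<nu>\<in>?I. B \<nu>)" unfolding orthonormal_def
  proof (intro conjI ballI)
   show "finite (\<Union>\<nu>\<in>?I. B \<nu>)" using fI onbD(2)[OF B] by blast
   fix a b assume "a \<in> (\<Union>\<nu>\<in>?I. B \<nu>)" "b \<in> (\<Union>\<nu>\<in>?I. B \<nu>)"
   then obtain \<nu> \<nu>' where a: "a \<in> B \<nu>" "b \<in> B \<nu>'" by blast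
   show "ip X a b = (if a = b then 1 else 0)"
   proof (cases "\<nu> = \<nu>'")
    case True thus ?thesis using a onbD(5)[OF B] by blast
   next
    case False
    hence "a \<noteq> b" using ne a by blast
    moreover have "ip X a b = 0"
     using a onbD(3)[OF B, of \<nu>] onbD(3)[OF B, of \<nu>'] False by (intro ip_wsp_neq[of a wg Y \<nu> b Y \<nu>' X]) auto
    ultimately show ?thesis by simp
   qed
  qed
  show "(\<Union>\<nu>\<in>?I. B \<nu>) \<subseteq> wsp wg' Y \<eta>" using sub onbD(3)[OF B] by blast
  fix x assume x: "x \<in> wsp wg' Y \<eta>"
  hence xY: "x \<in> Y" and xX: "x \<in> hil X" using Y(2) by (auto simp: wsp_def)
  have p: "(\<Sum>b\<in>B \<nu>. ip X x b *\<^sub>C b) = proj wg \<nu> x" for \<nu>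
  proof -
   have "ip X x b = ip X (proj wg \<nu> x) b" if "b \<in> B \<nu>" for b
   proof -
    have "b \<in> wsp wg Y \<nu>" using that onbD(3)[OF B] by blast
    from proj_id[OF this] show ?thesis by (simp add: ip_proj)
   qed
   hence "(\<Sum>b\<in>B \<nu>. ip X x b *\<^sub>C b) = (\<Sum>b\<in>B \<nu>. ip X (proj wg \<nu> x) b *\<^sub>C b)" by simp
   also have "\<dots> = proj wg \<nu> x" by (rule onbD(4)[OF B proj_wsp[OF Y(1) xY], symmetric])
   finally show ?thesis .
  qed
  have "(\<Sum>b\<in>(\<Union>\<nu>\<in>?I. B \<nu>). ip X x b *\<^sub>C b) = (\<Sum>\<nu>\<in>?I. \<Sum>b\<in>B \<nu>. ip X x b *\<^sub>C b)"
   using ne onbD(2)[OF B] by (intro sum.UNION_disjoint[OF fI]) blast+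
  also have "\<dots> = (\<Sum>\<nu>\<in>?I. proj wg \<nu> x)" by (simp only: p)
  also have "\<dots> = (\<Sum>\<nu>\<in>wg ` X. proj wg \<nu> x)"
  proof (rule sum.mono_neutral_left)
   show "\<forall>\<nu>\<in>wg ` X - ?I. proj wg \<nu> x = 0"
   proof
    fix \<nu> assume nu: "\<nu> \<in> wg ` X - ?I"
    have "proj wg \<nu> x u = 0" for u
    proof (cases "u \<in> X \<and> wg u = \<nu>")
     case True
     hence "wg' u \<noteq> \<eta>" using nu h by auto
     thus ?thesis using x by (auto simp: wsp_def proj_def)
    next
     case False thus ?thesis using xX by (auto simp: hil_def proj_def)
    qed
    thus "proj wg \<nu> x = 0" by (simp add: fun_eq_iff fn_ops)
   qed
  qed (use X in auto)
  also have "\<dots> = x" by (rule proj_sum[OF X xX])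
  finally show "x = (\<Sum>b\<in>(\<Union>\<nu>\<in>?I. B \<nu>). ip X x b *\<^sub>C b)" by simp
 qed
 hence "complex_vector.dim (wsp wg' Y \<eta>) = card (\<Union>\<nu>\<in>?I. B \<nu>)" by (rule onb_dim)
 also have "\<dots> = (\<Sum>\<nu>\<in>?I. card (B \<nu>))" using fI ne onbD(2)[OF B] by (intro card_UN_disjoint) blast+
 also have "\<dots> = (\<Sum>\<nu>\<in>?I. complex_vector.dim (wsp wg Y \<nu>))" by (simp only: onb_dim[OF B])
 finally show ?thesis .
qed

section \<open>Tensor powers of the natural module\<close>

text \<open>A tensor is stored by its coefficients on words, and \<open>eT i j\<close> is a matrix
  unit acting as a derivation. On coefficients the replacement runs backwards: the value at
  \<open>u\<close> is collected from the words in which one \<open>i\<close> of \<open>u\<close> is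
  replaced by \<open>j\<close>.\<close>

fun eT :: "nat \<Rightarrow> nat \<Rightarrow> tens \<Rightarrow> nat list \<Rightarrow> complex" where
 "eT i j f [] = 0"
| "eT i j f (b # u) = (if b = i then f (j # u) else 0) + eT i j (\<lambda>w. f (b # w)) u"

lemma eT_add: "eT i j (\<lambda>w. f w + g w) u = eT i j f u + eT i j g u" by (induction u arbitrary: f g) simp_all

lemma eT_scale: "eT i j (\<lambda>w. c * f w) u = c * eT i j f u"
 by (induction u arbitrary: f) (simp_all add: algebra_simps)

lemma eT_if: "eT i j (\<lambda>w. if P then f w else 0) u = (if P then eT i j f u else 0)"
 using eT_scale[of i j 0] by (cases P) simp_all

lemma eT_lin: "eT i j (\<lambda>w. f w - c * g w) u = eT i j f u - c * eT i j g u"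
 using eT_add[of i j f "\<lambda>w. - c * g w" u] eT_scale[of i j "- c" g u] by simp

text \<open>Contributions from two different positions commute; at a single position the bracket of
  matrix units remains.\<close>

lemma eT_bracket:
 "eT k l (eT i j f) u = eT i j (eT k l f) u + (if i = l then eT k j f u else 0) - (if j = k then eT i l f u else 0)"
proof (induction u arbitrary: f)
 case (Cons b u)
 have 1: "eT p q (eT r s f) (b # u)
   = (if b = p then (if q = r then f (s # u) else 0) + eT r s (\<lambda>w. f (q # w)) u else 0)
    + (if b = r then eT p q (\<lambda>w. f (s # w)) u else 0) + eT p q (eT r s (\<lambda>w. f (b # w))) u" for p q r s
  by (simp add: eT_add eT_if)
 show ?case unfolding 1 using Cons.IH[of "\<lambda>w. f (b # w)"] by auto
qed simp

lemma eT_supp: "eT i j f u \<noteq> 0 ==> \<exists>p<length u. u ! p = i \<and> f (u[p := j]) \<noteq> 0"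
proof (induction u arbitrary: f)
 case (Cons b u)
 show ?case
 proof (cases "b = i \<and> f (j # u) \<noteq> 0")
  case True thus ?thesis by (intro exI[of _ 0]) simp
 next
  case False
  hence "eT i j (\<lambda>w. f (b # w)) u \<noteq> 0" using Cons.prems by (auto split: if_splits)
  then obtain p where "p < length u" "u ! p = i" "f (b # u[p := j]) \<noteq> 0" using Cons.IH by blast
  thus ?thesis by (intro exI[of _ "Suc p"]) simp
 qed
qed simp

lemma eT_diag: "eT i i f u = of_nat (count_list u i) * f u"
 by (induction u arbitrary: f) (simp_all add: algebra_simps)

lemma eps2_sg: "eps2 i j = (-1) ^ i * (-1) ^ j" by (simp add: eps2_def power_add)

lemma sg_sq: "((-1) ^ i * (-1) ^ i :: complex) = 1" by (simp flip: power_mult_distrib)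

lemma eps2_mult: "eps2 i j * eps2 j k = eps2 i k" "eps2 i j = eps2 j i" "eps2 i i = 1" "cnj (eps2 i j) = eps2 i j"
  "eps2 i j * eps2 i j = 1" using sg_sq[of j] sg_sq[of i] by (simp_all add: eps2_sg mult.assoc mult.left_commute)

context folding
begin

lemma eps2_bar: "i < 2*n ==> eps2 (bar i) j = - eps2 i j" "j < 2*n ==> eps2 i (bar j) = - eps2 i j"
proof -
 have "(-1) ^ (bar i) = - ((-1) ^ i :: complex)" if "i < 2*n" for i
 proof -
  have "even (bar i) \<longleftrightarrow> odd i" using that unfolding bar_def by presburger
  thus ?thesis by (cases "even i") simp_all
 qed
 thus "i < 2*n ==> eps2 (bar i) j = - eps2 i j" "j < 2*n ==> eps2 i (bar j) = - eps2 i j" by (simp_all add: eps2_sg)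
qed

definition opT :: "nat \<Rightarrow> nat \<Rightarrow> tens \<Rightarrow> nat list \<Rightarrow> complex" where
 "opT i j f = (\<lambda>u. eT i j f u - of_int fold_coeff * eps2 i j * eT (bar j) (bar i) f u)"

primrec ww :: "nat list \<Rightarrow> nat \<Rightarrow> int" where
 "ww [] = 0"
| "ww (a # u) = hv a + ww u"

definition Wd :: "nat \<Rightarrow> nat list set" where "Wd N = {u. length u = N \<and> set u \<subseteq> {..<2*n}}"

abbreviation TS :: "nat \<Rightarrow> tens set" where "TS N \<equiv> hil (Wd N)"

lemma finite_Wd: "finite (Wd N)"
 unfolding Wd_def using finite_lists_length_eq[of "{..<2*n}" N] by (simp add: conj_commute)

lemma Wd_Suc: "Wd (Suc N) = (\<lambda>(b, u). b # u) ` ({..<2*n} \<times> Wd N)" by (force simp: Wd_def length_Suc_conv)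

lemma sum_Wd_Suc: "(\<Sum>u\<in>Wd (Suc N). g u) = (\<Sum>b<2*n. \<Sum>u\<in>Wd N. g (b # u))"
proof -
 have "inj_on (\<lambda>(b, u). b # u) ({..<2*n} \<times> Wd N)" by (auto intro!: inj_onI)
 from sum.reindex[OF this, of g] show ?thesis
  unfolding Wd_Suc by (simp add: sum.cartesian_product case_prod_unfold comp_def)
qed

lemma ip_Wd_Suc: "ip (Wd (Suc N)) f g = (\<Sum>b<2*n. ip (Wd N) (\<lambda>u. f (b # u)) (\<lambda>u. g (b # u)))"
 unfolding ip_def by (rule sum_Wd_Suc)

lemma eT_adjoint:
 assumes "i < 2*n" "j < 2*n"
 shows "ip (Wd N) (eT i j f) g = ip (Wd N) f (eT j i g)"
proof (induction N arbitrary: f g)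
 case 0
 have "Wd 0 = {[]}" by (auto simp: Wd_def)
 thus ?case by (simp add: ip_def)
next
 case (Suc N)
 have a: "ip X (\<lambda>u. (if P then p u else 0) + q u) r = (if P then ip X p r else 0) + ip X q r"
  "ip X r (\<lambda>u. (if P then p u else 0) + q u) = (if P then ip X r p else 0) + ip X r q"
  for X :: "nat list set" and P p q r by (simp_all add: ip_def algebra_simps sum.distrib)
 show ?case unfolding ip_Wd_Suc using assms by (simp add: a sum.distrib Suc)
qed

text \<open>Two uses: orthogonal complements of submodules are submodules, and norms of lowered
  vectors can be computed from commutators.\<close>

lemma opT_adjoint:
 assumes "i < 2*n" "j < 2*n"
 shows "ip (Wd N) (opT i j f) g = ip (Wd N) f (opT j i g)"
proof -
 have b: "bar i < 2*n" "bar j < 2*n" using assms by (auto simp: bar_def)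
 have o: "opT p q h = eT p q h - (of_int fold_coeff * eps2 p q) *\<^sub>C eT (bar q) (bar p) h" for p q h
  by (simp add: opT_def fun_eq_iff fn_ops)
 show ?thesis unfolding o
  by (simp add: ip_diff1 ip_diff2 ip_scale1 ip_scale2 eT_adjoint assms b eps2_mult(4) eps2_mult(2)[of i j])
qed

lemma opT_add: "opT i j (f + g) = opT i j f + opT i j g"
 and opT_scale: "opT i j (c *\<^sub>C f) = c *\<^sub>C opT i j f" using eT_scale[of _ _ c f] eT_add[of _ _ f g]
 by (simp_all add: opT_def fun_eq_iff fn_ops plus_fun_def scaleC_fun_def scaleC_complex_def algebra_simps)

lemma ww_update: "p < length u ==> ww (u[p := j]) = ww u - hv (u ! p) + hv j"
 by (induction u arbitrary: p) (auto simp: algebra_simps fun_eq_iff fun_ops nth_Cons split: nat.splits)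

lemma hv_bar_sp: "sp ==> i < 2*n ==> hv (bar i) = - hv i"
 by (auto simp: hv_def fold_coeff_def fun_eq_iff fun_ops bar_bar)

lemma opT_supp:
 assumes "opT i j f u \<noteq> 0" "i < 2*n" "j < 2*n"
 shows "\<exists>w. f w \<noteq> 0 \<and> ww u = ww w + root i j \<and> (\<forall>N. w \<in> Wd N \<longrightarrow> u \<in> Wd N)"
proof -
 have *: "\<exists>w. f w \<noteq> 0 \<and> ww u = ww w + root i j \<and> (\<forall>N. w \<in> Wd N \<longrightarrow> u \<in> Wd N)"
  if ne: "eT p q f u \<noteq> 0" and r: "root p q = root i j" and p: "p < 2*n" for p q
 proof -
  obtain t where t: "t < length u" "u ! t = p" "f (u[t := q]) \<noteq> 0" using eT_supp[OF ne] by blast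
  have "u \<in> Wd N" if w: "u[t := q] \<in> Wd N" for N
  proof -
   have "set u \<subseteq> insert p (set (u[t := q]))"
   proof -
    have "u[t := q, t := p] = u" using t(2) by auto
    thus ?thesis using set_update_subset_insert[of "u[t := q]" t p] by simp
   qed
   thus ?thesis using w p by (auto simp: Wd_def)
  qed
  moreover have "ww u = ww (u[t := q]) + root i j"
  proof -
   have "hv p = root i j + hv q" using r by (simp add: root_def diff_eq_eq)
   thus ?thesis using t(2) ww_update[OF t(1), of q] by (simp add: algebra_simps)
  qed
  ultimately show ?thesis using t(3) by blast
 qed
 show ?thesis
 proof (cases "eT i j f u = 0")
  case False thus ?thesis using * assms by blast
 next
  case True
  hence "sp" "eT (bar j) (bar i) f u \<noteq> 0" using assms(1) by (auto simp: opT_def fold_coeff_def split: if_splits)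
  moreover have "root (bar j) (bar i) = root i j" if "sp" using that assms by (simp add: root_def hv_bar_sp)
  moreover have "bar j < 2*n" using assms by (simp add: bar_def)
  ultimately show ?thesis using * by blast
 qed
qed

lemma opT_TS: "i < 2*n ==> j < 2*n ==> f \<in> TS N ==> opT i j f \<in> TS N"
proof -
 assume ij: "i < 2*n" "j < 2*n" and f: "f \<in> TS N"
 have "opT i j f u = 0" if u: "u \<notin> Wd N" for u
 proof (rule ccontr)
  assume "opT i j f u \<noteq> 0"
  then obtain w where w: "f w \<noteq> 0" "\<forall>N. w \<in> Wd N \<longrightarrow> u \<in> Wd N" using opT_supp[OF _ ij] by blast
  hence "w \<notin> Wd N" using u by blast
  thus False using f w(1) by (simp add: hil_def)
 qed
 thus ?thesis by (simp add: hil_def)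
qed

lemma ww_coord: "i < 2*n ==> set u \<subseteq> {..<2*n} ==>
  ww u i = int (count_list u i) - fold_coeff * int (count_list u (bar i))"
 by (induction u) (auto simp: fun_ops hv_def bv_def algebra_simps bar_bar)

lemma ww_lat: "u \<in> Wd N ==> ww u \<in> lat"
proof -
 have "set u \<subseteq> {..<2*n} ==> ww u \<in> lat" by (induction u) (auto intro: lat_add hv_lat lat_zero)
 thus "u \<in> Wd N ==> ww u \<in> lat" by (simp add: Wd_def)
qed

lemma opT_diag: "i < 2*n ==> set u \<subseteq> {..<2*n} ==> opT i i f u = of_int (ww u i) * f u"
 by (simp add: opT_def eT_diag eps2_mult ww_coord algebra_simps)

text \<open>After folding this is a sum of four brackets of matrix units, whose signs combine
  because \<open>eps2\<close> is multiplicative along a chain of indices and changes sign under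
  \<open>bar\<close>.\<close>

lemma opT_bracket:
 assumes b: "k < 2*n" "l < 2*n" "i < 2*n" "j < 2*n"
 shows "opT k l (opT i j f) = opT i j (opT k l f) + bracket_value opT k l i j f"
proof (cases sp)
 case False
 thus ?thesis by (simp add: opT_def fun_eq_iff fn_ops bracket_value_def fold_coeff_def eT_bracket[of k l])
next
 case True
 hence s: "of_int fold_coeff = (1::complex)" by (simp add: fold_coeff_def)
 have o: "opT p q (opT r t f) u = eT p q (eT r t f) u - eps2 r t * eT p q (eT (bar t) (bar r) f) u
   - eps2 p q * (eT (bar q) (bar p) (eT r t f) u - eps2 r t * eT (bar q) (bar p) (eT (bar t) (bar r) f) u)" for p q r t u
  unfolding opT_def s by (simp add: eT_lin)
 note B = eT_bracket[of k l i j f] eT_bracket[of k l "bar j" "bar i" f] eT_bracket[of "bar l" "bar k" i j f]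
  eT_bracket[of "bar l" "bar k" "bar j" "bar i" f]
 have iff: "bar j = l \<longleftrightarrow> j = bar l" "bar i = k \<longleftrightarrow> i = bar k" "bar j = bar k \<longleftrightarrow> j = k" "bar i = bar l \<longleftrightarrow> i = l"
  using b by (auto simp: bar_def)
 have c: "j = k ==> eps2 k l * eps2 i j = eps2 i l" "i = l ==> eps2 k l * eps2 i j = eps2 k j"
  "i = bar k ==> eps2 k l * eps2 (bar l) j = eps2 i j" "j = bar l ==> eps2 k l * eps2 i (bar k) = eps2 i j"
  using b eps2_mult(1)[of i k l] eps2_mult(1)[of k l j] eps2_mult(1)[of i k l]
  by (simp_all add: eps2_bar mult.commute eps2_mult(2)[of k i])
 have bb: "bar (bar k) = k" "bar (bar l) = l" using b by (auto simp: bar_def)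
 have "opT k l (opT i j f) u = opT i j (opT k l f) u + bracket_value opT k l i j f u" for u
 proof -
  have v: "bracket_value opT k l i j f u
    = (if i = l then eT k j f u - eps2 k j * eT (bar j) (bar k) f u else 0)
     - (if j = k then eT i l f u - eps2 i l * eT (bar l) (bar i) f u else 0)
     - eps2 k l * ((if i = bar k then eT (bar l) j f u - eps2 (bar l) j * eT (bar j) l f u else 0)
       - (if j = bar l then eT i (bar k) f u - eps2 i (bar k) * eT k (bar i) f u else 0))"
   using True by (simp add: bracket_value_def opT_def s fn_ops bb)
  have d: "opT k l (opT i j f) u - opT i j (opT k l f) u
    = ((if i = l then eT k j f u else 0) - (if j = k then eT i l f u else 0))
     - eps2 i j * ((if j = bar l then eT k (bar i) f u else 0) - (if i = bar k then eT (bar j) l f u else 0))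
     - eps2 k l * ((if i = bar k then eT (bar l) j f u else 0) - (if j = bar l then eT i (bar k) f u else 0))
     + (eps2 k l * eps2 i j) * ((if j = k then eT (bar l) (bar i) f u else 0) - (if i = l then eT (bar j) (bar k) f u else 0))"
   unfolding o B iff by (simp add: algebra_simps)
  have e: "eps2 k l * ((if i = bar k then x - eps2 (bar l) j * y else 0) - (if j = bar l then x' - eps2 i (bar k) * y' else 0))
    = eps2 k l * ((if i = bar k then x else 0) - (if j = bar l then x' else 0))
     - eps2 i j * ((if i = bar k then y else 0) - (if j = bar l then y' else 0))" for x y x' y'
   using c(3,4) by (cases "i = bar k"; cases "j = bar l") (simp_all add: algebra_simps flip: mult.assoc)
  have e2: "(eps2 k l * eps2 i j) * ((if j = k then x else 0) - (if i = l then y else 0))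
    = (if j = k then eps2 i l * x else 0) - (if i = l then eps2 k j * y else 0)" for x y
   using c(1,2) by (cases "j = k"; cases "i = l") (simp_all add: algebra_simps)
  have e3: "(if P then x - y else 0) = (if P then x else 0) - (if P then y else 0)" for P and x y :: complex
   by simp
  show ?thesis
   using d unfolding v e e2 e3[of "i = l"] e3[of "j = k"] by (simp only: diff_eq_eq) (simp only: algebra_simps)
 qed
 thus ?thesis by (simp add: fun_eq_iff fn_ops)
qed

lemma opmod_TS: "opmod (TS N) opT" unfolding opmod_def
proof (intro conjI allI impI ballI hil_subspace opT_TS opT_add opT_scale opT_bracket)
 fix i j v assume b: "i < 2*n" "j < 2*n" and s: "sp"
 have bb: "bar (bar i) = i" "bar (bar j) = j" using b by (auto simp: bar_def)
 have "opT (bar j) (bar i) v u = - (eps2 i j * opT i j v u)" for u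
 proof -
  have "eps2 (bar j) (bar i) = eps2 i j" using b by (simp add: eps2_bar eps2_mult(2)[of j i] bar_less')
  thus ?thesis using s eps2_mult(5)[of i j]
   by (simp add: opT_def bb fold_coeff_def algebra_simps flip: mult.assoc)
 qed
 thus "opT (bar j) (bar i) v = - (eps2 i j *\<^sub>C opT i j v)" by (simp add: fun_eq_iff fn_ops)
qed

lemma opT_zero: "opT i j 0 = 0" using opT_scale[of i j 0 0] by simp

lemma lat_eqI: "\<xi> \<in> lat ==> \<eta> \<in> lat ==> (\<And>i. i < 2*n ==> \<xi> i = \<eta> i) ==> \<xi> = \<eta>"
 by (rule ext) (metis (mono_tags, lifting) lat_def mem_Collect_eq not_less)

text \<open>Interpolation: the component of another weight \<eta> is removed by the operator
  \<open>(opT i i - \<eta> i) / (\<nu> i - \<eta> i)\<close> for a coordinate \<open>i\<close> in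
  which \<eta> and \<nu> differ, and this operator fixes the component of weight \<nu>.\<close>

lemma graded_opsub:
 assumes W: "opsub opT W" "W \<subseteq> TS N"
 shows "graded ww W" unfolding graded_def
proof (intro conjI ballI allI)
 show sW: "csubspace W" using W(1) by (simp add: opsub_def)
 fix f \<nu> assume f: "f \<in> W"
 have key: "\<exists>g\<in>W. \<forall>u. (ww u = \<nu> \<longrightarrow> g u = f u) \<and> (ww u \<in> V \<longrightarrow> g u = 0) \<and> (f u = 0 \<longrightarrow> g u = 0)"
  if "finite V" "V \<subseteq> ww ` Wd N - {\<nu>}" and nu: "\<nu> \<in> ww ` Wd N" for V using that(1,2)
 proof (induction V rule: finite_induct)
  case empty then show ?case using f by auto
 next
  case (insert \<eta> V)
  then obtain g where g: "g \<in> W" "\<And>u. ww u = \<nu> ==> g u = f u" "\<And>u. ww u \<in> V ==> g u = 0" "\<And>u. f u = 0 ==> g u = 0"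
   by auto
  have "\<eta> \<noteq> \<nu>" "\<eta> \<in> lat" "\<nu> \<in> lat" using insert.prems nu ww_lat by auto
  then obtain i where i: "i < 2*n" "\<eta> i \<noteq> \<nu> i" using lat_eqI by blast
  define h where "h = (1 / of_int (\<nu> i - \<eta> i)) *\<^sub>C (opT i i g - of_int (\<eta> i) *\<^sub>C g)"
  have hW: "h \<in> W" unfolding h_def
   using W(1) g(1) i(1) by (intro csub_intros(3,4)[OF sW]) (simp_all add: opsub_def csub_intros(4)[OF sW])
  have hu: "h u = of_int (ww u i - \<eta> i) / of_int (\<nu> i - \<eta> i) * g u" for u
  proof (cases "u \<in> Wd N")
   case True
   thus ?thesis using opT_diag[OF i(1), of u g] by (simp add: h_def fn_ops Wd_def algebra_simps diff_divide_distrib)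
  next
   case False
   hence "h u = 0" "g u = 0" using hW g(1) W(2) by (auto simp: hil_def)
   thus ?thesis by simp
  qed
  have "of_int (\<nu> i - \<eta> i) \<noteq> (0::complex)" using i(2) by simp
  hence "\<forall>u. (ww u = \<nu> \<longrightarrow> h u = f u) \<and> (ww u \<in> insert \<eta> V \<longrightarrow> h u = 0) \<and> (f u = 0 \<longrightarrow> h u = 0)"
   using g(2,3,4) by (auto simp: hu)
  thus ?case using hW by blast
 qed
 show "proj ww \<nu> f \<in> W"
 proof (cases "\<nu> \<in> ww ` Wd N")
  case True
  then obtain g where g: "g \<in> W" "\<And>u. ww u = \<nu> ==> g u = f u" "\<And>u. ww u \<in> ww ` Wd N - {\<nu>} ==> g u = 0" "\<And>u. f u = 0 ==> g u = 0"
   using key[of "ww ` Wd N - {\<nu>}"] finite_Wd True by auto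
  have "proj ww \<nu> f u = g u" for u
  proof (cases "u \<in> Wd N")
   case True thus ?thesis using g(2,3)[of u] by (auto simp: proj_def)
  next
   case False
   hence "f u = 0" using f W(2) by (auto simp: hil_def)
   thus ?thesis using g(4) by (simp add: proj_def)
  qed
  hence "proj ww \<nu> f = g" by (rule ext)
  thus ?thesis using g(1) by simp
 next
  case False
  have "proj ww \<nu> f u = 0" for u using False f W(2) by (cases "u \<in> Wd N") (auto simp: proj_def hil_def)
  hence "proj ww \<nu> f = 0" by (simp add: fun_eq_iff fn_ops)
  thus ?thesis using csub_intros(1)[OF sW] by simp
 qed
qed

lemma opT_wsp:
 assumes "opsub opT W" "f \<in> wsp ww W \<nu>" "i < 2*n" "j < 2*n"
 shows "opT i j f \<in> wsp ww W (\<nu> + root i j)" using assms opT_supp[of i j f] unfolding wsp_def opsub_def by blast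

lemma opT_diag_wsp:
 assumes "W \<subseteq> TS N" "f \<in> wsp ww W \<nu>" "i < 2*n"
 shows "opT i i f = of_int (\<nu> i) *\<^sub>C f"
proof
 fix u
 show "opT i i f u = (of_int (\<nu> i) *\<^sub>C f) u"
 proof (cases "f u = 0")
  case True
  have ff: "f \<in> TS N" using assms by (auto simp: wsp_def)
  show ?thesis
  proof (cases "u \<in> Wd N")
   case t: True
   show ?thesis using opT_diag[OF assms(3), of u f] t by (simp add: True fn_ops Wd_def)
  next
   case False
   thus ?thesis using opT_TS[OF assms(3,3) ff] True by (simp add: hil_def fn_ops)
  qed
 next
  case False
  hence "u \<in> Wd N" "ww u = \<nu>" using assms by (auto simp: wsp_def hil_def)
  thus ?thesis using opT_diag[OF assms(3), of u f] by (simp add: fn_ops Wd_def)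
 qed
qed

lemma opsub_oc:
 assumes "opsub opT Y" "opsub opT W"
 shows "opsub opT (oc (Wd N) Y W)"
 using assms oc_subspace[of Y "Wd N" W] unfolding opsub_def by (auto simp: oc_def opT_adjoint)

end

lemma sum_square_split:
 fixes g :: "nat \<Rightarrow> nat \<Rightarrow> 'a::comm_monoid_add"
 shows "(\<Sum>i<M. \<Sum>j<M. g i j) = (\<Sum>i<M. g i i) + (\<Sum>(i, j) | i < j \<and> j < M. g i j + g j i)"
proof (induction M)
 case (Suc M)
 have "{(i, j). i < j \<and> j < Suc M} = {(i, j). i < j \<and> j < M} \<union> (\<lambda>i. (i, M)) ` {..<M}" by (auto simp: less_Suc_eq)
 moreover have "finite {(i, j). i < j \<and> j < M}" by (rule finite_subset[of _ "{..<M} \<times> {..<M}"]) auto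
 ultimately have "(\<Sum>(i, j) | i < j \<and> j < Suc M. g i j + g j i)
   = (\<Sum>(i, j) | i < j \<and> j < M. g i j + g j i) + (\<Sum>i<M. g i M + g M i)"
  by (simp only:, subst sum.union_disjoint) (auto simp: sum.reindex inj_on_def)
 thus ?case using Suc by (simp add: sum.distrib ac_simps)
qed simp

lemma ip_pos_Re:
 assumes "finite X" "f \<in> hil X" "f \<noteq> 0"
 shows "0 < Re (ip X f f)"
proof -
 have "ip X f f \<noteq> 0" using ip_pos[OF assms(1,2)] assms(3) by blast
 hence "Re (ip X f f) \<noteq> 0" using ip_self_Re(1)[of X f] by (simp add: complex_eq_iff)
 thus ?thesis using ip_self_Re(2)[of X f] by simp
qed

lemma nonzero_in_subspace: "csubspace W ==> W \<noteq> {0} ==> \<exists>f\<in>W. f \<noteq> 0" using complex_vector.subspace_0[of W] by auto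

lemma nonzero_value: "f \<noteq> 0 ==> \<exists>u. f u \<noteq> 0" for f :: "'a \<Rightarrow> complex" by (rule ccontr) (simp add: fun_eq_iff fn_ops)

context folding
begin

section \<open>The Casimir operator\<close>

lemma opmod_sum:
 assumes M: "opmod S F" and ij: "i < 2*n" "j < 2*n" and g: "\<And>a. a \<in> A ==> g a \<in> S"
 shows "F i j (\<Sum>a\<in>A. g a) = (\<Sum>a\<in>A. F i j (g a))" using g
proof (induction A rule: infinite_finite_induct)
 case (insert a A)
 have "(\<Sum>a\<in>A. g a) \<in> S" using insert by (intro csub_intros(6) opmodD(1)[OF M]) auto
 thus ?case using insert by (simp add: opmodD(3)[OF M ij])
qed (simp_all add: opmod_zero[OF M ij])

text \<open>After folding this is still a multiple of the Casimir element of the trace form: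
  operators of short roots are counted twice, and for a long root the operator is itself a doubled
  matrix unit.\<close>

definition cas :: "'v ops \<Rightarrow> 'v \<Rightarrow> 'v::complex_vector" where
 "cas F x = (\<Sum>i<2*n. \<Sum>j<2*n. F i j (F j i x))"

lemma cas_closed: "opmod S F ==> x \<in> S ==> cas F x \<in> S"
 unfolding cas_def by (intro csub_intros(6) opmodD(1)) (auto intro: opmodD(2))

text \<open>Moving \<open>F k l\<close> through the two factors leaves two sums of brackets, which
  cancel once the summation indices are collected into \<open>P\<close> and
  \<open>R\<close>.\<close>

lemma cas_commute:
 assumes M: "opmod S F" and kl: "k < 2*n" "l < 2*n" and x: "x \<in> S"
 shows "F k l (cas F x) = cas F (F k l x)"
proof -
 note cl = opmodD(2)[OF M]
 define c where "c = (if sp then eps2 k l else 0)"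
 have bv: "bracket_value F k l i j y = (if i = l then F k j y else 0) - (if j = k then F i l y else 0)
   - c *\<^sub>C ((if i = bar k then F (bar l) j y else 0) - (if j = bar l then F i (bar k) y else 0))" for i j y
  by (simp add: bracket_value_def c_def)
 define P where "P a b = (\<Sum>j<2*n. F a j (F j b x))" for a b
 define R where "R b a = (\<Sum>i<2*n. F i b (F a i x))" for a b
 have b1: "bracket_value F k l i j (F j i x) = (if i = l then F k j (F j l x) else 0) - (if j = k then F i l (F k i x) else 0)
   - c *\<^sub>C ((if i = bar k then F (bar l) j (F j (bar k) x) else 0) - (if j = bar l then F i (bar k) (F (bar l) i x) else 0))" for i j
  unfolding bv by (auto cong: if_cong)
 have b2: "F i j (bracket_value F k l j i x) = (if j = l then F i l (F k i x) else 0) - (if i = k then F k j (F j l x) else 0)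
   - c *\<^sub>C ((if j = bar k then F i (bar k) (F (bar l) i x) else 0) - (if i = bar l then F (bar l) j (F j (bar k) x) else 0))"
  if ij: "i < 2*n" "j < 2*n" for i j
 proof -
  have d: "F i j (y - z) = F i j y - F i j z" if "y \<in> S" "z \<in> S" for y z
   using opmodD(3)[OF M ij csub_intros(3)[OF opmodD(1)[OF M] that] that(2)] by simp
  have e: "F i j (if Q then y else 0) = (if Q then F i j y else 0)" for Q y by (simp add: opmod_zero[OF M ij])
  have m: "(if Q then y else 0) \<in> S" if "y \<in> S" for Q y using that csub_intros(1)[OF opmodD(1)[OF M]] by simp
  have f: "F k i x \<in> S" "F j l x \<in> S" "F (bar l) i x \<in> S" "F j (bar k) x \<in> S" "F k i x \<in> S"
   using ij kl x by (auto intro!: cl)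
  note sI = csub_intros(3,4)[OF opmodD(1)[OF M]]
  have "F i j (bracket_value F k l j i x) = (if j = l then F i j (F k i x) else 0) - (if i = k then F i j (F j l x) else 0)
   - c *\<^sub>C ((if j = bar k then F i j (F (bar l) i x) else 0) - (if i = bar l then F i j (F j (bar k) x) else 0))"
   unfolding bv by (simp only: d m f sI e opmodD(4)[OF M ij])
  thus ?thesis by (auto cong: if_cong)
 qed
 have "F k l (F i j (F j i x)) = F i j (F j i (F k l x)) + (F i j (bracket_value F k l j i x) + bracket_value F k l i j (F j i x))"
  if ij: "i < 2*n" "j < 2*n" for i j
 proof -
  have "F k l (F i j (F j i x)) = F i j (F k l (F j i x)) + bracket_value F k l i j (F j i x)"
   by (rule opmodD(5)[OF M kl ij cl[OF ij(2,1) x]])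
  also have "F k l (F j i x) = F j i (F k l x) + bracket_value F k l j i x" by (rule opmodD(5)[OF M kl ij(2,1) x])
  also have "F i j \<dots> = F i j (F j i (F k l x)) + F i j (bracket_value F k l j i x)"
   by (intro opmodD(3)[OF M ij] cl[OF ij(2,1)] cl[OF kl x] bracket_value_closed[where F = F and v = x and Q = S, OF opmodD(1)[OF M] cl[OF _ _ x] kl ij(2,1)])
  finally show ?thesis by (simp only: add.assoc)
 qed
 note key = this
 have s1: "(\<Sum>i<2*n. \<Sum>j<2*n. if i = a then g j else 0) = sum g {..<2*n}" if "a < 2*n" for a and g :: "nat \<Rightarrow> 'a"
 proof -
  have "(\<Sum>i<2*n. \<Sum>j<2*n. if i = a then g j else 0) = (\<Sum>i<2*n. if i = a then sum g {..<2*n} else 0)"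
   by (rule sum.cong) auto
  thus ?thesis using that by simp
 qed
 have s2: "(\<Sum>i<2*n. \<Sum>j<2*n. if j = a then g i else 0) = sum g {..<2*n}" if "a < 2*n" for a and g :: "nat \<Rightarrow> 'a"
  using that by simp
 have "F k l (cas F x) = (\<Sum>i<2*n. \<Sum>j<2*n. F k l (F i j (F j i x)))" unfolding cas_def
  by (subst opmod_sum[OF M kl]) (auto intro!: csub_intros(6)[OF opmodD(1)[OF M]] sum.cong opmod_sum[OF M kl] cl x)
 also have "\<dots> = (\<Sum>i<2*n. \<Sum>j<2*n. F i j (F j i (F k l x)) + (F i j (bracket_value F k l j i x) + bracket_value F k l i j (F j i x)))"
  by (rule sum.cong[OF refl], rule sum.cong[OF refl], rule key) simp_all
 also have "\<dots> = cas F (F k l x) + ((\<Sum>i<2*n. \<Sum>j<2*n. F i j (bracket_value F k l j i x)) + (\<Sum>i<2*n. \<Sum>j<2*n. bracket_value F k l i j (F j i x)))"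
  unfolding cas_def by (simp only: sum.distrib)
 also have "(\<Sum>i<2*n. \<Sum>j<2*n. bracket_value F k l i j (F j i x)) = P k l - R l k - c *\<^sub>C (P (bar l) (bar k) - R (bar k) (bar l))"
 proof -
  show ?thesis unfolding b1 P_def R_def
   by (simp only: sum_subtractf s1 s2 kl bar_less' flip: complex_vector.scale_sum_right)
 qed
 also have "(\<Sum>i<2*n. \<Sum>j<2*n. F i j (bracket_value F k l j i x))
   = R l k - P k l - c *\<^sub>C (R (bar k) (bar l) - P (bar l) (bar k))"
 proof -
  have "(\<Sum>i<2*n. \<Sum>j<2*n. F i j (bracket_value F k l j i x))
   = (\<Sum>i<2*n. \<Sum>j<2*n. (if j = l then F i l (F k i x) else 0) - (if i = k then F k j (F j l x) else 0)
   - c *\<^sub>C ((if j = bar k then F i (bar k) (F (bar l) i x) else 0) - (if i = bar l then F (bar l) j (F j (bar k) x) else 0)))"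
   by (rule sum.cong[OF refl], rule sum.cong[OF refl], rule b2) simp_all
  thus ?thesis unfolding P_def R_def
   by (simp only: sum_subtractf s1 s2 kl bar_less' flip: complex_vector.scale_sum_right)
 qed
 finally show ?thesis by (simp add: algebra_simps complex_vector.scale_right_diff_distrib)
qed

section \<open>The fibres of the root map\<close>

lemma hv_pos: "1 \<le> hv a x ==> x = a" by (auto simp: hv_def bv_def fold_coeff_def split: if_splits)

lemma hv_neg: "hv a x \<le> -1 ==> sp \<and> x = bar a" by (auto simp: hv_def bv_def fold_coeff_def split: if_splits)

lemma hv_self: "a < 2*n ==> hv a a = 1" "x < 2*n ==> a < 2*n ==> x \<noteq> a ==> hv a x \<le> 0"
 using bar_neq[of a] not_sym[OF bar_neq[of a]] by (auto simp: hv_def bv_def fold_coeff_def)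

text \<open>A positive coordinate of a root reveals the first index and a negative one the second,
  up to mirroring. This tells which pairs belong to a root when the Casimir sum is sorted by
  roots.\<close>

lemma root_eq_iff:
 assumes ij: "i < j" "j < 2*n" and ab: "a < b" "b < 2*n"
 shows "root i j = root a b \<longleftrightarrow> i = a \<and> j = b \<or> sp \<and> i = bar b \<and> j = bar a"
proof
 assume e: "root i j = root a b"
 have l: "i < 2*n" "a < 2*n" using ij ab by auto
 have ev: "hv i x - hv j x = hv a x - hv b x" for x using fun_cong[OF e, of x] by (simp add: root_def fun_ops)
 have "hv a i - hv b i \<ge> 1" using ev[of i] hv_self(1)[OF l(1)] hv_self(2)[OF l(1) ij(2)] ij by auto
 hence "1 \<le> hv a i \<or> hv b i \<le> -1" by linarith
 hence i: "i = a \<or> sp \<and> i = bar b" using hv_pos[of a i] hv_neg[of b i] by auto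
 have "hv a j - hv b j \<le> -1" using ev[of j] hv_self(1)[OF ij(2)] hv_self(2)[OF ij(2) l(1)] ij by auto
 hence "hv a j \<le> -1 \<or> 1 \<le> hv b j" by linarith
 hence j: "j = b \<or> sp \<and> j = bar a" using hv_pos[of b j] hv_neg[of a j] by auto
 have k: "a = bar b" if "sp" "hv a = - hv b"
 proof -
  have "hv (bar b) a = 1" using that hv_self(1)[OF l(2)] hv_bar_sp[OF _ ab(2)] by simp
  thus ?thesis using hv_pos[of "bar b" a] by simp
 qed
 show "i = a \<and> j = b \<or> sp \<and> i = bar b \<and> j = bar a"
 proof (rule ccontr)
  assume ne: "\<not> ?thesis"
  then consider "i = a" "sp" "j = bar a" | "sp" "i = bar b" "j = b" using i j by blast
  hence "sp \<and> a = bar b"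
  proof cases
   case 1
   have "hv a = - hv b" using e 1 hv_bar_sp[OF _ l(2)] by (simp add: root_def)
   thus ?thesis using k 1 by blast
  next
   case 2
   have "hv a = - hv b" using e 2 hv_bar_sp[OF _ ab(2)] by (simp add: root_def eq_neg_iff_add_eq_0 add.commute)
   thus ?thesis using k 2 by blast
  qed
  moreover have "bar a = b" if "a = bar b" using that ab by simp
  ultimately show False using ne i j by metis
 qed
next
 assume "i = a \<and> j = b \<or> sp \<and> i = bar b \<and> j = bar a"
 thus "root i j = root a b" using root_bar[of a b] ab by auto
qed

section \<open>Characters of irreducible submodules of a tensor power\<close>

definition wm :: "tens set \<Rightarrow> ivec \<Rightarrow> nat" where
 "wm W \<nu> = complex_vector.dim (wsp ww W \<nu>)"

lemma wsp_TS: "W \<subseteq> TS N ==> wsp ww W \<nu> \<subseteq> TS N" by (auto simp: wsp_def)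

lemma wm_zero_iff: "csubspace W ==> W \<subseteq> TS N ==> wm W \<nu> = 0 \<longleftrightarrow> wsp ww W \<nu> = {0}"
 unfolding wm_def by (rule dim_pos[OF finite_Wd wsp_subspace wsp_TS])

lemma wm_nonzeroD:
 assumes "csubspace W" "W \<subseteq> TS N" "wm W \<nu> \<noteq> 0"
 obtains f u where "f \<in> wsp ww W \<nu>" "f \<noteq> 0" "u \<in> Wd N" "ww u = \<nu>" "f u \<noteq> 0"
proof -
 have "wsp ww W \<nu> \<noteq> {0}" using wm_zero_iff[OF assms(1,2), of \<nu>] assms(3) by simp
 then obtain f where f: "f \<in> wsp ww W \<nu>" "f \<noteq> 0"
  using nonzero_in_subspace[OF wsp_subspace[OF assms(1), of ww \<nu>]] by blast
 obtain u where u: "f u \<noteq> 0" using nonzero_value[OF f(2)] by blast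
 have "f \<in> TS N" using f(1) wsp_TS[OF assms(2)] by blast
 hence "u \<in> Wd N" using u unfolding hil_def by blast
 moreover have "ww u = \<nu>" using f(1) u by (simp add: wsp_def)
 ultimately show thesis by (rule that[OF f _ _ u])
qed

lemma wm_nonzero_wt: "csubspace W ==> W \<subseteq> TS N ==> wm W \<nu> \<noteq> 0 ==> \<nu> \<in> ww ` Wd N" by (erule (2) wm_nonzeroD) blast

lemma wm_nonzeroI:
 assumes "csubspace W" "W \<subseteq> TS N" "f \<in> wsp ww W \<nu>" "f \<noteq> 0"
 shows "wm W \<nu> \<noteq> 0" using wm_zero_iff[OF assms(1,2), of \<nu>] assms(3,4) by auto

lemma ww_sum: "u \<in> Wd N ==> (\<Sum>i<2*n. ww u i) = (1 - fold_coeff) * int N"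
proof -
 have hvs: "(\<Sum>k<2*n. hv a k) = 1 - fold_coeff" if "a < 2*n" for a
  using sum_bv[of a "\<lambda>_. 1"] sum_bv[of "bar a" "\<lambda>_. 1"] that
  by (simp add: hv_def sum_subtractf flip: sum_distrib_left)
 have "set u \<subseteq> {..<2*n} ==> (\<Sum>i<2*n. ww u i) = (1 - fold_coeff) * int (length u)"
  by (induction u) (simp_all add: fun_ops sum.distrib hvs ring_distribs)
 thus "u \<in> Wd N ==> ?thesis" by (auto simp: Wd_def)
qed

text \<open>For a long root the operators are doubled matrix units, which makes the bracket of
  opposite ones twice as large. A short folded root comes from two index pairs instead, so the
  totals agree.\<close>

definition kap :: "nat \<Rightarrow> nat \<Rightarrow> complex" where "kap i j = (if sp \<and> j = bar i then 2 else 1)"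

lemma bracket_opposite:
 assumes W: "W \<subseteq> TS N" and f: "f \<in> wsp ww W \<nu>" and ij: "i < 2*n" "j < 2*n" "i \<noteq> j"
 shows "opT i j (opT j i f) = opT j i (opT i j f) + (kap i j * of_int (\<nu> i - \<nu> j)) *\<^sub>C f"
proof -
 have d: "opT i i f = of_int (\<nu> i) *\<^sub>C f" "opT j j f = of_int (\<nu> j) *\<^sub>C f"
  by (rule opT_diag_wsp[OF W f ij(1)], rule opT_diag_wsp[OF W f ij(2)])
 have iff: "i = bar j \<longleftrightarrow> j = bar i" using bar_eq_swap[OF ij(1,2)] by auto
 have "bracket_value opT i j j i f = (kap i j * of_int (\<nu> i - \<nu> j)) *\<^sub>C f"
 proof (cases "sp \<and> j = bar i")
  case True
  have bi: "bar (bar i) = i" using ij by simp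
  have k: "kap i j = 2" using True by (simp add: kap_def)
  have e: "eps2 i j = -1" using True ij eps2_bar(2)[of i i] by (simp add: eps2_mult)
  have "bracket_value opT i j j i f = opT i i f - opT j j f + (opT i i f - opT j j f)"
   using True unfolding bracket_value_def e iff by (simp add: bi)
  also have "\<dots> = (kap i j * of_int (\<nu> i - \<nu> j)) *\<^sub>C f"
   unfolding d k by (simp add: kap_def fun_eq_iff fn_ops algebra_simps)
  finally show ?thesis .
 next
  case False
  hence k: "kap i j = 1" by (auto simp: kap_def)
  have "bracket_value opT i j j i f = opT i i f - opT j j f" using False unfolding bracket_value_def iff by auto
  also have "\<dots> = (kap i j * of_int (\<nu> i - \<nu> j)) *\<^sub>C f"
   unfolding d k by (simp add: kap_def fun_eq_iff fn_ops algebra_simps)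
  finally show ?thesis .
 qed
 thus ?thesis using opT_bracket[OF ij(1,2,2,1)] by simp
qed

lemma ip_op_norm:
 assumes "i < 2*n" "j < 2*n"
 shows "ip (Wd N) (opT i j (opT j i f)) f = ip (Wd N) (opT j i f) (opT j i f)" by (rule opT_adjoint[OF assms])

context
 fixes N W
 assumes irr: "opirr W opT" and WN: "W \<subseteq> TS N"
begin

lemma W_mod: "opmod W opT" and W_sub: "opsub opT W" and W_space: "csubspace W" and W_graded: "graded ww W"
proof -
 show m: "opmod W opT" using irr by (simp add: opirr_def)
 show s: "opsub opT W" using opmodD(1,2)[OF m] by (auto simp: opsub_def)
 show "csubspace W" using opmodD(1)[OF m] .
 show "graded ww W" by (rule graded_opsub[OF s WN])
qed

text \<open>A weight of maximal height cannot be raised. It is dominant because the squared norm of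
  a lowered vector is, up to a positive factor, the difference of two neighbouring coordinates of
  the weight.\<close>

lemma hwv_exists: "\<exists>\<kappa> v. \<kappa> \<in> lat \<and> wdec \<kappa> \<and> v \<noteq> 0 \<and> v \<in> wsp ww W \<kappa> \<and> hwv W opT \<kappa> v"
proof -
 define V where "V = {\<nu> \<in> ww ` Wd N. wm W \<nu> \<noteq> 0}"
 have fV: "finite V" unfolding V_def using finite_Wd by simp
 have "V \<noteq> {}"
 proof -
  obtain f where f: "f \<in> W" "f \<noteq> 0" using irr csub_intros(1)[OF W_space] unfolding opirr_def by blast
  then obtain u where u: "f u \<noteq> 0" using nonzero_value by blast
  hence uN: "u \<in> Wd N" using f WN by (auto simp: hil_def)
  have "proj ww (ww u) f \<in> wsp ww W (ww u)" by (rule proj_wsp[OF W_graded f(1)])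
  moreover have "proj ww (ww u) f \<noteq> 0" using u by (auto simp: proj_def fun_eq_iff fn_ops)
  ultimately have "wm W (ww u) \<noteq> 0" by (rule wm_nonzeroI[OF W_space WN])
  thus ?thesis using uN by (auto simp: V_def)
 qed
 define M where "M = Max ((\<lambda>\<nu>. ipr \<nu> delta) ` V)"
 have "M \<in> (\<lambda>\<nu>. ipr \<nu> delta) ` V" unfolding M_def using fV \<open>V \<noteq> {}\<close> by (intro Max_in) auto
 then obtain \<kappa> where k: "\<kappa> \<in> V" "ipr \<kappa> delta = M" by auto
 have mx: "ipr \<nu> delta \<le> ipr \<kappa> delta" if "\<nu> \<in> V" for \<nu> unfolding k(2) M_def using fV that by (intro Max_ge) auto
 have kl: "\<kappa> \<in> lat" using k ww_lat by (auto simp: V_def)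
 have "wm W \<kappa> \<noteq> 0" using k by (simp add: V_def)
 from wm_nonzeroD[OF W_space WN this] obtain v where v: "v \<in> wsp ww W \<kappa>" "v \<noteq> 0" by metis
 have vW: "v \<in> W" using v by (simp add: wsp_def)
 have kill: "opT i j v = 0" if "i < j" "j < 2*n" for i j
 proof (rule ccontr)
  assume ne: "opT i j v \<noteq> 0"
  have w: "opT i j v \<in> wsp ww W (\<kappa> + root i j)" using that by (intro opT_wsp[OF W_sub v(1)]) auto
  hence m0: "wm W (\<kappa> + root i j) \<noteq> 0" by (intro wm_nonzeroI[OF W_space WN w ne])
  hence "\<kappa> + root i j \<in> ww ` Wd N" by (rule wm_nonzero_wt[OF W_space WN])
  hence "\<kappa> + root i j \<in> V" using m0 by (simp add: V_def)
  hence "ipr (root i j) delta \<le> 0" using mx[of "\<kappa> + root i j"] by (simp add: ipr_add)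
  moreover have "0 < ipr (root i j) delta" by (rule ipr_root_pos[OF rootsI[OF that] delta_lat sdec_delta])
  ultimately show False by simp
 qed
 have "wdec \<kappa>" unfolding wdec_def
 proof (intro allI impI)
  fix a assume a: "Suc a < 2*n"
  hence a': "a < 2*n" by simp
  have "opT a (Suc a) (opT (Suc a) a v) = (kap a (Suc a) * of_int (\<kappa> a - \<kappa> (Suc a))) *\<^sub>C v"
   using bracket_opposite[OF WN v(1) a' a] kill[of a "Suc a"] a by (simp add: opT_zero)
  hence "ip (Wd N) (opT (Suc a) a v) (opT (Suc a) a v) = kap a (Suc a) * of_int (\<kappa> a - \<kappa> (Suc a)) * ip (Wd N) v v"
   using ip_op_norm[OF a' a, of N v] by (simp add: ip_scale1)
  note eq = this
  obtain q :: real where q: "kap a (Suc a) = of_real q" "0 < q"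
   by (rule that[of "if sp \<and> Suc a = bar a then 2 else 1"]) (simp_all add: kap_def)
  have "ip (Wd N) (opT (Suc a) a v) (opT (Suc a) a v) = of_real (q * of_int (\<kappa> a - \<kappa> (Suc a))) * of_real (Re (ip (Wd N) v v))"
   unfolding eq q(1) ip_self_Re(1)[symmetric] by simp
  hence r: "Re (ip (Wd N) (opT (Suc a) a v) (opT (Suc a) a v)) = q * of_int (\<kappa> a - \<kappa> (Suc a)) * Re (ip (Wd N) v v)"
   by (simp only: of_real_mult[symmetric] Re_complex_of_real)
  have p: "0 < Re (ip (Wd N) v v)" by (rule ip_pos_Re[OF finite_Wd subsetD[OF WN vW] v(2)])
  show "\<kappa> (Suc a) \<le> \<kappa> a"
  proof (rule ccontr)
   assume "\<not> ?thesis"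
   hence "q * (of_int (\<kappa> a - \<kappa> (Suc a)) :: real) * Re (ip (Wd N) v v) < 0"
    using p q(2) by (intro mult_neg_pos mult_pos_neg) auto
   thus False using ip_self_Re(2)[of "Wd N" "opT (Suc a) a v"] unfolding r by simp
  qed
 qed
 moreover have "hwv W opT \<kappa> v" unfolding hwv_def using vW kill opT_diag_wsp[OF WN v(1)] by auto
 ultimately show ?thesis using kl v by blast
qed

text \<open>The hypotheses of \<open>weyl_coefficient\<close> are verified with traces computed in
  orthonormal bases of the weight spaces.\<close>

theorem irr_character:
 "\<exists>\<kappa> v. \<kappa> \<in> lat \<and> wdec \<kappa> \<and> v \<noteq> 0 \<and> hwv W opT \<kappa> v \<and>
   (\<forall>\<mu>\<in>lat. wdec \<mu> \<longrightarrow> (\<Sum>\<eta>\<in>ww ` Wd N. of_nat (wm W \<eta>) * J (\<mu> + delta - \<eta>)) = (if \<mu> = \<kappa> then 1 else 0))"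
proof -
 obtain \<kappa> v where kl: "\<kappa> \<in> lat" and kd: "wdec \<kappa>" and v0: "v \<noteq> 0" and vk: "v \<in> wsp ww W \<kappa>" and hw: "hwv W opT \<kappa> v"
  using hwv_exists by blast
 have vW: "v \<in> W" using vk by (simp add: wsp_def)
 let ?X = "Wd N"
 have "\<exists>B. onb ?X B (wsp ww W \<nu>)" for \<nu> by (rule onb_exists[OF finite_Wd wsp_subspace[OF W_space] wsp_TS[OF WN]])
 then obtain B where B: "\<And>\<nu>. onb ?X (B \<nu>) (wsp ww W \<nu>)" by metis
 have BW: "b \<in> wsp ww W \<nu>" if "b \<in> B \<nu>" for b \<nu> using onbD(3)[OF B] that by blast
 have m: "wm W \<nu> = card (B \<nu>)" for \<nu> unfolding wm_def by (rule onb_dim[OF B])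
 \<comment> \<open>The trace of \<open>opT i j\<close> after \<open>opT j i\<close> on the weight
   space of \<nu>, written as a sum of squared norms.\<close>
 define T where "T i j \<nu> = (\<Sum>b\<in>B \<nu>. ip ?X (opT j i b) (opT j i b))" for i j \<nu>
 have T0: "T i j \<nu> = 0" if "wm W \<nu> = 0" for i j \<nu> using that onbD(2)[OF B] by (simp add: T_def m)
 have rr: "\<nu> + root j i + root i j = \<nu>" for \<nu> i j by (simp add: root_def)
 \<comment> \<open>Cyclicity of the trace: by Parseval both sides expand into the same squared inner
   products between the bases of two weight spaces.\<close>
 have shift: "T i j \<nu> = T j i (\<nu> + root j i)" if ij: "i < 2*n" "j < 2*n" for i j \<nu>
 proof -
  have 1: "ip ?X (opT j i b) (opT j i b) = (\<Sum>b'\<in>B (\<nu> + root j i). of_real ((cmod (ip ?X (opT j i b) b'))\<^sup>2))" if "b \<in> B \<nu>" for b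
   using parseval[OF B opT_wsp[OF W_sub BW[OF that] ij(2,1)]] by simp
  have 2: "ip ?X (opT i j b') (opT i j b') = (\<Sum>b\<in>B \<nu>. of_real ((cmod (ip ?X (opT i j b') b))\<^sup>2))" if "b' \<in> B (\<nu> + root j i)" for b'
   using parseval[OF B opT_wsp[OF W_sub BW[OF that] ij]] unfolding rr by simp
  have 3: "cmod (ip ?X (opT i j b') b) = cmod (ip ?X (opT j i b) b')" for b b'
   unfolding opT_adjoint[OF ij] using ip_cnj[of ?X "opT j i b" b'] complex_mod_cnj by metis
  have "T i j \<nu> = (\<Sum>b\<in>B \<nu>. \<Sum>b'\<in>B (\<nu> + root j i). of_real ((cmod (ip ?X (opT j i b) b'))\<^sup>2))"
   unfolding T_def by (rule sum.cong[OF refl 1])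
  also have "\<dots> = (\<Sum>b'\<in>B (\<nu> + root j i). \<Sum>b\<in>B \<nu>. of_real ((cmod (ip ?X (opT j i b) b'))\<^sup>2))" by (rule sum.swap)
  also have "\<dots> = T j i (\<nu> + root j i)" unfolding T_def by (rule sum.cong[OF refl]) (simp only: 2 3)
  finally show ?thesis .
 qed
 have diff: "T i j \<nu> - T j i \<nu> = kap i j * of_int (\<nu> i - \<nu> j) * of_nat (wm W \<nu>)"
  if ij: "i < 2*n" "j < 2*n" "i \<noteq> j" for i j \<nu>
 proof -
  have "ip ?X (opT j i b) (opT j i b) = ip ?X (opT i j b) (opT i j b) + kap i j * of_int (\<nu> i - \<nu> j)"
   if b: "b \<in> B \<nu>" for b
  proof -
   have "ip ?X (opT j i b) (opT j i b) = ip ?X (opT i j (opT j i b)) b"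
    by (rule ip_op_norm[OF ij(1,2), symmetric])
   also have "\<dots> = ip ?X (opT j i (opT i j b)) b + kap i j * of_int (\<nu> i - \<nu> j) * ip ?X b b"
    unfolding bracket_opposite[OF WN BW[OF b] ij] by (simp add: ip_add1 ip_scale1)
   also have "ip ?X (opT j i (opT i j b)) b = ip ?X (opT i j b) (opT i j b)" by (rule ip_op_norm[OF ij(2,1)])
   finally show ?thesis using onbD(5)[OF B b b] by simp
  qed
  thus ?thesis by (simp add: T_def m sum.distrib)
 qed
 define prs where "prs = {(i, j). i < j \<and> j < 2*n}"
 have fprs: "finite prs" unfolding prs_def by (rule finite_subset[of _ "{..<2*n} \<times> {..<2*n}"]) auto
 define fib where "fib \<alpha> = {p \<in> prs. root (fst p) (snd p) = \<alpha>}" for \<alpha>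
 define u where "u \<alpha> \<nu> = (\<Sum>p\<in>fib \<alpha>. T (fst p) (snd p) \<nu>)" for \<alpha> \<nu>
 have fibp: "fst p < 2*n" "snd p < 2*n" "fst p \<noteq> snd p" "root (fst p) (snd p) = \<alpha>" if "p \<in> fib \<alpha>" for p \<alpha>
  using that by (auto simp: fib_def prs_def)
 have u': "u \<alpha> (\<nu> + \<alpha>) = (\<Sum>p\<in>fib \<alpha>. T (snd p) (fst p) \<nu>)" for \<alpha> \<nu> unfolding u_def
 proof (rule sum.cong[OF refl])
  fix p assume p: "p \<in> fib \<alpha>"
  show "T (fst p) (snd p) (\<nu> + \<alpha>) = T (snd p) (fst p) \<nu>" using shift[OF fibp(2,1)[OF p]] fibp(4)[OF p] by simp
 qed
 \<comment> \<open>After folding, a short root has two index pairs with factor 1 and a long root one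
   pair with factor 2; both give \<open>1 + fold_coeff\<close>.\<close>
 have kapsum: "(\<Sum>p\<in>fib \<alpha>. kap (fst p) (snd p) * of_int (\<nu> (fst p) - \<nu> (snd p))) = of_int (ipr \<alpha> \<nu>)"
  if al: "\<alpha> \<in> roots" and nu: "\<nu> \<in> lat" for \<alpha> \<nu>
 proof -
  obtain a b where ab: "\<alpha> = root a b" "a < b" "b < 2*n" using al by (auto simp: roots_def)
  have a2: "a < 2*n" using ab by simp
  have fe: "fib \<alpha> = (if sp then {(a, b), (bar b, bar a)} else {(a, b)})"
   using root_eq_iff[OF _ _ ab(2,3)] ab a2 bar_less_iff[OF ab(3) a2] by (auto simp: fib_def prs_def)
  have e: "ipr \<alpha> \<nu> = (1 + fold_coeff) * (\<nu> a - \<nu> b)" unfolding ab(1) by (rule ipr_root[OF a2 ab(3) nu])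
  show ?thesis
  proof (cases sp)
   case False
   thus ?thesis by (simp add: fe e kap_def fold_coeff_def)
  next
   case True
   have nb: "\<nu> (bar i) = - \<nu> i" if "i < 2*n" for i using nu True that by (simp add: lat_def)
   show ?thesis
   proof (cases "b = bar a")
    case t: True
    hence "bar b = a" using a2 by simp
    thus ?thesis using True t by (simp add: fe e kap_def fold_coeff_def)
   next
    case False
    hence "bar b \<noteq> a" using bar_bar[OF ab(3)] by metis
    thus ?thesis using True False bar_bar[OF ab(3)] by (simp add: fe e kap_def fold_coeff_def nb ab(3) a2)
   qed
  qed
 qed
 have lat_m: "\<nu> \<in> ww ` Wd N" if "wm W \<nu> \<noteq> 0" for \<nu> by (rule wm_nonzero_wt[OF W_space WN that])
 have lat_m': "\<nu> \<in> lat" if "wm W \<nu> \<noteq> 0" for \<nu> using lat_m[OF that] ww_lat by blast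
 let ?m = "\<lambda>\<nu>. of_nat (wm W \<nu>) :: complex"
 have rec: "u \<alpha> \<nu> - u \<alpha> (\<nu> + \<alpha>) = of_int (ipr \<alpha> \<nu>) * ?m \<nu>" if al: "\<alpha> \<in> roots" for \<alpha> \<nu>
 proof -
  have "u \<alpha> \<nu> - u \<alpha> (\<nu> + \<alpha>) = (\<Sum>p\<in>fib \<alpha>. kap (fst p) (snd p) * of_int (\<nu> (fst p) - \<nu> (snd p)) * ?m \<nu>)"
   unfolding u' unfolding u_def sum_subtractf[symmetric]
   by (rule sum.cong[OF refl]) (rule diff; rule fibp; assumption)
  also have "\<dots> = (\<Sum>p\<in>fib \<alpha>. kap (fst p) (snd p) * of_int (\<nu> (fst p) - \<nu> (snd p))) * ?m \<nu>"
   by (rule sum_distrib_right[symmetric])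
  also have "\<dots> = of_int (ipr \<alpha> \<nu>) * ?m \<nu>" using kapsum[OF al] lat_m'[of \<nu>] by (cases "wm W \<nu> = 0") simp_all
  finally show ?thesis .
 qed
 \<comment> \<open>If \<nu> were not below \<kappa>, then all products of lowering operators applied
   to \<open>v\<close>, and so all of \<open>W\<close>, would vanish at a word of weight
   \<nu>.\<close>
 have vcone: "\<kappa> - \<nu> \<in> cone" if m0: "wm W \<nu> \<noteq> 0" for \<nu>
 proof (rule ccontr)
  assume nc: "\<kappa> - \<nu> \<notin> cone"
  obtain f w where f: "f \<in> wsp ww W \<nu>" "w \<in> Wd N" "ww w = \<nu>" "f w \<noteq> 0" by (rule wm_nonzeroD[OF W_space WN m0])
  have wq: "x w = 0" if "(\<beta>, x) \<in> words opT v" for \<beta> x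
  proof (rule ccontr)
   assume xw: "x w \<noteq> 0"
   note wp = words_props[OF W_mod hw that]
   have "of_int (ww w i) * x w = of_int ((\<kappa> - \<beta>) i) * x w" if i: "i < 2*n" for i
    using fun_cong[of "opT i i x" _ w] wp i opT_diag[OF i, of w x] f(2) by (auto simp: fn_ops Wd_def)
   hence "ww w i = (\<kappa> - \<beta>) i" if "i < 2*n" for i using that xw by (metis mult_cancel_right of_int_eq_iff)
   hence "\<nu> = \<kappa> - \<beta>" unfolding f(3)[symmetric]
    using ww_lat[OF f(2)] lat_diff[OF kl cone_lat] wp by (intro lat_eqI) auto
   hence "\<kappa> - \<nu> = \<beta>" by simp
   thus False using nc wp by simp
  qed
  have "f \<in> cspan (snd ` words opT v)" using Q_irr[OF W_mod hw irr v0] f(1) by (simp add: wsp_def)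
  moreover have "cspan (snd ` words opT v) \<subseteq> {x. x w = 0}"
  proof (rule complex_vector.span_minimal)
   show "snd ` words opT v \<subseteq> {x. x w = 0}" using wq by auto
   show "csubspace {x :: nat list \<Rightarrow> complex. x w = 0}" by (simp add: complex_vector.subspace_def fn_ops)
  qed
  ultimately have "f \<in> {x. x w = 0}" by (rule rev_subsetD)
  thus False using f(4) by simp
 qed
 have mk: "wm W \<kappa> = 1"
 proof -
  have mult: "\<exists>c. x = c *\<^sub>C v" if x: "x \<in> wsp ww W \<kappa>" for x
  proof -
   have "x \<in> cspan (snd ` words opT v)" using Q_irr[OF W_mod hw irr v0] x by (simp add: wsp_def)
   moreover have "ht W opT x = of_int (ipr \<kappa> delta) *\<^sub>C x" by (rule ht_weight) (rule opT_diag_wsp[OF WN x])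
   ultimately show ?thesis by (rule hwv_multiple[OF W_mod hw]) blast
  qed
  have "card (B \<kappa>) \<le> 1"
  proof (rule ccontr)
   assume "\<not> ?thesis"
   hence "Suc 1 \<le> card (B \<kappa>)" by simp
   then obtain a b where ab: "a \<in> B \<kappa>" "b \<in> B \<kappa>" "a \<noteq> b"
    by (metis card_le_Suc_iff card_1_singleton_iff insertCI One_nat_def)
   obtain c d where "a = c *\<^sub>C v" "b = d *\<^sub>C v" using mult BW ab by metis
   hence "ip ?X a b = c * cnj d * ip ?X v v" "ip ?X a a = c * cnj c * ip ?X v v" "ip ?X b b = d * cnj d * ip ?X v v"
    by (simp_all add: ip_scale1 ip_scale2)
   thus False using onbD(5)[OF B ab(1,2)] onbD(5)[OF B ab(1,1)] onbD(5)[OF B ab(2,2)] ab(3) by auto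
  qed
  moreover have "wm W \<kappa> \<noteq> 0" by (rule wm_nonzeroI[OF W_space WN vk v0])
  ultimately show ?thesis by (simp add: m)
 qed
 \<comment> \<open>The Casimir operator preserves the weight \<kappa> and so maps \<open>v\<close>
   to a multiple of itself; the eigenspace for that number is a nonzero submodule.\<close>
 obtain c where c: "\<And>x. x \<in> W ==> cas opT x = c *\<^sub>C x"
 proof -
  have "cas opT v \<in> wsp ww W \<kappa>"
  proof -
   have "opT i j (opT j i v) \<in> wsp ww W \<kappa>" if "i < 2*n" "j < 2*n" for i j
    using opT_wsp[OF W_sub opT_wsp[OF W_sub vk that(2,1)] that] by (simp add: rr)
   thus ?thesis unfolding cas_def by (intro csub_intros(6) wsp_subspace W_space) auto
  qed
  hence "ht W opT (cas opT v) = of_int (ipr \<kappa> delta) *\<^sub>C cas opT v"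
   by (intro ht_weight) (rule opT_diag_wsp[OF WN])
  moreover have "cas opT v \<in> cspan (snd ` words opT v)"
   using Q_irr[OF W_mod hw irr v0] cas_closed[OF W_mod vW] by simp
  ultimately obtain c where c: "cas opT v = c *\<^sub>C v" using hwv_multiple[OF W_mod hw] by metis
  define K where "K = {x \<in> W. cas opT x = c *\<^sub>C x}"
  have cl: "cas opT (x + y) = cas opT x + cas opT y" "cas opT (d *\<^sub>C x) = d *\<^sub>C cas opT x" for x y d
   by (simp_all add: cas_def opT_add opT_scale sum.distrib complex_vector.scale_sum_right)
  have "cas opT 0 = 0" using cl(2)[of 0 0] by simp
  hence "csubspace K"
   using csub_intros[OF W_space] by (auto simp: complex_vector.subspace_def K_def cl scaleC_add_right mult.commute)
  moreover have "opT i j x \<in> K" if "i < 2*n" "j < 2*n" "x \<in> K" for i j x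
   using that cas_commute[OF W_mod that(1,2), of x] opmodD(2)[OF W_mod that(1,2)] by (simp add: K_def opT_scale)
  ultimately have "opsub opT K" by (simp add: opsub_def)
  moreover have "K \<subseteq> W" "v \<in> K" using c vW by (auto simp: K_def)
  ultimately have "K = W" using irr v0 unfolding opirr_def by blast
  thus thesis using that[of c] by (auto simp: K_def)
 qed
 have cas_eq: "of_int (ipr \<nu> \<nu>) * ?m \<nu> + (\<Sum>\<alpha>\<in>roots. u \<alpha> \<nu> + u \<alpha> (\<nu> + \<alpha>)) = c * ?m \<nu>" for \<nu>
 proof -
  have diag: "T i i \<nu> = of_int (\<nu> i * \<nu> i) * ?m \<nu>" if "i < 2*n" for i
  proof -
   have "ip ?X (opT i i b) (opT i i b) = of_int (\<nu> i * \<nu> i)" if "b \<in> B \<nu>" for b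
    unfolding opT_diag_wsp[OF WN BW[OF that] \<open>i < 2*n\<close>] using onbD(5)[OF B that that]
    by (simp add: ip_scale1 ip_scale2)
   thus ?thesis by (simp add: T_def m)
  qed
  have "c * ?m \<nu> = (\<Sum>b\<in>B \<nu>. ip ?X (cas opT b) b)"
  proof -
   have "ip ?X (cas opT b) b = c" if "b \<in> B \<nu>" for b
   proof -
    have "b \<in> W" using BW[OF that] by (simp add: wsp_def)
    thus ?thesis using onbD(5)[OF B that that] by (simp add: c ip_scale1)
   qed
   thus ?thesis by (simp add: m)
  qed
  also have "\<dots> = (\<Sum>b\<in>B \<nu>. \<Sum>i<2*n. \<Sum>j<2*n. ip ?X (opT j i b) (opT j i b))" unfolding cas_def ip_sum1
   by (rule sum.cong[OF refl], rule sum.cong[OF refl], rule sum.cong[OF refl], rule ip_op_norm) simp_all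
  also have "\<dots> = (\<Sum>i<2*n. \<Sum>j<2*n. T i j \<nu>)"
   unfolding T_def by (subst sum.swap, rule sum.cong[OF refl], rule sum.swap)
  also have "\<dots> = (\<Sum>i<2*n. T i i \<nu>) + (\<Sum>p\<in>prs. T (fst p) (snd p) \<nu> + T (snd p) (fst p) \<nu>)"
   unfolding sum_square_split prs_def by (simp add: case_prod_unfold)
  also have "(\<Sum>i<2*n. T i i \<nu>) = of_int (ipr \<nu> \<nu>) * ?m \<nu>" by (simp add: diag ipr_def flip: sum_distrib_right)
  also have "(\<Sum>p\<in>prs. T (fst p) (snd p) \<nu> + T (snd p) (fst p) \<nu>)
    = (\<Sum>\<alpha>\<in>roots. \<Sum>p\<in>fib \<alpha>. T (fst p) (snd p) \<nu> + T (snd p) (fst p) \<nu>)"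
   unfolding fib_def by (rule sum.group[symmetric, OF fprs finite_roots]) (auto simp: prs_def intro: rootsI)
  also have "\<dots> = (\<Sum>\<alpha>\<in>roots. u \<alpha> \<nu> + u \<alpha> (\<nu> + \<alpha>))" unfolding u' unfolding u_def sum.distrib[symmetric] ..
  finally show ?thesis by simp
 qed
 have fin_m: "finite {\<nu>. ?m \<nu> \<noteq> 0}" by (rule finite_subset[of _ "ww ` Wd N"]) (use lat_m finite_Wd in auto)
 have fin_u: "finite {\<nu>. u \<alpha> \<nu> \<noteq> 0}" for \<alpha>
 proof (rule finite_subset[of _ "ww ` Wd N"])
  show "{\<nu>. u \<alpha> \<nu> \<noteq> 0} \<subseteq> ww ` Wd N"
  proof
   fix \<nu> assume "\<nu> \<in> {\<nu>. u \<alpha> \<nu> \<noteq> 0}"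
   hence "wm W \<nu> \<noteq> 0" by (cases "wm W \<nu> = 0") (simp_all add: u_def T0)
   thus "\<nu> \<in> ww ` Wd N" by (rule lat_m)
  qed
 qed (use finite_Wd in simp)
 have const: "(\<Sum>i<2*n. \<nu> i) = (1 - fold_coeff) * int N" if "?m \<nu> \<noteq> 0" for \<nu> using lat_m[of \<nu>] that ww_sum by auto
 have "(\<Sum>\<eta>\<in>ww ` Wd N. ?m \<eta> * J (\<mu> + delta - \<eta>)) = (if \<mu> = \<kappa> then 1 else 0)"
  if mu: "\<mu> \<in> lat" "wdec \<mu>" for \<mu>
 proof -
  have "(\<Sum>\<eta> | ?m \<eta> \<noteq> 0. ?m \<eta> * J (\<mu> + delta - \<eta>)) = (if \<mu> = \<kappa> then 1 else 0)"
   by (rule weyl_coefficient[OF fin_m fin_u const rec cas_eq _ kl kd _ mu])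
    (use mk vcone in auto)
  moreover have "(\<Sum>\<eta> | ?m \<eta> \<noteq> 0. ?m \<eta> * J (\<mu> + delta - \<eta>)) = (\<Sum>\<eta>\<in>ww ` Wd N. ?m \<eta> * J (\<mu> + delta - \<eta>))"
   by (rule sum.mono_neutral_left) (use lat_m finite_Wd in auto)
  ultimately show ?thesis by simp
 qed
 thus ?thesis using kl kd v0 hw by blast
qed

end

end

text \<open>The divided powers of \<open>eT i j\<close> and the action of the transvection \<open>1 + c E\<^sub>i\<^sub>j\<close>. A product of three transvections
 permutes two letters up to signs, so submodules for \<open>gl(2n)\<close> are stable under it.\<close>

fun gT :: "nat \<Rightarrow> nat \<Rightarrow> nat \<Rightarrow> tens \<Rightarrow> nat list \<Rightarrow> complex" where
 "gT k i j f [] = (if k = 0 then f [] else 0)"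
| "gT k i j f (b # u) = gT k i j (\<lambda>w. f (b # w)) u
   + (if b = i \<and> k > 0 then gT (k - 1) i j (\<lambda>w. f (j # w)) u else 0)"

fun xT :: "complex \<Rightarrow> nat \<Rightarrow> nat \<Rightarrow> tens \<Rightarrow> nat list \<Rightarrow> complex" where
 "xT c i j f [] = f []"
| "xT c i j f (b # u) = xT c i j (\<lambda>w. f (b # w) + (if b = i then c * f (j # w) else 0)) u"

lemma gT_0: "gT 0 i j f u = f u" by (induction u arbitrary: f) simp_all

lemma gT_big: "length u < k ==> gT k i j f u = 0" by (induction u arbitrary: f k) auto

lemma xT_lin: "xT c i j (\<lambda>w. f w + k * g w) u = xT c i j f u + k * xT c i j g u"
proof (induction u arbitrary: f g)
 case (Cons b u)
 have e: "(\<lambda>w. f (b # w) + k * g (b # w) + (if b = i then c * (f (j # w) + k * g (j # w)) else 0))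
   = (\<lambda>w. (f (b # w) + (if b = i then c * f (j # w) else 0)) + k * (g (b # w) + (if b = i then c * g (j # w) else 0)))"
  by (auto simp: algebra_simps)
 show ?case by (simp only: xT.simps e Cons)
qed simp

lemma gT_supp: "(\<And>w. length w = length u ==> f w = 0) ==> gT k i j f u = 0" by (induction u arbitrary: f k) simp_all

lemma xT_supp: "(\<And>w. length w = length u ==> f w = 0) ==> xT c i j f u = 0" by (induction u arbitrary: f) simp_all

text \<open>For \<open>i \<noteq> j\<close> a replaced letter is not replaced again, so each choice
  of \<open>k + 1\<close> positions arises \<open>k + 1\<close> times. This makes \<open>gT\<close>
  a divided power.\<close>

lemma eT_gT: "i \<noteq> j ==> eT i j (gT k i j f) u = of_nat (Suc k) * gT (Suc k) i j f u"
proof (induction u arbitrary: f k)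
 case (Cons b u)
 have "eT i j (\<lambda>w. gT k i j f (b # w)) u = eT i j (gT k i j (\<lambda>w. f (b # w))) u
   + (if b = i \<and> k > 0 then eT i j (gT (k - 1) i j (\<lambda>w. f (j # w))) u else 0)"
  by (simp only: gT.simps eT_add eT_if)
 also have "eT i j (gT k i j (\<lambda>w. f (b # w))) u = of_nat (Suc k) * gT (Suc k) i j (\<lambda>w. f (b # w)) u"
  by (rule Cons.IH[OF Cons.prems])
 also have "(if b = i \<and> k > 0 then eT i j (gT (k - 1) i j (\<lambda>w. f (j # w))) u else 0)
   = (if b = i then of_nat k * gT k i j (\<lambda>w. f (j # w)) u else 0)"
  using Cons.IH[OF Cons.prems, of "k - 1" "\<lambda>w. f (j # w)"] by auto
 finally show ?case using Cons.prems by (simp add: algebra_simps)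
qed simp

text \<open>The exponential series of \<open>c\<close> times \<open>eT i j\<close>, which ends
  because a word has only finitely many positions.\<close>

lemma xT_gT: "xT c i j f u = (\<Sum>k\<le>length u. c ^ k * gT k i j f u)"
proof (induction u arbitrary: f)
 case (Cons b u)
 have e: "(\<lambda>w. f (b # w) + (if b = i then c * f (j # w) else 0)) = (\<lambda>w. f (b # w) + (if b = i then c else 0) * f (j # w))"
  by auto
 have "(\<Sum>k\<le>length (b # u). c ^ k * gT k i j f (b # u))
  = (\<Sum>k\<le>Suc (length u). c ^ k * gT k i j (\<lambda>w. f (b # w)) u)
   + (\<Sum>k\<le>Suc (length u). c ^ k * (if b = i \<and> k > 0 then gT (k - 1) i j (\<lambda>w. f (j # w)) u else 0))"
  by (simp only: gT.simps list.size add_Suc_right add_0_right distrib_left sum.distrib)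
 also have "(\<Sum>k\<le>Suc (length u). c ^ k * gT k i j (\<lambda>w. f (b # w)) u) = xT c i j (\<lambda>w. f (b # w)) u"
  by (simp add: Cons gT_big)
 also have "(\<Sum>k\<le>Suc (length u). c ^ k * (if b = i \<and> k > 0 then gT (k - 1) i j (\<lambda>w. f (j # w)) u else 0))
   = (if b = i then c else 0) * xT c i j (\<lambda>w. f (j # w)) u"
  unfolding sum.atMost_Suc_shift Cons by (simp add: sum_distrib_left mult.assoc)
 finally show ?case by (simp only: xT.simps e xT_lin)
qed (simp add: gT_0)

definition swT :: "nat \<Rightarrow> nat \<Rightarrow> tens \<Rightarrow> nat list \<Rightarrow> complex" where
 "swT a b f = xT 1 a b (xT (-1) b a (xT 1 a b f))"

lemma swT_Cons:
 assumes "a \<noteq> b"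
 shows "swT a b f (x # u) = (if x = a then swT a b (\<lambda>w. f (b # w)) u
   else if x = b then - swT a b (\<lambda>w. f (a # w)) u else swT a b (\<lambda>w. f (x # w)) u)"
proof -
 define g where "g = xT 1 a b f"
 define h where "h = xT (-1) b a g"
 let ?f = "\<lambda>x w. f (x # w)"
 have ga: "(\<lambda>w. g (a # w)) = (\<lambda>w. xT 1 a b (?f a) w + xT 1 a b (?f b) w)"
  unfolding g_def using xT_lin[of 1 a b "?f a" 1 "?f b"] by (simp add: fun_eq_iff)
 have gx: "(\<lambda>w. g (x # w)) = xT 1 a b (?f x)" if "x \<noteq> a" for x unfolding g_def using that by (simp add: fun_eq_iff)
 have hb: "(\<lambda>w. h (b # w)) = (\<lambda>w. - 1 * xT (-1) b a (xT 1 a b (?f a)) w)"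
 proof -
  have "xT (-1) b a (\<lambda>w. g (b # w) + (-1) * g (a # w)) w = (-1) * xT (-1) b a (xT 1 a b (?f a)) w" for w
  proof -
   have "(\<lambda>w. g (b # w) + (-1) * g (a # w)) = (\<lambda>w. 0 + (-1) * xT 1 a b (?f a) w)"
    using fun_cong[OF ga] fun_cong[OF gx[OF assms[symmetric]]] by (simp add: fun_eq_iff)
   thus ?thesis by (simp only: xT_lin) (simp add: xT_supp)
  qed
  thus ?thesis unfolding h_def using assms by (simp add: fun_eq_iff)
 qed
 have ha: "(\<lambda>w. h (a # w)) = (\<lambda>w. xT (-1) b a (xT 1 a b (?f a)) w + 1 * xT (-1) b a (xT 1 a b (?f b)) w)"
  unfolding h_def using assms fun_cong[OF ga] xT_lin[of "-1" b a "xT 1 a b (?f a)" 1 "xT 1 a b (?f b)"]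
  by (simp add: fun_eq_iff)
 have hx: "(\<lambda>w. h (x # w)) = xT (-1) b a (xT 1 a b (?f x))" if "x \<noteq> a" "x \<noteq> b" for x
  unfolding h_def using that gx[OF that(1)] by (simp add: fun_eq_iff)
 show ?thesis
 proof (cases "x = a")
  case True
  have "(\<lambda>w. h (a # w) + 1 * h (b # w)) = xT (-1) b a (xT 1 a b (?f b))"
   using fun_cong[OF ha] fun_cong[OF hb] by (simp add: fun_eq_iff)
  thus ?thesis using True by (simp add: swT_def flip: g_def h_def)
 next
  case False
  show ?thesis
  proof (cases "x = b")
   case True
   have "xT 1 a b (\<lambda>w. h (b # w)) u = - xT 1 a b (xT (-1) b a (xT 1 a b (?f a))) u"
    unfolding hb using xT_lin[of 1 a b "\<lambda>_. 0" "-1" "xT (-1) b a (xT 1 a b (?f a))" u] by (simp add: xT_supp)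
   thus ?thesis using True False by (simp add: swT_def flip: g_def h_def)
  next
   case f: False
   show ?thesis using False f hx[OF False f] by (simp add: swT_def flip: g_def h_def)
  qed
 qed
qed

lemma swT_eq: "a \<noteq> b ==>
  swT a b f u = (-1) ^ count_list u b * f (map (Transposition.transpose a b) u)"
proof (induction u arbitrary: f)
 case Nil
 show ?case by (simp add: swT_def)
next
 case (Cons x u)
 thus ?case by (simp add: swT_Cons Transposition.transpose_def)
qed

context folding
begin

section \<open>Complete reducibility\<close>

definition hwt :: "tens set \<Rightarrow> nat \<Rightarrow> int" where
 "hwt W = (SOME \<kappa>. \<kappa> \<in> lat \<and> (\<exists>v. v \<noteq> 0 \<and> hwv W opT \<kappa> v))"

lemma hwt:
 assumes "opirr W opT" "W \<subseteq> TS N"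
 shows "hwt W \<in> lat" "wdec (hwt W)" "\<exists>v. v \<noteq> 0 \<and> hwv W opT (hwt W) v"
  "\<mu> \<in> lat ==> wdec \<mu> ==>
   (\<Sum>\<eta>\<in>ww ` Wd N. of_nat (wm W \<eta>) * J (\<mu> + delta - \<eta>)) = (if hwt W = \<mu> then 1 else 0)"
proof -
 obtain \<kappa> v where k: "\<kappa> \<in> lat" "wdec \<kappa>" "v \<noteq> 0" "hwv W opT \<kappa> v"
  "\<And>\<mu>. \<mu>\<in>lat ==> wdec \<mu> ==> (\<Sum>\<eta>\<in>ww ` Wd N. of_nat (wm W \<eta>) * J (\<mu> + delta - \<eta>)) = (if \<mu> = \<kappa> then 1 else 0)"
  using irr_character[OF assms] by blast
 have "\<exists>\<kappa>. \<kappa> \<in> lat \<and> (\<exists>v. v \<noteq> 0 \<and> hwv W opT \<kappa> v)" using k by blast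
 from someI_ex[OF this] have h: "hwt W \<in> lat" "\<exists>v. v \<noteq> 0 \<and> hwv W opT (hwt W) v" by (simp_all add: hwt_def)
 then obtain w where w: "w \<noteq> 0" "hwv W opT (hwt W) w" by blast
 have e: "hwt W = \<kappa>" by (rule lat_eqI[OF h(1) k(1)]) (rule hwv_unique(2)[OF assms(1) k(4,3) w(2,1)])
 show "hwt W \<in> lat" "wdec (hwt W)" "\<exists>v. v \<noteq> 0 \<and> hwv W opT (hwt W) v" using h k e by auto
 show "(\<Sum>\<eta>\<in>ww ` Wd N. of_nat (wm W \<eta>) * J (\<mu> + delta - \<eta>)) = (if hwt W = \<mu> then 1 else 0)"
  if "\<mu> \<in> lat" "wdec \<mu>" using k(5)[OF that] e by auto
qed

lemma hwt_unique:
 assumes "opirr W opT" "W \<subseteq> TS N" "\<kappa> \<in> lat" "v \<noteq> 0" "hwv W opT \<kappa> v"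
 shows "hwt W = \<kappa>"
proof -
 obtain w where w: "w \<noteq> 0" "hwv W opT (hwt W) w" using hwt(3)[OF assms(1,2)] by blast
 show ?thesis by (rule lat_eqI[OF hwt(1)[OF assms(1,2)] assms(3)]) (rule hwv_unique(2)[OF assms(1,5,4) w(2,1)])
qed

text \<open>Least dimension forces irreducibility: a nonzero submodule has at least the same
  dimension, so its orthogonal complement is 0.\<close>

lemma irr_exists:
 assumes Y: "opsub opT Y" "Y \<subseteq> TS N" "Y \<noteq> {0}"
 shows "\<exists>W. opirr W opT \<and> W \<subseteq> Y"
proof -
 define P where "P W \<longleftrightarrow> opsub opT W \<and> W \<subseteq> Y \<and> W \<noteq> {0}" for W
 have "P Y" using Y by (simp add: P_def)
 from ex_has_least_nat[of P, OF this, of complex_vector.dim]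
 obtain W where W: "P W" "\<And>W'. P W' ==> complex_vector.dim W \<le> complex_vector.dim W'" by blast
 have s: "opsub opT W" "W \<subseteq> Y" "W \<noteq> {0}" using W(1) by (auto simp: P_def)
 have WN: "W \<subseteq> TS N" using s Y by blast
 have sp: "csubspace W" using s(1) by (simp add: opsub_def)
 have "W' = W" if W': "opsub opT W'" "W' \<subseteq> W" "W' \<noteq> {0}" for W'
 proof -
  have "P W'" using W' s by (auto simp: P_def)
  have sp': "csubspace W'" using W'(1) by (simp add: opsub_def)
  have "complex_vector.dim (oc (Wd N) W W') = 0"
   using W(2)[OF \<open>P W'\<close>] dim_oc[OF finite_Wd sp' W'(2) sp WN] by simp
  moreover have "oc (Wd N) W W' \<subseteq> TS N" using WN by (auto simp: oc_def)
  ultimately have oc0: "oc (Wd N) W W' = {0}" using dim_pos[OF finite_Wd oc_subspace[OF sp]] by blast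
  have "w \<in> W'" if w: "w \<in> W" for w
  proof -
   obtain a b where "a \<in> W'" "b \<in> oc (Wd N) W W'" "w = a + b"
    using oc_split[OF finite_Wd sp' W'(2) sp WN w] by blast
   thus ?thesis using oc0 by simp
  qed
  thus ?thesis using W'(2) by blast
 qed
 hence "opirr W opT" using opmod_sub[OF opmod_TS s(1) WN] s(3) unfolding opirr_def by blast
 thus ?thesis using s(2) by blast
qed

text \<open>Besides orthogonality the decomposition records the additivity of weight multiplicities,
  through which the summands are counted.\<close>

definition odec :: "nat \<Rightarrow> tens set set \<Rightarrow> tens set \<Rightarrow> bool" where
 "odec N \<W> Y \<longleftrightarrow> finite \<W> \<and> (\<forall>W\<in>\<W>. opirr W opT \<and> W \<subseteq> Y) \<and>
   (\<forall>W\<in>\<W>. \<forall>W'\<in>\<W>. W \<noteq> W' \<longrightarrow> (\<forall>f\<in>W. \<forall>g\<in>W'. ip (Wd N) f g = 0)) \<and>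
   (\<forall>y\<in>Y. \<exists>h. (\<forall>W\<in>\<W>. h W \<in> W) \<and> y = (\<Sum>W\<in>\<W>. h W)) \<and>
   (\<forall>\<nu>. wm Y \<nu> = (\<Sum>W\<in>\<W>. wm W \<nu>))"

lemma odecD:
 assumes "odec N \<W> Y"
 shows "finite \<W>" "\<And>W. W \<in> \<W> ==> opirr W opT" "\<And>W. W \<in> \<W> ==> W \<subseteq> Y"
  "\<And>A B f g. A \<in> \<W> ==> B \<in> \<W> ==> A \<noteq> B ==> f \<in> A ==> g \<in> B ==> ip (Wd N) f g = 0"
  "\<And>y. y \<in> Y ==> \<exists>h. (\<forall>W\<in>\<W>. h W \<in> W) \<and> y = (\<Sum>W\<in>\<W>. h W)"
  "\<And>\<nu>. wm Y \<nu> = (\<Sum>W\<in>\<W>. wm W \<nu>)"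
proof -
 note a = assms[unfolded odec_def]
 note a2 = a[THEN conjunct2] note a3 = a2[THEN conjunct2] note a4 = a3[THEN conjunct2]
 show "finite \<W>" by (rule a[THEN conjunct1])
 show "opirr W opT" "W \<subseteq> Y" if "W \<in> \<W>" for W using bspec[OF a2[THEN conjunct1] that] by simp_all
 show "ip (Wd N) f g = 0" if "A \<in> \<W>" "B \<in> \<W>" "A \<noteq> B" "f \<in> A" "g \<in> B" for A B f g
  by (rule a3[THEN conjunct1, rule_format, OF that])
 show "\<exists>h. (\<forall>W\<in>\<W>. h W \<in> W) \<and> y = (\<Sum>W\<in>\<W>. h W)" if "y \<in> Y" for y by (rule bspec[OF a4[THEN conjunct1] that])
 show "wm Y \<nu> = (\<Sum>W\<in>\<W>. wm W \<nu>)" for \<nu> by (rule spec[OF a4[THEN conjunct2]])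
qed

lemma odec_exists:
 assumes "opsub opT Y" "Y \<subseteq> TS N"
 shows "\<exists>\<W>. odec N \<W> Y" using assms
proof (induction "complex_vector.dim Y" arbitrary: Y rule: less_induct)
 case less
 note Y = less.prems
 have sY: "csubspace Y" using Y(1) by (simp add: opsub_def)
 show ?case
 proof (cases "Y = {0}")
  case True
  have "wm Y \<nu> = 0" for \<nu>
   unfolding wm_zero_iff[OF sY Y(2)] using csub_intros(1)[OF wsp_subspace[OF sY, of ww \<nu>]] True
   by (auto simp: wsp_def)
  hence "odec N {} Y" using True by (simp add: odec_def)
  thus ?thesis by blast
 next
  case False
  obtain W where W: "opirr W opT" "W \<subseteq> Y" using irr_exists[OF Y False] by blast
  have WN: "W \<subseteq> TS N" using W Y by blast
  note Wf = W_sub[OF W(1) WN] W_space[OF W(1) WN] W_graded[OF W(1) WN]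
  let ?Z = "oc (Wd N) Y W"
  have Z: "opsub opT ?Z" "?Z \<subseteq> TS N" "?Z \<subseteq> Y" using opsub_oc[OF Y(1) Wf(1)] Y(2) by (auto simp: oc_def)
  have Wn: "W \<noteq> {0}" using W(1) by (simp add: opirr_def)
  have "complex_vector.dim W \<noteq> 0" using dim_pos[OF finite_Wd Wf(2) WN] Wn by simp
  hence "complex_vector.dim ?Z < complex_vector.dim Y" using dim_oc[OF finite_Wd Wf(2) W(2) sY Y(2)] by simp
  from less.hyps[OF this Z(1,2)] obtain \<W> where w: "odec N \<W> ?Z" by (elim exE)
  note d = odecD[OF w]
  have o: "ip (Wd N) f g = 0" "ip (Wd N) g f = 0" if "W' \<in> \<W>" "f \<in> W'" "g \<in> W" for W' f g
  proof -
   have "f \<in> ?Z" using d(3)[OF that(1)] that(2) by blast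
   thus "ip (Wd N) f g = 0" using that(3) by (simp add: oc_def)
   thus "ip (Wd N) g f = 0" using ip_cnj[of "Wd N" f g] by simp
  qed
  have nW: "W \<notin> \<W>"
  proof
   assume "W \<in> \<W>"
   hence "f = 0" if "f \<in> W" for f by (intro ip_pos[OF finite_Wd subsetD[OF WN that]] o(1)[OF _ that that])
   thus False using Wn csub_intros(1)[OF Wf(2)] by blast
  qed
  have "odec N (insert W \<W>) Y" unfolding odec_def
  proof (intro conjI ballI allI impI)
   show "finite (insert W \<W>)" using d(1) by simp
   show "opirr W' opT" if "W' \<in> insert W \<W>" for W' using that d(2) W(1) by blast
   show "W' \<subseteq> Y" if "W' \<in> insert W \<W>" for W' using that d(3)[of W'] W(2) Z(3) by blast
   show "ip (Wd N) f g = 0" if AB: "A \<in> insert W \<W>" "B \<in> insert W \<W>" "A \<noteq> B" "f \<in> A" "g \<in> B" for A B f g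
   proof -
    consider "A = W" "B \<in> \<W>" | "B = W" "A \<in> \<W>" | "A \<in> \<W>" "B \<in> \<W>" using AB(1-3) by blast
    thus ?thesis
    proof cases
     case 1 thus ?thesis using o(2)[of B g f] AB(4,5) by simp
    next
     case 2 thus ?thesis using o(1)[of A f g] AB(4,5) by simp
    next
     case 3 thus ?thesis using d(4)[OF _ _ AB(3-5)] by blast
    qed
   qed
   show "\<exists>h. (\<forall>W\<in>insert W \<W>. h W \<in> W) \<and> y = (\<Sum>W\<in>insert W \<W>. h W)" if y: "y \<in> Y" for y
   proof -
    obtain a b where ab: "a \<in> W" "b \<in> ?Z" "y = a + b" using oc_split[OF finite_Wd Wf(2) W(2) sY Y(2) y] by blast
    obtain h where h: "\<forall>W\<in>\<W>. h W \<in> W" "b = (\<Sum>W\<in>\<W>. h W)" using d(5)[OF ab(2)] by blast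
    have "(\<Sum>W'\<in>\<W>. (h(W := a)) W') = (\<Sum>W\<in>\<W>. h W)" using nW by (intro sum.cong) auto
    hence "y = (\<Sum>W'\<in>insert W \<W>. (h(W := a)) W')" using d(1) nW ab(3) h(2) by simp
    moreover have "\<forall>W'\<in>insert W \<W>. (h(W := a)) W' \<in> W'" using h(1) ab(1) by simp
    ultimately show ?thesis by blast
   qed
   show "wm Y \<nu> = (\<Sum>W\<in>insert W \<W>. wm W \<nu>)" for \<nu>
    using dim_wsp_oc[OF finite_Wd Wf(3) W(2) sY Y(2), of \<nu>] d(1) d(6)[of \<nu>] nW by (simp add: wm_def)
  qed
  thus ?thesis by blast
 qed
qed

theorem mult_count:
 assumes d: "odec N \<W> Y" and Y: "Y \<subseteq> TS N" and mu: "\<mu> \<in> lat" "wdec \<mu>"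
 shows "(\<Sum>\<eta>\<in>ww ` Wd N. of_nat (wm Y \<eta>) * J (\<mu> + delta - \<eta>)) = of_nat (card {W \<in> \<W>. hwt W = \<mu>})"
proof -
 note f = odecD(1)[OF d] and w = odecD(6)[OF d]
 have W: "opirr W opT" "W \<subseteq> TS N" if "W \<in> \<W>" for W using odecD(2,3)[OF d that] Y by auto
 have "(\<Sum>\<eta>\<in>ww ` Wd N. of_nat (wm Y \<eta>) * J (\<mu> + delta - \<eta>))
   = (\<Sum>W\<in>\<W>. \<Sum>\<eta>\<in>ww ` Wd N. of_nat (wm W \<eta>) * J (\<mu> + delta - \<eta>))"
  unfolding w of_nat_sum sum_distrib_right by (rule sum.swap)
 also have "\<dots> = (\<Sum>W\<in>\<W>. if hwt W = \<mu> then 1 else 0)"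
 proof (rule sum.cong[OF refl])
  fix W assume "W \<in> \<W>"
  thus "(\<Sum>\<eta>\<in>ww ` Wd N. of_nat (wm W \<eta>) * J (\<mu> + delta - \<eta>)) = (if hwt W = \<mu> then 1 else 0)"
   using hwt(4)[OF W mu] by blast
 qed
 also have "\<dots> = of_nat (card {W \<in> \<W>. hwt W = \<mu>})" using f by (simp add: sum.If_cases Int_def)
 finally show ?thesis .
qed

section \<open>The symmetric group in the general linear case\<close>

lemma ww_map_sw:
 assumes "Suc a < 2*n" "set u \<subseteq> {..<2*n}"
 shows "ww (map (sw a) u) = ww u \<circ> sw a"
 using assms(2) by (induction u) (simp_all add: hv_sw[OF assms(1), symmetric] fun_eq_iff fun_ops)

lemma sw_Wd:
 assumes a: "Suc a < 2*n"
 shows "bij_betw (map (sw a)) (Wd N) (Wd N)"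
proof (rule bij_betw_byWitness[where f' = "map (sw a)"])
 show "\<forall>u\<in>Wd N. map (sw a) (map (sw a) u) = u" using a by (simp add: map_idI)
 thus "\<forall>u\<in>Wd N. map (sw a) (map (sw a) u) = u" .
 show "map (sw a) ` Wd N \<subseteq> Wd N" by (auto simp: Wd_def subset_iff intro!: sw_less[OF a])
 thus "map (sw a) ` Wd N \<subseteq> Wd N" .
qed

text \<open>Permuting the words by the reflection fixes \<zeta> and changes the sign of every
  term.\<close>

lemma sum_J_wall:
 assumes z: "\<zeta> \<in> lat" "Suc a < 2*n" "\<zeta> a = \<zeta> (Suc a)"
 shows "(\<Sum>u\<in>Wd N. J (\<zeta> - ww u)) = 0"
proof -
 have "(\<Sum>u\<in>Wd N. J (\<zeta> - ww u)) = (\<Sum>u\<in>Wd N. J (\<zeta> - ww (map (sw a) u)))"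
  by (rule sum.reindex_bij_betw[OF sw_Wd[OF z(2)], symmetric])
 also have "\<dots> = (\<Sum>u\<in>Wd N. - J (\<zeta> - ww u))"
 proof (rule sum.cong[OF refl])
  fix u assume "u \<in> Wd N"
  hence "\<zeta> - ww (map (sw a) u) = (\<zeta> \<circ> sw a) - (ww u \<circ> sw a)"
   using ww_map_sw[OF z(2)] sw_stabilizes[OF z] by (simp add: Wd_def)
  also have "\<dots> = (\<zeta> - ww u) \<circ> sw a" by (simp add: fun_eq_iff fun_ops)
  finally show "J (\<zeta> - ww (map (sw a) u)) = - J (\<zeta> - ww u)" using J_sw[OF z(2)] by simp
 qed
 finally show ?thesis by (simp add: sum_negf)
qed

text \<open>The number of summands of highest weight \<open>\<xi>\<close> satisfies the recursion of removing one box from \<open>\<xi>\<close>, because the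
 terms with \<open>\<xi>\<close> outside of the dominant chamber lie on a wall and vanish.\<close>

lemma tensor_coeff:
 assumes s: "\<not> sp"
 shows "\<xi> \<in> lat ==> wdec \<xi> ==> \<exists>k::nat. (\<Sum>u\<in>Wd N. J (\<xi> + delta - ww u)) = of_nat k \<and>
   ((\<forall>i. 0 \<le> \<xi> i) \<longrightarrow> (\<Sum>i<2*n. \<xi> i) = int N \<longrightarrow> 0 < k)"
proof (induction N arbitrary: \<xi>)
 case 0
 have W0: "Wd 0 = {[]}" by (auto simp: Wd_def)
 have "J (\<xi> + delta) = (if \<xi> + delta = delta then 1 else 0)"
  by (rule J_sdec[OF lat_add[OF 0(1) delta_lat] sdec_plus_delta[OF 0(2)]])
 moreover have "\<xi> = 0" if "\<forall>i. 0 \<le> \<xi> i" "(\<Sum>i<2*n. \<xi> i) = 0"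
 proof (rule lat_eqI[OF 0(1) lat_zero])
  have "\<forall>i\<in>{..<2*n}. \<xi> i = 0" using that by (subst (asm) sum_nonneg_eq_0_iff) auto
  thus "\<xi> i = 0 i" if "i < 2*n" for i using that by (simp add: fun_ops)
 qed
 ultimately show ?case by (intro exI[of _ "if \<xi> = 0 then 1 else 0"]) (simp add: W0)
next
 case (Suc N)
 have fc: "fold_coeff = 0" using s by (simp add: fold_coeff_def)
 have hvb: "hv a = bv a" for a by (simp add: hv_def fc fun_eq_iff)
 define c where "c a = (\<Sum>u\<in>Wd N. J (\<xi> - hv a + delta - ww u))" for a
 have tot: "(\<Sum>u\<in>Wd (Suc N). J (\<xi> + delta - ww u)) = (\<Sum>a<2*n. c a)"
  unfolding sum_Wd_Suc c_def by (simp add: algebra_simps)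
 have latc: "\<xi> - hv a \<in> lat" if "a < 2*n" for a by (rule lat_diff[OF Suc.prems(1) hv_lat[OF that]])
 have c0: "c a = 0" if a: "a < 2*n" "\<not> wdec (\<xi> - hv a)" for a
 proof -
  obtain k where k: "Suc k < 2*n" "(\<xi> - hv a) k < (\<xi> - hv a) (Suc k)" using a(2) by (auto simp: wdec_def)
  have "\<xi> (Suc k) \<le> \<xi> k" using Suc.prems(2) k(1) by (simp add: wdec_def)
  hence e: "k = a" "\<xi> (Suc k) = \<xi> k" using k(2) by (auto simp: hvb bv_def fun_ops split: if_splits)
  \<comment> \<open>Removing the box creates an ascent by 1, which \<open>delta\<close> compensates
    exactly; the shifted weight lies on a wall.\<close>
  have d: "delta k = delta (Suc k) + 1" using k(1) s by (simp add: delta_def)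
  show ?thesis unfolding c_def
   by (rule sum_J_wall[of _ k]) (use latc[OF a(1)] delta_lat k e d in \<open>auto simp: hvb bv_def fun_ops intro: lat_add\<close>)
 qed
 have ex: "\<exists>k. c a = of_nat k \<and> (wdec (\<xi> - hv a) \<longrightarrow> (\<forall>i. 0 \<le> (\<xi> - hv a) i) \<longrightarrow> (\<Sum>i<2*n. (\<xi> - hv a) i) = int N \<longrightarrow> 0 < k)" if a: "a < 2*n" for a
 proof (cases "wdec (\<xi> - hv a)")
  case True
  thus ?thesis unfolding c_def using Suc.IH[OF latc[OF a] True] by blast
 next
  case False
  thus ?thesis using c0[OF a False] by (intro exI[of _ 0]) simp
 qed
 then obtain k where k: "\<And>a. a < 2*n ==> c a = of_nat (k a)"
  and kp: "\<And>a. a < 2*n ==> wdec (\<xi> - hv a) ==> (\<forall>i. 0 \<le> (\<xi> - hv a) i) ==> (\<Sum>i<2*n. (\<xi> - hv a) i) = int N ==> 0 < k a"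
  by metis
 have "0 < (\<Sum>a<2*n. k a)" if nn: "\<forall>i. 0 \<le> \<xi> i" and sm: "(\<Sum>i<2*n. \<xi> i) = int (Suc N)"
 proof -
  have "\<exists>i<2*n. \<xi> i \<noteq> 0"
  proof (rule ccontr)
   assume "\<not> ?thesis"
   hence "(\<Sum>i<2*n. \<xi> i) = 0" by simp
   thus False using sm by simp
  qed
  define A where "A = {i. i < 2*n \<and> \<xi> i \<noteq> 0}"
  \<comment> \<open>The last nonempty row, from which a box can always be removed.\<close>
  define a where "a = Max A"
  have fA: "finite A" "A \<noteq> {}" using \<open>\<exists>i<2*n. \<xi> i \<noteq> 0\<close> by (auto simp: A_def)
  have a: "a < 2*n" "\<xi> a \<noteq> 0" using Max_in[OF fA] by (auto simp: A_def a_def)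
  have mx: "\<xi> i = 0" if "a < i" "i < 2*n" for i
  proof (rule ccontr)
   assume "\<xi> i \<noteq> 0"
   hence "i \<le> a" unfolding a_def by (intro Max_ge[OF fA(1)]) (simp add: A_def that)
   thus False using that by simp
  qed
  have pos: "0 < \<xi> a" using nn a(2) by (metis order_le_less)
  have "wdec (\<xi> - hv a)" unfolding wdec_def
  proof (intro allI impI)
   fix i assume i: "Suc i < 2*n"
   have "\<xi> (Suc i) \<le> \<xi> i" using Suc.prems(2) i by (simp add: wdec_def)
   thus "(\<xi> - hv a) (Suc i) \<le> (\<xi> - hv a) i" using mx[of "Suc i"] i pos by (auto simp: hvb bv_def fun_ops)
  qed
  moreover have "\<forall>i. 0 \<le> (\<xi> - hv a) i" using nn pos by (auto simp: hvb bv_def fun_ops)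
  moreover have "(\<Sum>i<2*n. (\<xi> - hv a) i) = int N"
   using sm a(1) sum_bv[OF a(1), of "\<lambda>_. 1"] by (simp add: fun_ops hvb sum_subtractf)
  ultimately have "0 < k a" using kp[OF a(1)] by blast
  moreover have "k a \<le> sum k {..<2*n}" by (rule member_le_sum) (use a(1) in auto)
  ultimately show ?thesis by simp
 qed
 moreover have "(\<Sum>u\<in>Wd (Suc N). J (\<xi> + delta - ww u)) = of_nat (\<Sum>a<2*n. k a)" unfolding tot using k by simp
 ultimately show ?case by blast
qed

lemma wm_TS: "wm (TS N) \<eta> = card {u \<in> Wd N. ww u = \<eta>}"
proof -
 define e where "e u = (\<lambda>w. if w = u then 1 else 0 :: complex)" for u :: "nat list"
 let ?U = "{u \<in> Wd N. ww u = \<eta>}"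
 have fU: "finite ?U" using finite_Wd by simp
 have inj: "inj_on e A" for A by (auto simp: inj_on_def e_def fun_eq_iff split: if_splits)
 have ipe: "ip (Wd N) f (e u) = f u" if "u \<in> Wd N" for f u
 proof -
  have "ip (Wd N) f (e u) = (\<Sum>w\<in>Wd N. if w = u then f w else 0)" unfolding ip_def e_def by (rule sum.cong) auto
  thus ?thesis using that finite_Wd by simp
 qed
 have "onb (Wd N) (e ` ?U) (wsp ww (TS N) \<eta>)" unfolding onb_def orthonormal_def
 proof (intro conjI ballI)
  show "finite (e ` ?U)" using fU by simp
  fix a b assume "a \<in> e ` ?U" "b \<in> e ` ?U"
  then obtain u w where uw: "u \<in> Wd N" "w \<in> Wd N" "a = e u" "b = e w" by blast
  have "e u = e w \<longleftrightarrow> u = w" using inj_on_eq_iff[OF inj[of UNIV], of u w] by simp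
  thus "ip (Wd N) a b = (if a = b then 1 else 0)" unfolding uw(3,4) ipe[OF uw(2)] by (simp add: e_def)
 next
  show "e ` ?U \<subseteq> wsp ww (TS N) \<eta>" by (auto simp: wsp_def hil_def e_def split: if_splits)
  fix x assume x: "x \<in> wsp ww (TS N) \<eta>"
  have "(\<Sum>b\<in>e ` ?U. ip (Wd N) x b *\<^sub>C b) w = x w" for w
  proof -
   have "(\<Sum>b\<in>e ` ?U. ip (Wd N) x b *\<^sub>C b) w = (\<Sum>u\<in>?U. ip (Wd N) x (e u) * e u w)"
    by (simp add: sum.reindex[OF inj] sum_fun_apply fn_ops)
   also have "\<dots> = (\<Sum>u\<in>?U. if u = w then x w else 0)"
   proof (rule sum.cong[OF refl])
    fix u assume "u \<in> ?U"
    hence "u \<in> Wd N" by simp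
    thus "ip (Wd N) x (e u) * e u w = (if u = w then x w else 0)" by (simp only: ipe) (simp add: e_def)
   qed
   also have "\<dots> = x w" using fU x by (auto simp: wsp_def hil_def)
   finally show ?thesis .
  qed
  thus "x = (\<Sum>b\<in>e ` ?U. ip (Wd N) x b *\<^sub>C b)" by (simp add: fun_eq_iff)
 qed
 from onb_dim[OF this] show ?thesis by (simp add: wm_def card_image[OF inj])
qed

lemma sum_fibres:
 assumes "finite A" "finite B" "f ` A \<subseteq> B"
 shows "(\<Sum>\<eta>\<in>B. of_nat (card {x \<in> A. f x = \<eta>}) * g \<eta>) = (\<Sum>x\<in>A. g (f x) :: complex)"
proof -
 have "(\<Sum>\<eta>\<in>B. of_nat (card {x \<in> A. f x = \<eta>}) * g \<eta>) = (\<Sum>\<eta>\<in>B. \<Sum>x\<in>{x \<in> A. f x = \<eta>}. g (f x))"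
  by (rule sum.cong[OF refl]) simp
 also have "\<dots> = (\<Sum>x\<in>A. g (f x))" by (rule sum.group[OF assms])
 finally show ?thesis .
qed

lemma irr_of_weight_exists:
 assumes s: "\<not> sp" and x: "\<xi> \<in> lat" "wdec \<xi>" "\<And>i. 0 \<le> \<xi> i" "(\<Sum>i<2*n. \<xi> i) = int N"
 shows "\<exists>W. opirr W opT \<and> W \<subseteq> TS N \<and> hwt W = \<xi>"
proof -
 have "opsub opT (TS N)" using hil_subspace opT_TS by (auto simp: opsub_def)
 then obtain \<W> where w: "odec N \<W> (TS N)" using odec_exists by blast
 have "of_nat (card {W \<in> \<W>. hwt W = \<xi>}) = (\<Sum>\<eta>\<in>ww ` Wd N. of_nat (wm (TS N) \<eta>) * J (\<xi> + delta - \<eta>))"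
  by (rule mult_count[OF w order_refl x(1,2), symmetric])
 also have "\<dots> = (\<Sum>u\<in>Wd N. J (\<xi> + delta - ww u))"
  unfolding wm_TS by (rule sum_fibres[where g = "\<lambda>\<eta>. J (\<xi> + delta - \<eta>)"]) (use finite_Wd in auto)
 finally have c: "of_nat (card {W \<in> \<W>. hwt W = \<xi>}) = (\<Sum>u\<in>Wd N. J (\<xi> + delta - ww u))" .
 obtain k where k: "(\<Sum>u\<in>Wd N. J (\<xi> + delta - ww u)) = of_nat k" "0 < k"
  using tensor_coeff[OF s x(1,2), of N] x(3,4) by blast
 have "card {W \<in> \<W>. hwt W = \<xi>} = k" using c unfolding k(1) of_nat_eq_iff .
 hence "{W \<in> \<W>. hwt W = \<xi>} \<noteq> {}" using k(2) by (intro notI) simp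
 then obtain W where "W \<in> \<W>" "hwt W = \<xi>" by blast
 thus ?thesis using odecD(2,3)[OF w] by blast
qed

lemma swT_closed:
 assumes s: "\<not> sp" and W: "opsub opT W" "W \<subseteq> TS N" and ab: "a < 2*n" "b < 2*n" "a \<noteq> b" and f: "f \<in> W"
 shows "swT a b f \<in> W"
proof -
 have sW: "csubspace W" using W(1) by (simp add: opsub_def)
 have o: "opT i j g = eT i j g" for i j g using s by (simp add: opT_def fold_coeff_def)
 have x: "xT c i j g \<in> W" if ij: "i < 2*n" "j < 2*n" "i \<noteq> j" and g: "g \<in> W" for c i j g
 proof -
  have G: "gT k i j g \<in> W" for k
  proof (induction k)
   case 0
   have "gT 0 i j g = g" by (rule ext) (rule gT_0)
   thus ?case using g by simp
  next
   case (Suc k)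
   have "gT (Suc k) i j g = (1 / of_nat (Suc k)) *\<^sub>C opT i j (gT k i j g)"
    by (rule ext) (simp add: o eT_gT[OF ij(3)] fn_ops del: of_nat_Suc)
   moreover have "opT i j (gT k i j g) \<in> W" using W(1) Suc ij by (simp add: opsub_def)
   ultimately show ?case using csub_intros(4)[OF sW] by simp
  qed
  have "xT c i j g u = (\<Sum>k\<le>N. c ^ k *\<^sub>C gT k i j g) u" for u
  proof (cases "length u = N")
   case True
   thus ?thesis by (simp add: xT_gT sum_fun_apply fn_ops)
  next
   case False
   hence "g w = 0" if "length w = length u" for w using that g W(2) by (auto simp: hil_def Wd_def)
   thus ?thesis by (simp add: xT_supp gT_supp sum_fun_apply fn_ops)
  qed
  hence "xT c i j g = (\<Sum>k\<le>N. c ^ k *\<^sub>C gT k i j g)" by (rule ext)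
  also have "\<dots> \<in> W" by (intro csub_intros(4,6)[OF sW] G)
  finally show ?thesis .
 qed
 show ?thesis unfolding swT_def by (intro x ab f ab(3)[symmetric])
qed

text \<open>The signed permutation \<open>swT\<close> preserves inner products and the submodule and
  moves weight spaces by the reflection. One inequality is enough, as the reflection is an
  involution.\<close>

lemma wm_symmetric:
 assumes s: "\<not> sp" and W: "opsub opT W" "W \<subseteq> TS N" and a: "Suc a < 2*n"
 shows "wm W (\<eta> \<circ> sw a) = wm W \<eta>"
proof -
 have sW: "csubspace W" using W(1) by (simp add: opsub_def)
 have swt: "Transposition.transpose a (Suc a) = sw a" using s by (auto simp: sw_def Transposition.transpose_def fun_eq_iff)
 let ?S = "swT a (Suc a)"
 have S: "?S f u = (-1) ^ count_list u (Suc a) * f (map (sw a) u)" for f u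
  using swT_eq[of a "Suc a" f u] swt by simp
 have le: "wm W \<eta> \<le> wm W (\<eta> \<circ> sw a)" for \<eta>
 proof -
  obtain B where B: "onb (Wd N) B (wsp ww W \<eta>)"
   using onb_exists[OF finite_Wd wsp_subspace[OF sW] wsp_TS[OF W(2)]] by blast
  have ipS: "ip (Wd N) (?S f) (?S g) = ip (Wd N) f g" for f g
  proof -
   have "ip (Wd N) (?S f) (?S g) = (\<Sum>u\<in>Wd N. f (map (sw a) u) * cnj (g (map (sw a) u)))" unfolding ip_def
   proof (rule sum.cong[OF refl])
    fix u
    have e: "(s * x) * cnj (s * y) = x * cnj y" if "s * s = 1" "cnj s = s" for s x y :: complex
    proof -
     have "(s * x) * cnj (s * y) = (s * s) * (x * cnj y)"
      unfolding complex_cnj_mult that(2) by (simp only: ac_simps)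
     thus ?thesis using that(1) by simp
    qed
    show "?S f u * cnj (?S g u) = f (map (sw a) u) * cnj (g (map (sw a) u))"
     unfolding S by (rule e[OF sg_sq]) simp
   qed
   also have "\<dots> = ip (Wd N) f g" unfolding ip_def by (rule sum.reindex_bij_betw[OF sw_Wd[OF a]])
   finally show ?thesis .
  qed
  have inj: "inj_on ?S B"
  proof (rule inj_onI)
   fix f g assume fg: "f \<in> B" "g \<in> B" "?S f = ?S g"
   hence "ip (Wd N) f g = ip (Wd N) f f" using ipS[of f g] ipS[of f f] by simp
   thus "f = g" using onbD(5)[OF B fg(1,2)] onbD(5)[OF B fg(1,1)] by (metis zero_neq_one)
  qed
  have "orthonormal (Wd N) (?S ` B)" unfolding orthonormal_def
  proof (intro conjI ballI)
   show "finite (?S ` B)" using onbD(2)[OF B] by simp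
   fix x y assume "x \<in> ?S ` B" "y \<in> ?S ` B"
   then obtain f g where fg: "f \<in> B" "g \<in> B" "x = ?S f" "y = ?S g" by blast
   thus "ip (Wd N) x y = (if x = y then 1 else 0)"
    using onbD(5)[OF B fg(1,2)] inj_on_eq_iff[OF inj fg(1,2)] by (simp add: ipS)
  qed
  moreover have "?S ` B \<subseteq> wsp ww W (\<eta> \<circ> sw a)"
  proof
   fix x assume "x \<in> ?S ` B"
   then obtain f where f: "f \<in> wsp ww W \<eta>" "x = ?S f" using onbD(3)[OF B] by blast
   have fW: "f \<in> W" using f(1) by (simp add: wsp_def)
   have xW: "?S f \<in> W" by (rule swT_closed[OF s W _ a _ fW]) (use a in auto)
   have "ww u = \<eta> \<circ> sw a" if u: "?S f u \<noteq> 0" for u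
   proof -
    have fu: "f (map (sw a) u) \<noteq> 0" using u by (simp add: S)
    have uN: "u \<in> Wd N" using subsetD[OF W(2) xW] u by (auto simp: hil_def)
    have e: "ww (map (sw a) u) = \<eta>" using f(1) fu by (simp add: wsp_def)
    have "ww u = (ww u \<circ> sw a) \<circ> sw a" using a by (simp add: fun_eq_iff)
    also have "ww u \<circ> sw a = \<eta>" using ww_map_sw[OF a, of u] uN e by (simp add: Wd_def)
    finally show ?thesis .
   qed
   thus "x \<in> wsp ww W (\<eta> \<circ> sw a)" using f xW by (simp add: wsp_def)
  qed
  ultimately have "card (?S ` B) \<le> wm W (\<eta> \<circ> sw a)"
   unfolding wm_def by (intro orthonormal_card_le_dim[OF finite_Wd wsp_subspace[OF sW] wsp_TS[OF W(2)]])
  thus ?thesis using card_image[OF inj] onb_dim[OF B] by (simp add: wm_def)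
 qed
 have "\<eta> \<circ> sw a \<circ> sw a = \<eta>" using a by (simp add: fun_eq_iff)
 thus ?thesis using le[of \<eta>] le[of "\<eta> \<circ> sw a"] by simp
qed

text \<open>The functionals at dominant weights are triangular: at a weight \<mu> of maximal height
  in the support of \<open>d\<close>, all terms with \<open>\<eta> \<noteq> \<mu>\<close> vanish.
  Symmetry makes such a \<mu> dominant.\<close>

lemma symmetric_zero:
 fixes d :: "ivec \<Rightarrow> complex"
 assumes S: "finite S" "S \<subseteq> lat" and supp: "\<And>\<eta>. d \<eta> \<noteq> 0 ==> \<eta> \<in> S"
  and sym: "\<And>a \<eta>. Suc a < 2*n ==> d (\<eta> \<circ> sw a) = d \<eta>"
  and zero: "\<And>\<mu>. \<mu> \<in> lat ==> wdec \<mu> ==> (\<Sum>\<eta>\<in>S. d \<eta> * J (\<mu> + delta - \<eta>)) = 0"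
 shows "d \<eta> = 0"
proof (rule ccontr)
 assume "d \<eta> \<noteq> 0"
 define V where "V = {\<eta>. d \<eta> \<noteq> 0}"
 have fV: "finite V" "V \<noteq> {}" using finite_subset[OF _ S(1), of V] supp \<open>d \<eta> \<noteq> 0\<close> by (auto simp: V_def)
 define M where "M = Max ((\<lambda>\<nu>. ipr \<nu> delta) ` V)"
 have "M \<in> (\<lambda>\<nu>. ipr \<nu> delta) ` V" unfolding M_def using fV by (intro Max_in) auto
 then obtain \<mu> where mu: "\<mu> \<in> V" "ipr \<mu> delta = M" by auto
 have mx: "ipr \<nu> delta \<le> ipr \<mu> delta" if "\<nu> \<in> V" for \<nu> unfolding mu(2) M_def using fV that by (intro Max_ge) auto
 have lm: "\<mu> \<in> lat" using mu(1) supp S(2) by (auto simp: V_def)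
 have "wdec \<mu>" unfolding wdec_def
 proof (intro allI impI)
  fix a assume a: "Suc a < 2*n"
  have "\<mu> \<circ> sw a \<in> V" using mu(1) sym[OF a] by (simp add: V_def)
  hence "(1 + fold_coeff) * (\<mu> (Suc a) - \<mu> a) \<le> 0" using mx ipr_sw_delta[OF lm a] by fastforce
  thus "\<mu> (Suc a) \<le> \<mu> a" by (auto simp: fold_coeff_def split: if_splits)
 qed
 have "d \<eta> * J (\<mu> + delta - \<eta>) = (if \<eta> = \<mu> then d \<mu> else 0)" for \<eta>
 proof (cases "d \<eta> = 0 \<or> J (\<mu> + delta - \<eta>) = 0 \<or> \<eta> = \<mu>")
  case True
  thus ?thesis by (auto simp: J_delta)
 next
  case False
  hence c: "\<eta> - \<mu> \<in> cone" using J_support[of "\<mu> + delta - \<eta>"] by (simp add: algebra_simps)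
  have "ipr \<eta> delta \<le> ipr \<mu> delta" using mx False by (simp add: V_def)
  hence "\<eta> - \<mu> = 0" using cone_ipr[OF c delta_lat sdec_delta] by (simp add: ipr_diff)
  thus ?thesis using False by simp
 qed
 hence "(\<Sum>\<eta>\<in>S. d \<eta> * J (\<mu> + delta - \<eta>)) = d \<mu>" using S(1) supp mu(1) by (simp add: V_def)
 thus False using zero[OF lm \<open>wdec \<mu>\<close>] mu(1) by (simp add: V_def)
qed

end

context shape
begin

text \<open>Every entry \<open>a + 2\<close> has an \<open>a + 1\<close> above it in its column,
  which is read earlier.\<close>

lemma dominated_row_tableau: "\<not> sp ==> dominated row_tableau"
proof -
 assume s: "\<not> sp"
 show ?thesis unfolding dominated_def wdec_def
 proof (intro allI impI)
  fix t a assume a: "Suc a < 2*n"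
  let ?C = "rest row_tableau t"
  have fC: "finite ?C" using finite_D by (simp add: rest_def)
  have "card {(r, c) \<in> ?C. row_tableau r c = Suc (Suc a)} \<le> card {(r, c) \<in> ?C. row_tableau r c = Suc a}"
  proof (rule card_inj_on_le[of "\<lambda>(r, c). (Suc a, c)"])
   show "inj_on (\<lambda>(r, c). (Suc a, c)) {(r, c) \<in> ?C. row_tableau r c = Suc (Suc a)}"
    by (auto simp: inj_on_def row_tableau_def split: if_splits)
   show "finite {(r, c) \<in> ?C. row_tableau r c = Suc a}" by (rule finite_subset[OF _ fC]) auto
   show "(\<lambda>(r, c). (Suc a, c)) ` {(r, c) \<in> ?C. row_tableau r c = Suc (Suc a)} \<subseteq> {(r, c) \<in> ?C. row_tableau r c = Suc a}"
    using p_anti[of "Suc a"] a by (auto simp: rest_def row_tableau_def tm_def D_def split: if_splits)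
  qed
  thus "wt row_tableau ?C (Suc a) \<le> wt row_tableau ?C a" using a s by (simp add: wt_def cnt_def fold_coeff_def)
 qed
qed

definition pvec :: "nat \<Rightarrow> int" where "pvec i = (if i < 2*n then int (p (Suc i)) else 0)"

lemma wt_row_tableau: "\<not> sp ==> wt row_tableau D = pvec"
 by (rule ext) (simp add: wt_def pvec_def cnt_row_tableau fold_coeff_def)

theorem gl_weight_multiplicity:
 assumes s: "\<not> sp" and W: "opirr W opT" "W \<subseteq> TS N" "hwt W = pvec"
 shows "wm W \<eta> = card {T \<in> sst. wt T D = \<eta>}"
proof -
 define S where "S = ww ` Wd N \<union> (\<lambda>T. wt T D) ` sst"
 define d where "d \<eta> = of_nat (wm W \<eta>) - (of_nat (card {T \<in> sst. wt T D = \<eta>}) :: complex)" for \<eta>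
 have fS: "finite S" unfolding S_def using finite_Wd finite_sst by simp
 note W' = W_sub[OF W(1,2)] W_space[OF W(1,2)]
 have "d \<eta> = 0"
 proof (rule symmetric_zero[OF fS])
  show "S \<subseteq> lat" using ww_lat wt_lat by (auto simp: S_def)
  show "\<eta> \<in> S" if "d \<eta> \<noteq> 0" for \<eta>
  proof (rule ccontr)
   assume n: "\<eta> \<notin> S"
   hence "wm W \<eta> = 0" using wm_nonzero_wt[OF W'(2) W(2)] by (auto simp: S_def)
   moreover have e: "{T \<in> sst. wt T D = \<eta>} = {}" using n by (auto simp: S_def)
   ultimately show False using that unfolding d_def e by simp
  qed
  show "d (\<eta> \<circ> sw a) = d \<eta>" if "Suc a < 2*n" for a \<eta>
   using wm_symmetric[OF s W'(1) W(2) that] wt_symmetric[OF that s] by (simp add: d_def)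
  fix \<mu> assume mu: "\<mu> \<in> lat" "wdec \<mu>"
  have "(\<Sum>\<eta>\<in>S. of_nat (wm W \<eta>) * J (\<mu> + delta - \<eta>)) = (\<Sum>\<eta>\<in>ww ` Wd N. of_nat (wm W \<eta>) * J (\<mu> + delta - \<eta>))"
   by (rule sum.mono_neutral_right[OF fS]) (use wm_nonzero_wt[OF W'(2) W(2)] in \<open>auto simp: S_def\<close>)
  also have "\<dots> = (if pvec = \<mu> then 1 else 0)" using hwt(4)[OF W(1,2) mu] W(3) by simp
  finally have 1: "(\<Sum>\<eta>\<in>S. of_nat (wm W \<eta>) * J (\<mu> + delta - \<eta>)) = (if pvec = \<mu> then 1 else 0)" .
  have "(\<Sum>\<eta>\<in>S. of_nat (card {T \<in> sst. wt T D = \<eta>}) * J (\<mu> + delta - \<eta>)) = (\<Sum>T\<in>sst. J (\<mu> + delta - wt T D))"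
   by (rule sum_fibres[OF finite_sst fS, where g = "\<lambda>\<eta>. J (\<mu> + delta - \<eta>)"]) (auto simp: S_def)
  also have "\<dots> = of_nat (card {T \<in> sst. dominated T \<and> wt T D = \<mu>})"
   by (rule stembridge_cancellation[OF J_sw J_sdec mu])
  also have "{T \<in> sst. dominated T \<and> wt T D = \<mu>} = (if pvec = \<mu> then {row_tableau} else {})"
  proof -
   have "T \<in> sst \<and> dominated T \<and> wt T D = \<mu> \<longleftrightarrow> T = row_tableau \<and> pvec = \<mu>" for T
    using dominated_gl[OF s, of T] dominated_row_tableau[OF s] row_tableau_sst wt_row_tableau[OF s] by metis
   thus ?thesis by simp
  qed
  also have "of_nat (card (if pvec = \<mu> then {row_tableau} else {})) = (if pvec = \<mu> then 1 else 0 :: complex)"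
   by simp
  finally have 2: "(\<Sum>\<eta>\<in>S. of_nat (card {T \<in> sst. wt T D = \<eta>}) * J (\<mu> + delta - \<eta>)) = (if pvec = \<mu> then 1 else 0)" .
  show "(\<Sum>\<eta>\<in>S. d \<eta> * J (\<mu> + delta - \<eta>)) = 0" unfolding d_def left_diff_distrib sum_subtractf 1 2 by simp
 qed
 thus ?thesis by (simp add: d_def)
qed

end

section \<open>Restriction from the general linear to the symplectic Lie algebra\<close>

locale branching =
 fixes n :: nat and p :: "nat \<Rightarrow> nat"
 assumes n0: "0 < n" and p0: "\<And>r. 1 \<le> r ==> r < 2*n ==> p (Suc r) \<le> p r"
begin

text \<open>Constants that do not depend on \<open>sp\<close>, such as \<open>D\<close>,
  \<open>sst\<close>, \<open>tm\<close> and \<open>Wd\<close>, are the same in both interpretations,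
  while weights, roots and operators differ.\<close>

sublocale gl: shape n False p by unfold_locales (use n0 p0 in auto)
sublocale sp: shape n True p by unfold_locales (use n0 p0 in auto)

lemma sp_simps: "\<not> gl.sp" "sp.sp" "gl.fold_coeff = 0" "sp.fold_coeff = 1"
 by (simp_all add: gl.sp_def sp.sp_def gl.fold_coeff_def sp.fold_coeff_def)

definition hfold :: "ivec \<Rightarrow> nat \<Rightarrow> int" where
 "hfold \<nu> = (\<lambda>i. if i < 2*n then \<nu> i - \<nu> (sp.bar i) else 0)"

lemma wt_hfold: "sp.wt T C = hfold (gl.wt T C)" by (simp add: hfold_def sp.wt_def gl.wt_def sp_simps fun_eq_iff)

lemma ww_hfold:
 assumes "u \<in> gl.Wd N"
 shows "sp.ww u = hfold (gl.ww u)"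
proof
 fix i
 show "sp.ww u i = hfold (gl.ww u) i"
 proof (cases "i < 2*n")
  case True
  thus ?thesis using assms sp.ww_coord[OF True, of u] gl.ww_coord[OF True, of u] gl.ww_coord[of "sp.bar i" u]
   by (simp add: hfold_def sp_simps gl.Wd_def)
 next
  case False
  moreover have "sp.ww u \<in> sp.lat" using sp.ww_lat assms by blast
  ultimately show ?thesis by (simp add: hfold_def sp.lat_def)
 qed
qed

lemma opT_hfold: "sp.opT i j f = gl.opT i j f - eps2 i j *\<^sub>C gl.opT (sp.bar j) (sp.bar i) f"
 by (simp add: sp.opT_def gl.opT_def sp_simps fun_eq_iff fn_ops)

lemma opsub_restrict:
 assumes "gl.opsub gl.opT Y"
 shows "sp.opsub sp.opT Y"
proof -
 have s: "csubspace Y" using assms by (simp add: gl.opsub_def)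
 have "sp.opT i j f \<in> Y" if "i < 2*n" "j < 2*n" "f \<in> Y" for i j f
  unfolding opT_hfold using assms that by (intro csub_intros(3,4)[OF s]) (simp_all add: gl.opsub_def)
 thus ?thesis using s by (simp add: sp.opsub_def)
qed

lemma card_D: "int (card gl.D) = (\<Sum>i<2*n. gl.pvec i)"
proof -
 have "gl.D = Sigma {1..2*n} (\<lambda>r. {1..p r})" by (auto simp: gl.D_def)
 hence "card gl.D = (\<Sum>r\<in>{1..2*n}. p r)" by simp
 also have "\<dots> = (\<Sum>i<2*n. p (Suc i))" by (rule sum.reindex_bij_witness[of _ Suc "\<lambda>r. r - 1"]) auto
 finally show ?thesis by (simp add: gl.pvec_def)
qed

text \<open>One tensor space carries both actions, so an irreducible submodule for
  \<open>gl(2n)\<close> can be decomposed again under the folded operators with respect to the same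
  inner product.\<close>

theorem tensor_branching:
 obtains Y \<W> v where "gl.opirr Y gl.opT" "gl.hwv Y gl.opT gl.pvec v" "v \<noteq> 0" "Y \<subseteq> gl.TS (card gl.D)"
  "sp.odec (card gl.D) \<W> Y"
  "\<And>\<mu>. \<mu> \<in> sp.lat ==> sp.wdec \<mu> ==> card {W \<in> \<W>. sp.hwt W = \<mu>} = card {T \<in> gl.sst. sp.dominated T \<and> sp.wt T gl.D = \<mu>}"
proof -
 define N where "N = card gl.D"
 have "gl.pvec \<in> gl.lat" by (simp add: gl.lat_def sp_simps gl.pvec_def)
 moreover have "gl.wdec gl.pvec" using p0 by (auto simp: gl.wdec_def gl.pvec_def)
 moreover have "0 \<le> gl.pvec i" for i by (simp add: gl.pvec_def)
 moreover have "(\<Sum>i<2*n. gl.pvec i) = int N" unfolding N_def by (rule card_D[symmetric])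
 ultimately have "\<exists>Y. gl.opirr Y gl.opT \<and> Y \<subseteq> gl.TS N \<and> gl.hwt Y = gl.pvec"
  by (rule gl.irr_of_weight_exists[OF sp_simps(1)])
 then obtain Y where Y: "gl.opirr Y gl.opT" "Y \<subseteq> gl.TS N" "gl.hwt Y = gl.pvec" by (elim exE conjE)
 obtain v where v: "v \<noteq> 0" "gl.hwv Y gl.opT gl.pvec v" using gl.hwt(3)[OF Y(1,2)] Y(3) by auto
 note Ys = gl.W_sub[OF Y(1,2)] gl.W_graded[OF Y(1,2)] gl.W_space[OF Y(1,2)]
 obtain \<W> where w: "sp.odec N \<W> Y" using sp.odec_exists[OF opsub_restrict[OF Ys(1)] Y(2)] by blast
 have "card {W \<in> \<W>. sp.hwt W = \<mu>} = card {T \<in> gl.sst. sp.dominated T \<and> sp.wt T gl.D = \<mu>}"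
  if mu: "\<mu> \<in> sp.lat" "sp.wdec \<mu>" for \<mu>
 proof -
  define g where "g \<eta> = sp.J (\<mu> + sp.delta - \<eta>)" for \<eta>
  let ?X = "gl.Wd N"
  have mult: "gl.wm Y \<nu> = card {T \<in> gl.sst. gl.wt T gl.D = \<nu>}" for \<nu>
   by (rule gl.gl_weight_multiplicity[OF sp_simps(1) Y])
  \<comment> \<open>The content of a tableau is the weight of a word because its multiplicity in
    \<open>Y\<close> is not 0.\<close>
  have im: "(\<lambda>T. gl.wt T gl.D) ` gl.sst \<subseteq> gl.ww ` ?X"
  proof
   fix \<nu> assume "\<nu> \<in> (\<lambda>T. gl.wt T gl.D) ` gl.sst"
   hence "{T \<in> gl.sst. gl.wt T gl.D = \<nu>} \<noteq> {}" by auto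
   hence "gl.wm Y \<nu> \<noteq> 0" unfolding mult using gl.finite_sst by simp
   thus "\<nu> \<in> gl.ww ` ?X" by (rule gl.wm_nonzero_wt[OF Ys(3) Y(2)])
  qed
  have "of_nat (card {W \<in> \<W>. sp.hwt W = \<mu>}) = (\<Sum>\<eta>\<in>sp.ww ` ?X. of_nat (sp.wm Y \<eta>) * g \<eta>)"
   unfolding g_def by (rule sp.mult_count[OF w Y(2) mu, symmetric])
  also have "\<dots> = (\<Sum>\<eta>\<in>sp.ww ` ?X. \<Sum>\<nu> | \<nu> \<in> gl.ww ` ?X \<and> hfold \<nu> = \<eta>. of_nat (gl.wm Y \<nu>) * g (hfold \<nu>))"
  proof (rule sum.cong[OF refl])
   fix \<eta>
   have "sp.wm Y \<eta> = (\<Sum>\<nu> | \<nu> \<in> gl.ww ` ?X \<and> hfold \<nu> = \<eta>. gl.wm Y \<nu>)"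
    unfolding sp.wm_def gl.wm_def by (rule dim_wsp_coarse[OF gl.finite_Wd Ys(2) Y(2)]) (rule ww_hfold)
   thus "of_nat (sp.wm Y \<eta>) * g \<eta> = (\<Sum>\<nu> | \<nu> \<in> gl.ww ` ?X \<and> hfold \<nu> = \<eta>. of_nat (gl.wm Y \<nu>) * g (hfold \<nu>))"
    by (simp add: sum_distrib_right)
  qed
  also have "\<dots> = (\<Sum>\<nu>\<in>gl.ww ` ?X. of_nat (gl.wm Y \<nu>) * g (hfold \<nu>))"
   by (rule sum.group) (use gl.finite_Wd ww_hfold in auto)
  also have "\<dots> = (\<Sum>T\<in>gl.sst. g (hfold (gl.wt T gl.D)))"
   unfolding mult by (rule gl.sum_fibres[OF gl.finite_sst _ im]) (use gl.finite_Wd in simp)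
  also have "\<dots> = (\<Sum>T\<in>gl.sst. sp.J (\<mu> + sp.delta - sp.wt T gl.D))" unfolding g_def wt_hfold ..
  also have "\<dots> = of_nat (card {T \<in> gl.sst. sp.dominated T \<and> sp.wt T gl.D = \<mu>})"
   by (rule sp.stembridge_cancellation[OF sp.J_sw sp.J_sdec mu])
  finally show ?thesis unfolding of_nat_eq_iff .
 qed
 from that[OF Y(1) v(2,1) Y(2)[unfolded N_def] w[unfolded N_def] this] show thesis .
qed

end

section \<open>Matrix units and the involution\<close>

definition eu :: "nat \<Rightarrow> nat \<Rightarrow> nat \<Rightarrow> complex mat" where "eu n i j = E_unit n (Suc i) (Suc j)"

definition sgm :: "nat \<Rightarrow> complex mat \<Rightarrow> complex mat" where
 "sgm n x = mat (2*n) (2*n) (\<lambda>(a, b). - eps2 a b * x $$ (2*n - Suc b, 2*n - Suc a))"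

lemma glI: "x \<in> gl n \<longleftrightarrow> dim_row x = 2*n \<and> dim_col x = 2*n" by (auto simp: gl_def)

lemma eu_gl [simp]: "eu n i j \<in> gl n" by (simp add: glI eu_def E_unit_def)

lemma eu_index [simp]: "a < 2*n ==> b < 2*n ==> eu n i j $$ (a, b) = (if a = i \<and> b = j then 1 else 0)"
 "dim_row (eu n i j) = 2*n" "dim_col (eu n i j) = 2*n" by (simp_all add: eu_def E_unit_def)

lemma sgm_index [simp]: "a < 2*n ==> b < 2*n ==> sgm n x $$ (a, b) = - eps2 a b * x $$ (2*n - Suc b, 2*n - Suc a)"
 "dim_row (sgm n x) = 2*n" "dim_col (sgm n x) = 2*n" by (simp_all add: sgm_def)

lemma sgm_gl [simp]: "sgm n x \<in> gl n" by (simp add: glI)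

lemma gl_closed [simp]: "x \<in> gl n ==> y \<in> gl n ==> x + y \<in> gl n" "x \<in> gl n ==> c \<cdot>\<^sub>m x \<in> gl n"
 "x \<in> gl n ==> y \<in> gl n ==> x - y \<in> gl n" "x \<in> gl n ==> y \<in> gl n ==> lie_bracket x y \<in> gl n"
 "0\<^sub>m (2*n) (2*n) \<in> gl n" by (simp_all add: glI lie_bracket_def)

lemma sgm_add: "x \<in> gl n ==> y \<in> gl n ==> sgm n (x + y) = sgm n x + sgm n y"
 by (rule eq_matI) (auto simp: glI algebra_simps)

lemma sgm_scale: "x \<in> gl n ==> sgm n (c \<cdot>\<^sub>m x) = c \<cdot>\<^sub>m sgm n x" by (rule eq_matI) (auto simp: glI)

lemma eps2_rev:
 assumes "a < 2*n" "b < 2*n" shows "eps2 (2*n - Suc b) (2*n - Suc a) = eps2 a b"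
proof -
 have "even (2*n - Suc b + (2*n - Suc a)) \<longleftrightarrow> even (a + b)" using assms by presburger
 thus ?thesis unfolding eps2_def by (metis neg_one_even_power neg_one_odd_power)
qed

lemma sgm_sgm: "x \<in> gl n ==> sgm n (sgm n x) = x"
proof (rule eq_matI)
 assume x: "x \<in> gl n"
 fix a b assume "a < dim_row x" "b < dim_col x"
 hence ab: "a < 2*n" "b < 2*n" using x by (auto simp: glI)
 thus "sgm n (sgm n x) $$ (a, b) = x $$ (a, b)" using eps2_mult(5)[of a b] by (simp add: eps2_rev flip: mult.assoc)
qed (auto simp: glI)

lemma lie_bracket_index:
 assumes "x \<in> gl n" "y \<in> gl n" "a < 2*n" "b < 2*n"
 shows "lie_bracket x y $$ (a, b) = (\<Sum>k<2*n. x $$ (a, k) * y $$ (k, b) - y $$ (a, k) * x $$ (k, b))"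
 using assms by (simp add: lie_bracket_def glI scalar_prod_def sum_subtractf atLeast0LessThan)

lemma sgm_bracket:
 assumes x: "x \<in> gl n" "y \<in> gl n"
 shows "sgm n (lie_bracket x y) = lie_bracket (sgm n x) (sgm n y)"
proof (rule eq_matI)
 fix a b assume "a < dim_row (lie_bracket (sgm n x) (sgm n y))" "b < dim_col (lie_bracket (sgm n x) (sgm n y))"
 hence ab: "a < 2*n" "b < 2*n" by (auto simp: lie_bracket_def)
 have k: "2*n - Suc (2*n - Suc k) = k" "2*n - Suc k < 2*n" if "k < 2*n" for k using that by auto
 have "lie_bracket (sgm n x) (sgm n y) $$ (a, b)
   = (\<Sum>k<2*n. sgm n x $$ (a, k) * sgm n y $$ (k, b) - sgm n y $$ (a, k) * sgm n x $$ (k, b))"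
  by (rule lie_bracket_index) (use ab in auto)
 also have "\<dots> = (\<Sum>k<2*n. eps2 a b * (y $$ (2*n - Suc b, 2*n - Suc k) * x $$ (2*n - Suc k, 2*n - Suc a)
   - x $$ (2*n - Suc b, 2*n - Suc k) * y $$ (2*n - Suc k, 2*n - Suc a)))"
 proof (rule sum.cong[OF refl])
  fix k assume "k \<in> {..<2*n}"
  hence kk: "k < 2*n" by simp
  have e: "eps2 a k * p * (eps2 k b * q) = eps2 a b * (q * p)" for p q
   using eps2_mult(1)[of a k b] by (metis mult.assoc mult.commute mult.left_commute)
  show "sgm n x $$ (a, k) * sgm n y $$ (k, b) - sgm n y $$ (a, k) * sgm n x $$ (k, b)
   = eps2 a b * (y $$ (2*n - Suc b, 2*n - Suc k) * x $$ (2*n - Suc k, 2*n - Suc a)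
   - x $$ (2*n - Suc b, 2*n - Suc k) * y $$ (2*n - Suc k, 2*n - Suc a))"
   using ab kk by (simp add: e right_diff_distrib)
 qed
 also have "\<dots> = (\<Sum>k<2*n. eps2 a b * (y $$ (2*n - Suc b, k) * x $$ (k, 2*n - Suc a)
   - x $$ (2*n - Suc b, k) * y $$ (k, 2*n - Suc a)))" by (rule sum.nat_diff_reindex)
 also have "\<dots> = - eps2 a b * lie_bracket x y $$ (2*n - Suc b, 2*n - Suc a)"
 proof -
  have ab': "2*n - Suc b < 2*n" "2*n - Suc a < 2*n" using ab by auto
  show ?thesis
   unfolding lie_bracket_index[OF x ab'] sum_distrib_left by (rule sum.cong[OF refl]) (simp add: right_diff_distrib)
 qed
 finally show "sgm n (lie_bracket x y) $$ (a, b) = lie_bracket (sgm n x) (sgm n y) $$ (a, b)" using ab by simp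
qed (auto simp: lie_bracket_def)

lemma sgm_eu:
 assumes "i < 2*n" "j < 2*n"
 shows "sgm n (eu n i j) = (- eps2 i j) \<cdot>\<^sub>m eu n (2*n - Suc j) (2*n - Suc i)"
proof (rule eq_matI)
 fix a b assume "a < dim_row ((- eps2 i j) \<cdot>\<^sub>m eu n (2*n - Suc j) (2*n - Suc i))"
  "b < dim_col ((- eps2 i j) \<cdot>\<^sub>m eu n (2*n - Suc j) (2*n - Suc i))"
 hence ab: "a < 2*n" "b < 2*n" by auto
 have "2*n - Suc b = i \<and> 2*n - Suc a = j \<longleftrightarrow> a = 2*n - Suc j \<and> b = 2*n - Suc i" using ab assms by auto
 thus "sgm n (eu n i j) $$ (a, b) = ((- eps2 i j) \<cdot>\<^sub>m eu n (2*n - Suc j) (2*n - Suc i)) $$ (a, b)"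
  using ab eps2_rev[OF assms] by auto
qed auto

lemma eu_bracket:
 assumes "k < 2*n" "l < 2*n" "i < 2*n" "j < 2*n"
 shows "lie_bracket (eu n k l) (eu n i j)
  = (if i = l then eu n k j else 0\<^sub>m (2*n) (2*n)) - (if j = k then eu n i l else 0\<^sub>m (2*n) (2*n))"
proof (rule eq_matI)
 fix a b assume "a < dim_row ((if i = l then eu n k j else 0\<^sub>m (2*n) (2*n)) - (if j = k then eu n i l else 0\<^sub>m (2*n) (2*n)))"
  "b < dim_col ((if i = l then eu n k j else 0\<^sub>m (2*n) (2*n)) - (if j = k then eu n i l else 0\<^sub>m (2*n) (2*n)))"
 hence ab: "a < 2*n" "b < 2*n" by (auto split: if_splits)
 have s: "(\<Sum>c<2*n. eu n p q $$ (a, c) * eu n r t $$ (c, b)) = (if a = p \<and> q = r \<and> b = t then 1 else 0)"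
  if "q < 2*n" for p q r t
 proof -
  have "(\<Sum>c<2*n. eu n p q $$ (a, c) * eu n r t $$ (c, b)) = (\<Sum>c<2*n. if c = q then (if a = p \<and> q = r \<and> b = t then 1 else 0) else 0)"
   by (rule sum.cong[OF refl]) (simp add: ab)
  thus ?thesis using that by simp
 qed
 show "lie_bracket (eu n k l) (eu n i j) $$ (a, b)
  = ((if i = l then eu n k j else 0\<^sub>m (2*n) (2*n)) - (if j = k then eu n i l else 0\<^sub>m (2*n) (2*n))) $$ (a, b)"
  unfolding lie_bracket_index[OF eu_gl eu_gl ab] sum_subtractf s[OF assms(2)] s[OF assms(4)]
  by (cases "i = l"; cases "j = k"; simp add: ab)
qed (auto simp: lie_bracket_def)

lemma lie_bracket_lin1:
 assumes "x \<in> gl n" "y \<in> gl n" "z \<in> gl n"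
 shows "lie_bracket (x + c \<cdot>\<^sub>m y) z = lie_bracket x z + c \<cdot>\<^sub>m lie_bracket y z"
proof (rule eq_matI)
 fix a b assume "a < dim_row (lie_bracket x z + c \<cdot>\<^sub>m lie_bracket y z)" "b < dim_col (lie_bracket x z + c \<cdot>\<^sub>m lie_bracket y z)"
 hence ab: "a < 2*n" "b < 2*n" using assms by (auto simp: lie_bracket_def glI)
 have "(lie_bracket x z + c \<cdot>\<^sub>m lie_bracket y z) $$ (a, b) = lie_bracket x z $$ (a, b) + c * lie_bracket y z $$ (a, b)"
  using ab assms by (simp add: lie_bracket_def glI)
 thus "lie_bracket (x + c \<cdot>\<^sub>m y) z $$ (a, b) = (lie_bracket x z + c \<cdot>\<^sub>m lie_bracket y z) $$ (a, b)"
  using ab assms unfolding lie_bracket_index[OF gl_closed(1)[OF assms(1) gl_closed(2)[OF assms(2)]] assms(3) ab]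
   lie_bracket_index[OF assms(1,3) ab] lie_bracket_index[OF assms(2,3) ab]
  by (simp add: glI sum_distrib_left sum.distrib[symmetric] algebra_simps)
qed (use assms in \<open>auto simp: lie_bracket_def glI\<close>)

lemma lie_bracket_add2:
 assumes "x \<in> gl n" "y \<in> gl n" "z \<in> gl n"
 shows "lie_bracket z (x + y) = lie_bracket z x + lie_bracket z y"
proof (rule eq_matI)
 fix a b assume "a < dim_row (lie_bracket z x + lie_bracket z y)" "b < dim_col (lie_bracket z x + lie_bracket z y)"
 hence ab: "a < 2*n" "b < 2*n" using assms by (auto simp: lie_bracket_def glI)
 have "(lie_bracket z x + lie_bracket z y) $$ (a, b) = lie_bracket z x $$ (a, b) + lie_bracket z y $$ (a, b)"
  using ab assms by (simp add: lie_bracket_def glI)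
 thus "lie_bracket z (x + y) $$ (a, b) = (lie_bracket z x + lie_bracket z y) $$ (a, b)"
  using ab assms unfolding lie_bracket_index[OF assms(3) gl_closed(1)[OF assms(1,2)] ab]
   lie_bracket_index[OF assms(3,1) ab] lie_bracket_index[OF assms(3,2) ab]
  by (simp add: glI sum.distrib[symmetric] algebra_simps)
qed (use assms in \<open>auto simp: lie_bracket_def glI\<close>)

lemma lin_expand:
 fixes f :: "complex mat \<Rightarrow> 'v::complex_vector"
 assumes add: "\<And>x y. x \<in> gl n ==> y \<in> gl n ==> f (x + y) = f x + f y"
  and scale: "\<And>c x. x \<in> gl n ==> f (c \<cdot>\<^sub>m x) = c *\<^sub>C f x" and x: "x \<in> gl n"
 shows "f x = (\<Sum>i<2*n. \<Sum>j<2*n. x $$ (i, j) *\<^sub>C f (eu n i j))"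
proof -
 \<comment> \<open>The matrix cut down to a set of positions, so that it can be built up one entry
   at a time.\<close>
 define r where "r A = mat (2*n) (2*n) (\<lambda>ab. if ab \<in> A then x $$ ab else 0)" for A
 have r_gl: "r A \<in> gl n" for A by (simp add: r_def glI)
 have "f (r A) = (\<Sum>q\<in>A. x $$ q *\<^sub>C f (eu n (fst q) (snd q)))" if "finite A" "A \<subseteq> {..<2*n} \<times> {..<2*n}" for A
  using that
 proof (induction A rule: finite_induct)
  case empty
  have "r {} = 0 \<cdot>\<^sub>m r {}" by (rule eq_matI) (auto simp: r_def)
  hence "f (r {}) = f (0 \<cdot>\<^sub>m r {})" by (rule arg_cong)
  thus ?case using scale[OF r_gl, of 0 "{}"] by simp
 next
  case (insert q A)
  have "r (insert q A) = r A + x $$ q \<cdot>\<^sub>m eu n (fst q) (snd q)" using insert by (intro eq_matI) (auto simp: r_def)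
  thus ?case using insert by (simp add: add r_gl scale add.commute)
 qed
 from this[of "{..<2*n} \<times> {..<2*n}"] have "f (r ({..<2*n} \<times> {..<2*n})) = (\<Sum>i<2*n. \<Sum>j<2*n. x $$ (i, j) *\<^sub>C f (eu n i j))"
  by (simp add: sum.cartesian_product case_prod_unfold)
 moreover have "r ({..<2*n} \<times> {..<2*n}) = x" using x by (intro eq_matI) (auto simp: r_def glI)
 ultimately show ?thesis by simp
qed

section \<open>Modules over the two Lie algebras as operator modules\<close>

lemma lie_moduleD:
 assumes "lie_module \<gg> M"
 shows "csubspace (mspace M)" "\<And>x v. x \<in> \<gg> ==> v \<in> mspace M ==> mact M x v \<in> mspace M"
  "\<And>x u v. x \<in> \<gg> ==> u \<in> mspace M ==> v \<in> mspace M ==> mact M x (u + v) = mact M x u + mact M x v"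
  "\<And>x c v. x \<in> \<gg> ==> v \<in> mspace M ==> mact M x (c *\<^sub>C v) = c *\<^sub>C mact M x v"
  "\<And>x y v. x \<in> \<gg> ==> y \<in> \<gg> ==> v \<in> mspace M ==> mact M (x + y) v = mact M x v + mact M y v"
  "\<And>c x v. x \<in> \<gg> ==> v \<in> mspace M ==> mact M (c \<cdot>\<^sub>m x) v = c *\<^sub>C mact M x v"
  "\<And>x y v. x \<in> \<gg> ==> y \<in> \<gg> ==> v \<in> mspace M ==>
    mact M (lie_bracket x y) v = mact M x (mact M y v) - mact M y (mact M x v)"
 using assms by (simp_all add: lie_module_def)

context folding
begin

definition galg :: "complex mat set" where
 "galg = {x \<in> gl n. sp \<longrightarrow> sgm n x = x}"

text \<open>Not divided by 2, so that \<open>Fm i i\<close> acts by the coordinates of a folded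
  weight; on fixed points it is multiplication by \<open>1 + fold_coeff\<close>.\<close>

definition Asym :: "complex mat \<Rightarrow> complex mat" where
 "Asym x = (if sp then x + sgm n x else x)"

definition Fm :: "nat \<Rightarrow> nat \<Rightarrow> complex mat" where "Fm i j = Asym (eu n i j)"

abbreviation mF :: "'v::complex_vector lie_rep \<Rightarrow> nat \<Rightarrow> nat \<Rightarrow> 'v \<Rightarrow> 'v" where
 "mF M i j \<equiv> mact M (Fm i j)"

lemma add_gl_commute: "x \<in> gl n ==> y \<in> gl n ==> x + y = y + x" by (rule eq_matI) (auto simp: glI)

lemma Asym_galg: "x \<in> gl n ==> Asym x \<in> galg" by (simp add: galg_def Asym_def sgm_add sgm_sgm add_gl_commute)

lemma galg_gl: "x \<in> galg ==> x \<in> gl n" by (simp add: galg_def)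

lemma Fm_galg: "Fm i j \<in> galg" by (simp add: Fm_def Asym_galg)

lemma Asym_add: "x \<in> gl n ==> y \<in> gl n ==> Asym (x + y) = Asym x + Asym y"
 by (rule eq_matI) (auto simp: Asym_def sgm_add glI algebra_simps)

lemma Asym_scale: "x \<in> gl n ==> Asym (c \<cdot>\<^sub>m x) = c \<cdot>\<^sub>m Asym x"
 by (rule eq_matI) (auto simp: Asym_def sgm_scale glI algebra_simps)

lemma Asym_fixed: "x \<in> galg ==> Asym x = (1 + of_int fold_coeff) \<cdot>\<^sub>m x"
 by (rule eq_matI) (auto simp: Asym_def galg_def fold_coeff_def glI)

text \<open>The involution fixes \<open>Asym x\<close>, so bracketing with this element commutes
  with symmetrization.\<close>

lemma Asym_bracket:
 assumes "x \<in> gl n" "y \<in> gl n"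
 shows "lie_bracket (Asym x) (Asym y) = Asym (lie_bracket (Asym x) y)"
proof (cases sp)
 case True
 have X: "Asym x \<in> gl n" "sgm n (Asym x) = Asym x" using Asym_galg[OF assms(1)] True by (auto simp: galg_def)
 have "lie_bracket (Asym x) (Asym y) = lie_bracket (Asym x) y + lie_bracket (Asym x) (sgm n y)"
  using lie_bracket_add2[OF assms(2) sgm_gl[of n y] X(1)] True by (simp add: Asym_def[of y])
 also have "lie_bracket (Asym x) (sgm n y) = sgm n (lie_bracket (Asym x) y)"
  using sgm_bracket[OF X(1) assms(2)] X(2) by simp
 finally show ?thesis using True by (simp add: Asym_def[of "lie_bracket (Asym x) y"])
qed (simp add: Asym_def)

lemma Fm_eq: "i < 2*n ==> j < 2*n ==>
  Fm i j = (if sp then eu n i j + (- eps2 i j) \<cdot>\<^sub>m eu n (bar j) (bar i) else eu n i j)"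
 by (simp add: Fm_def Asym_def sgm_eu bar_def)

lemma act_Asym:
 assumes M: "lie_module galg M" and v: "v \<in> mspace M"
 shows "x \<in> gl n ==> y \<in> gl n ==> mact M (Asym (x + y)) v = mact M (Asym x) v + mact M (Asym y) v"
  "x \<in> gl n ==> mact M (Asym (c \<cdot>\<^sub>m x)) v = c *\<^sub>C mact M (Asym x) v"
  "x \<in> gl n ==> y \<in> gl n ==> mact M (Asym (x - y)) v = mact M (Asym x) v - mact M (Asym y) v"
  "mact M (Asym (if P then x else 0\<^sub>m (2*n) (2*n))) v = (if P then mact M (Asym x) v else 0)"
proof -
 show a: "mact M (Asym (x + y)) v = mact M (Asym x) v + mact M (Asym y) v" if "x \<in> gl n" "y \<in> gl n" for x y
  using that v by (simp add: Asym_add lie_moduleD(5)[OF M] Asym_galg)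
 show s: "mact M (Asym (c \<cdot>\<^sub>m x)) v = c *\<^sub>C mact M (Asym x) v" if "x \<in> gl n" for c x
  using that v by (simp add: Asym_scale lie_moduleD(6)[OF M] Asym_galg)
 show "mact M (Asym (x - y)) v = mact M (Asym x) v - mact M (Asym y) v" if xy: "x \<in> gl n" "y \<in> gl n"
 proof -
  have "x - y = x + (-1) \<cdot>\<^sub>m y" by (rule eq_matI) (use xy in \<open>auto simp: glI\<close>)
  thus ?thesis using xy by (simp add: a s complex_vector.scale_minus_left scaleC_one)
 qed
 have "0\<^sub>m (2*n) (2*n) = 0 \<cdot>\<^sub>m (0\<^sub>m (2*n) (2*n) :: complex mat)" by (rule eq_matI) auto
 hence "mact M (Asym (0\<^sub>m (2*n) (2*n))) v = 0" using s[of "0\<^sub>m (2*n) (2*n)" 0] by simp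
 thus "mact M (Asym (if P then x else 0\<^sub>m (2*n) (2*n))) v = (if P then mact M (Asym x) v else 0)" by simp
qed

theorem module_opmod:
 assumes M: "lie_module galg M"
 shows "opmod (mspace M) (mF M)" unfolding opmod_def
proof (intro conjI allI impI ballI)
 show "csubspace (mspace M)" by (rule lie_moduleD(1)[OF M])
 show "mF M i j v \<in> mspace M" if "v \<in> mspace M" for i j v by (rule lie_moduleD(2)[OF M Fm_galg that])
 show "mF M i j (v + w) = mF M i j v + mF M i j w" if "v \<in> mspace M" "w \<in> mspace M" for i j v w
  by (rule lie_moduleD(3)[OF M Fm_galg that])
 show "mF M i j (c *\<^sub>C v) = c *\<^sub>C mF M i j v" if "v \<in> mspace M" for i j v c
  by (rule lie_moduleD(4)[OF M Fm_galg that])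
 fix i j v assume ij: "i < 2*n" "j < 2*n" and v: "v \<in> mspace M"
 note A = act_Asym[OF M v]
 have br: "mact M (Asym (lie_bracket (eu n k l) (eu n i j))) v = (if i = l then mF M k j v else 0) - (if j = k then mF M i l v else 0)"
  if "k < 2*n" "l < 2*n" for k l
  using A(3)[of "if i = l then eu n k j else 0\<^sub>m (2*n) (2*n)" "if j = k then eu n i l else 0\<^sub>m (2*n) (2*n)"]
   A(4)[of "i = l"] A(4)[of "j = k"] by (simp add: eu_bracket[OF that ij] Fm_def del: if_split)
 show "mF M k l (mF M i j v) = mF M i j (mF M k l v) + bracket_value (mF M) k l i j v" if kl: "k < 2*n" "l < 2*n" for k l
 proof -
  have b: "bar k < 2*n" "bar l < 2*n" by auto
  have "mF M k l (mF M i j v) - mF M i j (mF M k l v) = mact M (lie_bracket (Fm k l) (Fm i j)) v"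
   by (rule lie_moduleD(7)[OF M Fm_galg Fm_galg v, symmetric])
  also have "lie_bracket (Fm k l) (Fm i j) = Asym (lie_bracket (Fm k l) (eu n i j))"
   unfolding Fm_def by (rule Asym_bracket) auto
  also have "mact M (Asym (lie_bracket (Fm k l) (eu n i j))) v = bracket_value (mF M) k l i j v"
  proof (cases sp)
   case False
   thus ?thesis by (simp add: Fm_eq[OF kl] br[OF kl] bracket_value_def)
  next
   case True
   have "lie_bracket (Fm k l) (eu n i j) = lie_bracket (eu n k l) (eu n i j) + (- eps2 k l) \<cdot>\<^sub>m lie_bracket (eu n (bar l) (bar k)) (eu n i j)"
    unfolding Fm_eq[OF kl] if_P[OF True] by (rule lie_bracket_lin1[OF eu_gl eu_gl eu_gl])
   thus ?thesis using True
    by (simp add: A(1,2) br[OF kl] br[OF b(2,1)] bracket_value_def complex_vector.scale_minus_left)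
  qed
  finally show ?thesis by (simp add: algebra_simps)
 qed
 assume s: sp
 have "eu n (bar j) (bar i) = (- eps2 i j) \<cdot>\<^sub>m sgm n (eu n i j)"
  using eps2_mult(5)[of i j] by (intro eq_matI) (simp_all add: sgm_eu[OF ij] bar_def flip: mult.assoc)
 moreover have "Asym (sgm n (eu n i j)) = Asym (eu n i j)" using s by (simp add: Asym_def sgm_sgm add_gl_commute)
 ultimately show "mF M (bar j) (bar i) v = - (eps2 i j *\<^sub>C mF M i j v)"
  unfolding Fm_def by (simp add: A(2) complex_vector.scale_minus_left)
qed

text \<open>The matrices \<open>Fm i j\<close> span the algebra, which carries statements about the
  operators over to all of its elements.\<close>

lemma act_expand:
 assumes M: "lie_module galg M" and x: "x \<in> galg" and v: "v \<in> mspace M"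
 shows "mact M x v = (1 / (1 + of_int fold_coeff)) *\<^sub>C (\<Sum>i<2*n. \<Sum>j<2*n. x $$ (i, j) *\<^sub>C mF M i j v)"
proof -
 have c: "(1 + of_int fold_coeff) \<noteq> (0::complex)" by (simp add: fold_coeff_def)
 have "mact M (Asym x) v = (\<Sum>i<2*n. \<Sum>j<2*n. x $$ (i, j) *\<^sub>C mF M i j v)" unfolding Fm_def
  by (rule lin_expand[where f = "\<lambda>x. mact M (Asym x) v"]) (use galg_gl[OF x] in \<open>auto simp: act_Asym[OF M v]\<close>)
 moreover have "mact M (Asym x) v = (1 + of_int fold_coeff) *\<^sub>C mact M x v"
  unfolding Asym_fixed[OF x] by (rule lie_moduleD(6)[OF M x v])
 ultimately show ?thesis using c by (metis (no_types, lifting) divide_self_if mult.commute scaleC_one scaleC_scaleC times_divide_eq_right mult_1_right)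
qed

lemma submodule_iff:
 assumes M: "lie_module galg M"
 shows "lie_submodule galg M W \<longleftrightarrow> opsub (mF M) W \<and> W \<subseteq> mspace M"
proof
 assume "lie_submodule galg M W"
 thus "opsub (mF M) W \<and> W \<subseteq> mspace M" by (simp add: lie_submodule_def opsub_def Fm_galg)
next
 assume W: "opsub (mF M) W \<and> W \<subseteq> mspace M"
 hence s: "csubspace W" by (simp add: opsub_def)
 have "mact M x v \<in> W" if x: "x \<in> galg" and v: "v \<in> W" for x v
 proof -
  have "v \<in> mspace M" using W v by blast
  from act_expand[OF M x this] show ?thesis using W v by (auto simp: opsub_def intro!: csub_intros(4,6)[OF s])
 qed
 thus "lie_submodule galg M W" using W s by (simp add: lie_submodule_def)
qed

lemma irreducible_iff:
 assumes M: "lie_module galg M"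
 shows "irreducible_module galg M \<longleftrightarrow> opirr (mspace M) (mF M)"
 unfolding irreducible_module_def opirr_def submodule_iff[OF M] using M module_opmod[OF M] by simp

lemma sub_rep_simps [simp]: "mspace (sub_rep M W) = W" "mact (sub_rep M W) = mact M" by (simp_all add: sub_rep_def)

lemma sub_rep_module:
 assumes "lie_module galg M" "lie_submodule galg M W"
 shows "lie_module galg (sub_rep M W)"
proof -
 have W: "csubspace W" "W \<subseteq> mspace M" "\<And>x v. x \<in> galg ==> v \<in> W ==> mact M x v \<in> W"
  using assms(2) by (auto simp: lie_submodule_def)
 note d = lie_moduleD[OF assms(1)]
 show ?thesis unfolding lie_module_def sub_rep_simps
  using W(1,3) d(3-7) subsetD[OF W(2)] by (intro conjI ballI allI) auto
qed

lemma opiso_module_iso: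
 assumes M: "lie_module galg M" and M': "lie_module galg M'" and i: "opiso (mspace M) (mF M) (mspace M') (mF M') \<phi>"
  and x: "x \<in> galg" and v: "v \<in> mspace M"
 shows "\<phi> (mact M x v) = mact M' x (\<phi> v)"
proof -
 have b: "bij_betw \<phi> (mspace M) (mspace M')" and a: "\<And>u v. u \<in> mspace M ==> v \<in> mspace M ==> \<phi> (u + v) = \<phi> u + \<phi> v"
  and c: "\<And>c v. v \<in> mspace M ==> \<phi> (c *\<^sub>C v) = c *\<^sub>C \<phi> v"
  and f: "\<And>i j v. i < 2*n ==> j < 2*n ==> v \<in> mspace M ==> \<phi> (mF M i j v) = mF M' i j (\<phi> v)"
  using i by (simp_all add: opiso_def)
 note sM = lie_moduleD(1)[OF M]
 have z: "\<phi> 0 = 0" using c[of 0 0] csub_intros(1)[OF sM] by simp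
 have s: "\<phi> (\<Sum>i\<in>A. g i) = (\<Sum>i\<in>A. \<phi> (g i))" if "\<And>i. i \<in> A ==> g i \<in> mspace M" for g and A :: "nat set" using that
 proof (induction A rule: infinite_finite_induct)
  case (insert i A)
  hence "(\<Sum>i\<in>A. g i) \<in> mspace M" by (intro csub_intros(6)[OF sM]) auto
  thus ?case using insert a by simp
 qed (simp_all add: z)
 have pv: "\<phi> v \<in> mspace M'" using b v by (auto simp: bij_betw_def)
 have cl: "mF M i j v \<in> mspace M" for i j by (rule lie_moduleD(2)[OF M Fm_galg v])
 have cl2: "x $$ (i, j) *\<^sub>C mF M i j v \<in> mspace M" for i j by (rule csub_intros(4)[OF sM cl])
 have cl3: "(\<Sum>j\<in>B. x $$ (i, j) *\<^sub>C mF M i j v) \<in> mspace M" for i and B :: "nat set" by (rule csub_intros(6)[OF sM cl2])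
 have "\<phi> (\<Sum>i<2*n. \<Sum>j<2*n. x $$ (i, j) *\<^sub>C mF M i j v) = (\<Sum>i<2*n. \<Sum>j<2*n. x $$ (i, j) *\<^sub>C mF M' i j (\<phi> v))"
  by (simp add: s cl3 cl2 c cl f v)
 thus ?thesis unfolding act_expand[OF M x v] act_expand[OF M' x pv] by (simp add: c csub_intros(6)[OF sM cl3])
qed

lemma opiso_imp_module_iso:
 assumes "lie_module galg M" "lie_module galg M'" "opiso (mspace M) (mF M) (mspace M') (mF M') \<phi>"
 shows "module_iso galg M M'" unfolding module_iso_def using assms(3) opiso_module_iso[OF assms]
 by (intro exI[of _ \<phi>]) (simp add: opiso_def)

lemma module_iso_imp_opiso:
 assumes "module_iso galg M M'"
 shows "\<exists>\<phi>. opiso (mspace M) (mF M) (mspace M') (mF M') \<phi>"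
 using assms unfolding module_iso_def opiso_def using Fm_galg by metis

section \<open>Highest weight vectors\<close>

text \<open>Up to a nonzero factor \<open>F i (Suc j)\<close> is the bracket of \<open>F i j\<close>
  and \<open>F j (Suc j)\<close>. Folding adds a term when an index meets a mirror image; then the
  factor is 2.\<close>

lemma simple_roots_kill:
 assumes M: "opmod S F" and v: "v \<in> S" and k: "\<And>a. Suc a < 2*n ==> F a (Suc a) v = 0"
 shows "i < j ==> j < 2*n ==> F i j v = 0"
proof (induction j)
 case (Suc j)
 show ?case
 proof (cases "i = j")
  case True thus ?thesis using k[of j] Suc.prems by simp
 next
  case False
  hence ij: "i < j" "i < 2*n" "j < 2*n" "Suc j < 2*n" using Suc.prems by auto
  have 0: "F i j v = 0" using Suc.IH ij by simp
  have bb: "bar (bar i) = i" "bar (bar j) = j" using ij by simp_all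
  have e: "F i j (F j (Suc j) v) = F j (Suc j) (F i j v) + bracket_value F i j j (Suc j) v"
   by (rule opmodD(5)[OF M ij(2,3,3,4) v])
  have "bracket_value F i j j (Suc j) v = 0"
   using e k[OF ij(4)] opmod_zero[OF M ij(2,3)] opmod_zero[OF M ij(3,4)] 0 by simp
  moreover have "\<exists>c. c \<noteq> 0 \<and> bracket_value F i j j (Suc j) v = c *\<^sub>C F i (Suc j) v"
  proof -
   have ne: "Suc j \<noteq> i" using ij by simp
   consider "\<not> sp \<or> (j \<noteq> bar i \<and> Suc j \<noteq> bar j)" | "sp" "j = bar i" "Suc j \<noteq> bar j" | "sp" "j \<noteq> bar i" "Suc j = bar j" | "j = bar i" "Suc j = bar j"
    by blast
   thus ?thesis
   proof cases
    case 1
    hence "bracket_value F i j j (Suc j) v = 1 *\<^sub>C F i (Suc j) v"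
     using ne by (auto simp: bracket_value_def scaleC_one)
    thus ?thesis using zero_neq_one by metis
   next
    case 2
    have "eps2 i j = -1" using 2(2) ij eps2_bar(2)[of i i] by (simp add: eps2_mult)
    hence "bracket_value F i j j (Suc j) v = F i (Suc j) v + F i (Suc j) v"
     using 2 ne bb ij by (simp add: bracket_value_def)
    also have "\<dots> = 2 *\<^sub>C F i (Suc j) v" using scaleC_add_left[of 1 1 "F i (Suc j) v"] by (simp add: scaleC_one)
    finally show ?thesis by (metis zero_neq_numeral)
   next
    case 3
    have "F (bar (bar j)) (bar i) v = - (eps2 i (bar j) *\<^sub>C F i (bar j) v)"
     by (rule opmodD(6)[OF M ij(2) bar_less' v 3(1)])
    hence r: "F j (bar i) v = eps2 i j *\<^sub>C F i (Suc j) v" using 3 ij bb by (simp add: eps2_bar)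
    have "bracket_value F i j j (Suc j) v = F i (Suc j) v + eps2 i j *\<^sub>C (eps2 i j *\<^sub>C F i (Suc j) v)"
     using 3 ne bb ij r by (simp add: bracket_value_def)
    also have "\<dots> = 2 *\<^sub>C F i (Suc j) v"
     using scaleC_add_left[of 1 1 "F i (Suc j) v"] eps2_mult(5)[of i j] by (simp add: scaleC_one)
    finally show ?thesis by (metis zero_neq_numeral)
   next
    case 4
    hence "i = Suc j" using ij bar_eq_iff[of i j] bb by (metis bar_eq_swap)
    thus ?thesis using ij by simp
   qed
  qed
  ultimately show ?thesis by (metis complex_vector.scale_eq_0_iff)
 qed
qed simp

end

section \<open>The diagram automorphism\<close>

definition tr :: "nat \<Rightarrow> complex mat \<Rightarrow> complex" where "tr n x = (\<Sum>i<2*n. x $$ (i, i))"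

lemma sl_iff: "x \<in> sl n \<longleftrightarrow> x \<in> gl n \<and> tr n x = 0" by (simp add: sl_def tr_def)

lemma tr_add: "x \<in> gl n ==> y \<in> gl n ==> tr n (x + y) = tr n x + tr n y"
 and tr_diff: "x \<in> gl n ==> y \<in> gl n ==> tr n (x - y) = tr n x - tr n y"
 and tr_scale: "x \<in> gl n ==> tr n (c \<cdot>\<^sub>m x) = c * tr n x"
 by (simp_all add: tr_def glI sum.distrib sum_subtractf sum_distrib_left)

lemma tr_bracket: "x \<in> gl n ==> y \<in> gl n ==> tr n (lie_bracket x y) = 0"
proof -
 assume x: "x \<in> gl n" "y \<in> gl n"
 have "tr n (lie_bracket x y) = (\<Sum>i<2*n. \<Sum>k<2*n. x $$ (i, k) * y $$ (k, i) - y $$ (i, k) * x $$ (k, i))"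
  unfolding tr_def by (rule sum.cong[OF refl], rule lie_bracket_index[OF x]) simp_all
 also have "\<dots> = (\<Sum>i<2*n. \<Sum>k<2*n. x $$ (i, k) * y $$ (k, i)) - (\<Sum>k<2*n. \<Sum>i<2*n. y $$ (i, k) * x $$ (k, i))"
  unfolding sum_subtractf by (rule arg_cong2[where f = minus, OF refl], rule sum.swap)
 also have "\<dots> = 0" by (simp add: mult.commute)
 finally show ?thesis .
qed

lemma tr_sgm: "tr n (sgm n x) = - tr n x"
proof -
 have "tr n (sgm n x) = (\<Sum>a<2*n. - x $$ (2*n - Suc a, 2*n - Suc a))"
  unfolding tr_def by (rule sum.cong[OF refl]) (simp add: eps2_mult)
 also have "\<dots> = (\<Sum>a<2*n. - x $$ (a, a))" by (rule sum.nat_diff_reindex)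
 finally show ?thesis by (simp add: tr_def sum_negf)
qed

lemma tr_eu: "i < 2*n ==> tr n (eu n i j) = (if i = j then 1 else 0)"
proof -
 assume i: "i < 2*n"
 have "tr n (eu n i j) = (\<Sum>a<2*n. if a = i then (if i = j then 1 else 0) else 0)"
  unfolding tr_def by (rule sum.cong[OF refl]) simp
 thus ?thesis using i by simp
qed

lemma sl_closed:
 "x \<in> sl n ==> y \<in> sl n ==> x + y \<in> sl n" "x \<in> sl n ==> c \<cdot>\<^sub>m x \<in> sl n"
 "x \<in> gl n ==> y \<in> gl n ==> lie_bracket x y \<in> sl n" "x \<in> sl n ==> sgm n x \<in> sl n"
 by (simp_all add: sl_iff tr_add tr_scale tr_bracket tr_sgm)

lemma gens_eu:
 assumes "Suc a < 2*n"
 shows "e_gen n (Suc a) = eu n a (Suc a)" "f_gen n (Suc a) = eu n (Suc a) a"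
  "h_gen n (Suc a) = eu n a a - eu n (Suc a) (Suc a)" by (simp_all add: e_gen_def f_gen_def h_gen_def eu_def)

lemma sgm_diff: "x \<in> gl n ==> y \<in> gl n ==> sgm n (x - y) = sgm n x - sgm n y"
 by (rule eq_matI) (auto simp: glI algebra_simps)

lemma sgm_gens:
 assumes i: "i \<in> {1..2*n-1}"
 shows "sgm n (e_gen n i) = e_gen n (2*n-i)" "sgm n (f_gen n i) = f_gen n (2*n-i)" "sgm n (h_gen n i) = h_gen n (2*n-i)"
proof -
 obtain a where a: "i = Suc a" "Suc a < 2*n" using i by (cases i) auto
 define b where "b = 2*n - Suc (Suc a)"
 have b: "2*n - i = Suc b" "Suc b < 2*n" "2*n - Suc a = Suc b" "2*n - Suc (Suc a) = b" using a by (auto simp: b_def)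
 have one: "1 \<cdot>\<^sub>m x = x" "(-1) \<cdot>\<^sub>m y - (-1) \<cdot>\<^sub>m x = x - y" if "x \<in> gl n" "y \<in> gl n" for x y :: "complex mat"
  using that by (auto intro!: eq_matI simp: glI)
 have e: "eps2 a (Suc a) = -1" "eps2 (Suc a) a = -1" by (simp_all add: eps2_def flip: mult_2)
 have a': "a < 2*n" using a by simp
 show "sgm n (e_gen n i) = e_gen n (2*n-i)"
  unfolding b(1) unfolding a(1) gens_eu[OF a(2)] gens_eu[OF b(2)] sgm_eu[OF a' a(2)] by (simp add: b e one(1)[OF eu_gl eu_gl])
 show "sgm n (f_gen n i) = f_gen n (2*n-i)"
  unfolding b(1) unfolding a(1) gens_eu[OF a(2)] gens_eu[OF b(2)] sgm_eu[OF a(2) a'] by (simp add: b e one(1)[OF eu_gl eu_gl])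
 show "sgm n (h_gen n i) = h_gen n (2*n-i)"
  unfolding b(1) unfolding a(1) gens_eu[OF a(2)] gens_eu[OF b(2)] sgm_diff[OF eu_gl eu_gl] sgm_eu[OF a(2,2)] sgm_eu[OF a' a']
  by (simp add: b eps2_mult one(2)[OF eu_gl eu_gl])
qed

lemma sl_maps_agree:
 assumes n: "0 < n"
  and add: "\<And>x y. x \<in> sl n ==> y \<in> sl n ==> f (x + y) = f x + f y"
  and scale: "\<And>c x. x \<in> sl n ==> f (c \<cdot>\<^sub>m x) = c * f x"
  and e: "\<And>i j. i < 2*n ==> j < 2*n ==> i \<noteq> j ==> f (eu n i j) = 0"
  and h: "\<And>i. Suc i < 2*n ==> f (eu n i i - eu n (Suc i) (Suc i)) = 0"
  and x: "x \<in> sl n"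
 shows "f x = (0::complex)"
proof -
 have s0: "eu n i j \<in> sl n" if "i < 2*n" "i \<noteq> j" for i j using that by (simp add: sl_iff tr_eu)
 have sd: "eu n i i - eu n j j \<in> sl n" if "i < 2*n" "j < 2*n" for i j using that by (simp add: sl_iff tr_eu tr_diff)
 have d: "f (eu n i i - eu n 0 0) = 0" if "i < 2*n" for i using that
 proof (induction i)
  case 0
  have "eu n 0 0 - eu n 0 0 = 0 \<cdot>\<^sub>m (eu n 0 0 - eu n 0 0)" by (rule eq_matI) auto
  hence "f (eu n 0 0 - eu n 0 0) = f (0 \<cdot>\<^sub>m (eu n 0 0 - eu n 0 0))" by (rule arg_cong)
  thus ?case using scale[OF sd[OF 0 0], of 0] by simp
 next
  case (Suc i)
  have i: "i < 2*n" "0 < 2*n" using Suc.prems n by auto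
  have "eu n (Suc i) (Suc i) - eu n 0 0 = (eu n i i - eu n 0 0) + (-1) \<cdot>\<^sub>m (eu n i i - eu n (Suc i) (Suc i))"
   by (rule eq_matI) auto
  thus ?case
   using add[OF sd[OF i] sl_closed(2)[OF sd[OF i(1) Suc.prems], of "-1"]] scale[OF sd[OF i(1) Suc.prems], of "-1"]
    Suc.IH[OF i(1)] h[OF Suc.prems] by simp
 qed
 \<comment> \<open>Subtracting the trace at one diagonal place extends the map to all of
   \<open>gl n\<close>, where the expansion in matrix units applies.\<close>
 define g where "g y = f (y - tr n y \<cdot>\<^sub>m eu n 0 0)" for y
 have sg: "y - tr n y \<cdot>\<^sub>m eu n 0 0 \<in> sl n" if "y \<in> gl n" for y
  using that n by (simp add: sl_iff tr_diff tr_scale tr_eu)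
 have "g x = (\<Sum>i<2*n. \<Sum>j<2*n. x $$ (i, j) *\<^sub>C g (eu n i j))"
 proof (rule lin_expand)
  show "x \<in> gl n" using x by (simp add: sl_iff)
  show "g (y + z) = g y + g z" if y: "y \<in> gl n" "z \<in> gl n" for y z
  proof -
   have "y + z - tr n (y + z) \<cdot>\<^sub>m eu n 0 0 = (y - tr n y \<cdot>\<^sub>m eu n 0 0) + (z - tr n z \<cdot>\<^sub>m eu n 0 0)"
    unfolding tr_add[OF y] by (rule eq_matI) (use y in \<open>auto simp: glI algebra_simps\<close>)
   thus ?thesis unfolding g_def by (simp add: add[OF sg[OF y(1)] sg[OF y(2)]])
  qed
  show "g (c \<cdot>\<^sub>m y) = c *\<^sub>C g y" if y: "y \<in> gl n" for c y
  proof -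
   have "c \<cdot>\<^sub>m y - tr n (c \<cdot>\<^sub>m y) \<cdot>\<^sub>m eu n 0 0 = c \<cdot>\<^sub>m (y - tr n y \<cdot>\<^sub>m eu n 0 0)"
    unfolding tr_scale[OF y] by (rule eq_matI) (use y in \<open>auto simp: glI algebra_simps\<close>)
   thus ?thesis unfolding g_def scaleC_complex_def by (simp add: scale[OF sg[OF y]])
  qed
 qed
 moreover have "g (eu n i j) = 0" if ij: "i < 2*n" "j < 2*n" for i j
 proof (cases "i = j")
  case True
  have "eu n j j - 1 \<cdot>\<^sub>m eu n 0 0 = eu n j j - eu n 0 0" by (rule eq_matI) auto
  thus ?thesis using True d[OF ij(2)] ij by (simp add: g_def tr_eu)
 next
  case False
  have "eu n i j - 0 \<cdot>\<^sub>m eu n 0 0 = eu n i j" by (rule eq_matI) auto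
  thus ?thesis using False e[OF ij False] ij by (simp add: g_def tr_eu)
 qed
 moreover have "g x = f x"
 proof -
  have "x - 0 \<cdot>\<^sub>m eu n 0 0 = x" using x by (intro eq_matI) (auto simp: sl_iff glI)
  thus ?thesis using x by (simp add: g_def sl_iff)
 qed
 ultimately show ?thesis by simp
qed

lemma eu_step:
 assumes "i < 2*n" "j < 2*n" "k < 2*n" "i \<noteq> k"
 shows "lie_bracket (eu n i j) (eu n j k) = eu n i k"
proof -
 have "eu n i k - 0\<^sub>m (2*n) (2*n) = eu n i k" by (rule eq_matI) auto
 thus ?thesis using assms by (simp add: eu_bracket)
qed

text \<open>Brackets of neighbouring generators produce all off-diagonal matrix units, and these
  together with the \<open>h_gen\<close> span \<open>sl n\<close>; so there is at most one such
  automorphism, and \<open>sgm\<close> is one.\<close>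

theorem sigma_eq:
 assumes n: "0 < n"
 shows "sigma n = restrict (sgm n) (sl n)" unfolding sigma_def
proof (rule the_equality)
 have gens: "e_gen n i \<in> sl n" "f_gen n i \<in> sl n" "h_gen n i \<in> sl n" if i: "i \<in> {1..2*n-1}" for i
 proof -
  obtain a where a: "i = Suc a" "Suc a < 2*n" using i by (cases i) auto
  show "e_gen n i \<in> sl n" "f_gen n i \<in> sl n" "h_gen n i \<in> sl n"
   unfolding a(1) gens_eu[OF a(2)] using a by (simp_all add: sl_iff tr_eu tr_diff)
 qed
 have "lie_automorphism (sl n) (restrict (sgm n) (sl n))" unfolding lie_automorphism_def
 proof (intro conjI ballI allI)
  show "bij_betw (restrict (sgm n) (sl n)) (sl n) (sl n)"
   by (rule bij_betw_byWitness[where f' = "sgm n"]) (auto simp: sl_closed(4) sgm_sgm sl_iff tr_sgm)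
 qed (auto simp: sl_closed sl_iff[THEN iffD1] sgm_add sgm_scale sgm_bracket)
 thus "restrict (sgm n) (sl n) \<in> extensional (sl n) \<and> lie_automorphism (sl n) (restrict (sgm n) (sl n)) \<and>
   (\<forall>i\<in>{1..2*n-1}. restrict (sgm n) (sl n) (e_gen n i) = e_gen n (2*n-i) \<and>
    restrict (sgm n) (sl n) (f_gen n i) = f_gen n (2*n-i) \<and> restrict (sgm n) (sl n) (h_gen n i) = h_gen n (2*n-i))"
  using gens sgm_gens by simp
 fix s assume s: "s \<in> extensional (sl n) \<and> lie_automorphism (sl n) s \<and>
   (\<forall>i\<in>{1..2*n-1}. s (e_gen n i) = e_gen n (2*n-i) \<and> s (f_gen n i) = f_gen n (2*n-i) \<and> s (h_gen n i) = h_gen n (2*n-i))"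
 have aut: "\<And>x y. x \<in> sl n ==> y \<in> sl n ==> s (x + y) = s x + s y" "\<And>c x. x \<in> sl n ==> s (c \<cdot>\<^sub>m x) = c \<cdot>\<^sub>m s x"
  "\<And>x y. x \<in> sl n ==> y \<in> sl n ==> s (lie_bracket x y) = lie_bracket (s x) (s y)"
  "\<And>x. x \<in> sl n ==> s x \<in> sl n" using s unfolding lie_automorphism_def bij_betw_def by auto
 have sgl: "s x \<in> gl n" if "x \<in> sl n" for x using aut(4)[OF that] by (simp add: sl_iff)
 have g: "s (e_gen n i) = sgm n (e_gen n i)" "s (f_gen n i) = sgm n (f_gen n i)" "s (h_gen n i) = sgm n (h_gen n i)"
  if "i \<in> {1..2*n-1}" for i using s sgm_gens[OF that] that by auto
 have s0: "eu n i j \<in> sl n" if "i < 2*n" "i \<noteq> j" for i j using that by (simp add: sl_iff tr_eu)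
 have up: "s (eu n i j) = sgm n (eu n i j)" if "i < j" "j < 2*n" for i j using that
 proof (induction j)
  case (Suc j)
  have g1: "s (eu n j (Suc j)) = sgm n (eu n j (Suc j))" using g(1)[of "Suc j"] Suc.prems gens_eu[of j n] by auto
  show ?case
  proof (cases "i = j")
   case False
   hence ij: "i < j" "i < 2*n" "j < 2*n" "i \<noteq> Suc j" using Suc.prems by auto
   have st: "eu n i (Suc j) = lie_bracket (eu n i j) (eu n j (Suc j))"
    by (rule eu_step[symmetric]) (use ij Suc.prems in auto)
   have m: "eu n i j \<in> sl n" "eu n j (Suc j) \<in> sl n" using s0 ij by auto
   show ?thesis unfolding st aut(3)[OF m] g1 Suc.IH[OF ij(1,3)] by (rule sgm_bracket[symmetric]) auto
  qed (use g1 in simp)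
 qed simp
 have down: "s (eu n j i) = sgm n (eu n j i)" if "i < j" "j < 2*n" for i j using that
 proof (induction j)
  case (Suc j)
  have g1: "s (eu n (Suc j) j) = sgm n (eu n (Suc j) j)" using g(2)[of "Suc j"] Suc.prems gens_eu[of j n] by auto
  show ?case
  proof (cases "i = j")
   case False
   hence ij: "i < j" "i < 2*n" "j < 2*n" "Suc j \<noteq> i" using Suc.prems by auto
   have st: "eu n (Suc j) i = lie_bracket (eu n (Suc j) j) (eu n j i)"
    by (rule eu_step[symmetric]) (use ij Suc.prems in auto)
   have m: "eu n j i \<in> sl n" "eu n (Suc j) j \<in> sl n" using s0 ij Suc.prems by auto
   show ?thesis unfolding st aut(3)[OF m(2,1)] g1 Suc.IH[OF ij(1,3)] by (rule sgm_bracket[symmetric]) auto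
  qed (use g1 in simp)
 qed simp
 have eq: "s x = sgm n x" if x: "x \<in> sl n" for x
 proof (rule eq_matI)
  fix a b assume "a < dim_row (sgm n x)" "b < dim_col (sgm n x)"
  hence ab: "a < 2*n" "b < 2*n" by auto
  let ?f = "\<lambda>y. s y $$ (a, b) - sgm n y $$ (a, b)"
  have "?f x = 0"
  proof (rule sl_maps_agree[OF n _ _ _ _ x, where f = ?f])
   fix y z assume y: "y \<in> sl n" "z \<in> sl n"
   hence yg: "y \<in> gl n" "z \<in> gl n" by (auto simp: sl_iff)
   show "?f (y + z) = ?f y + ?f z"
    unfolding aut(1)[OF y] sgm_add[OF yg] using ab sgl[OF y(1)] sgl[OF y(2)] by (simp add: glI)
  next
   fix c y assume y: "y \<in> sl n"
   hence yg: "y \<in> gl n" by (auto simp: sl_iff)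
   show "?f (c \<cdot>\<^sub>m y) = c * ?f y"
    unfolding aut(2)[OF y] sgm_scale[OF yg] using ab sgl[OF y] by (simp add: glI algebra_simps)
  next
   fix i j assume ij: "i < 2*n" "j < 2*n" "i \<noteq> j"
   have "s (eu n i j) = sgm n (eu n i j)" using up[of i j] down[of j i] ij by (cases "i < j") auto
   thus "?f (eu n i j) = 0" by simp
  next
   fix i assume i: "Suc i < 2*n"
   have "s (eu n i i - eu n (Suc i) (Suc i)) = sgm n (eu n i i - eu n (Suc i) (Suc i))"
    using g(3)[of "Suc i"] i gens_eu(3)[OF i] by auto
   thus "?f (eu n i i - eu n (Suc i) (Suc i)) = 0" by simp
  qed
  thus "s x $$ (a, b) = sgm n x $$ (a, b)" by simp
 qed (use sgl[OF x] in \<open>auto simp: glI\<close>)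
 show "s = restrict (sgm n) (sl n)" by (rule extensionalityI[of _ "sl n"]) (use s eq in auto)
qed

text \<open>The involution negates the trace, so every fixed matrix is traceless.\<close>

lemma ghat_eq: "0 < n ==> ghat n = {x \<in> gl n. sgm n x = x}"
proof -
 assume n: "0 < n"
 have "tr n x = 0" if "sgm n x = x" for x using tr_sgm[of n x] that by simp
 thus ?thesis unfolding ghat_def sigma_eq[OF n] by (auto simp: sl_iff)
qed

section \<open>Weights as integer vectors\<close>

lemma E_unit_Pv: "i < 2*n ==> E_unit n (Suc i) (Suc i) \<in> Pv n" unfolding Pv_def
proof (intro CollectI exI[of _ "\<lambda>j. if j = Suc i then 1 else 0"] eq_matI)
 let ?h = "mat (2*n) (2*n) (\<lambda>ab. \<Sum>j=1..2*n. of_int (if j = Suc i then 1 else 0) * E_unit n j j $$ ab)"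
 fix a b
 assume i: "i < 2*n" and ab: "a < dim_row ?h" "b < dim_col ?h"
 have "(\<Sum>j=1..2*n. of_int (if j = Suc i then 1 else 0) * E_unit n j j $$ (a, b))
   = (\<Sum>j=1..2*n. if j = Suc i then E_unit n j j $$ (a, b) else 0)" by (rule sum.cong) auto
 thus "E_unit n (Suc i) (Suc i) $$ (a, b) = ?h $$ (a, b)" using ab i by simp
qed (simp_all add: E_unit_def)

context branching
begin

lemma galg_eqs: "gl.galg = gl n" "sp.galg = ghat n"
 using n0 by (auto simp: gl.galg_def sp.galg_def sp_simps ghat_eq)

text \<open>The coweight that reads off the coordinate \<open>i\<close> of a folded weight. For
  \<open>i < n\<close> these form a basis of the coweight lattice; the \<open>h_hat\<close> are
  differences of neighbours, except for the last one.\<close>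

definition Dm :: "nat \<Rightarrow> complex mat" where "Dm i = eu n i i - eu n (sp.bar i) (sp.bar i)"

lemma Dm_Fm: "i < 2*n ==> sp.Fm i i = Dm i"
proof -
 assume i: "i < 2*n"
 have "eu n i i + (- 1) \<cdot>\<^sub>m eu n (sp.bar i) (sp.bar i) = Dm i" unfolding Dm_def by (rule eq_matI) auto
 thus ?thesis using sp.Fm_eq[OF i i] by (simp add: sp_simps eps2_mult)
qed

lemma Dm_gl [simp]: "Dm i \<in> gl n" "dim_row (Dm i) = 2*n" "dim_col (Dm i) = 2*n" by (simp_all add: Dm_def)

lemma Dm_index: "a < 2*n ==> b < 2*n ==> Dm i $$ (a, b)
  = (if a = b then (if a = i then 1 else 0) - (if a = sp.bar i then 1 else 0) else 0)" by (simp add: Dm_def)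

lemma h_hat_Dm: "1 \<le> i ==> i < n ==> h_hat n i = Dm (i - 1) - Dm i" "h_hat n n = Dm (n - 1)"
proof -
 show "h_hat n n = Dm (n - 1)"
  using n0 by (intro eq_matI) (auto simp: h_hat_def h_gen_def E_unit_def Dm_def eu_def sp.bar_def)
 show "h_hat n i = Dm (i - 1) - Dm i" if i: "1 \<le> i" "i < n"
  using i by (intro eq_matI) (auto simp: h_hat_def h_gen_def E_unit_def Dm_def eu_def sp.bar_def)
qed

lemma h_hat_dims: "dim_row (h_hat n i) = 2*n" "dim_col (h_hat n i) = 2*n"
 by (simp_all add: h_hat_def h_gen_def E_unit_def)

lemma h_hat_Pv_hat: "1 \<le> i ==> i \<le> n ==> h_hat n i \<in> Pv_hat n" unfolding Pv_hat_def
proof (intro CollectI exI[of _ "\<lambda>j. if j = i then 1 else 0"] eq_matI)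
 fix a b assume i: "1 \<le> i" "i \<le> n"
 have "(\<Sum>j = 1..n. of_int (if j = i then 1 else 0) * h_hat n j $$ (a, b)) = (\<Sum>j = 1..n. if j = i then h_hat n j $$ (a, b) else 0)"
  by (rule sum.cong) auto
 moreover assume "a < dim_row (mat (2*n) (2*n) (\<lambda>ab. \<Sum>j = 1..n. of_int (if j = i then 1 else 0) * h_hat n j $$ ab))"
  "b < dim_col (mat (2*n) (2*n) (\<lambda>ab. \<Sum>j = 1..n. of_int (if j = i then 1 else 0) * h_hat n j $$ ab))"
 ultimately show "h_hat n i $$ (a, b) = mat (2*n) (2*n) (\<lambda>ab. \<Sum>j = 1..n. of_int (if j = i then 1 else 0) * h_hat n j $$ ab) $$ (a, b)"
  using i by simp
qed (simp_all add: h_hat_dims)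

lemma Pv_hatI: "h = mat (2*n) (2*n) (\<lambda>ab. \<Sum>i=1..n. of_int (c i) * h_hat n i $$ ab) ==> h \<in> Pv_hat n"
 unfolding Pv_hat_def by (rule CollectI, rule exI)

lemma Pv_hat_add: "h \<in> Pv_hat n ==> k \<in> Pv_hat n ==> h + k \<in> Pv_hat n"
 and Pv_hat_neg: "h \<in> Pv_hat n ==> (-1) \<cdot>\<^sub>m h \<in> Pv_hat n"
proof -
 assume "h \<in> Pv_hat n"
 then obtain c where c: "h = mat (2*n) (2*n) (\<lambda>ab. \<Sum>i=1..n. of_int (c i) * h_hat n i $$ ab)" by (auto simp: Pv_hat_def)
 have "(-1) \<cdot>\<^sub>m h = mat (2*n) (2*n) (\<lambda>ab. \<Sum>i=1..n. of_int (- c i) * h_hat n i $$ ab)"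
  unfolding c by (rule eq_matI) (simp_all add: sum_negf)
 thus "(-1) \<cdot>\<^sub>m h \<in> Pv_hat n" by (rule Pv_hatI)
 assume "k \<in> Pv_hat n"
 then obtain d where d: "k = mat (2*n) (2*n) (\<lambda>ab. \<Sum>i=1..n. of_int (d i) * h_hat n i $$ ab)" by (auto simp: Pv_hat_def)
 have "h + k = mat (2*n) (2*n) (\<lambda>ab. \<Sum>i=1..n. of_int (c i + d i) * h_hat n i $$ ab)"
  unfolding c d by (rule eq_matI) (simp_all add: distrib_right sum.distrib)
 thus "h + k \<in> Pv_hat n" by (rule Pv_hatI)
qed

lemma Pv_hat_gl: "h \<in> Pv_hat n ==> h \<in> gl n" by (auto simp: Pv_hat_def glI)

lemma Dm_bar: "i < 2*n ==> Dm (sp.bar i) = (-1) \<cdot>\<^sub>m Dm i" by (rule eq_matI) (auto simp: Dm_def)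

lemma Dm_Pv_hat: "i < 2*n ==> Dm i \<in> Pv_hat n"
proof -
 have low: "Dm i \<in> Pv_hat n" if "i \<le> n - 1" for i using that
 proof (induction i rule: inc_induct)
  case base
  thus ?case using h_hat_Pv_hat[of n] h_hat_Dm(2) n0 by simp
 next
  case (step i)
  have "h_hat n (Suc i) = Dm i - Dm (Suc i)" using h_hat_Dm(1)[of "Suc i"] step by simp
  hence "Dm i = h_hat n (Suc i) + Dm (Suc i)" by (intro eq_matI) auto
  moreover have "h_hat n (Suc i) \<in> Pv_hat n" by (rule h_hat_Pv_hat) (use step in auto)
  ultimately show ?case using Pv_hat_add[of "h_hat n (Suc i)" "Dm (Suc i)"] step.IH by simp
 qed
 assume i: "i < 2*n"
 show ?thesis
 proof (cases "i \<le> n - 1")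
  case False
  hence "Dm (sp.bar i) \<in> Pv_hat n" by (intro low) (simp add: sp.bar_def)
  thus ?thesis using Pv_hat_neg[of "Dm (sp.bar i)"] Dm_bar[of "sp.bar i"] i by simp
 qed (rule low)
qed

lemma P_hatD:
 assumes "\<mu> \<in> P_hat n"
 shows "\<And>h k. h \<in> Pv_hat n ==> k \<in> Pv_hat n ==> \<mu> (h + k) = \<mu> h + \<mu> k"
  "\<And>h. h \<in> Pv_hat n ==> \<mu> h \<in> \<int>" "\<And>h. h \<notin> Pv_hat n ==> \<mu> h = 0"
  "\<And>h. h \<in> Pv_hat n ==> \<mu> ((-1) \<cdot>\<^sub>m h) = - \<mu> h"
proof -
 show a: "\<mu> (h + k) = \<mu> h + \<mu> k" if "h \<in> Pv_hat n" "k \<in> Pv_hat n" for h k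
  using assms that by (simp add: P_hat_def integral_dual_def)
 show "\<mu> h \<in> \<int>" if "h \<in> Pv_hat n" for h using assms that by (simp add: P_hat_def integral_dual_def)
 show "\<mu> h = 0" if "h \<notin> Pv_hat n" for h using assms that by (simp add: P_hat_def integral_dual_def)
 show "\<mu> ((-1) \<cdot>\<^sub>m h) = - \<mu> h" if h: "h \<in> Pv_hat n" for h
 proof -
  let ?z = "h + (-1) \<cdot>\<^sub>m h"
  have z: "?z \<in> Pv_hat n" by (intro Pv_hat_add h Pv_hat_neg)
  \<comment> \<open>Elements of \<open>P_hat\<close> are only known to be additive; the zero matrix,
    being its own double, must go to 0.\<close>
  have "?z + ?z = ?z" using Pv_hat_gl[OF h] by (intro eq_matI) (auto simp: glI)
  hence "\<mu> ?z = 0" using a[OF z z] by simp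
  thus ?thesis using a[OF h Pv_hat_neg[OF h]] by simp
 qed
qed

definition fvec :: "weight \<Rightarrow> nat \<Rightarrow> int" where
 "fvec \<mu> i = (if i < 2*n then \<lfloor>\<mu> (Dm i)\<rfloor> else 0)"

lemma fvec_of_int: "\<mu> \<in> P_hat n ==> i < 2*n ==> of_int (fvec \<mu> i) = \<mu> (Dm i)"
 using P_hatD(2)[OF _ Dm_Pv_hat] by (simp add: fvec_def)

lemma fvec_lat: "\<mu> \<in> P_hat n ==> fvec \<mu> \<in> sp.lat"
proof -
 assume m: "\<mu> \<in> P_hat n"
 have "fvec \<mu> (sp.bar i) = - fvec \<mu> i" if i: "i < 2*n" for i
 proof -
  have "(of_int (fvec \<mu> (sp.bar i)) :: real) = of_int (- fvec \<mu> i)"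
   using fvec_of_int[OF m i] fvec_of_int[OF m sp.bar_less'] P_hatD(4)[OF m Dm_Pv_hat[OF i]] by (simp add: Dm_bar[OF i])
  thus ?thesis by linarith
 qed
 thus ?thesis by (simp add: sp.lat_def fvec_def)
qed

lemma h_hat_value:
 assumes m: "\<mu> \<in> P_hat n"
 shows "1 \<le> i ==> i < n ==> \<mu> (h_hat n i) = of_int (fvec \<mu> (i - 1) - fvec \<mu> i)"
  "\<mu> (h_hat n n) = of_int (fvec \<mu> (n - 1))"
proof -
 show "\<mu> (h_hat n n) = of_int (fvec \<mu> (n - 1))"
  unfolding h_hat_Dm(2) by (rule fvec_of_int[OF m, symmetric]) (use n0 in simp)
 assume i: "1 \<le> i" "i < n"
 have "Dm (i - 1) = h_hat n i + Dm i" unfolding h_hat_Dm(1)[OF i] by (rule eq_matI) auto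
 hence "\<mu> (Dm (i - 1)) = \<mu> (h_hat n i) + \<mu> (Dm i)"
  using P_hatD(1)[OF m h_hat_Pv_hat[OF i(1)] Dm_Pv_hat, of i] i by simp
 thus "\<mu> (h_hat n i) = of_int (fvec \<mu> (i - 1) - fvec \<mu> i)"
  using fvec_of_int[OF m, of i] fvec_of_int[OF m, of "i - 1"] i by simp
qed

text \<open>Antisymmetry mirrors the inequalities of the first half into the second and turns the
  middle one into the sign of the coordinate \<open>n - 1\<close>. The right-hand side is what
  pairing with the \<open>h_hat\<close> tests.\<close>

lemma wdec_sp_iff:
 assumes x: "\<xi> \<in> sp.lat"
 shows "sp.wdec \<xi> \<longleftrightarrow> (\<forall>i\<in>{1..<n}. \<xi> i \<le> \<xi> (i - 1)) \<and> 0 \<le> \<xi> (n - 1)"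
proof
 assume w: "sp.wdec \<xi>"
 have w': "\<xi> (Suc a) \<le> \<xi> a" if "Suc a < 2*n" for a using w that by (simp add: sp.wdec_def)
 have b: "sp.bar (n - 1) = n" using n0 by (simp add: sp.bar_def)
 have "\<xi> (sp.bar (n - 1)) = - \<xi> (n - 1)" using x n0 by (simp add: sp.lat_def sp_simps)
 hence "\<xi> n = - \<xi> (n - 1)" unfolding b .
 moreover have "\<xi> n \<le> \<xi> (n - 1)" using w'[of "n - 1"] n0 by simp
 moreover have "\<xi> i \<le> \<xi> (i - 1)" if "i \<in> {1..<n}" for i using w'[of "i - 1"] that by simp
 ultimately show "(\<forall>i\<in>{1..<n}. \<xi> i \<le> \<xi> (i - 1)) \<and> 0 \<le> \<xi> (n - 1)" by simp
next
 assume h: "(\<forall>i\<in>{1..<n}. \<xi> i \<le> \<xi> (i - 1)) \<and> 0 \<le> \<xi> (n - 1)"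
 have low: "\<xi> (Suc a) \<le> \<xi> a" if "Suc a < n" for a using h that by (auto dest: bspec[of _ _ "Suc a"])
 have anti: "\<xi> (2*n - 1 - i) = - \<xi> i" if "i < 2*n" for i using x that by (simp add: sp.lat_def sp_simps sp.bar_def)
 show "sp.wdec \<xi>" unfolding sp.wdec_def
 proof (intro allI impI)
  fix a assume a: "Suc a < 2*n"
  consider "Suc a < n" | "Suc a = n" | "n \<le> a" by linarith
  thus "\<xi> (Suc a) \<le> \<xi> a"
  proof cases
   case 2
   hence "2*n - 1 - a = Suc a" by simp
   thus ?thesis using anti[of a] h 2 a by auto
  next
   case 3
   define b where "b = 2*n - 1 - Suc a"
   have b: "Suc b < n" "2*n - 1 - b = Suc a" "2*n - 1 - Suc b = a" using 3 a by (auto simp: b_def)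
   thus ?thesis using low[OF b(1)] anti[of b] anti[of "Suc b"] by simp
  qed (rule low)
 qed
qed

lemma P_hat_plus_iff: "\<mu> \<in> P_hat_plus n \<longleftrightarrow> \<mu> \<in> P_hat n \<and> sp.wdec (fvec \<mu>)"
proof (cases "\<mu> \<in> P_hat n")
 case m: True
 have "(\<forall>i\<in>{1..n}. 0 \<le> \<mu> (h_hat n i)) \<longleftrightarrow> (\<forall>i\<in>{1..<n}. 0 \<le> \<mu> (h_hat n i)) \<and> 0 \<le> \<mu> (h_hat n n)"
 proof -
  have "{1..n} = insert n {1..<n}" using n0 by auto
  thus ?thesis by auto
 qed
 also have "\<dots> \<longleftrightarrow> (\<forall>i\<in>{1..<n}. fvec \<mu> i \<le> fvec \<mu> (i - 1)) \<and> 0 \<le> fvec \<mu> (n - 1)" using h_hat_value[OF m] by simp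
 also have "\<dots> \<longleftrightarrow> sp.wdec (fvec \<mu>)" by (rule wdec_sp_iff[OF fvec_lat[OF m], symmetric])
 finally show ?thesis using m by (simp add: P_hat_plus_def)
qed (simp add: P_hat_plus_def)

text \<open>Induction on the sum of the absolute values of the coefficients. It shows that additive
  functions on the lattice are determined by their values on the \<open>h_hat\<close>.\<close>

lemma Pv_hat_induct [consumes 1, case_names zero add sub]:
 assumes h: "h \<in> Pv_hat n" and P0: "P (0\<^sub>m (2*n) (2*n))"
  and Pa: "\<And>h j. h \<in> Pv_hat n ==> P h ==> 1 \<le> j ==> j \<le> n ==> P (h + h_hat n j)"
  and Ps: "\<And>h j. h \<in> Pv_hat n ==> P h ==> 1 \<le> j ==> j \<le> n ==> P (h + (-1) \<cdot>\<^sub>m h_hat n j)"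
 shows "P h"
proof -
 define H where "H c = mat (2*n) (2*n) (\<lambda>ab. \<Sum>i=1..n. of_int (c i) * h_hat n i $$ ab)" for c :: "nat \<Rightarrow> int"
 have Hm: "H c \<in> Pv_hat n" for c by (auto simp: Pv_hat_def H_def)
 have upd: "H c = H (c(j := c j - d)) + of_int d \<cdot>\<^sub>m h_hat n j" if "1 \<le> j" "j \<le> n" for c j d
 proof (rule eq_matI)
  fix a b assume "a < dim_row (H (c(j := c j - d)) + of_int d \<cdot>\<^sub>m h_hat n j)" "b < dim_col (H (c(j := c j - d)) + of_int d \<cdot>\<^sub>m h_hat n j)"
  hence ab: "a < 2*n" "b < 2*n" by (auto simp: h_hat_dims)
  have "(\<Sum>i=1..n. of_int (c i) * h_hat n i $$ (a, b))
    = (\<Sum>i=1..n. of_int ((c(j := c j - d)) i) * h_hat n i $$ (a, b) + (if i = j then of_int d * h_hat n i $$ (a, b) else 0))"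
   by (rule sum.cong[OF refl]) (simp add: algebra_simps)
  also have "\<dots> = (\<Sum>i=1..n. of_int ((c(j := c j - d)) i) * h_hat n i $$ (a, b)) + of_int d * h_hat n j $$ (a, b)"
   using that by (simp add: sum.distrib)
  finally show "H c $$ (a, b) = (H (c(j := c j - d)) + of_int d \<cdot>\<^sub>m h_hat n j) $$ (a, b)"
   using ab by (simp add: H_def h_hat_dims)
 qed (simp_all add: H_def h_hat_dims)
 have "P (H c)" for c
 proof (induction "\<Sum>i=1..n. nat \<bar>c i\<bar>" arbitrary: c rule: less_induct)
  case less
  show ?case
  proof (cases "\<exists>j\<in>{1..n}. c j \<noteq> 0")
   case False
   hence "H c = 0\<^sub>m (2*n) (2*n)" by (intro eq_matI) (auto simp: H_def)
   thus ?thesis using P0 by simp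
  next
   case True
   then obtain j where j: "1 \<le> j" "j \<le> n" "c j \<noteq> 0" by auto
   define d where "d = sgn (c j)"
   have "(\<Sum>i=1..n. nat \<bar>(c(j := c j - d)) i\<bar>) < (\<Sum>i=1..n. nat \<bar>c i\<bar>)"
    by (rule sum_strict_mono_ex1) (use j in \<open>auto simp: d_def sgn_if intro!: bexI[of _ j]\<close>)
   from less[OF this] have IH: "P (H (c(j := c j - d)))" .
   have "d = 1 \<or> d = -1" using j by (auto simp: d_def sgn_if)
   thus ?thesis
   proof
    assume d: "d = 1"
    have "1 \<cdot>\<^sub>m h_hat n j = (h_hat n j :: complex mat)" by (rule eq_matI) auto
    thus ?thesis using Pa[OF Hm IH j(1,2)] upd[OF j(1,2), of c d] d by simp
   next
    assume d: "d = -1"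
    thus ?thesis using Ps[OF Hm IH j(1,2)] upd[OF j(1,2), of c d] by simp
   qed
  qed
 qed
 moreover obtain c where "h = H c" using h by (auto simp: Pv_hat_def H_def)
 ultimately show ?thesis by simp
qed

lemma fvec_inj:
 assumes m: "\<mu> \<in> P_hat n" "\<mu>' \<in> P_hat n" and e: "fvec \<mu> = fvec \<mu>'"
 shows "\<mu> = \<mu>'"
proof
 fix h
 have hh: "\<mu> (h_hat n j) = \<mu>' (h_hat n j)" if "1 \<le> j" "j \<le> n" for j
  using h_hat_value[OF m(1)] h_hat_value[OF m(2)] e that by (cases "j = n") auto
 show "\<mu> h = \<mu>' h"
 proof (cases "h \<in> Pv_hat n")
  case True
  thus ?thesis
  proof (induction rule: Pv_hat_induct)
   case zero
   have z: "0\<^sub>m (2*n) (2*n) \<in> Pv_hat n" unfolding Pv_hat_def by (intro CollectI exI[of _ "\<lambda>_. 0"] eq_matI) auto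
   have "0\<^sub>m (2*n) (2*n) + 0\<^sub>m (2*n) (2*n) = (0\<^sub>m (2*n) (2*n) :: complex mat)" by (rule eq_matI) auto
   thus ?case using P_hatD(1)[OF m(1) z z] P_hatD(1)[OF m(2) z z] by simp
  next
   case (add h j)
   thus ?case using P_hatD(1)[OF m(1) add(1) h_hat_Pv_hat] P_hatD(1)[OF m(2) add(1) h_hat_Pv_hat] hh by simp
  next
   case (sub h j)
   note p = h_hat_Pv_hat[OF sub(2,3)]
   show ?case using P_hatD(1)[OF m(1) sub(1) Pv_hat_neg[OF p]] P_hatD(1)[OF m(2) sub(1) Pv_hat_neg[OF p]]
     P_hatD(4)[OF m(1) p] P_hatD(4)[OF m(2) p] hh[OF sub(2,3)] sub(4) by simp
  qed
 qed (simp add: P_hatD(3)[OF m(1)] P_hatD(3)[OF m(2)])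
qed

text \<open>The conditions on the generators give the first \<open>n\<close> simple root operators,
  with a factor 2 at the long root; mirroring gives the others, and brackets give all positive
  roots.\<close>

lemma sp_hwv:
 assumes m: "\<mu> \<in> P_hat n" and M: "is_L_hat n \<mu> M"
 shows "\<exists>v. v \<noteq> 0 \<and> sp.hwv (mspace M) (sp.mF M) (fvec \<mu>) v"
proof -
 obtain v where v: "v \<in> mspace M" "v \<noteq> 0" "\<And>i. i \<in> {1..n} ==> mact M (e_hat n i) v = 0"
  "\<And>h. h \<in> Pv_hat n ==> mact M h v = of_real (\<mu> h) *\<^sub>C v" using M unfolding is_L_hat_def by blast
 have L: "lie_module sp.galg M" using M by (simp add: is_L_hat_def irreducible_module_def galg_eqs)
 note op = sp.module_opmod[OF L]
 have low: "sp.mF M a (Suc a) v = 0" if a: "Suc a \<le> n" for a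
 proof -
  have a2: "a < 2*n" "Suc a < 2*n" using a n0 by auto
  have e: "eps2 a (Suc a) = -1" by (simp add: eps2_def flip: mult_2)
  show ?thesis
  proof (cases "Suc a = n")
   case True
   have b: "sp.bar (Suc a) = a" "sp.bar a = Suc a" using True by (auto simp: sp.bar_def)
   have "sp.Fm a (Suc a) = 2 \<cdot>\<^sub>m e_hat n n"
    unfolding sp.Fm_eq[OF a2] b e using True sp_simps by (intro eq_matI) (auto simp: e_hat_def e_gen_def eu_def E_unit_def)
   moreover have g: "e_hat n n \<in> sp.galg"
   proof -
    have "e_hat n n = (1/2) \<cdot>\<^sub>m sp.Fm a (Suc a)" unfolding calculation by (rule eq_matI) auto
    thus ?thesis using sp.Fm_galg[of a "Suc a"] by (simp add: sp.galg_def sp_simps sgm_scale)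
   qed
   ultimately show ?thesis using lie_moduleD(6)[OF L g v(1), of 2] v(3)[of n] n0 by simp
  next
   case False
   hence "a < n - 1" using a by simp
   have b: "sp.bar (Suc a) = 2*n - Suc (Suc a)" "sp.bar a = 2*n - Suc a" using a by (auto simp: sp.bar_def)
   have "sp.Fm a (Suc a) = e_hat n (Suc a)" unfolding sp.Fm_eq[OF a2] b e using \<open>a < n - 1\<close> sp_simps
    by (intro eq_matI) (auto simp: e_hat_def e_gen_def eu_def E_unit_def)
   thus ?thesis using v(3)[of "Suc a"] a by simp
  qed
 qed
 have "sp.mF M a (Suc a) v = 0" if a: "Suc a < 2*n" for a
 proof (cases "Suc a \<le> n")
  case False
  define b where "b = sp.bar (Suc a)"
  have b: "Suc b \<le> n" "sp.bar b = Suc a" "sp.bar (Suc b) = a" "b < 2*n" "Suc b < 2*n"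
   using False a by (auto simp: b_def sp.bar_def)
  have "sp.mF M (sp.bar (Suc b)) (sp.bar b) v = - (eps2 b (Suc b) *\<^sub>C sp.mF M b (Suc b) v)"
   by (rule sp.opmodD(6)[OF op b(4,5) v(1) sp_simps(2)])
  thus ?thesis using low[OF b(1)] b by simp
 qed (rule low)
 from sp.simple_roots_kill[where F = "sp.mF M", OF op v(1) this]
 have kill: "sp.mF M i j v = 0" if "i < j" "j < 2*n" for i j using that by blast
 have "sp.mF M i i v = of_int (fvec \<mu> i) *\<^sub>C v" if i: "i < 2*n" for i
  unfolding Dm_Fm[OF i] v(4)[OF Dm_Pv_hat[OF i]] fvec_of_int[OF m i, symmetric] by simp
 thus ?thesis using v(1,2) kill unfolding sp.hwv_def by blast
qed

lemma gl_hwv: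
 assumes lam: "\<And>i. i < 2*n ==> lam (E_unit n (Suc i) (Suc i)) = of_nat (p (Suc i))" and M: "is_L n lam M"
 shows "\<exists>v. v \<noteq> 0 \<and> gl.hwv (mspace M) (gl.mF M) gl.pvec v"
proof -
 obtain v where v: "v \<in> mspace M" "v \<noteq> 0" "\<And>i. i \<in> {1..2*n-1} ==> mact M (e_gen n i) v = 0"
  "\<And>h. h \<in> Pv n ==> mact M h v = of_real (lam h) *\<^sub>C v" using M unfolding is_L_def by blast
 have L: "lie_module gl.galg M" using M by (simp add: is_L_def irreducible_module_def galg_eqs)
 note op = gl.module_opmod[OF L]
 have F: "gl.Fm i j = eu n i j" if "i < 2*n" "j < 2*n" for i j using gl.Fm_eq[OF that] by (simp add: sp_simps)
 have "gl.mF M a (Suc a) v = 0" if "Suc a < 2*n" for a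
  using v(3)[of "Suc a"] that gens_eu(1)[OF that] by (simp add: F)
 from gl.simple_roots_kill[where F = "gl.mF M", OF op v(1) this]
 have kill: "gl.mF M i j v = 0" if "i < j" "j < 2*n" for i j using that by blast
 have "gl.mF M i i v = of_int (gl.pvec i) *\<^sub>C v" if i: "i < 2*n" for i
 proof -
  have "E_unit n (Suc i) (Suc i) \<in> Pv n" by (rule E_unit_Pv[OF i])
  thus ?thesis using v(4) lam[OF i] i by (simp add: F eu_def gl.pvec_def)
 qed
 thus ?thesis using v(1,2) kill unfolding gl.hwv_def by blast
qed

end

section \<open>Prefixes of strictly sorted lists\<close>

lemma strict_sorted_distinct: "sorted_wrt (\<lambda>x y. f y < (f x :: nat)) xs ==> distinct xs" by (induction xs) auto

text \<open>The vertices of a path are indexed by prefixes of the reading word, the dominance of a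
  tableau by thresholds on times. This and its converse pass between the two.\<close>

lemma threshold_is_prefix:
 "sorted_wrt (\<lambda>x y. f y < (f x :: nat)) xs ==> \<exists>j\<le>length xs. {x \<in> set xs. t \<le> f x} = set (take j xs)"
proof (induction xs)
 case (Cons x xs)
 then obtain j where j: "j \<le> length xs" "{x \<in> set xs. t \<le> f x} = set (take j xs)" by auto
 show ?case
 proof (cases "t \<le> f x")
  case True
  hence "{y \<in> set (x # xs). t \<le> f y} = set (take (Suc j) (x # xs))" using j(2) by auto
  thus ?thesis using j(1) by (intro exI[of _ "Suc j"]) simp
 next
  case False
  hence "{y \<in> set (x # xs). t \<le> f y} = {}" using Cons.prems by fastforce
  thus ?thesis by (intro exI[of _ 0]) simp
 qed
qed simp

lemma prefix_is_threshold:
 "sorted_wrt (\<lambda>x y. f y < (f x :: nat)) xs ==> j \<le> length xs ==> \<exists>t. {x \<in> set xs. t \<le> f x} = set (take j xs)"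
proof (induction xs arbitrary: j)
 case (Cons x xs)
 show ?case
 proof (cases j)
  case 0
  have "{y \<in> set (x # xs). Suc (f x) \<le> f y} = {}" using Cons.prems by fastforce
  thus ?thesis using 0 by (intro exI[of _ "Suc (f x)"]) simp
 next
  case (Suc i)
  have "\<exists>t. {y \<in> set xs. t \<le> f y} = set (take i xs)" by (rule Cons.IH) (use Cons.prems Suc in auto)
  then obtain t where t: "{y \<in> set xs. t \<le> f y} = set (take i xs)" ..
  have "{y \<in> set (x # xs). min t (f x) \<le> f y} = insert x {y \<in> set xs. t \<le> f y}"
   using Cons.prems by (auto simp: min_le_iff_disj)
  thus ?thesis using t Suc by (intro exI[of _ "min t (f x)"]) simp
 qed
qed simp

section \<open>Values of word paths\<close>

definition pw :: "nat \<Rightarrow> nat list \<Rightarrow> nat \<Rightarrow> weight" where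
 "pw n w j h = (\<Sum>k<j. eps n (w ! k) h)"

lemma sum_pred: "(\<Sum>k=1..j. g (k - 1)) = (\<Sum>k<j. g k)" for g :: "nat \<Rightarrow> real"
 by (rule sum.reindex_bij_witness[of _ Suc "\<lambda>k. k - 1"]) auto

lemma word_path_between:
 assumes "1 \<le> j" "j \<le> length w" "real (j-1) / real (length w) \<le> t" "t \<le> real j / real (length w)"
 shows "word_path n w t h = pw n w (j - 1) h + real (length w) * (t - real (j-1) / real (length w)) * (pw n w j h - pw n w (j - 1) h)"
proof -
 obtain i where i: "j = Suc i" using assms(1) by (cases j) auto
 show ?thesis unfolding word_path_segment[OF assms] sum_pred[of "\<lambda>k. eps n (w ! k) h"] unfolding i pw_def by simp
qed

lemma word_path_empty: "word_path n [] t h = 0" by (simp add: word_path_def Let_def)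

lemma word_path_at:
 assumes "j \<le> length w"
 shows "word_path n w (real j / real (length w)) h = pw n w j h"
proof (cases "w = []")
 case True
 thus ?thesis using assms by (simp add: word_path_empty pw_def)
next
 case False
 hence N: "0 < length w" by simp
 show ?thesis
 proof (cases j)
  case 0
  thus ?thesis using word_path_between[of 1 w 0 n h] N by simp
 next
  case (Suc i)
  have "real (length w) * (real j / real (length w) - real i / real (length w)) = 1"
   using N Suc by (simp add: right_diff_distrib)
  thus ?thesis using word_path_between[of j w "real j / real (length w)" n h] N Suc assms
   by (simp add: divide_right_mono)
 qed
qed

text \<open>Between two vertices each pairing is a convex combination of its values there.\<close>

lemma word_path_nonneg_iff:
 "(\<forall>t\<in>{0..1}. 0 \<le> word_path n w t h) \<longleftrightarrow> (\<forall>j\<le>length w. 0 \<le> pw n w j h)"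
proof
 assume a: "\<forall>t\<in>{0..1}. 0 \<le> word_path n w t h"
 show "\<forall>j\<le>length w. 0 \<le> pw n w j h"
 proof (intro allI impI)
  fix j assume j: "j \<le> length w"
  have "real j / real (length w) \<in> {0..1}" using j by (cases "w = []") (simp_all add: divide_le_eq)
  thus "0 \<le> pw n w j h" using a word_path_at[OF j, of n h] by (metis (no_types))
 qed
next
 assume a: "\<forall>j\<le>length w. 0 \<le> pw n w j h"
 show "\<forall>t\<in>{0..1}. 0 \<le> word_path n w t h"
 proof
  fix t :: real assume t: "t \<in> {0..1}"
  show "0 \<le> word_path n w t h"
  proof (cases "w = []")
   case True thus ?thesis by (simp add: word_path_empty)
  next
   case False
   define N where "N = real (length w)"
   have N: "N > 0" using False by (simp add: N_def)
   define j where "j = max 1 (nat \<lceil>N * t\<rceil>)"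
   have Nt: "0 \<le> N * t" "N * t \<le> N" using t N by (simp_all add: mult_left_le)
   have j: "1 \<le> j" "j \<le> length w"
    using Nt(2) False by (auto simp: j_def N_def nat_le_iff ceiling_le_iff Suc_le_eq)
   have up: "N * t \<le> real j" using Nt(1) unfolding j_def by linarith
   have lo: "real (j - 1) \<le> N * t" using Nt(1) unfolding j_def by linarith
   have b: "real (j - 1) / real (length w) \<le> t" "t \<le> real j / real (length w)"
    using up lo N by (simp_all add: N_def[symmetric] field_simps)
   define s where "s = real (length w) * (t - real (j - 1) / real (length w))"
   have "s = N * t - real (j - 1)" using N by (simp add: s_def N_def[symmetric] right_diff_distrib)
   hence s: "0 \<le> s" "s \<le> 1" using up lo j(1) by (simp_all add: of_nat_diff)
   have "word_path n w t h = (1 - s) * pw n w (j - 1) h + s * pw n w j h"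
    unfolding word_path_between[OF j b] s_def[symmetric] by (simp add: algebra_simps)
   moreover have "0 \<le> pw n w (j - 1) h" "0 \<le> pw n w j h" using a j by simp_all
   ultimately show ?thesis using s by simp
  qed
 qed
qed

section \<open>Tableaux and their paths\<close>

lemma P_plus_part:
 assumes "0 < n" "lam \<in> P_plus_ge0 n"
 shows "\<And>i. i < 2*n ==> lam (E_unit n (Suc i) (Suc i)) = of_nat (part n lam (Suc i))"
  "\<And>r. 1 \<le> r ==> r < 2*n ==> part n lam (Suc r) \<le> part n lam r"
proof -
 obtain l :: "nat \<Rightarrow> int" where l: "lam = (\<lambda>h. \<Sum>i=1..2*n. of_int (l i) * eps n i h)"
  "\<And>i. 1 \<le> i ==> i < 2*n ==> l (i+1) \<le> l i" "0 \<le> l (2*n)" using assms(2) unfolding P_plus_ge0_def by auto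
 note Pv = E_unit_Pv
 have val: "lam (E_unit n (Suc i) (Suc i)) = of_int (l (Suc i))" if i: "i < 2*n" for i
 proof -
  have "of_int (l k) * eps n k (E_unit n (Suc i) (Suc i)) = (if k = Suc i then of_int (l k) else 0)" if "k \<in> {1..2*n}" for k
   using that i Pv[OF i] by (auto simp: eps_def E_unit_def split: if_splits)
  hence "lam (E_unit n (Suc i) (Suc i)) = (\<Sum>k=1..2*n. if k = Suc i then of_int (l k) else 0)"
   unfolding l(1) by (intro sum.cong) auto
  thus ?thesis using i by simp
 qed
 have nn: "0 \<le> l i" if "i \<le> 2*n" "1 \<le> i" for i using that
 proof (induction i rule: inc_induct)
  case (step i)
  thus ?case using l(2)[of i] by auto
 qed (rule l(3))
 have pt: "int (part n lam (Suc i)) = l (Suc i)" if i: "i < 2*n" for i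
  using val[OF i] nn[of "Suc i"] i by (simp add: part_def)
 show "lam (E_unit n (Suc i) (Suc i)) = of_nat (part n lam (Suc i))" if i: "i < 2*n" for i
  using val[OF i] pt[OF i] by (metis of_int_of_nat_eq)
 show "part n lam (Suc r) \<le> part n lam r" if r: "1 \<le> r" "r < 2*n" for r
 proof -
  obtain i where i: "r = Suc i" using r(1) by (cases r) auto
  show ?thesis using l(2)[OF r] pt[of i] pt[of r] r unfolding i by simp
 qed
qed

locale tableau_paths =
 fixes n :: nat and lam :: weight
 assumes n_positive: "0 < n" and lam: "lam \<in> P_plus_ge0 n"
begin

sublocale branching n "part n lam" by unfold_locales (use n_positive P_plus_part[OF n_positive lam] in auto)

lemma D_eq: "gl.D = diagram n lam" by (simp add: gl.D_def diagram_def)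

lemma sst_eq: "gl.sst = SST n lam" by (simp add: gl.sst_def SST_def D_eq)

definition column :: "nat \<Rightarrow> (nat \<times> nat) list" where
 "column c = map (\<lambda>r. (r, c)) (filter (\<lambda>r. (r, c) \<in> gl.D) [1..<2*n+1])"

definition cells_upto :: "nat \<Rightarrow> (nat \<times> nat) list" where
 "cells_upto m = concat (map column (rev [1..<m + 1]))"

definition cells :: "(nat \<times> nat) list" where "cells = cells_upto (part n lam 1)"

lemma reading_word_cells: "reading_word n lam T = map (\<lambda>(r, c). T r c) cells"
 by (simp add: reading_word_def cells_def cells_upto_def column_def map_concat comp_def D_eq)

lemma set_column: "set (column c) = {(r, c') \<in> gl.D. c' = c}" by (auto simp: column_def gl.D_def)

lemma cells_upto_Suc: "cells_upto (Suc m) = column (Suc m) @ cells_upto m" by (simp add: cells_upto_def)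

lemma set_cells_upto: "set (cells_upto m) = {(r, c) \<in> gl.D. c \<le> m}"
proof (induction m)
 case 0
 thus ?case by (auto simp: cells_upto_def gl.D_def)
next
 case (Suc m)
 thus ?case by (auto simp: cells_upto_Suc set_column)
qed

lemma set_cells: "set cells = gl.D" using gl.p_mono[of 1] by (fastforce simp: cells_def set_cells_upto gl.D_def)

text \<open>The reading order runs backwards in time: further down in a column the entries are
  larger and their times smaller, and each column takes up \<open>2n\<close> units of time.\<close>

lemma sorted_cells:
 assumes T: "T \<in> gl.sst"
 shows "sorted_wrt (\<lambda>x y. gl.tm T y < gl.tm T x) cells"
proof -
 have col: "sorted_wrt (\<lambda>x y. gl.tm T y < gl.tm T x) (column c)" for c
 proof -
  have "sorted_wrt (<) (filter (\<lambda>r. (r, c) \<in> gl.D) [1..<2*n+1])" by (intro sorted_wrt_filter sorted_wrt_upt)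
  thus ?thesis unfolding column_def sorted_wrt_map
  proof (rule sorted_wrt_mono_rel[rotated])
   fix r r' assume r: "r \<in> set (filter (\<lambda>r. (r, c) \<in> gl.D) [1..<2*n+1])" "r' \<in> set (filter (\<lambda>r. (r, c) \<in> gl.D) [1..<2*n+1])" "r < r'"
   have "(r', c) \<in> gl.D" using r(2) unfolding set_filter by blast
   thus "gl.tm T (r', c) < gl.tm T (r, c)"
    using r(3) gl.sst_col[OF T, of r' c r] gl.sst_le[OF T, of r' c] by (simp add: gl.tm_def)
  qed
 qed
 have "sorted_wrt (\<lambda>x y. gl.tm T y < gl.tm T x) (cells_upto m)" for m
 proof (induction m)
  case 0
  thus ?case by (simp add: cells_upto_def)
 next
  case (Suc m)
  have "gl.tm T y < gl.tm T x" if xy: "x \<in> set (column (Suc m))" "y \<in> set (cells_upto m)" for x y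
  proof -
   obtain r r' c where x: "x = (r, Suc m)" and y: "y = (r', c)" "c \<le> m" "(r', c) \<in> gl.D"
    using xy by (auto simp: set_column set_cells_upto)
   have c: "1 \<le> c" "T r' c \<noteq> 0" using gl.D_pos[OF y(3)] gl.sst_D[OF T] y(3) by auto
   have "(c - 1) * (2*n) + (2*n - T r' c) < (c - 1) * (2*n) + 2*n" using c n_positive by simp
   also have "\<dots> = c * (2*n)" using c(1) by (cases c) simp_all
   also have "\<dots> \<le> m * (2*n)" by (rule mult_le_mono1[OF y(2)])
   finally show ?thesis by (simp add: x y(1) gl.tm_def)
  qed
  thus ?case unfolding cells_upto_Suc sorted_wrt_append using Suc col by blast
 qed
 thus ?thesis by (simp add: cells_def)
qed

lemma distinct_cells: "distinct cells" using strict_sorted_distinct[OF sorted_cells[OF gl.row_tableau_sst]] .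

lemma Pv_diag: "Pv n = {h \<in> gl n. (\<forall>a<2*n. \<exists>z::int. h $$ (a, a) = of_int z) \<and> (\<forall>a<2*n. \<forall>b<2*n. a \<noteq> b \<longrightarrow> h $$ (a, b) = 0)}"
proof (intro equalityI subsetI)
 have s: "(\<Sum>i=1..2*n. of_int (c i) * E_unit n i i $$ (a, b)) = (if a = b then of_int (c (Suc a)) else 0)"
  if ab: "a < 2*n" "b < 2*n" for c :: "nat \<Rightarrow> int" and a b
 proof -
  have "(\<Sum>i=1..2*n. of_int (c i) * E_unit n i i $$ (a, b)) = (\<Sum>i=1..2*n. if i = Suc a then (if a = b then of_int (c i) else 0) else 0)"
   by (rule sum.cong[OF refl]) (use ab in \<open>auto simp: E_unit_def\<close>)
  thus ?thesis using ab by simp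
 qed
 fix h
 show "h \<in> {h \<in> gl n. (\<forall>a<2*n. \<exists>z::int. h $$ (a, a) = of_int z) \<and> (\<forall>a<2*n. \<forall>b<2*n. a \<noteq> b \<longrightarrow> h $$ (a, b) = 0)}" if hP: "h \<in> Pv n"
 proof -
  obtain c where h: "h = mat (2*n) (2*n) (\<lambda>ab. \<Sum>i=1..2*n. of_int (c i) * E_unit n i i $$ ab)"
   using hP unfolding Pv_def by blast
  have "h $$ (a, b) = (if a = b then of_int (c (Suc a)) else 0)" if "a < 2*n" "b < 2*n" for a b
   unfolding h using s[OF that, of c] that by simp
  moreover have "h \<in> gl n" unfolding h by (simp add: glI)
  ultimately show ?thesis by auto
 qed
 assume "h \<in> {h \<in> gl n. (\<forall>a<2*n. \<exists>z::int. h $$ (a, a) = of_int z) \<and> (\<forall>a<2*n. \<forall>b<2*n. a \<noteq> b \<longrightarrow> h $$ (a, b) = 0)}"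
 hence h: "h \<in> gl n" "\<And>a b. a < 2*n ==> b < 2*n ==> a \<noteq> b ==> h $$ (a, b) = 0"
  "\<And>a. a < 2*n ==> \<exists>z::int. h $$ (a, a) = of_int z" by simp_all
 define z where "z a = (SOME z::int. h $$ (a, a) = of_int z)" for a
 have z: "h $$ (a, a) = of_int (z a)" if "a < 2*n" for a unfolding z_def by (rule someI_ex[OF h(3)[OF that]])
 have "h = mat (2*n) (2*n) (\<lambda>ab. \<Sum>i=1..2*n. of_int (z (i - 1)) * E_unit n i i $$ ab)"
 proof (rule eq_matI)
  fix a b assume "a < dim_row (mat (2*n) (2*n) (\<lambda>ab. \<Sum>i=1..2*n. of_int (z (i - 1)) * E_unit n i i $$ ab))"
   "b < dim_col (mat (2*n) (2*n) (\<lambda>ab. \<Sum>i=1..2*n. of_int (z (i - 1)) * E_unit n i i $$ ab))"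
  hence ab: "a < 2*n" "b < 2*n" by auto
  show "h $$ (a, b) = mat (2*n) (2*n) (\<lambda>ab. \<Sum>i=1..2*n. of_int (z (i - 1)) * E_unit n i i $$ ab) $$ (a, b)"
   using s[OF ab, of "\<lambda>i. z (i - 1)"] h(2)[OF ab] z ab by (cases "a = b") simp_all
 qed (use h(1) in \<open>auto simp: glI\<close>)
 note hm = this
 show "h \<in> Pv n" unfolding Pv_def by (rule CollectI, rule exI[of _ "\<lambda>i. z (i - 1)"], rule hm)
qed

lemma Dm_Pv: "Dm i \<in> Pv n"
proof -
 have "\<exists>z::int. (if Q then 1 else 0) - (if R then 1 else 0) = (of_int z :: complex)" for Q R
  by (rule exI[of _ "(if Q then 1 else 0) - (if R then 1 else 0)"]) simp
 thus ?thesis by (auto simp: Pv_diag Dm_index)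
qed

lemma Pv_closed: "h \<in> Pv n ==> k \<in> Pv n ==> h + k \<in> Pv n" "h \<in> Pv n ==> (-1) \<cdot>\<^sub>m h \<in> Pv n"
proof -
 show "(-1) \<cdot>\<^sub>m h \<in> Pv n" if h: "h \<in> Pv n"
 proof -
  have "\<exists>z::int. - h $$ (a, a) = of_int z" if "a < 2*n" for a
  proof -
   obtain z :: int where "h $$ (a, a) = of_int z" using h \<open>a < 2*n\<close> unfolding Pv_diag by auto
   thus ?thesis by (intro exI[of _ "- z"]) simp
  qed
  thus ?thesis using h by (auto simp: Pv_diag glI)
 qed
 show "h + k \<in> Pv n" if h: "h \<in> Pv n" "k \<in> Pv n"
 proof -
  have "\<exists>z::int. h $$ (a, a) + k $$ (a, a) = of_int z" if "a < 2*n" for a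
  proof -
   obtain z w :: int where "h $$ (a, a) = of_int z" "k $$ (a, a) = of_int w" using h \<open>a < 2*n\<close> unfolding Pv_diag by force
   thus ?thesis by (intro exI[of _ "z + w"]) simp
  qed
  thus ?thesis using h by (auto simp: Pv_diag glI)
 qed
qed

lemma h_hat_Pv: "1 \<le> i ==> i \<le> n ==> h_hat n i \<in> Pv n"
proof (cases "i = n")
 case True thus ?thesis using h_hat_Dm(2) Dm_Pv by simp
next
 case False
 assume i: "1 \<le> i" "i \<le> n"
 have "h_hat n i = Dm (i - 1) + (-1) \<cdot>\<^sub>m Dm i" using h_hat_Dm(1)[of i] i False by (intro eq_matI) auto
 thus ?thesis by (simp add: Pv_closed Dm_Pv)
qed

lemma Pv_hat_Pv: "h \<in> Pv_hat n ==> h \<in> Pv n"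
proof (induction rule: Pv_hat_induct)
 case zero
 have "\<exists>z::int. (0::complex) = of_int z" by (rule exI[of _ 0]) simp
 thus ?case by (auto simp: Pv_diag)
qed (auto intro!: Pv_closed h_hat_Pv)

lemma eps_add: "h \<in> Pv n ==> k \<in> Pv n ==> 1 \<le> x ==> x \<le> 2*n ==> eps n x (h + k) = eps n x h + eps n x k"
 using Pv_closed(1)[of h k] by (auto simp: eps_def Pv_diag glI)

lemma eps_Ints: "h \<in> Pv n ==> 1 \<le> x ==> x \<le> 2*n ==> eps n x h \<in> \<int>"
proof -
 assume h: "h \<in> Pv n" "1 \<le> x" "x \<le> 2*n"
 have l: "x - 1 < 2*n" using h by simp
 have "\<exists>z::int. h $$ (x - 1, x - 1) = of_int z" using h(1) l unfolding Pv_diag by fastforce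
 thus ?thesis using h(1) by (auto simp: eps_def)
qed

lemma eps_Dm: "1 \<le> x ==> x \<le> 2*n ==> i < 2*n ==>
  eps n x (Dm i) = of_int ((if x = Suc i then 1 else 0) - (if x = Suc (sp.bar i) then 1 else 0))"
 by (auto simp: eps_def Dm_Pv Dm_index)

context
 fixes T assumes T: "T \<in> gl.sst"
begin

lemma letters: "k < length cells ==> 1 \<le> reading_word n lam T ! k \<and> reading_word n lam T ! k \<le> 2*n"
proof -
 assume k: "k < length cells"
 have x: "cells ! k \<in> gl.D" using nth_mem[OF k] set_cells by simp
 obtain r c where rc: "cells ! k = (r, c)" by fastforce
 have "T r c \<in> {1..2*n}" using T x rc by (simp add: gl.sst_def)
 thus ?thesis using k rc by (simp add: reading_word_cells)
qed

lemma length_word: "length (reading_word n lam T) = length cells" by (simp add: reading_word_cells)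

lemma pw_wt:
 assumes j: "j \<le> length cells" and i: "i < 2*n"
 shows "pw n (reading_word n lam T) j (Dm i) = of_int (sp.wt T (set (take j cells)) i)"
proof -
 let ?C = "set (take j cells)"
 have CD: "?C \<subseteq> gl.D" using set_take_subset[of j cells] set_cells by simp
 define g where "g = (\<lambda>(r, c). eps n (T r c) (Dm i))"
 have "pw n (reading_word n lam T) j (Dm i) = (\<Sum>k<j. g (take j cells ! k))" unfolding pw_def
 proof (rule sum.cong[OF refl])
  fix k assume "k \<in> {..<j}"
  hence k: "k < j" "k < length cells" using j by auto
  thus "eps n (reading_word n lam T ! k) (Dm i) = g (take j cells ! k)"
   by (simp add: reading_word_cells g_def case_prod_unfold)
 qed
 also have "\<dots> = sum_list (map g (take j cells))" using j by (simp add: sum_list_sum_nth atLeast0LessThan min_def)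
 also have "\<dots> = sum g ?C" using distinct_cells by (simp add: sum_list_distinct_conv_sum_set)
 also have "\<dots> = (\<Sum>x\<in>?C. of_int ((if T (fst x) (snd x) = Suc i then 1 else 0) - (if T (fst x) (snd x) = Suc (sp.bar i) then 1 else 0)))"
 proof (rule sum.cong[OF refl])
  fix x assume "x \<in> ?C"
  hence "(fst x, snd x) \<in> gl.D" using CD by auto
  hence "T (fst x) (snd x) \<in> {1..2*n}" using T by (simp add: gl.sst_def)
  thus "g x = of_int ((if T (fst x) (snd x) = Suc i then 1 else 0) - (if T (fst x) (snd x) = Suc (sp.bar i) then 1 else 0))"
   using eps_Dm[OF _ _ i, of "T (fst x) (snd x)"] by (simp add: g_def case_prod_unfold)
 qed
 also have "\<dots> = of_int (sp.cnt T ?C i - sp.cnt T ?C (sp.bar i))"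
 proof -
  have c: "sp.cnt T ?C k = (\<Sum>x\<in>?C. if T (fst x) (snd x) = Suc k then 1 else 0)" for k
  proof -
   have "{(r, c) \<in> ?C. T r c = Suc k} = {x \<in> ?C. T (fst x) (snd x) = Suc k}" by auto
   thus ?thesis by (simp add: sp.cnt_def sum.If_cases Int_def)
  qed
  show ?thesis unfolding c sum_subtractf[symmetric] of_int_sum ..
 qed
 also have "sp.cnt T ?C i - sp.cnt T ?C (sp.bar i) = sp.wt T ?C i" using i by (simp add: sp.wt_def sp_simps)
 finally show ?thesis .
qed

lemma pw_h_hat:
 assumes j: "j \<le> length cells"
 shows "1 \<le> i ==> i < n ==> pw n (reading_word n lam T) j (h_hat n i)
   = of_int (sp.wt T (set (take j cells)) (i - 1) - sp.wt T (set (take j cells)) i)"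
  "pw n (reading_word n lam T) j (h_hat n n) = of_int (sp.wt T (set (take j cells)) (n - 1))"
proof -
 show "pw n (reading_word n lam T) j (h_hat n n) = of_int (sp.wt T (set (take j cells)) (n - 1))"
  unfolding h_hat_Dm(2) by (rule pw_wt[OF j]) (use n_positive in simp)
 assume i: "1 \<le> i" "i < n"
 have e: "Dm (i - 1) = h_hat n i + Dm i" unfolding h_hat_Dm(1)[OF i] by (rule eq_matI) auto
 have "pw n (reading_word n lam T) j (Dm (i - 1)) = pw n (reading_word n lam T) j (h_hat n i) + pw n (reading_word n lam T) j (Dm i)"
  unfolding pw_def sum.distrib[symmetric] unfolding e
 proof (rule sum.cong[OF refl])
  fix k assume "k \<in> {..<j}"
  hence "k < length cells" using j by simp
  thus "eps n (reading_word n lam T ! k) (h_hat n i + Dm i) = eps n (reading_word n lam T ! k) (h_hat n i) + eps n (reading_word n lam T ! k) (Dm i)"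
   using letters[of k] i by (intro eps_add h_hat_Pv Dm_Pv) auto
 qed
 thus "pw n (reading_word n lam T) j (h_hat n i)
   = of_int (sp.wt T (set (take j cells)) (i - 1) - sp.wt T (set (take j cells)) i)"
 proof -
  assume e: "pw n (reading_word n lam T) j (Dm (i - 1)) = pw n (reading_word n lam T) j (h_hat n i) + pw n (reading_word n lam T) j (Dm i)"
  have "i - 1 < 2*n" "i < 2*n" using i by auto
  from e[unfolded this[THEN pw_wt[OF j]]] show ?thesis by simp
 qed
qed

text \<open>It suffices to test the vertices of the path. These are the weights of the prefixes of
  the reading word, and as sets of cells the prefixes are the sets \<open>rest T t\<close>.\<close>

theorem ghat_dominant_iff: "ghat_dominant n (tableau_path n lam T) \<longleftrightarrow> sp.dominated T"
proof -
 let ?w = "reading_word n lam T"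
 let ?C = "\<lambda>j. set (take j cells)"
 have "ghat_dominant n (tableau_path n lam T) \<longleftrightarrow> (\<forall>i\<in>{1..n}. \<forall>t\<in>{0..1}. 0 \<le> word_path n ?w t (h_hat n i))"
  unfolding ghat_dominant_def hat_def tableau_path_def using h_hat_Pv_hat by auto
 also have "\<dots> \<longleftrightarrow> (\<forall>i\<in>{1..n}. \<forall>j\<le>length cells. 0 \<le> pw n ?w j (h_hat n i))"
  unfolding word_path_nonneg_iff length_word ..
 also have "\<dots> \<longleftrightarrow> (\<forall>j\<le>length cells. (\<forall>i\<in>{1..<n}. 0 \<le> pw n ?w j (h_hat n i)) \<and> 0 \<le> pw n ?w j (h_hat n n))"
 proof -
  have "{1..n} = insert n {1..<n}" using n_positive by auto
  thus ?thesis by auto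
 qed
 also have "\<dots> \<longleftrightarrow> (\<forall>j\<le>length cells. sp.wdec (sp.wt T (?C j)))"
  unfolding wdec_sp_iff[OF sp.wt_lat] using pw_h_hat by simp
 also have "\<dots> \<longleftrightarrow> sp.dominated T"
 proof -
  have s: "sorted_wrt (\<lambda>x y. gl.tm T y < gl.tm T x) cells" by (rule sorted_cells[OF T])
  have r: "sp.rest T t = {x \<in> set cells. t \<le> gl.tm T x}" for t by (simp add: sp.rest_def set_cells)
  show ?thesis unfolding sp.dominated_def r using threshold_is_prefix[OF s] prefix_is_threshold[OF s] by metis
 qed
 finally show ?thesis .
qed

lemma path_end: "tableau_path n lam T 1 h = pw n (reading_word n lam T) (length cells) h"
proof (cases "cells = []")
 case True
 hence "reading_word n lam T = []" by (simp add: reading_word_cells)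
 thus ?thesis using True by (simp add: tableau_path_def word_path_empty pw_def)
next
 case False
 thus ?thesis
  using word_path_at[of "length cells" "reading_word n lam T" n h] by (simp add: tableau_path_def length_word)
qed

lemma path_end_P_hat: "hat n (tableau_path n lam T 1) \<in> P_hat n"
proof -
 have "eps n (reading_word n lam T ! k) (h + h') = eps n (reading_word n lam T ! k) h + eps n (reading_word n lam T ! k) h'"
  if "k < length cells" "h \<in> Pv_hat n" "h' \<in> Pv_hat n" for k h h'
  using letters[OF that(1)] that by (intro eps_add Pv_hat_Pv) auto
 moreover have "eps n (reading_word n lam T ! k) h \<in> \<int>" if "k < length cells" "h \<in> Pv_hat n" for k h
  using letters[OF that(1)] that by (intro eps_Ints Pv_hat_Pv) auto
 ultimately show ?thesis unfolding P_hat_def integral_dual_def hat_def path_end pw_def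
  by (auto simp: Pv_hat_add sum.distrib[symmetric] intro!: Ints_sum sum.cong)
qed

lemma fvec_path_end: "fvec (hat n (tableau_path n lam T 1)) = sp.wt T gl.D"
proof
 fix i
 show "fvec (hat n (tableau_path n lam T 1)) i = sp.wt T gl.D i"
 proof (cases "i < 2*n")
  case True
  have "of_int (fvec (hat n (tableau_path n lam T 1)) i) = hat n (tableau_path n lam T 1) (Dm i)"
   by (rule fvec_of_int[OF path_end_P_hat True])
  also have "\<dots> = tableau_path n lam T 1 (Dm i)" by (simp add: hat_def Dm_Pv_hat[OF True])
  also have "\<dots> = of_int (sp.wt T gl.D i)" unfolding path_end using pw_wt[OF order_refl True] by (simp add: set_cells)
  finally show ?thesis by simp
 next
  case False thus ?thesis by (simp add: fvec_def sp.wt_def)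
 qed
qed

end

text \<open>Consecutive vertices differ by the weight of one letter, and before restriction the
  diagonal matrix units tell these weights apart; the word then determines the tableau. So the
  direct sum over paths is one over tableaux.\<close>

lemma tableau_path_inj: "inj_on (tableau_path n lam) gl.sst"
proof (rule inj_onI)
 fix S T assume S: "S \<in> gl.sst" and T: "T \<in> gl.sst" and e: "tableau_path n lam S = tableau_path n lam T"
 have pwe: "pw n (reading_word n lam S) j h = pw n (reading_word n lam T) j h" if "j \<le> length cells" for j h
  using word_path_at[of j "reading_word n lam S" n h] word_path_at[of j "reading_word n lam T" n h] that
   fun_cong[OF fun_cong[OF e], of "real j / real (length cells)" h]
  by (simp add: tableau_path_def length_word[OF S] length_word[OF T])
 have le: "reading_word n lam S ! k = reading_word n lam T ! k" if k: "k < length cells" for k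
 proof -
  let ?x = "reading_word n lam S ! k" and ?y = "reading_word n lam T ! k"
  define h where "h = eu n (?x - 1) (?x - 1)"
  have hP: "h \<in> Pv n"
  proof -
   have "\<exists>z::int. (if Q then 1 else 0) = (of_int z :: complex)" for Q
    by (rule exI[of _ "if Q then 1 else 0"]) simp
   thus ?thesis unfolding h_def by (auto simp: Pv_diag)
  qed
  have "eps n ?x h = eps n ?y h" using pwe[of "Suc k" h] pwe[of k h] k by (simp add: pw_def)
  thus ?thesis using letters[OF S k] letters[OF T k] hP by (auto simp: eps_def h_def split: if_splits)
 qed
 have eqD: "S r c = T r c" if rc: "(r, c) \<in> gl.D" for r c
 proof -
  obtain k where k: "k < length cells" "cells ! k = (r, c)" using rc set_cells by (metis in_set_conv_nth)
  show ?thesis using le[OF k(1)] k by (simp add: reading_word_cells)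
 qed
 show "S = T"
 proof (intro ext)
  fix r c
  show "S r c = T r c"
   using eqD gl.sst_out[OF S, of r c] gl.sst_out[OF T, of r c] by (cases "(r, c) \<in> gl.D") simp_all
 qed
qed

end

section \<open>Decompositions and multiplicities\<close>

lemma matching_bijection:
 assumes A: "finite A" and B: "finite B" and c: "\<And>k. card {a \<in> A. f a = k} = card {b \<in> B. g b = k}"
 shows "\<exists>\<beta>. bij_betw \<beta> A B \<and> (\<forall>a\<in>A. g (\<beta> a) = f a)"
proof -
 have "\<exists>h. bij_betw h {a \<in> A. f a = k} {b \<in> B. g b = k}" for k by (rule finite_same_card_bij) (use A B c in auto)
 then obtain h where h: "\<And>k. bij_betw (h k) {a \<in> A. f a = k} {b \<in> B. g b = k}" by metis
 define \<beta> where "\<beta> a = h (f a) a" for a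
 have m: "\<beta> a \<in> B" "g (\<beta> a) = f a" if "a \<in> A" for a using bij_betwE[OF h[of "f a"]] that by (auto simp: \<beta>_def)
 have "bij_betw \<beta> A B" unfolding bij_betw_def
 proof
  show "inj_on \<beta> A"
  proof (rule inj_onI)
   fix a a' assume a: "a \<in> A" "a' \<in> A" "\<beta> a = \<beta> a'"
   hence e: "f a = f a'" using m(2) by metis
   hence "h (f a) a = h (f a) a'" using a(3) by (simp add: \<beta>_def)
   thus "a = a'" using inj_onD[OF bij_betw_imp_inj_on[OF h[of "f a"]]] a(1,2) e by simp
  qed
  show "\<beta> ` A = B"
  proof
   show "\<beta> ` A \<subseteq> B" using m(1) by auto
   show "B \<subseteq> \<beta> ` A"
   proof
    fix b assume b: "b \<in> B"
    hence "b \<in> h (g b) ` {a \<in> A. f a = g b}" using bij_betw_imp_surj_on[OF h[of "g b"]] by simp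
    then obtain a where a: "a \<in> A" "f a = g b" "b = h (g b) a" by auto
    have "b = \<beta> a" using a(3) by (simp add: \<beta>_def a(2))
    thus "b \<in> \<beta> ` A" using a(1) by (rule image_eqI)
   qed
  qed
 qed
 thus ?thesis using m(2) by blast
qed

lemma mspace_direct_sum:
 assumes "finite I"
 shows "f \<in> mspace (direct_sum I S) \<longleftrightarrow> (\<forall>i\<in>I. f i \<in> mspace (S i)) \<and> (\<forall>i. i \<notin> I \<longrightarrow> f i = 0)"
proof -
 have "finite {i. f i \<noteq> 0}" if "\<forall>i. i \<notin> I \<longrightarrow> f i = 0" by (rule finite_subset[OF _ assms]) (use that in auto)
 thus ?thesis by (auto simp: direct_sum_def)
qed

lemma irreducible_decompositionD:
 assumes "irreducible_decomposition \<gg> M \<U>"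
 shows "finite \<U>" "\<And>U. U \<in> \<U> ==> lie_submodule \<gg> M U" "\<And>U. U \<in> \<U> ==> irreducible_module \<gg> (sub_rep M U)"
  "\<And>x. x \<in> mspace M ==> \<exists>f. (\<forall>U\<in>\<U>. f U \<in> U) \<and> x = (\<Sum>U\<in>\<U>. f U)"
  "\<And>f g U. (\<And>V. V \<in> \<U> ==> f V \<in> V) ==> (\<And>V. V \<in> \<U> ==> g V \<in> V) ==>
    (\<Sum>V\<in>\<U>. f V) = (\<Sum>V\<in>\<U>. g V) ==> U \<in> \<U> ==> f U = g U"
proof -
 note a = assms[unfolded irreducible_decomposition_def]
 show fin: "finite \<U>" by (rule a[THEN conjunct1])
 have b: "bij_betw (\<lambda>f. \<Sum>W\<in>\<U>. f W) (mspace (direct_sum \<U> (sub_rep M))) (mspace M)"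
  by (rule a[THEN conjunct2, THEN conjunct2])
 show "lie_submodule \<gg> M U" "irreducible_module \<gg> (sub_rep M U)" if "U \<in> \<U>" for U
  using bspec[OF a[THEN conjunct2, THEN conjunct1] that] by simp_all
 have ms: "f \<in> mspace (direct_sum \<U> (sub_rep M)) \<longleftrightarrow> (\<forall>U\<in>\<U>. f U \<in> U) \<and> (\<forall>U. U \<notin> \<U> \<longrightarrow> f U = 0)" for f
  by (simp add: mspace_direct_sum[OF fin] sub_rep_def)
 show "\<exists>f. (\<forall>U\<in>\<U>. f U \<in> U) \<and> x = (\<Sum>U\<in>\<U>. f U)" if "x \<in> mspace M" for x
 proof -
  have "x \<in> (\<lambda>f. \<Sum>W\<in>\<U>. f W) ` mspace (direct_sum \<U> (sub_rep M))" using bij_betw_imp_surj_on[OF b] that by simp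
  thus ?thesis using ms by auto
 qed
 show "f U = g U" if fg: "\<And>V. V \<in> \<U> ==> f V \<in> V" "\<And>V. V \<in> \<U> ==> g V \<in> V"
  "(\<Sum>V\<in>\<U>. f V) = (\<Sum>V\<in>\<U>. g V)" "U \<in> \<U>" for f g U
 proof -
  let ?r = "\<lambda>f V. if V \<in> \<U> then f V else 0"
  have "?r f = ?r g" by (rule inj_onD[OF bij_betw_imp_inj_on[OF b]]) (use fg in \<open>simp_all only: ms, simp_all\<close>)
  from fun_cong[OF this, of U] show ?thesis using fg(4) by simp
 qed
qed

lemma irreducible_decompositionI:
 assumes M: "csubspace (mspace M)" and fin: "finite \<U>"
  and U: "\<And>U. U \<in> \<U> ==> lie_submodule \<gg> M U" "\<And>U. U \<in> \<U> ==> irreducible_module \<gg> (sub_rep M U)"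
  and ex: "\<And>x. x \<in> mspace M ==> \<exists>f. (\<forall>U\<in>\<U>. f U \<in> U) \<and> x = (\<Sum>U\<in>\<U>. f U)"
  and indep: "\<And>f U. (\<And>V. V \<in> \<U> ==> f V \<in> V) ==> (\<Sum>V\<in>\<U>. f V) = 0 ==> U \<in> \<U> ==> f U = 0"
 shows "irreducible_decomposition \<gg> M \<U>"
proof -
 have sU: "csubspace U" "U \<subseteq> mspace M" if "U \<in> \<U>" for U using U(1)[OF that] by (simp_all add: lie_submodule_def)
 have ms: "f \<in> mspace (direct_sum \<U> (sub_rep M)) \<longleftrightarrow> (\<forall>U\<in>\<U>. f U \<in> U) \<and> (\<forall>U. U \<notin> \<U> \<longrightarrow> f U = 0)" for f
  by (simp add: mspace_direct_sum[OF fin] sub_rep_def)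
 have "bij_betw (\<lambda>f. \<Sum>W\<in>\<U>. f W) (mspace (direct_sum \<U> (sub_rep M))) (mspace M)" unfolding bij_betw_def
 proof
  show "inj_on (\<lambda>f. \<Sum>W\<in>\<U>. f W) (mspace (direct_sum \<U> (sub_rep M)))"
  proof (rule inj_onI)
   fix f g assume f: "f \<in> mspace (direct_sum \<U> (sub_rep M))" and g: "g \<in> mspace (direct_sum \<U> (sub_rep M))"
    and e: "(\<Sum>W\<in>\<U>. f W) = (\<Sum>W\<in>\<U>. g W)"
   have fm: "f V \<in> V" "g V \<in> V" if "V \<in> \<U>" for V
    using f[unfolded ms, THEN conjunct1] g[unfolded ms, THEN conjunct1] that by auto
   have fz: "f V = 0" "g V = 0" if "V \<notin> \<U>" for V
    using f[unfolded ms, THEN conjunct2] g[unfolded ms, THEN conjunct2] that by auto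
   have "f U - g U = 0" if "U \<in> \<U>" for U
   proof (rule indep[of "\<lambda>U. f U - g U", OF _ _ that])
    show "f V - g V \<in> V" if "V \<in> \<U>" for V by (rule csub_intros(3)[OF sU(1)[OF that] fm[OF that]])
    show "(\<Sum>V\<in>\<U>. f V - g V) = 0" using e by (simp add: sum_subtractf)
   qed
   hence "f U = g U" for U using fz[of U] by (cases "U \<in> \<U>") simp_all
   thus "f = g" by (rule ext)
  qed
  show "(\<lambda>f. \<Sum>W\<in>\<U>. f W) ` mspace (direct_sum \<U> (sub_rep M)) = mspace M"
  proof (intro equalityI subsetI)
   fix x assume "x \<in> (\<lambda>f. \<Sum>W\<in>\<U>. f W) ` mspace (direct_sum \<U> (sub_rep M))"
   then obtain f where f: "x = (\<Sum>W\<in>\<U>. f W)" "f \<in> mspace (direct_sum \<U> (sub_rep M))" by blast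
   hence m: "\<And>W. W \<in> \<U> ==> f W \<in> W" unfolding ms by blast
   show "x \<in> mspace M" unfolding f(1) by (rule csub_intros(6)[OF M]) (rule subsetD[OF sU(2) m]; assumption)
  next
   fix x assume "x \<in> mspace M"
   then obtain f where f: "\<forall>U\<in>\<U>. f U \<in> U" "x = (\<Sum>U\<in>\<U>. f U)" using ex by blast
   let ?r = "\<lambda>V. if V \<in> \<U> then f V else 0"
   have rm: "?r \<in> mspace (direct_sum \<U> (sub_rep M))" unfolding ms using f(1) by simp
   have rx: "x = (\<Sum>W\<in>\<U>. ?r W)" using f(2) by simp
   show "x \<in> (\<lambda>f. \<Sum>W\<in>\<U>. f W) ` mspace (direct_sum \<U> (sub_rep M))"
    by (rule image_eqI[of x "\<lambda>f. \<Sum>W\<in>\<U>. f W" ?r]) (rule rx, rule rm)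
  qed
 qed
 thus ?thesis using fin U unfolding irreducible_decomposition_def by blast
qed

lemma act_sum:
 assumes M: "lie_module \<gg> M" and x: "x \<in> \<gg>" and g: "\<And>a. a \<in> A ==> g a \<in> mspace M"
 shows "mact M x (\<Sum>a\<in>A. g a) = (\<Sum>a\<in>A. mact M x (g a))"
proof -
 have z: "mact M x 0 = 0" using lie_moduleD(4)[OF M x csub_intros(1)[OF lie_moduleD(1)[OF M]], of 0] by simp
 show ?thesis using g
 proof (induction A rule: infinite_finite_induct)
  case (insert a A)
  have "(\<Sum>a\<in>A. g a) \<in> mspace M" using insert by (intro csub_intros(6) lie_moduleD(1)[OF M]) auto
  thus ?case using insert by (simp add: lie_moduleD(3)[OF M x])
 qed (simp_all add: z)
qed

lemma module_iso_direct_sum: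
 assumes M: "lie_module \<gg> M" and dec: "irreducible_decomposition \<gg> M \<U>" and b: "bij_betw \<beta> I \<U>"
  and iso: "\<And>i. i \<in> I ==> module_iso \<gg> (sub_rep M (\<beta> i)) (S i)"
 shows "module_iso \<gg> M (direct_sum I S)"
proof -
 note d = irreducible_decompositionD[OF dec]
 have fI: "finite I" using bij_betw_finite[OF b] d(1) by simp
 have bI: "\<beta> i \<in> \<U>" if "i \<in> I" for i using bij_betwE[OF b] that by blast
 have sU: "csubspace U" "U \<subseteq> mspace M" "\<And>x v. x \<in> \<gg> ==> v \<in> U ==> mact M x v \<in> U" if "U \<in> \<U>" for U
  using d(2)[OF that] by (simp_all add: lie_submodule_def)
 have "\<exists>\<psi>. \<forall>i\<in>I. bij_betw (\<psi> i) (\<beta> i) (mspace (S i)) \<and>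
   (\<forall>u\<in>\<beta> i. \<forall>v\<in>\<beta> i. \<psi> i (u + v) = \<psi> i u + \<psi> i v) \<and> (\<forall>c. \<forall>v\<in>\<beta> i. \<psi> i (c *\<^sub>C v) = c *\<^sub>C \<psi> i v) \<and>
   (\<forall>x\<in>\<gg>. \<forall>v\<in>\<beta> i. \<psi> i (mact M x v) = mact (S i) x (\<psi> i v))"
  by (rule bchoice) (use iso in \<open>simp add: module_iso_def sub_rep_def\<close>)
 then obtain \<psi> where psi: "\<And>i. i \<in> I ==> bij_betw (\<psi> i) (\<beta> i) (mspace (S i))"
   "\<And>i u v. i \<in> I ==> u \<in> \<beta> i ==> v \<in> \<beta> i ==> \<psi> i (u + v) = \<psi> i u + \<psi> i v"
   "\<And>i c v. i \<in> I ==> v \<in> \<beta> i ==> \<psi> i (c *\<^sub>C v) = c *\<^sub>C \<psi> i v"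
   "\<And>i x v. i \<in> I ==> x \<in> \<gg> ==> v \<in> \<beta> i ==> \<psi> i (mact M x v) = mact (S i) x (\<psi> i v)" by blast
 \<comment> \<open>The components of \<open>x\<close> in the summands; the choice is harmless
   because the sum is direct.\<close>
 define comp where "comp x = (SOME f. (\<forall>U\<in>\<U>. f U \<in> U) \<and> x = (\<Sum>U\<in>\<U>. f U))" for x
 have comp: "\<And>U. U \<in> \<U> ==> comp x U \<in> U" "(\<Sum>U\<in>\<U>. comp x U) = x" if "x \<in> mspace M" for x
  using someI_ex[OF d(4)[OF that]] unfolding comp_def by auto
 have compI: "comp x U = f U" if "\<And>V. V \<in> \<U> ==> f V \<in> V" "x = (\<Sum>V\<in>\<U>. f V)" "x \<in> mspace M" "U \<in> \<U>" for x f U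
  by (rule d(5)[OF comp(1)[OF that(3)] that(1) _ that(4)]) (simp_all add: comp(2)[OF that(3)] that(2)[symmetric])
 note sM = lie_moduleD(1)[OF M]
 define \<Phi> where "\<Phi> x i = (if i \<in> I then \<psi> i (comp x (\<beta> i)) else 0)" for x i
 note ms = mspace_direct_sum[OF fI, where S = S]
 have "bij_betw \<Phi> (mspace M) (mspace (direct_sum I S))" unfolding bij_betw_def
 proof
  show "inj_on \<Phi> (mspace M)"
  proof (rule inj_onI)
   fix x y assume x: "x \<in> mspace M" and y: "y \<in> mspace M" and e: "\<Phi> x = \<Phi> y"
   have "comp x U = comp y U" if U: "U \<in> \<U>" for U
   proof -
    obtain i where i: "i \<in> I" "U = \<beta> i" using bij_betw_imp_surj_on[OF b] U by blast
    have "\<psi> i (comp x U) = \<psi> i (comp y U)" using fun_cong[OF e, of i] i by (simp add: \<Phi>_def)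
    thus ?thesis
     using inj_onD[OF bij_betw_imp_inj_on[OF psi(1)[OF i(1)]]] comp(1)[OF x U] comp(1)[OF y U] i(2) by simp
   qed
   hence "(\<Sum>U\<in>\<U>. comp x U) = (\<Sum>U\<in>\<U>. comp y U)" by (rule sum.cong[OF refl])
   thus "x = y" unfolding comp(2)[OF x] comp(2)[OF y] .
  qed
  show "\<Phi> ` mspace M = mspace (direct_sum I S)"
  proof (intro equalityI subsetI)
   fix f assume "f \<in> \<Phi> ` mspace M"
   then obtain x where x: "x \<in> mspace M" "f = \<Phi> x" by blast
   have "\<psi> i (comp x (\<beta> i)) \<in> mspace (S i)" if i: "i \<in> I" for i
    using bij_betwE[OF psi(1)[OF i]] comp(1)[OF x(1) bI[OF i]] by blast
   thus "f \<in> mspace (direct_sum I S)" unfolding ms x(2) by (simp add: \<Phi>_def)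
  next
   fix g assume g: "g \<in> mspace (direct_sum I S)"
   define f where "f U = (let i = the_inv_into I \<beta> U in the_inv_into (\<beta> i) (\<psi> i) (g i))" for U
   have fb: "f (\<beta> i) \<in> \<beta> i" "\<psi> i (f (\<beta> i)) = g i" if i: "i \<in> I" for i
   proof -
    have e: "f (\<beta> i) = the_inv_into (\<beta> i) (\<psi> i) (g i)"
     by (simp add: f_def the_inv_into_f_f[OF bij_betw_imp_inj_on[OF b] i])
    have gi: "g i \<in> \<psi> i ` \<beta> i" using bij_betw_imp_surj_on[OF psi(1)[OF i]] g i unfolding ms by blast
    show "f (\<beta> i) \<in> \<beta> i" unfolding e
     by (rule the_inv_into_into[OF bij_betw_imp_inj_on[OF psi(1)[OF i]] gi order_refl])
    show "\<psi> i (f (\<beta> i)) = g i" unfolding e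
     by (rule f_the_inv_into_f[OF bij_betw_imp_inj_on[OF psi(1)[OF i]] gi])
   qed
   have fU: "f U \<in> U" if "U \<in> \<U>" for U using fb(1) bij_betw_imp_surj_on[OF b] that by blast
   define x where "x = (\<Sum>U\<in>\<U>. f U)"
   have xM: "x \<in> mspace M" unfolding x_def
    by (rule csub_intros(6)[OF sM]) (rule subsetD[OF sU(2) fU]; assumption)
   have "\<Phi> x i = g i" for i
   proof (cases "i \<in> I")
    case True
    have "comp x (\<beta> i) = f (\<beta> i)" by (rule compI[OF fU x_def xM bI[OF True]])
    thus ?thesis using fb(2)[OF True] True by (simp add: \<Phi>_def)
   next
    case False thus ?thesis using g unfolding ms by (simp add: \<Phi>_def)
   qed
   hence "g = \<Phi> x" by (intro ext) simp
   thus "g \<in> \<Phi> ` mspace M" using xM by blast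
  qed
 qed
 moreover have "\<Phi> (x + y) = \<Phi> x + \<Phi> y" if x: "x \<in> mspace M" and y: "y \<in> mspace M" for x y
 proof
  fix i
  have "comp (x + y) U = comp x U + comp y U" if U: "U \<in> \<U>" for U
  proof (rule compI[of "\<lambda>U. comp x U + comp y U", OF _ _ csub_intros(2)[OF sM x y] U])
   show "comp x V + comp y V \<in> V" if "V \<in> \<U>" for V
    by (rule csub_intros(2)[OF sU(1)[OF that] comp(1)[OF x that] comp(1)[OF y that]])
   show "x + y = (\<Sum>V\<in>\<U>. comp x V + comp y V)" by (simp add: sum.distrib comp(2)[OF x] comp(2)[OF y])
  qed
  thus "\<Phi> (x + y) i = (\<Phi> x + \<Phi> y) i" by (simp add: \<Phi>_def plus_fun_def bI psi(2) comp(1)[OF x] comp(1)[OF y])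
 qed
 moreover have "\<Phi> (c *\<^sub>C x) = c *\<^sub>C \<Phi> x" if x: "x \<in> mspace M" for c x
 proof
  fix i
  have "comp (c *\<^sub>C x) U = c *\<^sub>C comp x U" if U: "U \<in> \<U>" for U
  proof (rule compI[of "\<lambda>U. c *\<^sub>C comp x U", OF _ _ csub_intros(4)[OF sM x] U])
   show "c *\<^sub>C comp x V \<in> V" if "V \<in> \<U>" for V by (rule csub_intros(4)[OF sU(1)[OF that] comp(1)[OF x that]])
   show "c *\<^sub>C x = (\<Sum>V\<in>\<U>. c *\<^sub>C comp x V)" unfolding complex_vector.scale_sum_right[symmetric] comp(2)[OF x] ..
  qed
  thus "\<Phi> (c *\<^sub>C x) i = (c *\<^sub>C \<Phi> x) i" by (simp add: \<Phi>_def scaleC_fun_def bI psi(3) comp(1)[OF x])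
 qed
 moreover have "\<Phi> (mact M a x) = mact (direct_sum I S) a (\<Phi> x)" if a: "a \<in> \<gg>" and x: "x \<in> mspace M" for a x
 proof
  fix i
  have "comp (mact M a x) U = mact M a (comp x U)" if U: "U \<in> \<U>" for U
  proof (rule compI[of "\<lambda>U. mact M a (comp x U)", OF _ _ lie_moduleD(2)[OF M a x] U])
   show "mact M a (comp x V) \<in> V" if "V \<in> \<U>" for V by (rule sU(3)[OF that a comp(1)[OF x that]])
   have "mact M a (\<Sum>V\<in>\<U>. comp x V) = (\<Sum>V\<in>\<U>. mact M a (comp x V))"
    by (rule act_sum[OF M a]) (rule subsetD[OF sU(2) comp(1)[OF x]]; assumption)
   thus "mact M a x = (\<Sum>V\<in>\<U>. mact M a (comp x V))" unfolding comp(2)[OF x] .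
  qed
  thus "\<Phi> (mact M a x) i = mact (direct_sum I S) a (\<Phi> x) i"
   by (simp add: \<Phi>_def direct_sum_def bI psi(4)[OF _ a] comp(1)[OF x])
 qed
 ultimately show ?thesis unfolding module_iso_def by blast
qed

context folding
begin

lemma opiso_hwv:
 assumes M: "opmod S F" and M': "opmod S' F'" and i: "opiso S F S' F' \<phi>" and h: "hwv S' F' \<nu> v'"
 shows "\<exists>v. hwv S F \<nu> v \<and> \<phi> v = v'"
proof -
 have b: "bij_betw \<phi> S S'" and sc: "\<And>c v. v \<in> S ==> \<phi> (c *\<^sub>C v) = c *\<^sub>C \<phi> v"
  and f: "\<And>i j v. i < 2*n ==> j < 2*n ==> v \<in> S ==> \<phi> (F i j v) = F' i j (\<phi> v)" using i by (simp_all add: opiso_def)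
 note inj = inj_onD[OF bij_betw_imp_inj_on[OF b]]
 have z: "0 \<in> S" "\<phi> 0 = 0" using csub_intros(1)[OF opmodD(1)[OF M]] sc[of 0 0] by simp_all
 have h': "v' \<in> S'" "\<And>i j. i < j ==> j < 2*n ==> F' i j v' = 0" "\<And>i. i < 2*n ==> F' i i v' = of_int (\<nu> i) *\<^sub>C v'"
  using h by (auto simp: hwv_def)
 obtain v where v: "v \<in> S" "\<phi> v = v'" using bij_betw_imp_surj_on[OF b] h'(1) by blast
 have "F i j v = 0" if "i < j" "j < 2*n" for i j
  by (rule inj) (use that f[of i j v] v z h'(2)[OF that] opmodD(2)[OF M, of i j v] in auto)
 moreover have "F i i v = of_int (\<nu> i) *\<^sub>C v" if "i < 2*n" for i
  by (rule inj) (use that f[of i i v] v sc h'(3)[OF that] opmodD(2)[OF M, of i i v] csub_intros(4)[OF opmodD(1)[OF M]] in auto)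
 ultimately show ?thesis using v unfolding hwv_def by blast
qed

lemma opirr_transfer:
 assumes S: "opirr S F" and M': "opmod S' F'" and i: "opiso S F S' F' \<phi>"
 shows "opirr S' F'"
proof -
 have M: "opmod S F" using S by (simp add: opirr_def)
 have b: "bij_betw \<phi> S S'" and ad: "\<And>u v. u \<in> S ==> v \<in> S ==> \<phi> (u + v) = \<phi> u + \<phi> v"
  and sc: "\<And>c v. v \<in> S ==> \<phi> (c *\<^sub>C v) = c *\<^sub>C \<phi> v"
  and f: "\<And>i j v. i < 2*n ==> j < 2*n ==> v \<in> S ==> \<phi> (F i j v) = F' i j (\<phi> v)" using i by (simp_all add: opiso_def)
 note sI = csub_intros[OF opmodD(1)[OF M]]
 have z: "\<phi> 0 = 0" using sc[of 0 0] sI(1) by simp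
 have im: "\<phi> ` S = S'" by (rule bij_betw_imp_surj_on[OF b])
 have "S' \<noteq> {0}"
 proof
  assume e: "S' = {0}"
  have "x = 0" if "x \<in> S" for x by (rule inj_onD[OF bij_betw_imp_inj_on[OF b]]) (use that im e z sI(1) in auto)
  hence "S = {0}" using sI(1) by blast
  thus False using S by (simp add: opirr_def)
 qed
 moreover have "W' = {0} \<or> W' = S'" if W': "opsub F' W'" "W' \<subseteq> S'" for W'
 proof -
  define W where "W = {x \<in> S. \<phi> x \<in> W'}"
  have sW': "csubspace W'" using W'(1) by (simp add: opsub_def)
  note wI = csub_intros[OF sW']
  have "csubspace W" unfolding complex_vector.subspace_def W_def using sI(1,2,4) wI(1,2,4) z ad sc by auto
  moreover have "F i j x \<in> W" if "i < 2*n" "j < 2*n" "x \<in> W" for i j x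
   using that W'(1) opmodD(2)[OF M, of i j x] f[of i j x] by (simp add: W_def opsub_def)
  ultimately have "opsub F W" by (simp add: opsub_def)
  moreover have "W \<subseteq> S" by (auto simp: W_def)
  ultimately have "W = {0} \<or> W = S" using S unfolding opirr_def by blast
  moreover have "\<phi> ` W = W'" using im W'(2) by (auto simp: W_def)
  ultimately show ?thesis using z im by auto
 qed
 ultimately show ?thesis using M' unfolding opirr_def by blast
qed

lemma module_iso_iff_hwv:
 assumes U: "lie_module galg U" "opirr (mspace U) (mF U)"
  and S: "lie_module galg S" "opirr (mspace S) (mF S)" and s: "hwv (mspace S) (mF S) \<nu> s" "s \<noteq> 0"
 shows "module_iso galg U S \<longleftrightarrow> (\<exists>v. v \<noteq> 0 \<and> hwv (mspace U) (mF U) \<nu> v)"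
proof
 assume "module_iso galg U S"
 then obtain \<phi> where p: "opiso (mspace U) (mF U) (mspace S) (mF S) \<phi>" using module_iso_imp_opiso by blast
 obtain v where v: "hwv (mspace U) (mF U) \<nu> v" "\<phi> v = s"
  using opiso_hwv[OF module_opmod[OF U(1)] module_opmod[OF S(1)] p s(1)] by blast
 have "\<phi> 0 = 0"
 proof -
  have "\<phi> (0 *\<^sub>C 0) = 0 *\<^sub>C \<phi> 0" using p csub_intros(1)[OF lie_moduleD(1)[OF U(1)]] unfolding opiso_def by blast
  thus ?thesis by simp
 qed
 hence "v \<noteq> 0" using v(2) s(2) by metis
 thus "\<exists>v. v \<noteq> 0 \<and> hwv (mspace U) (mF U) \<nu> v" using v(1) by blast
next
 assume "\<exists>v. v \<noteq> 0 \<and> hwv (mspace U) (mF U) \<nu> v"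
 then obtain v where v: "v \<noteq> 0" "hwv (mspace U) (mF U) \<nu> v" by blast
 obtain \<phi> where "opiso (mspace U) (mF U) (mspace S) (mF S) \<phi>" using hw_irr_iso[OF U(2) S(2) v(2,1) s] by blast
 thus "module_iso galg U S" by (rule opiso_imp_module_iso[OF U(1) S(1)])
qed

text \<open>The right-hand side does not mention the decomposition, so all decompositions give the
  same multiplicity. A summand contributes a line of such vectors if it is isomorphic to
  \<open>S\<close>, and 0 otherwise.\<close>

theorem multiplicity_eq_dim:
 assumes M: "lie_module galg M" and dec: "irreducible_decomposition galg M \<U>"
  and S: "lie_module galg S" "opirr (mspace S) (mF S)" and s: "hwv (mspace S) (mF S) \<nu> s" "s \<noteq> 0"
 shows "card {U \<in> \<U>. module_iso galg (sub_rep M U) S} = complex_vector.dim {v. hwv (mspace M) (mF M) \<nu> v}"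
proof -
 note d = irreducible_decompositionD[OF dec]
 have op: "opmod (mspace M) (mF M)" by (rule module_opmod[OF M])
 have Um: "lie_module galg (sub_rep M U)" if "U \<in> \<U>" for U by (rule sub_rep_module[OF M d(2)[OF that]])
 have Ui: "opirr U (mF M)" if "U \<in> \<U>" for U using irreducible_iff[OF Um[OF that]] d(3)[OF that] by simp
 have Us: "opsub (mF M) U" "U \<subseteq> mspace M" if "U \<in> \<U>" for U using submodule_iff[OF M] d(2)[OF that] by auto
 have sU: "csubspace U" if "U \<in> \<U>" for U using Us(1)[OF that] by (simp add: opsub_def)
 have iso: "module_iso galg (sub_rep M U) S \<longleftrightarrow> (\<exists>v. v \<noteq> 0 \<and> hwv U (mF M) \<nu> v)" if "U \<in> \<U>" for U
  using module_iso_iff_hwv[OF Um[OF that] _ S s] Ui[OF that] by simp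
 define K where "K = {U \<in> \<U>. module_iso galg (sub_rep M U) S}"
 have fK: "finite K" and KU: "\<And>U. U \<in> K ==> U \<in> \<U>" using d(1) by (auto simp: K_def)
 have "\<exists>b. \<forall>U\<in>K. b U \<noteq> 0 \<and> hwv U (mF M) \<nu> (b U)" by (rule bchoice) (use iso in \<open>auto simp: K_def\<close>)
 then obtain b where b: "\<And>U. U \<in> K ==> b U \<noteq> 0" "\<And>U. U \<in> K ==> hwv U (mF M) \<nu> (b U)" by blast
 have bU: "b U \<in> U" if "U \<in> K" for U using b(2)[OF that] by (simp add: hwv_def)
 have zU: "0 \<in> U" if "U \<in> \<U>" for U by (rule csub_intros(1)[OF sU[OF that]])
 have indep0: "f U = 0" if f: "\<And>U. U \<in> K ==> f U \<in> U" "(\<Sum>U\<in>K. f U) = 0" and U: "U \<in> K" for f U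
 proof -
  have "(\<Sum>V\<in>\<U>. if V \<in> K then f V else 0) = (\<Sum>V\<in>K. f V)"
   using d(1) KU by (simp add: sum.If_cases Int_absorb1 subsetI)
  hence "(if U \<in> K then f U else 0) = 0"
   by (intro d(5)[of "\<lambda>V. if V \<in> K then f V else 0" "\<lambda>_. 0", OF _ _ _ KU[OF U]]) (use f zU in auto)
  thus ?thesis using U by simp
 qed
 have inj: "inj_on b K"
 proof (rule inj_onI, rule ccontr)
  fix U V assume UV: "U \<in> K" "V \<in> K" "b U = b V" "U \<noteq> V"
  let ?f = "\<lambda>W. if W = U then b U else if W = V then - b V else 0"
  have "(\<Sum>W\<in>K. ?f W) = (\<Sum>W\<in>{U, V}. ?f W)" by (rule sum.mono_neutral_right[OF fK]) (use UV in auto)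
  hence "(\<Sum>W\<in>K. ?f W) = 0" using UV by simp
  moreover have "?f W \<in> W" if "W \<in> K" for W
   using that bU[OF that] zU[OF KU[OF that]] csub_intros(5)[OF sU[OF KU[OF that]]] by auto
  ultimately have "?f U = 0" using indep0[of ?f U] UV(1) by blast
  thus False using b(1)[OF UV(1)] by simp
 qed
 have "complex_vector.dim {v. hwv (mspace M) (mF M) \<nu> v} = card (b ` K)"
 proof (rule complex_vector.dim_unique[OF _ _ _ refl])
  show "b ` K \<subseteq> {v. hwv (mspace M) (mF M) \<nu> v}" using b(2) Us(2) KU by (fastforce simp: hwv_def)
  show "{v. hwv (mspace M) (mF M) \<nu> v} \<subseteq> cspan (b ` K)"
  proof
   fix v assume "v \<in> {v. hwv (mspace M) (mF M) \<nu> v}"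
   hence v: "v \<in> mspace M" "\<And>i j. i < j ==> j < 2*n ==> mF M i j v = 0" "\<And>i. i < 2*n ==> mF M i i v = of_int (\<nu> i) *\<^sub>C v"
    by (auto simp: hwv_def)
   obtain f where f: "\<forall>U\<in>\<U>. f U \<in> U" "v = (\<Sum>U\<in>\<U>. f U)" using d(4)[OF v(1)] by blast
   have fM: "f U \<in> mspace M" if "U \<in> \<U>" for U using f(1) Us(2)[OF that] that by blast
   have cl: "mF M i j (f U) \<in> U" if "i < 2*n" "j < 2*n" "U \<in> \<U>" for i j U
    using Us(1)[OF that(3)] f(1) that by (simp add: opsub_def)
   have Fsum: "mF M i j v = (\<Sum>U\<in>\<U>. mF M i j (f U))" if "i < 2*n" "j < 2*n" for i j
    unfolding f(2) by (rule opmod_sum[OF op that fM])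
   \<comment> \<open>Directness of the sum allows the defining equations of a highest weight vector
     to be read off in each summand.\<close>
   have hw: "hwv U (mF M) \<nu> (f U)" if U: "U \<in> \<U>" for U unfolding hwv_def
   proof (intro conjI allI impI)
    show "f U \<in> U" using f(1) U by blast
    show "mF M i j (f U) = 0" if ij: "j < 2*n" "i < j" for i j
    proof (rule d(5)[of "\<lambda>U. mF M i j (f U)" "\<lambda>_. 0", OF _ _ _ U])
     have i: "i < 2*n" using ij by simp
     show "mF M i j (f V) \<in> V" if "V \<in> \<U>" for V by (rule cl[OF i ij(1) that])
     show "0 \<in> V" if "V \<in> \<U>" for V by (rule zU[OF that])
     show "(\<Sum>V\<in>\<U>. mF M i j (f V)) = (\<Sum>V\<in>\<U>. 0)" using Fsum[OF i ij(1)] v(2)[OF ij(2,1)] by simp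
    qed
    show "mF M i i (f U) = of_int (\<nu> i) *\<^sub>C f U" if i: "i < 2*n" for i
    proof (rule d(5)[of "\<lambda>U. mF M i i (f U)" "\<lambda>U. of_int (\<nu> i) *\<^sub>C f U", OF _ _ _ U])
     show "mF M i i (f V) \<in> V" if "V \<in> \<U>" for V by (rule cl[OF i i that])
     show "of_int (\<nu> i) *\<^sub>C f V \<in> V" if "V \<in> \<U>" for V using csub_intros(4)[OF sU[OF that]] f(1) that by blast
     show "(\<Sum>V\<in>\<U>. mF M i i (f V)) = (\<Sum>V\<in>\<U>. of_int (\<nu> i) *\<^sub>C f V)"
      unfolding Fsum[OF i i, symmetric] v(3)[OF i] complex_vector.scale_sum_right[symmetric] f(2)[symmetric] ..
    qed
   qed
   have "f U \<in> cspan (b ` K)" if U: "U \<in> \<U>" for U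
   proof (cases "f U = 0")
    case True thus ?thesis by (simp add: complex_vector.span_zero)
   next
    case False
    hence "\<exists>v. v \<noteq> 0 \<and> hwv U (mF M) \<nu> v" using hw[OF U] by blast
    hence UK: "U \<in> K" unfolding K_def using iso[OF U] U by simp
    obtain c where c: "f U = c *\<^sub>C b U" using hwv_unique(1)[OF Ui[OF U] b(2)[OF UK] b(1)[OF UK] hw[OF U] False] by blast
    show ?thesis unfolding c using UK by (intro complex_vector.span_scale complex_vector.span_base) simp
   qed
   thus "v \<in> cspan (b ` K)" unfolding f(2) by (rule complex_vector.span_sum)
  qed
  show "complex_vector.independent (b ` K)" unfolding complex_vector.dependent_finite[OF finite_imageI[OF fK]]
  proof
   assume "\<exists>u. (\<exists>v\<in>b ` K. u v \<noteq> 0) \<and> (\<Sum>v\<in>b ` K. u v *\<^sub>C v) = 0"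
   then obtain u U where u: "U \<in> K" "u (b U) \<noteq> 0" "(\<Sum>v\<in>b ` K. u v *\<^sub>C v) = 0" by blast
   have "(\<Sum>U\<in>K. u (b U) *\<^sub>C b U) = 0" using u(3) by (simp add: sum.reindex[OF inj])
   moreover have "u (b U) *\<^sub>C b U \<in> U" if "U \<in> K" for U
    by (rule csub_intros(4)[OF sU[OF KU[OF that]] bU[OF that]])
   ultimately have "u (b U) *\<^sub>C b U = 0" using indep0[of "\<lambda>U. u (b U) *\<^sub>C b U" U] u(1) by blast
   thus False using u(2) b(1)[OF u(1)] by (simp add: complex_vector.scale_eq_0_iff)
  qed
 qed
 thus ?thesis unfolding K_def[symmetric] card_image[OF inj] by simp
qed

end

context folding
begin

lemma galg_closed:
 "x \<in> galg ==> y \<in> galg ==> x + y \<in> galg" "x \<in> galg ==> c \<cdot>\<^sub>m x \<in> galg"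
 "x \<in> galg ==> y \<in> galg ==> lie_bracket x y \<in> galg" by (simp_all add: galg_def sgm_add sgm_scale sgm_bracket)

lemma Res_module:
 assumes "lie_module (gl n) M"
 shows "lie_module galg (Res galg M)"
proof -
 have g: "x \<in> gl n" if "x \<in> galg" for x using that by (rule galg_gl)
 have ms: "mspace (Res galg M) = mspace M" "\<And>x. x \<in> galg ==> mact (Res galg M) x = mact M x"
  by (simp_all add: Res_def)
 note d = lie_moduleD[OF assms]
 show ?thesis
  unfolding lie_module_def ms(1) by (intro conjI ballI allI d(1)) (simp_all add: ms(2) galg_closed d(2-7) g)
qed

lemma opiso_hwv_image:
 assumes i: "opiso S F S' F' \<phi>" and z: "\<phi> 0 = 0" and h: "hwv S F \<nu> v"
 shows "hwv S' F' \<nu> (\<phi> v)"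
proof -
 have b: "bij_betw \<phi> S S'" and sc: "\<And>c v. v \<in> S ==> \<phi> (c *\<^sub>C v) = c *\<^sub>C \<phi> v"
  and f: "\<And>i j v. i < 2*n ==> j < 2*n ==> v \<in> S ==> \<phi> (F i j v) = F' i j (\<phi> v)" using i by (simp_all add: opiso_def)
 have h': "v \<in> S" "\<And>i j. i < j ==> j < 2*n ==> F i j v = 0" "\<And>i. i < 2*n ==> F i i v = of_int (\<nu> i) *\<^sub>C v"
  using h by (auto simp: hwv_def)
 have "F' i j (\<phi> v) = 0" if "i < j" "j < 2*n" for i j using f[of i j v] h'(1) h'(2)[OF that] z that by simp
 moreover have "F' i i (\<phi> v) = of_int (\<nu> i) *\<^sub>C \<phi> v" if "i < 2*n" for i
  using f[of i i v] h'(1) h'(3)[OF that] sc that by simp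
 moreover have "\<phi> v \<in> S'" using bij_betwE[OF b] h'(1) by blast
 ultimately show ?thesis by (simp add: hwv_def)
qed

end

context tableau_paths
begin

theorem restriction_decomposition:
 fixes L :: "'v::complex_vector lie_rep" and L_hat :: "weight \<Rightarrow> 'w::complex_vector lie_rep"
 assumes L: "is_L n lam L" and Lh: "\<And>\<mu>. \<mu> \<in> P_hat_plus n ==> is_L_hat n \<mu> (L_hat \<mu>)"
 shows "module_iso (ghat n) (Res (ghat n) L)
      (direct_sum {\<pi> \<in> B_paths n lam. ghat_dominant n \<pi>} (\<lambda>\<pi>. L_hat (hat n (\<pi> 1))))
    \<and> (\<forall>\<mu> \<in> P_hat_plus n.
      irr_multiplicity (ghat n) (Res (ghat n) L) (L_hat \<mu>)
      = card {T \<in> SST n lam. ghat_dominant n (tableau_path n lam T)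
                 \<and> hat n (tableau_path n lam T 1) = \<mu>})"
proof -
 let ?R = "Res (ghat n) L"
 let ?N = "card gl.D"
 obtain Y \<W> v where Y: "gl.opirr Y gl.opT" "gl.hwv Y gl.opT gl.pvec v" "v \<noteq> 0" "Y \<subseteq> gl.TS ?N"
  and odec: "sp.odec ?N \<W> Y"
  and count: "\<And>\<mu>. \<mu> \<in> sp.lat ==> sp.wdec \<mu> ==> card {W \<in> \<W>. sp.hwt W = \<mu>} = card {T \<in> gl.sst. sp.dominated T \<and> sp.wt T gl.D = \<mu>}"
  by (rule tensor_branching) (rule that; assumption)
 note o = sp.odecD[OF odec]
 have Lm: "lie_module (gl n) L" using L by (simp add: is_L_def irreducible_module_def)
 have Lm': "lie_module gl.galg L" using Lm by (simp add: galg_eqs)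
 have Li: "gl.opirr (mspace L) (gl.mF L)" using L gl.irreducible_iff[OF Lm'] by (simp add: is_L_def galg_eqs)
 obtain w where w: "w \<noteq> 0" "gl.hwv (mspace L) (gl.mF L) gl.pvec w"
  using gl_hwv[OF P_plus_part(1)[OF n_positive lam] L] by blast
 obtain \<theta> where th: "gl.opiso Y gl.opT (mspace L) (gl.mF L) \<theta>"
  using gl.hw_irr_iso[OF Y(1) Li Y(2,3) w(2,1)] by blast
 have tb: "bij_betw \<theta> Y (mspace L)" and ta: "\<And>x y. x \<in> Y ==> y \<in> Y ==> \<theta> (x + y) = \<theta> x + \<theta> y"
  and tc: "\<And>c x. x \<in> Y ==> \<theta> (c *\<^sub>C x) = c *\<^sub>C \<theta> x"
  and tF: "\<And>i j x. i < 2*n ==> j < 2*n ==> x \<in> Y ==> \<theta> (gl.opT i j x) = gl.mF L i j (\<theta> x)"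
  using th by (simp_all add: gl.opiso_def)
 have Ym: "gl.opmod Y gl.opT" using Y(1) by (simp add: gl.opirr_def)
 note sY = gl.opmodD(1)[OF Ym]
 note YI = csub_intros[OF sY]
 have t0: "\<theta> 0 = 0" using tc[OF YI(1), of 0] by simp
 have tinj: "inj_on \<theta> Y" by (rule bij_betw_imp_inj_on[OF tb])
 have tm: "\<theta> x \<in> mspace L" if "x \<in> Y" for x using bij_betwE[OF tb] that by blast
 have tsum: "\<theta> (\<Sum>a\<in>A. g a) = (\<Sum>a\<in>A. \<theta> (g a))" if "\<And>a. a \<in> A ==> g a \<in> Y"
  for g :: "tens set \<Rightarrow> nat list \<Rightarrow> complex" and A using that
 proof (induction A rule: infinite_finite_induct)
  case (insert a A)
  have "(\<Sum>a\<in>A. g a) \<in> Y" using insert by (intro YI(6)) auto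
  thus ?case using insert ta by simp
 qed (simp_all add: t0)
 have Rm: "lie_module sp.galg ?R" using sp.Res_module[OF Lm] by (simp only: galg_eqs)
 have Rs: "mspace ?R = mspace L" "\<And>x. x \<in> sp.galg ==> mact ?R x = mact L x" by (simp_all add: Res_def galg_eqs)
 note Rop = sp.module_opmod[OF Rm]
 \<comment> \<open>On both sides the subalgebra acts by the same symmetrization of the
   \<open>gl(2n)\<close>-action, with which \<theta> is compatible.\<close>
 have tS: "\<theta> (sp.opT i j x) = sp.mF ?R i j (\<theta> x)" if ij: "i < 2*n" "j < 2*n" and x: "x \<in> Y" for i j x
 proof -
  have b: "sp.bar i < 2*n" "sp.bar j < 2*n" by auto
  have F: "gl.Fm k l = eu n k l" if "k < 2*n" "l < 2*n" for k l using gl.Fm_eq[OF that] by (simp add: sp_simps)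
  have y: "gl.opT i j x \<in> Y" "gl.opT (sp.bar j) (sp.bar i) x \<in> Y" using gl.opmodD(2)[OF Ym] ij b x by auto
  have oe: "sp.opT i j x = gl.opT i j x + (- eps2 i j) *\<^sub>C gl.opT (sp.bar j) (sp.bar i) x"
   unfolding opT_hfold by (simp add: complex_vector.scale_minus_left)
  have "\<theta> (sp.opT i j x) = gl.mF L i j (\<theta> x) + (- eps2 i j) *\<^sub>C gl.mF L (sp.bar j) (sp.bar i) (\<theta> x)"
   unfolding oe ta[OF y(1) YI(4)[OF y(2)]] tc[OF y(2)] tF[OF ij x] tF[OF b(2,1) x] ..
  also have "\<dots> = mact L (sp.Fm i j) (\<theta> x)"
   using sp.Fm_eq[OF ij] sp_simps(2) lie_moduleD(5)[OF Lm eu_gl gl_closed(2)[OF eu_gl] tm[OF x]] lie_moduleD(6)[OF Lm eu_gl tm[OF x]]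
   by (simp add: F ij b)
  finally show ?thesis using Rs(2)[OF sp.Fm_galg] by simp
 qed
 have W: "sp.opirr W sp.opT" "W \<subseteq> Y" "W \<subseteq> gl.TS ?N" if "W \<in> \<W>" for W using o(2,3)[OF that] Y(4) by auto
 have Wm: "sp.opmod W sp.opT" if "W \<in> \<W>" for W using W(1)[OF that] by (simp add: sp.opirr_def)
 have iW: "sp.opiso W sp.opT (\<theta> ` W) (sp.mF ?R) \<theta>" if "W \<in> \<W>" for W unfolding sp.opiso_def
  using inj_on_subset[OF tinj W(2)[OF that]] subsetD[OF W(2)[OF that]] ta tc tS by (auto simp: bij_betw_def)
 have tW: "sp.opsub (sp.mF ?R) (\<theta> ` W)" if Wi: "W \<in> \<W>" for W
 proof -
  note WI = csub_intros[OF sp.opmodD(1)[OF Wm[OF Wi]]]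
  note WY = subsetD[OF W(2)[OF Wi]]
  have "csubspace (\<theta> ` W)" unfolding complex_vector.subspace_def
  proof (intro conjI ballI allI)
   show "0 \<in> \<theta> ` W" using t0 WI(1) by force
   show "a + b \<in> \<theta> ` W" if "a \<in> \<theta> ` W" "b \<in> \<theta> ` W" for a b
   proof -
    obtain x y where "x \<in> W" "y \<in> W" "a = \<theta> x" "b = \<theta> y" using \<open>a \<in> \<theta> ` W\<close> \<open>b \<in> \<theta> ` W\<close> by blast
    thus ?thesis using ta[OF WY WY, of x y] WI(2)[of x y] by (metis imageI)
   qed
   show "c *\<^sub>C a \<in> \<theta> ` W" if "a \<in> \<theta> ` W" for c a
   proof -
    obtain x where "x \<in> W" "a = \<theta> x" using \<open>a \<in> \<theta> ` W\<close> by blast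
    thus ?thesis using tc[OF WY, of x c] WI(4)[of x c] by (metis imageI)
   qed
  qed
  moreover have "sp.mF ?R i j a \<in> \<theta> ` W" if ij: "i < 2*n" "j < 2*n" and a: "a \<in> \<theta> ` W" for i j a
  proof -
   obtain x where x: "x \<in> W" "a = \<theta> x" using a by blast
   show ?thesis unfolding x(2) tS[OF ij WY[OF x(1)], symmetric]
    by (rule imageI) (rule sp.opmodD(2)[OF Wm[OF Wi] ij x(1)])
  qed
  ultimately show ?thesis by (simp add: sp.opsub_def)
 qed
 have tWs: "\<theta> ` W \<subseteq> mspace ?R" if "W \<in> \<W>" for W using W(2)[OF that] tm Rs(1) by auto
 have tirr: "sp.opirr (\<theta> ` W) (sp.mF ?R)" if "W \<in> \<W>" for W
  by (rule sp.opirr_transfer[OF W(1)[OF that] sp.opmod_sub[OF Rop tW[OF that] tWs[OF that]] iW[OF that]])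
 have tsm: "lie_submodule sp.galg ?R (\<theta> ` W)" if "W \<in> \<W>" for W
  using sp.submodule_iff[OF Rm] tW[OF that] tWs[OF that] by blast
 have tmod: "lie_module sp.galg (sub_rep ?R (\<theta> ` W))" if "W \<in> \<W>" for W
  by (rule sp.sub_rep_module[OF Rm tsm[OF that]])
 define \<U> where "\<U> = (`) \<theta> ` \<W>"
 have injW: "inj_on ((`) \<theta>) \<W>" by (rule inj_onI) (use inj_on_image_eq_iff[OF tinj] W(2) in blast)
 have dec: "irreducible_decomposition sp.galg ?R \<U>"
 proof (rule irreducible_decompositionI)
  show "csubspace (mspace ?R)" by (rule lie_moduleD(1)[OF Rm])
  show "finite \<U>" using o(1) by (simp add: \<U>_def)
  show "lie_submodule sp.galg ?R U" if "U \<in> \<U>" for U using that tsm by (auto simp: \<U>_def)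
  show "irreducible_module sp.galg (sub_rep ?R U)" if Ui: "U \<in> \<U>" for U
  proof -
   obtain W' where W': "W' \<in> \<W>" "U = \<theta> ` W'" using Ui by (auto simp: \<U>_def)
   show ?thesis unfolding W'(2) using sp.irreducible_iff[OF tmod[OF W'(1)]] tirr[OF W'(1)] by simp
  qed
  show "\<exists>f. (\<forall>U\<in>\<U>. f U \<in> U) \<and> x = (\<Sum>U\<in>\<U>. f U)" if x: "x \<in> mspace ?R" for x
  proof -
   obtain y where y: "y \<in> Y" "x = \<theta> y" using bij_betw_imp_surj_on[OF tb] x Rs(1) by blast
   obtain h where h: "\<forall>W\<in>\<W>. h W \<in> W" "y = (\<Sum>W\<in>\<W>. h W)" using o(5)[OF y(1)] by blast
   define f where "f U = \<theta> (h (the_inv_into \<W> ((`) \<theta>) U))" for U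
   have fW: "f (\<theta> ` W) = \<theta> (h W)" if "W \<in> \<W>" for W by (simp add: f_def the_inv_into_f_f[OF injW that])
   have hY: "h W \<in> Y" if "W \<in> \<W>" for W by (rule subsetD[OF W(2)[OF that] bspec[OF h(1) that]])
   have "x = (\<Sum>W\<in>\<W>. \<theta> (h W))" unfolding y(2) h(2) by (rule tsum[OF hY])
   also have "\<dots> = (\<Sum>W\<in>\<W>. f (\<theta> ` W))" by (rule sum.cong[OF refl]) (simp add: fW)
   also have "\<dots> = (\<Sum>U\<in>\<U>. f U)" unfolding \<U>_def by (simp add: sum.reindex[OF injW])
   finally have "x = (\<Sum>U\<in>\<U>. f U)" .
   moreover have "\<forall>U\<in>\<U>. f U \<in> U" using fW h(1) by (auto simp: \<U>_def)
   ultimately show ?thesis by blast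
  qed
  show "f U = 0" if f: "\<And>V. V \<in> \<U> ==> f V \<in> V" and s: "(\<Sum>V\<in>\<U>. f V) = 0" and U: "U \<in> \<U>" for f U
  proof -
   have "\<forall>W\<in>\<W>. \<exists>y. y \<in> W \<and> \<theta> y = f (\<theta> ` W)"
   proof
    fix W assume "W \<in> \<W>"
    hence "f (\<theta> ` W) \<in> \<theta> ` W" by (intro f) (simp add: \<U>_def)
    then obtain y where "f (\<theta> ` W) = \<theta> y" "y \<in> W" by (rule imageE)
    thus "\<exists>y. y \<in> W \<and> \<theta> y = f (\<theta> ` W)" by (intro exI[of _ y]) simp
   qed
   from bchoice[OF this] obtain e where e: "\<And>W. W \<in> \<W> ==> e W \<in> W" "\<And>W. W \<in> \<W> ==> \<theta> (e W) = f (\<theta> ` W)" by blast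
   have eY: "e W \<in> Y" if "W \<in> \<W>" for W using e(1)[OF that] W(2)[OF that] by blast
   have "\<theta> (\<Sum>W\<in>\<W>. e W) = (\<Sum>W\<in>\<W>. \<theta> (e W))" by (rule tsum[OF eY])
   also have "\<dots> = (\<Sum>W\<in>\<W>. f (\<theta> ` W))" by (rule sum.cong[OF refl e(2)])
   also have "\<dots> = 0" using s unfolding \<U>_def by (simp add: sum.reindex[OF injW])
   finally have "\<theta> (\<Sum>W\<in>\<W>. e W) = \<theta> 0" using t0 by simp
   hence z: "(\<Sum>W\<in>\<W>. e W) = 0" by (rule inj_onD[OF tinj]) (use YI(1,6) eY in auto)
   obtain W0 where W0: "W0 \<in> \<W>" "U = \<theta> ` W0" using U by (auto simp: \<U>_def)
   \<comment> \<open>Independence of the summands comes from their orthogonality in the tensor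
     power.\<close>
   have "0 = ip (gl.Wd ?N) (\<Sum>W\<in>\<W>. e W) (e W0)" unfolding z by (simp add: ip_zero1)
   also have "\<dots> = (\<Sum>W\<in>\<W>. ip (gl.Wd ?N) (e W) (e W0))" by (rule ip_sum1)
   also have "\<dots> = (\<Sum>W\<in>\<W>. if W = W0 then ip (gl.Wd ?N) (e W0) (e W0) else 0)"
    by (rule sum.cong[OF refl]) (use o(4)[OF _ W0(1) _ e(1) e(1)[OF W0(1)]] in auto)
   also have "\<dots> = ip (gl.Wd ?N) (e W0) (e W0)" using o(1) W0(1) by simp
   finally have "e W0 = 0" using ip_pos[OF gl.finite_Wd subsetD[OF W(3)[OF W0(1)] e(1)[OF W0(1)]]] by simp
   thus ?thesis using e(2)[OF W0(1)] t0 W0(2) by simp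
  qed
 qed
 have Lhm: "lie_module sp.galg (L_hat \<mu>)" "sp.opirr (mspace (L_hat \<mu>)) (sp.mF (L_hat \<mu>))" if mu: "\<mu> \<in> P_hat_plus n" for \<mu>
 proof -
  show m: "lie_module sp.galg (L_hat \<mu>)" using Lh[OF mu] by (simp add: is_L_hat_def irreducible_module_def galg_eqs)
  show "sp.opirr (mspace (L_hat \<mu>)) (sp.mF (L_hat \<mu>))"
   using Lh[OF mu] sp.irreducible_iff[OF m] by (simp add: is_L_hat_def galg_eqs)
 qed
 have Lhw: "\<exists>s. s \<noteq> 0 \<and> sp.hwv (mspace (L_hat \<mu>)) (sp.mF (L_hat \<mu>)) (fvec \<mu>) s" if mu: "\<mu> \<in> P_hat_plus n" for \<mu>
  using sp_hwv[OF _ Lh[OF mu]] mu by (simp add: P_hat_plus_iff)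
 have crit: "module_iso sp.galg (sub_rep ?R (\<theta> ` W)) (L_hat \<mu>) \<longleftrightarrow> sp.hwt W = fvec \<mu>"
  if Wi: "W \<in> \<W>" and mu: "\<mu> \<in> P_hat_plus n" for W \<mu>
 proof -
  obtain s where s: "s \<noteq> 0" "sp.hwv (mspace (L_hat \<mu>)) (sp.mF (L_hat \<mu>)) (fvec \<mu>) s" using Lhw[OF mu] by blast
  have "module_iso sp.galg (sub_rep ?R (\<theta> ` W)) (L_hat \<mu>) \<longleftrightarrow> (\<exists>v. v \<noteq> 0 \<and> sp.hwv (\<theta> ` W) (sp.mF ?R) (fvec \<mu>) v)"
   using sp.module_iso_iff_hwv[OF tmod[OF Wi] _ Lhm[OF mu] s(2,1)] tirr[OF Wi] by simp
  also have "\<dots> \<longleftrightarrow> sp.hwt W = fvec \<mu>"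
  proof
   assume "\<exists>v. v \<noteq> 0 \<and> sp.hwv (\<theta> ` W) (sp.mF ?R) (fvec \<mu>) v"
   then obtain v where v: "v \<noteq> 0" "sp.hwv (\<theta> ` W) (sp.mF ?R) (fvec \<mu>) v" by blast
   obtain x where x: "sp.hwv W sp.opT (fvec \<mu>) x" "\<theta> x = v"
    using sp.opiso_hwv[OF Wm[OF Wi] sp.opmod_sub[OF Rop tW[OF Wi] tWs[OF Wi]] iW[OF Wi] v(2)] by blast
   have "x \<noteq> 0"
   proof
    assume "x = 0"
    thus False using x(2) v(1) t0 by simp
   qed
   moreover have "fvec \<mu> \<in> sp.lat" using mu fvec_lat by (simp add: P_hat_plus_iff)
   ultimately show "sp.hwt W = fvec \<mu>" by (intro sp.hwt_unique[OF W(1,3)[OF Wi] _ _ x(1)])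
  next
   assume e: "sp.hwt W = fvec \<mu>"
   obtain x where x: "x \<noteq> 0" "sp.hwv W sp.opT (fvec \<mu>) x" using sp.hwt(3)[OF W(1,3)[OF Wi]] e by auto
   have xW: "x \<in> W" using x(2) by (simp add: sp.hwv_def)
   have "\<theta> x \<noteq> 0"
   proof
    assume "\<theta> x = 0"
    hence "\<theta> x = \<theta> 0" using t0 by simp
    hence "x = 0" by (rule inj_onD[OF tinj _ subsetD[OF W(2)[OF Wi] xW] YI(1)])
    thus False using x(1) by simp
   qed
   thus "\<exists>v. v \<noteq> 0 \<and> sp.hwv (\<theta> ` W) (sp.mF ?R) (fvec \<mu>) v"
    using sp.opiso_hwv_image[OF iW[OF Wi] t0 x(2)] by blast
  qed
  finally show ?thesis .
 qed
 define dom_paths where "dom_paths = {\<pi> \<in> B_paths n lam. ghat_dominant n \<pi>}"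
 have dom_paths_eq: "dom_paths = tableau_path n lam ` {T \<in> gl.sst. sp.dominated T}"
  unfolding dom_paths_def B_paths_def sst_eq[symmetric] using ghat_dominant_iff by blast
 have fPi: "finite dom_paths" unfolding dom_paths_eq using gl.finite_sst by simp
 have wtD: "sp.wt T gl.D \<in> sp.lat \<and> sp.wdec (sp.wt T gl.D)" if "sp.dominated T" for T
 proof -
  have "sp.rest T 0 = gl.D" by (simp add: sp.rest_def)
  thus ?thesis using that sp.wt_lat unfolding sp.dominated_def by metis
 qed
 have PiP: "hat n (\<pi> 1) \<in> P_hat_plus n" if p: "\<pi> \<in> dom_paths" for \<pi>
 proof -
  obtain T where T: "T \<in> gl.sst" "sp.dominated T" "\<pi> = tableau_path n lam T" using p unfolding dom_paths_eq by blast
  show ?thesis unfolding P_hat_plus_iff T(3) fvec_path_end[OF T(1)] using path_end_P_hat[OF T(1)] wtD[OF T(2)] by blast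
 qed
 \<comment> \<open>For every weight there are as many dominant paths as summands; weights outside of
   the dominant chamber occur on neither side.\<close>
 have fib: "card {\<pi> \<in> dom_paths. fvec (hat n (\<pi> 1)) = k} = card {W \<in> \<W>. sp.hwt W = k}" for k
 proof (cases "k \<in> sp.lat \<and> sp.wdec k")
  case True
  have "{\<pi> \<in> dom_paths. fvec (hat n (\<pi> 1)) = k} = tableau_path n lam ` {T \<in> gl.sst. sp.dominated T \<and> sp.wt T gl.D = k}"
   unfolding dom_paths_eq using fvec_path_end by (auto simp: image_iff)
  moreover have "inj_on (tableau_path n lam) {T \<in> gl.sst. sp.dominated T \<and> sp.wt T gl.D = k}"
   by (rule inj_on_subset[OF tableau_path_inj]) auto
  ultimately show ?thesis using count True by (simp add: card_image)
 next
  case False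
  have "{\<pi> \<in> dom_paths. fvec (hat n (\<pi> 1)) = k} = {}" unfolding dom_paths_eq using fvec_path_end wtD False by auto
  moreover have "{W \<in> \<W>. sp.hwt W = k} = {}" using sp.hwt(1,2)[OF W(1,3)] False by auto
  ultimately show ?thesis by (simp only: card.empty)
 qed
 obtain \<beta> where b: "bij_betw \<beta> dom_paths \<W>" "\<forall>\<pi>\<in>dom_paths. sp.hwt (\<beta> \<pi>) = fvec (hat n (\<pi> 1))"
  using matching_bijection[OF fPi o(1) fib] by (elim exE conjE)
 have first: "module_iso sp.galg ?R (direct_sum dom_paths (\<lambda>\<pi>. L_hat (hat n (\<pi> 1))))"
 proof (rule module_iso_direct_sum[OF Rm dec])
  have "bij_betw ((`) \<theta>) \<W> \<U>" using injW by (simp add: bij_betw_def \<U>_def)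
  from bij_betw_trans[OF b(1) this] show "bij_betw (((`) \<theta>) \<circ> \<beta>) dom_paths \<U>" .
  fix \<pi> assume p: "\<pi> \<in> dom_paths"
  have "\<beta> \<pi> \<in> \<W>" using bij_betwE[OF b(1)] p by blast
  thus "module_iso sp.galg (sub_rep ?R (((`) \<theta> \<circ> \<beta>) \<pi>)) (L_hat (hat n (\<pi> 1)))"
   using crit[OF _ PiP[OF p]] b(2) p by simp
 qed
 have second: "irr_multiplicity sp.galg ?R (L_hat \<mu>)
   = card {T \<in> SST n lam. ghat_dominant n (tableau_path n lam T) \<and> hat n (tableau_path n lam T 1) = \<mu>}"
  if mu: "\<mu> \<in> P_hat_plus n" for \<mu>
 proof -
  obtain s where s: "s \<noteq> 0" "sp.hwv (mspace (L_hat \<mu>)) (sp.mF (L_hat \<mu>)) (fvec \<mu>) s" using Lhw[OF mu] by blast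
  have muP: "\<mu> \<in> P_hat n" "sp.wdec (fvec \<mu>)" using mu by (simp_all add: P_hat_plus_iff)
  have "{U \<in> \<U>. module_iso sp.galg (sub_rep ?R U) (L_hat \<mu>)} = (`) \<theta> ` {W \<in> \<W>. sp.hwt W = fvec \<mu>}"
  proof -
   have "{W \<in> \<W>. module_iso sp.galg (sub_rep ?R (\<theta> ` W)) (L_hat \<mu>)} = {W \<in> \<W>. sp.hwt W = fvec \<mu>}"
    by (rule Collect_cong, rule conj_cong[OF refl], rule crit[OF _ mu])
   thus ?thesis unfolding \<U>_def Compr_image_eq by simp
  qed
  moreover have "inj_on ((`) \<theta>) {W \<in> \<W>. sp.hwt W = fvec \<mu>}" by (rule inj_on_subset[OF injW]) auto
  ultimately have "card {U \<in> \<U>. module_iso sp.galg (sub_rep ?R U) (L_hat \<mu>)} = card {W \<in> \<W>. sp.hwt W = fvec \<mu>}"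
   by (simp add: card_image)
  also have "\<dots> = card {T \<in> gl.sst. sp.dominated T \<and> sp.wt T gl.D = fvec \<mu>}"
   by (rule count[OF fvec_lat[OF muP(1)] muP(2)])
  also have "{T \<in> gl.sst. sp.dominated T \<and> sp.wt T gl.D = fvec \<mu>}
    = {T \<in> SST n lam. ghat_dominant n (tableau_path n lam T) \<and> hat n (tableau_path n lam T 1) = \<mu>}"
  proof -
   have "sp.wt T gl.D = fvec \<mu> \<longleftrightarrow> hat n (tableau_path n lam T 1) = \<mu>" if T: "T \<in> gl.sst" for T
    using fvec_path_end[OF T] fvec_inj[OF path_end_P_hat[OF T] muP(1)] by auto
   thus ?thesis unfolding sst_eq[symmetric] using ghat_dominant_iff by auto
  qed
  finally have k: "card {U \<in> \<U>. module_iso sp.galg (sub_rep ?R U) (L_hat \<mu>)}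
    = card {T \<in> SST n lam. ghat_dominant n (tableau_path n lam T) \<and> hat n (tableau_path n lam T 1) = \<mu>}" .
  \<comment> \<open>The multiplicity is a definite description, so every other decomposition is
    compared with this one through the dimension of the space of highest weight vectors.\<close>
  show ?thesis unfolding irr_multiplicity_def k[symmetric]
  proof (rule the_equality)
   show "\<exists>\<U>'. irreducible_decomposition sp.galg ?R \<U>' \<and>
     card {U \<in> \<U>. module_iso sp.galg (sub_rep ?R U) (L_hat \<mu>)} = card {U \<in> \<U>'. module_iso sp.galg (sub_rep ?R U) (L_hat \<mu>)}"
    using dec by blast
   fix j assume "\<exists>\<U>'. irreducible_decomposition sp.galg ?R \<U>' \<and> j = card {U \<in> \<U>'. module_iso sp.galg (sub_rep ?R U) (L_hat \<mu>)}"
   then obtain \<U>' where u: "irreducible_decomposition sp.galg ?R \<U>'" "j = card {U \<in> \<U>'. module_iso sp.galg (sub_rep ?R U) (L_hat \<mu>)}" by blast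
   show "j = card {U \<in> \<U>. module_iso sp.galg (sub_rep ?R U) (L_hat \<mu>)}"
    unfolding u(2) sp.multiplicity_eq_dim[OF Rm u(1) Lhm[OF mu] s(2,1)]
     sp.multiplicity_eq_dim[OF Rm dec Lhm[OF mu] s(2,1)] ..
  qed
 qed
 show ?thesis using first second unfolding dom_paths_def galg_eqs by blast
qed

end

theorem theoremA:
  fixes n :: nat and lam :: weight
    and L :: "'v::complex_vector lie_rep"
    and L_hat :: "weight \<Rightarrow> 'w::complex_vector lie_rep"
  assumes "n \<ge> 2" and "lam \<in> P_plus_ge0 n"
    and "is_L n lam L"
    and "\<And>\<mu>. \<mu> \<in> P_hat_plus n \<Longrightarrow> is_L_hat n \<mu> (L_hat \<mu>)"
  shows "module_iso (ghat n) (Res (ghat n) L)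
           (direct_sum {\<pi> \<in> B_paths n lam. ghat_dominant n \<pi>} (\<lambda>\<pi>. L_hat (hat n (\<pi> 1))))
       \<and> (\<forall>\<mu> \<in> P_hat_plus n.
            irr_multiplicity (ghat n) (Res (ghat n) L) (L_hat \<mu>)
            = card {T \<in> SST n lam. ghat_dominant n (tableau_path n lam T)
                                 \<and> hat n (tableau_path n lam T 1) = \<mu>})"
proof -
 interpret tableau_paths n lam using assms(1,2) by unfold_locales auto
 show ?thesis by (rule restriction_decomposition[OF assms(3,4)])
qed

end
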